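(* Let $A$ be a commutative noetherian ring that is regular and of infinite Krull dimension, and let $\tilde A$ be its cover (the triangular matrix ring defined in the context). Then \[\operatorname{fin.dim}\tilde A=\infty\qquad\text{and}\qquad\operatorname{fin.dim}\tilde A^{\mathrm{op}}=0 .\]
   Context: A noetherian ring is called regular if all its finitely generated modules have finite projective dimension (no uniform bound is required). Modules are right modules; left $R$-modules are identified with modules over the opposite ring $R^{\mathrm{op}}$. Trivial extension: for a ring $B$, $T(B)$ is the abelian group $B\oplus B^\natural$, where $B^\natural={}_BB_B$, with multiplication $(x,y)(x',y')=(xx',xy'+yx')$. The projection $(x,y)\mapsto x$ is a surjective ring homomorphism $T(B)\to B$ with kernel the two-sided ideal $B^\natural$. The cover $\tilde A$: let $\Sigma(A)$ be the set of isomorphism classes of simple (right) $A$-modules. Put \[\bar S:=\coprod_{S\in\Sigma(A)}S,\qquad \bar A:=\prod_{S\in\Sigma(A)}T(\operatorname{End}_A(S)),\] where $\coprod$ is the direct sum. View $\bar S$ as an $\bar A$-$A$-bimodule, where the factor $T(\operatorname{End}_A(S))$ acts from the left on the summand $S$ via the projection $T(\operatorname{End}_A(S))\to\operatorname{End}_A(S)$. Then $\tilde A$ is the triangular matrix ring \[\tilde A:=\begin{bmatrix}A&0\\ \bar S&\bar A\end{bmatrix}.\] Small finitistic dimension: for a ring $R$, let $\mathcal P(R)$ be the class of right $R$-modules $M$ admitting a finite resolution $0\to P_n\to\cdots\to P_1\to P_0\to M\to0$ with all $P_i$ finitely generated projective. Then $\operatorname{fin.dim}R:=\sup\{\operatorname{proj.dim}M\mid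 M\in\mathcal P(R)\}\in\{0,1,2,\dots,\infty\}$ (the zero module is counted as having projective dimension $0$). *)

theory Defs
  imports "HOL-Algebra.Ring_Divisibility" "HOL-Library.Extended_Nat"
begin

section \<open>Right modules over arbitrary rings\<close>

text \<open>
  The library's \<^locale>\<open>module\<close> is restricted to commutative base rings. As there, the
  multiplicative fields inherited from \<^typ>\<open>'b ring\<close> carry no meaning in a module record.
\<close>

record ('a, 'b) rmod = "'b ring" +
  ract :: "['b, 'a] \<Rightarrow> 'b" (infixl "\<cdot>\<index>" 70)

locale right_module = R?: ring R + M?: abelian_group M
  for R :: "('a, 'r) ring_scheme" (structure) and M :: "('a, 'b, 'm) rmod_scheme" (structure) +
  assumes ract_closed [simp, intro]:
      "\<lbrakk>x \<in> carrier M; a \<in> carrier R\<rbrakk> \<Longrightarrow> x \<cdot>\<^bsub>M\<^esub> a \<in> carrier M"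
    and ract_add_left:
      "\<lbrakk>x \<in> carrier M; y \<in> carrier M; a \<in> carrier R\<rbrakk>
        \<Longrightarrow> (x \<oplus>\<^bsub>M\<^esub> y) \<cdot>\<^bsub>M\<^esub> a = x \<cdot>\<^bsub>M\<^esub> a \<oplus>\<^bsub>M\<^esub> y \<cdot>\<^bsub>M\<^esub> a"
    and ract_add_right:
      "\<lbrakk>x \<in> carrier M; a \<in> carrier R; b \<in> carrier R\<rbrakk>
        \<Longrightarrow> x \<cdot>\<^bsub>M\<^esub> (a \<oplus>\<^bsub>R\<^esub> b) = x \<cdot>\<^bsub>M\<^esub> a \<oplus>\<^bsub>M\<^esub> x \<cdot>\<^bsub>M\<^esub> b"
    and ract_assoc:
      "\<lbrakk>x \<in> carrier M; a \<in> carrier R; b \<in> carrier R\<rbrakk>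
        \<Longrightarrow> x \<cdot>\<^bsub>M\<^esub> (a \<otimes>\<^bsub>R\<^esub> b) = (x \<cdot>\<^bsub>M\<^esub> a) \<cdot>\<^bsub>M\<^esub> b"
    and ract_one [simp]: "x \<in> carrier M \<Longrightarrow> x \<cdot>\<^bsub>M\<^esub> \<one>\<^bsub>R\<^esub> = x"

definition rmod_hom :: "('a, 'r) ring_scheme \<Rightarrow> ('a, 'b, 'm) rmod_scheme
    \<Rightarrow> ('a, 'c, 'n) rmod_scheme \<Rightarrow> ('b \<Rightarrow> 'c) set" where
  "rmod_hom R M N = {f \<in> carrier M \<rightarrow> carrier N.
     (\<forall>x\<in>carrier M. \<forall>y\<in>carrier M. f (x \<oplus>\<^bsub>M\<^esub> y) = f x \<oplus>\<^bsub>N\<^esub> f y) \<and>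
     (\<forall>x\<in>carrier M. \<forall>a\<in>carrier R. f (x \<cdot>\<^bsub>M\<^esub> a) = f x \<cdot>\<^bsub>N\<^esub> a)}"

definition rmod_iso :: "('a, 'r) ring_scheme \<Rightarrow> ('a, 'b, 'm) rmod_scheme
    \<Rightarrow> ('a, 'c, 'n) rmod_scheme \<Rightarrow> bool" where
  "rmod_iso R M N \<longleftrightarrow> (\<exists>f\<in>rmod_hom R M N. bij_betw f (carrier M) (carrier N))"

definition submod :: "('a, 'r) ring_scheme \<Rightarrow> ('a, 'b, 'm) rmod_scheme \<Rightarrow> 'b set \<Rightarrow> bool" where
  "submod R M N \<longleftrightarrow> N \<subseteq> carrier M \<and> \<zero>\<^bsub>M\<^esub> \<in> N \<and>
     (\<forall>x\<in>N. \<forall>y\<in>N. x \<oplus>\<^bsub>M\<^esub> y \<in> N) \<and> (\<forall>x\<in>N. \<forall>a\<in>carrier R. x \<cdot>\<^bsub>M\<^esub> a \<in> N)"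

definition fin_gen :: "('a, 'r) ring_scheme \<Rightarrow> ('a, 'b, 'm) rmod_scheme \<Rightarrow> bool" where
  "fin_gen R M \<longleftrightarrow> (\<exists>G. finite G \<and> G \<subseteq> carrier M \<and>
     (\<forall>N. submod R M N \<and> G \<subseteq> N \<longrightarrow> N = carrier M))"

definition simple_rmod :: "('a, 'r) ring_scheme \<Rightarrow> ('a, 'b, 'm) rmod_scheme \<Rightarrow> bool" where
  "simple_rmod R M \<longleftrightarrow> right_module R M \<and> carrier M \<noteq> {\<zero>\<^bsub>M\<^esub>} \<and>
     (\<forall>N. submod R M N \<longrightarrow> N = {\<zero>\<^bsub>M\<^esub>} \<or> N = carrier M)"

text \<open>The free right module on a set of basis elements: finitely supported functions.\<close>

definition free_rmod :: "('a, 'r) ring_scheme \<Rightarrow> 'x set \<Rightarrow> ('a, 'x \<Rightarrow> 'a) rmod" where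
  "free_rmod R X = \<lparr>
     carrier = {f \<in> X \<rightarrow>\<^sub>E carrier R. finite {i \<in> X. f i \<noteq> \<zero>\<^bsub>R\<^esub>}},
     mult = undefined, one = undefined,
     zero = \<lambda>i\<in>X. \<zero>\<^bsub>R\<^esub>, add = \<lambda>f g. \<lambda>i\<in>X. f i \<oplus>\<^bsub>R\<^esub> g i,
     ract = \<lambda>f a. \<lambda>i\<in>X. f i \<otimes>\<^bsub>R\<^esub> a\<rparr>"

text \<open>
  A module is projective if it is a direct summand of a free module. The basis may be
  taken inside the carrier type of the module without loss of generality, since a summand of any
  free module is a summand of the free module on its own set of elements.
\<close>

definition projective_rmod :: "('a, 'r) ring_scheme \<Rightarrow> ('a, 'b, 'm) rmod_scheme \<Rightarrow> bool" where
  "projective_rmod R M \<longleftrightarrow> right_module R M \<and>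
     (\<exists>X :: 'b set. \<exists>s\<in>rmod_hom R M (free_rmod R X). \<exists>p\<in>rmod_hom R (free_rmod R X) M.
        \<forall>x\<in>carrier M. p (s x) = x)"


section \<open>Homological dimensions\<close>

text \<open>
  A projective resolution \<open>0 \<rightarrow> P n \<rightarrow> \<dots> \<rightarrow> P 0 \<rightarrow> M \<rightarrow> 0\<close>, where \<open>d 0\<close> is the augmentation
  \<open>P 0 \<rightarrow> M\<close> and \<open>d (Suc i)\<close> is the map \<open>P (Suc i) \<rightarrow> P i\<close>.
\<close>

definition proj_resolution :: "('a, 'r) ring_scheme \<Rightarrow> ('a, 'b, 'm) rmod_scheme \<Rightarrow> nat
    \<Rightarrow> (nat \<Rightarrow> ('a, 'b) rmod) \<Rightarrow> (nat \<Rightarrow> 'b \<Rightarrow> 'b) \<Rightarrow> bool" where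
  "proj_resolution R M n P d \<longleftrightarrow>
     (\<forall>i\<le>n. projective_rmod R (P i)) \<and>
     d 0 \<in> rmod_hom R (P 0) M \<and>
     (\<forall>i<n. d (Suc i) \<in> rmod_hom R (P (Suc i)) (P i)) \<and>
     d 0 ` carrier (P 0) = carrier M \<and>
     (0 < n \<longrightarrow> d 1 ` carrier (P 1) = {x \<in> carrier (P 0). d 0 x = \<zero>\<^bsub>M\<^esub>}) \<and>
     (\<forall>i. Suc i < n \<longrightarrow> d (Suc (Suc i)) ` carrier (P (Suc (Suc i))) =
        {x \<in> carrier (P (Suc i)). d (Suc i) x = \<zero>\<^bsub>P i\<^esub>}) \<and>
     inj_on (d n) (carrier (P n))"

text \<open>
  HOL cannot quantify over all modules of all types, so modules and the terms of their
  resolutions are taken in one universe. It is large enough: it contains an isomorphic copy of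
  every finitely generated module (a quotient of \<open>R\<^sup>n\<close>, whose elements are sets of \<open>n\<close>-tuples), and
  of every module of cardinality at most that of \<open>nat \<Rightarrow> 'a\<close>. The latter include a free
  module on the elements of a finitely generated module and all iterated syzygies obtained in
  this way, so restricting resolutions to the universe does not change the projective
  dimension of a finitely generated module.
\<close>

type_synonym 'a univ = "(nat \<Rightarrow> 'a) set"

definition proj_dim :: "('a, 'r) ring_scheme \<Rightarrow> ('a, 'a univ) rmod \<Rightarrow> enat" where
  "proj_dim R M = Inf {enat n | n. \<exists>P d. proj_resolution R M n P d}"

definition fin_proj_class :: "('a, 'r) ring_scheme \<Rightarrow> ('a, 'a univ) rmod set" where
  "fin_proj_class R = {M. right_module R M \<and>
     (\<exists>n P d. proj_resolution R M n P d \<and> (\<forall>i\<le>n. fin_gen R (P i)))}"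

definition fin_dim :: "('a, 'r) ring_scheme \<Rightarrow> enat" where
  "fin_dim R = Sup (proj_dim R ` fin_proj_class R)"

text \<open>Regularity of a noetherian ring; no uniform bound on the projective dimensions is required.\<close>

definition regular_ring :: "('a, 'r) ring_scheme \<Rightarrow> bool" where
  "regular_ring R \<longleftrightarrow> (\<forall>M :: ('a, 'a univ) rmod.
     right_module R M \<and> fin_gen R M \<longrightarrow> proj_dim R M \<noteq> \<infinity>)"

definition krull_dim :: "('a, 'r) ring_scheme \<Rightarrow> enat" where
  "krull_dim R = Sup {enat n | n. \<exists>p. (\<forall>i\<le>n. primeideal (p i) R) \<and> (\<forall>i<n. p i \<subset> p (Suc i))}"


section \<open>Ring constructions\<close>

definition opposite_ring :: "('a, 'r) ring_scheme \<Rightarrow> 'a ring" where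
  "opposite_ring R = \<lparr>carrier = carrier R, mult = \<lambda>x y. y \<otimes>\<^bsub>R\<^esub> x, one = \<one>\<^bsub>R\<^esub>,
     zero = \<zero>\<^bsub>R\<^esub>, add = (\<oplus>\<^bsub>R\<^esub>)\<rparr>"

definition trivial_ext :: "('a, 'r) ring_scheme \<Rightarrow> ('a \<times> 'a) ring" where
  "trivial_ext B = \<lparr>carrier = carrier B \<times> carrier B,
     mult = \<lambda>(x, y) (x', y'). (x \<otimes>\<^bsub>B\<^esub> x', x \<otimes>\<^bsub>B\<^esub> y' \<oplus>\<^bsub>B\<^esub> y \<otimes>\<^bsub>B\<^esub> x'),
     one = (\<one>\<^bsub>B\<^esub>, \<zero>\<^bsub>B\<^esub>),
     zero = (\<zero>\<^bsub>B\<^esub>, \<zero>\<^bsub>B\<^esub>),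
     add = \<lambda>(x, y) (x', y'). (x \<oplus>\<^bsub>B\<^esub> x', y \<oplus>\<^bsub>B\<^esub> y')\<rparr>"

definition ring_product :: "'i set \<Rightarrow> ('i \<Rightarrow> ('b, 'r) ring_scheme) \<Rightarrow> ('i \<Rightarrow> 'b) ring" where
  "ring_product I B = \<lparr>carrier = (\<Pi>\<^sub>E i\<in>I. carrier (B i)),
     mult = \<lambda>f g. \<lambda>i\<in>I. f i \<otimes>\<^bsub>B i\<^esub> g i,
     one = \<lambda>i\<in>I. \<one>\<^bsub>B i\<^esub>,
     zero = \<lambda>i\<in>I. \<zero>\<^bsub>B i\<^esub>,
     add = \<lambda>f g. \<lambda>i\<in>I. f i \<oplus>\<^bsub>B i\<^esub> g i\<rparr>"

text \<open>Endomorphisms act from the left, so their product is composition in the usual order.\<close>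

definition end_ring :: "('a, 'r) ring_scheme \<Rightarrow> ('a, 'b, 'm) rmod_scheme \<Rightarrow> ('b \<Rightarrow> 'b) ring" where
  "end_ring R M = \<lparr>carrier = rmod_hom R M M \<inter> extensional (carrier M),
     mult = compose (carrier M),
     one = \<lambda>x\<in>carrier M. x,
     zero = \<lambda>x\<in>carrier M. \<zero>\<^bsub>M\<^esub>,
     add = \<lambda>f g. \<lambda>x\<in>carrier M. f x \<oplus>\<^bsub>M\<^esub> g x\<rparr>"

definition direct_sum :: "'i set \<Rightarrow> ('i \<Rightarrow> ('a, 'b, 'm) rmod_scheme) \<Rightarrow> ('a, 'i \<Rightarrow> 'b) rmod" where
  "direct_sum I S = \<lparr>
     carrier = {f \<in> (\<Pi>\<^sub>E i\<in>I. carrier (S i)). finite {i \<in> I. f i \<noteq> \<zero>\<^bsub>S i\<^esub>}},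
     mult = undefined, one = undefined,
     zero = \<lambda>i\<in>I. \<zero>\<^bsub>S i\<^esub>, add = \<lambda>f g. \<lambda>i\<in>I. f i \<oplus>\<^bsub>S i\<^esub> g i,
     ract = \<lambda>f a. \<lambda>i\<in>I. f i \<cdot>\<^bsub>S i\<^esub> a\<rparr>"

text \<open>
  The triangular matrix ring of matrices with rows \<open>(a, 0)\<close> and \<open>(s, b)\<close>, encoded as triples
  \<open>(a, s, b)\<close>, for a bimodule \<open>S\<close> with left action \<open>l\<close> of \<open>B\<close> and right action of \<open>A\<close>.
\<close>

definition triangular_ring :: "('a, 'r) ring_scheme \<Rightarrow> ('b, 'q) ring_scheme
    \<Rightarrow> ('a, 's, 'm) rmod_scheme \<Rightarrow> ('b \<Rightarrow> 's \<Rightarrow> 's) \<Rightarrow> ('a \<times> 's \<times> 'b) ring" where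
  "triangular_ring A B S l = \<lparr>carrier = carrier A \<times> carrier S \<times> carrier B,
     mult = \<lambda>(a, s, b) (a', s', b').
       (a \<otimes>\<^bsub>A\<^esub> a', s \<cdot>\<^bsub>S\<^esub> a' \<oplus>\<^bsub>S\<^esub> l b s', b \<otimes>\<^bsub>B\<^esub> b'),
     one = (\<one>\<^bsub>A\<^esub>, \<zero>\<^bsub>S\<^esub>, \<one>\<^bsub>B\<^esub>),
     zero = (\<zero>\<^bsub>A\<^esub>, \<zero>\<^bsub>S\<^esub>, \<zero>\<^bsub>B\<^esub>),
     add = \<lambda>(a, s, b) (a', s', b'). (a \<oplus>\<^bsub>A\<^esub> a', s \<oplus>\<^bsub>S\<^esub> s', b \<oplus>\<^bsub>B\<^esub> b')\<rparr>"


section \<open>The cover\<close>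

text \<open>
  Every simple right module is isomorphic to a quotient of the base ring by a maximal right
  ideal, whose elements are cosets; hence modules with elements of type \<^typ>\<open>'a set\<close> represent all
  isomorphism classes of simple modules.
\<close>

definition simple_classes :: "('a, 'r) ring_scheme \<Rightarrow> ('a, 'a set) rmod set set" where
  "simple_classes A = {M. simple_rmod A M} //
     {(M, N). simple_rmod A M \<and> simple_rmod A N \<and> rmod_iso A M N}"

definition class_rep :: "('a, 'b) rmod set \<Rightarrow> ('a, 'b) rmod" where
  "class_rep c = (SOME M. M \<in> c)"

definition cover_bimodule ::
    "('a, 'r) ring_scheme \<Rightarrow> ('a, ('a, 'a set) rmod set \<Rightarrow> 'a set) rmod" where
  "cover_bimodule A = direct_sum (simple_classes A) class_rep"

definition cover_corner :: "('a, 'r) ring_scheme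
    \<Rightarrow> (('a, 'a set) rmod set \<Rightarrow> ('a set \<Rightarrow> 'a set) \<times> ('a set \<Rightarrow> 'a set)) ring" where
  "cover_corner A =
     ring_product (simple_classes A) (\<lambda>c. trivial_ext (end_ring A (class_rep c)))"

definition cover :: "('a, 'r) ring_scheme \<Rightarrow> ('a \<times> (('a, 'a set) rmod set \<Rightarrow> 'a set) \<times>
    (('a, 'a set) rmod set \<Rightarrow> ('a set \<Rightarrow> 'a set) \<times> ('a set \<Rightarrow> 'a set))) ring" where
  "cover A = triangular_ring A (cover_corner A) (cover_bimodule A)
     (\<lambda>b s. \<lambda>c\<in>simple_classes A. fst (b c) (s c))"

end

theory Submission
  imports Defs
begin

text \<open>
  If all finitely generated modules over a commutative noetherian ring \<open>A\<close> have projective dimension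
  at most \<open>d\<close>, then chains of primes have length at most \<open>d\<close>: for primes \<open>p \<subset> q\<close> and
  \<open>x \<in> q - p\<close>, the element \<open>x\<close> is regular on \<open>A / p\<close>, and comparing \<open>A / p\<close> with \<open>A / (p + x A)\<close>
  bounds the projective dimension of \<open>A / p\<close> at \<open>p\<close> by that of \<open>A / q\<close> at \<open>q\<close> minus one. So
  infinite Krull dimension gives modules of arbitrarily large projective dimension, which is finite
  by regularity. Restricting them along \<open>fst\<close>, which splits and has free modules projective over
  the cover, preserves finite resolutions and projective dimensions.

  On the opposite side, every proper finitely generated right ideal of the cover has a nonzero left
  annihilator: its first components lie in a maximal ideal \<open>m\<close> and an element of the simple module
  \<open>A / m\<close> kills them, or its components in some \<open>T(End(S))\<close> lie in the square-zero ideal, which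
  \<open>(0, 1)\<close> kills. By Bass's argument, injections between finitely generated projective modules
  then split, so finite resolutions collapse from the left.
\<close>

section \<open>Right modules and homomorphisms\<close>

text \<open>Localisation cannot be avoided in the comparison of \<open>A / p\<close> with
  \<open>A / q\<close>. The hypothesis at \<open>q\<close> only concerns the residue field of the
  localisation, and noetherian induction over all ideals turns it into a bound for every cyclic
  module, in particular for \<open>A / (p + x A)\<close>. This works only up to denominators outside
  \<open>q\<close>: there an ideal not contained in \<open>q\<close> has zero quotient, and
  Nakayama's lemma is available. Passing to \<open>p\<close> enlarges the set of denominators, so
  the argument repeats down a chain of primes until a residue field at a nonminimal prime would have
  to be projective, which is impossible. A second obstacle is that resolutions live in one fixed
  carrier type. Modules over \<open>A\<close> are kept in the type
  \<open>nat \<Rightarrow> 'a\<close>, which is stable under kernels of finite free covers, and are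
  moved along injections only where resolutions over \<open>A\<close> or over the cover enter. On
  the opposite side the square-zero part of \<open>T(End(S))\<close> is essential: an element
  killing a corner entry must also act as zero on the bimodule, and no nonzero element of the
  division ring \<open>End(S)\<close> does.\<close>

context right_module
begin

lemma ract_zero_right [simp]: "x \<in> carrier M \<Longrightarrow> x \<cdot>\<^bsub>M\<^esub> \<zero>\<^bsub>R\<^esub> = \<zero>\<^bsub>M\<^esub>"
  using ract_add_right[of x "\<zero>\<^bsub>R\<^esub>" "\<zero>\<^bsub>R\<^esub>"] M.add.r_cancel_one[of "x \<cdot>\<^bsub>M\<^esub> \<zero>\<^bsub>R\<^esub>" "x \<cdot>\<^bsub>M\<^esub> \<zero>\<^bsub>R\<^esub>"] by simp

lemma ract_zero_left [simp]: "a \<in> carrier R \<Longrightarrow> \<zero>\<^bsub>M\<^esub> \<cdot>\<^bsub>M\<^esub> a = \<zero>\<^bsub>M\<^esub>"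
  using ract_add_left[of "\<zero>\<^bsub>M\<^esub>" "\<zero>\<^bsub>M\<^esub>" a] M.add.r_cancel_one[of "\<zero>\<^bsub>M\<^esub> \<cdot>\<^bsub>M\<^esub> a" "\<zero>\<^bsub>M\<^esub> \<cdot>\<^bsub>M\<^esub> a"] by simp

lemma ract_minus_right: "x \<in> carrier M \<Longrightarrow> a \<in> carrier R \<Longrightarrow> x \<cdot>\<^bsub>M\<^esub> (\<ominus>\<^bsub>R\<^esub> a) = \<ominus>\<^bsub>M\<^esub> (x \<cdot>\<^bsub>M\<^esub> a)"
  using ract_add_right[of x "\<ominus>\<^bsub>R\<^esub> a" a] M.minus_equality[of "x \<cdot>\<^bsub>M\<^esub> (\<ominus>\<^bsub>R\<^esub> a)" "x \<cdot>\<^bsub>M\<^esub> a"]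
  by (simp add: R.l_neg)

lemma ract_minus_left: "x \<in> carrier M \<Longrightarrow> a \<in> carrier R \<Longrightarrow> (\<ominus>\<^bsub>M\<^esub> x) \<cdot>\<^bsub>M\<^esub> a = \<ominus>\<^bsub>M\<^esub> (x \<cdot>\<^bsub>M\<^esub> a)"
  using ract_add_left[of "\<ominus>\<^bsub>M\<^esub> x" x a] M.minus_equality[of "(\<ominus>\<^bsub>M\<^esub> x) \<cdot>\<^bsub>M\<^esub> a" "x \<cdot>\<^bsub>M\<^esub> a"]
  by (simp add: M.l_neg)

lemma diff_eq_zero_iff: "x \<in> carrier M \<Longrightarrow> y \<in> carrier M \<Longrightarrow> x \<ominus>\<^bsub>M\<^esub> y = \<zero>\<^bsub>M\<^esub> \<longleftrightarrow> x = y"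
  by (metis M.add.inv_closed M.add.inv_solve_right' M.l_zero M.zero_closed a_minus_def)

end

lemma right_moduleI:
  assumes "ring R" "abelian_group M"
    and "\<And>x a. x \<in> carrier M \<Longrightarrow> a \<in> carrier R \<Longrightarrow> x \<cdot>\<^bsub>M\<^esub> a \<in> carrier M"
    and "\<And>x y a. x \<in> carrier M \<Longrightarrow> y \<in> carrier M \<Longrightarrow> a \<in> carrier R
        \<Longrightarrow> (x \<oplus>\<^bsub>M\<^esub> y) \<cdot>\<^bsub>M\<^esub> a = x \<cdot>\<^bsub>M\<^esub> a \<oplus>\<^bsub>M\<^esub> y \<cdot>\<^bsub>M\<^esub> a"
    and "\<And>x a b. x \<in> carrier M \<Longrightarrow> a \<in> carrier R \<Longrightarrow> b \<in> carrier R
        \<Longrightarrow> x \<cdot>\<^bsub>M\<^esub> (a \<oplus>\<^bsub>R\<^esub> b) = x \<cdot>\<^bsub>M\<^esub> a \<oplus>\<^bsub>M\<^esub> x \<cdot>\<^bsub>M\<^esub> b"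
    and "\<And>x a b. x \<in> carrier M \<Longrightarrow> a \<in> carrier R \<Longrightarrow> b \<in> carrier R
        \<Longrightarrow> x \<cdot>\<^bsub>M\<^esub> (a \<otimes>\<^bsub>R\<^esub> b) = (x \<cdot>\<^bsub>M\<^esub> a) \<cdot>\<^bsub>M\<^esub> b"
    and "\<And>x. x \<in> carrier M \<Longrightarrow> x \<cdot>\<^bsub>M\<^esub> \<one>\<^bsub>R\<^esub> = x"
  shows "right_module R M"
  using assms by (simp add: right_module_def right_module_axioms_def)

lemma rmod_homI:
  assumes "\<And>x. x \<in> carrier M \<Longrightarrow> f x \<in> carrier N"
    and "\<And>x y. x \<in> carrier M \<Longrightarrow> y \<in> carrier M \<Longrightarrow> f (x \<oplus>\<^bsub>M\<^esub> y) = f x \<oplus>\<^bsub>N\<^esub> f y"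
    and "\<And>x a. x \<in> carrier M \<Longrightarrow> a \<in> carrier R \<Longrightarrow> f (x \<cdot>\<^bsub>M\<^esub> a) = f x \<cdot>\<^bsub>N\<^esub> a"
  shows "f \<in> rmod_hom R M N"
  using assms by (auto simp: rmod_hom_def)

lemma hom_closed: "f \<in> rmod_hom R M N \<Longrightarrow> x \<in> carrier M \<Longrightarrow> f x \<in> carrier N"
  by (auto simp: rmod_hom_def)

lemma hom_add: "f \<in> rmod_hom R M N \<Longrightarrow> x \<in> carrier M \<Longrightarrow> y \<in> carrier M
    \<Longrightarrow> f (x \<oplus>\<^bsub>M\<^esub> y) = f x \<oplus>\<^bsub>N\<^esub> f y"
  by (auto simp: rmod_hom_def)

lemma hom_ract: "f \<in> rmod_hom R M N \<Longrightarrow> x \<in> carrier M \<Longrightarrow> a \<in> carrier R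
    \<Longrightarrow> f (x \<cdot>\<^bsub>M\<^esub> a) = f x \<cdot>\<^bsub>N\<^esub> a"
  by (auto simp: rmod_hom_def)

lemmas hom_simps = hom_closed hom_add hom_ract

lemma hom_zero:
  assumes f: "f \<in> rmod_hom R M N" and "right_module R M" "right_module R N"
  shows "f \<zero>\<^bsub>M\<^esub> = \<zero>\<^bsub>N\<^esub>"
proof -
  interpret M: right_module R M by fact
  interpret N: right_module R N by fact
  show ?thesis
    using hom_ract[OF f, of "\<zero>\<^bsub>M\<^esub>" "\<zero>\<^bsub>R\<^esub>"] hom_closed[OF f, of "\<zero>\<^bsub>M\<^esub>"] by simp
qed

lemma hom_neg:
  assumes f: "f \<in> rmod_hom R M N" and "right_module R M" "right_module R N" "x \<in> carrier M"
  shows "f (\<ominus>\<^bsub>M\<^esub> x) = \<ominus>\<^bsub>N\<^esub> f x"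
proof -
  interpret M: right_module R M by fact
  interpret N: right_module R N by fact
  have "f (\<ominus>\<^bsub>M\<^esub> x) \<oplus>\<^bsub>N\<^esub> f x = \<zero>\<^bsub>N\<^esub>"
    using assms(4) hom_add[OF f, of "\<ominus>\<^bsub>M\<^esub> x" x, symmetric] hom_zero[OF f] assms
    by (simp add: M.M.l_neg)
  then show ?thesis
    using hom_closed[OF f] assms(4) N.M.minus_equality by fastforce
qed

lemma hom_minus:
  assumes f: "f \<in> rmod_hom R M N" and "right_module R M" "right_module R N"
    and "x \<in> carrier M" "y \<in> carrier M"
  shows "f (x \<ominus>\<^bsub>M\<^esub> y) = f x \<ominus>\<^bsub>N\<^esub> f y"
proof -
  interpret M: right_module R M by fact
  show ?thesis using assms by (simp add: a_minus_def hom_add[OF f] hom_neg[OF f])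
qed

lemma hom_cong:
  assumes "f \<in> rmod_hom R M N" "right_module R M" "\<And>x. x \<in> carrier M \<Longrightarrow> g x = f x"
  shows "g \<in> rmod_hom R M N"
proof -
  interpret M: right_module R M by fact
  show ?thesis using assms by (auto simp: rmod_hom_def)
qed

lemma hom_id: "(\<lambda>x. x) \<in> rmod_hom R M M"
  by (auto simp: rmod_hom_def)

lemma hom_comp: "f \<in> rmod_hom R M N \<Longrightarrow> g \<in> rmod_hom R N P \<Longrightarrow> (\<lambda>x. g (f x)) \<in> rmod_hom R M P"
  by (auto simp: rmod_hom_def Pi_def)

lemma hom_const_zero:
  assumes "right_module R N"
  shows "(\<lambda>x. \<zero>\<^bsub>N\<^esub>) \<in> rmod_hom R M N"
proof -
  interpret N: right_module R N by fact
  show ?thesis by (rule rmod_homI) auto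
qed

lemma hom_plus:
  assumes f: "f \<in> rmod_hom R M N" and g: "g \<in> rmod_hom R M N" and "right_module R N"
  shows "(\<lambda>x. f x \<oplus>\<^bsub>N\<^esub> g x) \<in> rmod_hom R M N"
proof -
  interpret N: right_module R N by fact
  show ?thesis
    by (rule rmod_homI)
      (simp_all add: hom_simps[OF f] hom_simps[OF g] N.M.a_ac N.ract_add_left)
qed

lemma hom_uminus:
  assumes f: "f \<in> rmod_hom R M N" and "right_module R N"
  shows "(\<lambda>x. \<ominus>\<^bsub>N\<^esub> f x) \<in> rmod_hom R M N"
proof -
  interpret N: right_module R N by fact
  show ?thesis
    by (rule rmod_homI)
      (simp_all add: hom_simps[OF f] N.M.minus_add N.ract_minus_left)
qed

lemma hom_diff:
  assumes "f \<in> rmod_hom R M N" and "g \<in> rmod_hom R M N" and "right_module R N"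
  shows "(\<lambda>x. f x \<ominus>\<^bsub>N\<^esub> g x) \<in> rmod_hom R M N"
  unfolding a_minus_def by (intro hom_plus hom_uminus assms)

text \<open>Commutativity makes multiplication by a ring element linear; every scaling of a
  homomorphism by a denominator below rests on this.\<close>

lemma hom_scale:
  assumes f: "f \<in> rmod_hom R M N" and "right_module R N" "cring R" "s \<in> carrier R"
  shows "(\<lambda>x. f x \<cdot>\<^bsub>N\<^esub> s) \<in> rmod_hom R M N"
proof -
  interpret N: right_module R N by fact
  interpret R: cring R by fact
  show ?thesis
    using assms(4)
    by (intro rmod_homI)
      (simp_all add: hom_simps[OF f] N.ract_add_left N.ract_assoc[symmetric] R.m_comm)
qed

lemma hom_inj:
  assumes f: "f \<in> rmod_hom R M N" and "right_module R M" "right_module R N"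
    and "\<And>x. x \<in> carrier M \<Longrightarrow> f x = \<zero>\<^bsub>N\<^esub> \<Longrightarrow> x = \<zero>\<^bsub>M\<^esub>"
  shows "inj_on f (carrier M)"
proof (rule inj_onI)
  interpret M: right_module R M by fact
  interpret N: right_module R N by fact
  fix x y assume "x \<in> carrier M" "y \<in> carrier M" "f x = f y"
  then have "f (x \<ominus>\<^bsub>M\<^esub> y) = \<zero>\<^bsub>N\<^esub>"
    using hom_minus[OF f assms(2,3), of x y] hom_closed[OF f]
    by (simp add: N.diff_eq_zero_iff)
  then show "x = y"
    using assms(4)[of "x \<ominus>\<^bsub>M\<^esub> y"] M.diff_eq_zero_iff[of x y]
    by (simp add: \<open>x \<in> carrier M\<close> \<open>y \<in> carrier M\<close>)
qed

lemma inv_hom: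
  assumes f: "f \<in> rmod_hom R M N" and "right_module R M" and b: "bij_betw f (carrier M) (carrier N)"
  shows "the_inv_into (carrier M) f \<in> rmod_hom R N M"
proof (rule rmod_homI)
  interpret M: right_module R M by fact
  let ?g = "the_inv_into (carrier M) f"
  have i: "inj_on f (carrier M)" and s: "f ` carrier M = carrier N"
    using b by (auto simp: bij_betw_def)
  have gf: "f (?g y) = y" if "y \<in> carrier N" for y using f_the_inv_into_f[OF i] that s by auto
  show c: "?g y \<in> carrier M" if "y \<in> carrier N" for y
    using the_inv_into_into[OF i, of y "carrier M"] that s by auto
  show "?g (x \<oplus>\<^bsub>N\<^esub> y) = ?g x \<oplus>\<^bsub>M\<^esub> ?g y" if "x \<in> carrier N" "y \<in> carrier N" for x y
    using that c by (intro the_inv_into_f_eq[OF i]) (auto simp: hom_add[OF f] gf)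
  show "?g (x \<cdot>\<^bsub>N\<^esub> a) = ?g x \<cdot>\<^bsub>M\<^esub> a" if "x \<in> carrier N" "a \<in> carrier R" for x a
    using that c by (intro the_inv_into_f_eq[OF i]) (auto simp: hom_ract[OF f] gf)
qed

subsection \<open>Submodules\<close>

lemma submodD:
  assumes "submod R M U"
  shows "U \<subseteq> carrier M" "\<zero>\<^bsub>M\<^esub> \<in> U" "\<And>x y. x \<in> U \<Longrightarrow> y \<in> U \<Longrightarrow> x \<oplus>\<^bsub>M\<^esub> y \<in> U"
    "\<And>x a. x \<in> U \<Longrightarrow> a \<in> carrier R \<Longrightarrow> x \<cdot>\<^bsub>M\<^esub> a \<in> U"
  using assms by (auto simp: submod_def)

lemma submodI:
  assumes "U \<subseteq> carrier M" "\<zero>\<^bsub>M\<^esub> \<in> U" "\<And>x y. x \<in> U \<Longrightarrow> y \<in> U \<Longrightarrow> x \<oplus>\<^bsub>M\<^esub> y \<in> U"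
    "\<And>x a. x \<in> U \<Longrightarrow> a \<in> carrier R \<Longrightarrow> x \<cdot>\<^bsub>M\<^esub> a \<in> U"
  shows "submod R M U"
  using assms by (auto simp: submod_def)

lemma submod_carrier:
  assumes "right_module R M" shows "submod R M (carrier M)"
proof -
  interpret right_module R M by fact
  show ?thesis by (rule submodI) auto
qed

text \<open>A negative is a multiple by \<open>\<ominus> \<one>\<close>, so the closure conditions
  of \<open>submod\<close> already give a subgroup.\<close>

lemma submod_neg:
  assumes "right_module R M" "submod R M U" "x \<in> U"
  shows "\<ominus>\<^bsub>M\<^esub> x \<in> U"
proof -
  interpret right_module R M by fact
  have x: "x \<in> carrier M" using assms submodD(1) by blast
  have "x \<cdot>\<^bsub>M\<^esub> (\<ominus>\<^bsub>R\<^esub> \<one>\<^bsub>R\<^esub>) \<in> U" using submodD(4)[OF assms(2,3)] by simp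
  with x show ?thesis by (simp add: ract_minus_right)
qed

lemma submod_diff:
  assumes "right_module R M" "submod R M U" "x \<in> U" "y \<in> U"
  shows "x \<ominus>\<^bsub>M\<^esub> y \<in> U"
  unfolding a_minus_def using assms by (intro submodD(3)[OF assms(2)] submod_neg)

lemma submod_module:
  assumes "right_module R M" "submod R M U"
  shows "right_module R (M\<lparr>carrier := U\<rparr>)"
proof -
  interpret right_module R M by fact
  note U = submodD[OF assms(2)]
  have sub: "x \<in> carrier M" if "x \<in> U" for x using that U(1) by auto
  show ?thesis
  proof (rule right_moduleI)
    show "abelian_group (M\<lparr>carrier := U\<rparr>)"
    proof (rule abelian_groupI)
      fix x assume "x \<in> carrier (M\<lparr>carrier := U\<rparr>)"
      then show "\<exists>y\<in>carrier (M\<lparr>carrier := U\<rparr>). y \<oplus>\<^bsub>M\<lparr>carrier := U\<rparr>\<^esub> x = \<zero>\<^bsub>M\<lparr>carrier := U\<rparr>\<^esub>"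
        using submod_neg[OF assms, of x] sub[of x] by (auto intro!: bexI[of _ "\<ominus>\<^bsub>M\<^esub> x"] simp: M.l_neg)
    qed (use U sub in \<open>auto simp: M.a_ac\<close>)
  qed (use U sub in \<open>auto simp: R.ring_axioms ract_add_left ract_add_right ract_assoc\<close>)
qed

lemma submod_incl: "submod R M U \<Longrightarrow> (\<lambda>x. x) \<in> rmod_hom R (M\<lparr>carrier := U\<rparr>) M"
  by (auto simp: rmod_hom_def submod_def)

lemma submod_sub:
  assumes "submod R M U"
  shows "submod R (M\<lparr>carrier := U\<rparr>) V \<longleftrightarrow> submod R M V \<and> V \<subseteq> U"
  using assms by (auto simp: submod_def)

lemma hom_into_sub:
  "f \<in> rmod_hom R M N \<Longrightarrow> (\<And>x. x \<in> carrier M \<Longrightarrow> f x \<in> U) \<Longrightarrow> f \<in> rmod_hom R M (N\<lparr>carrier := U\<rparr>)"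
  by (auto simp: rmod_hom_def)

lemma submod_ker:
  assumes f: "f \<in> rmod_hom R M N" and "right_module R M" "right_module R N"
  shows "submod R M {x \<in> carrier M. f x = \<zero>\<^bsub>N\<^esub>}"
proof -
  interpret M: right_module R M by fact
  interpret N: right_module R N by fact
  show ?thesis
    by (rule submodI) (auto simp: hom_simps[OF f] hom_zero[OF f] assms)
qed

lemma submod_eqlz:
  assumes f: "f \<in> rmod_hom R M N" and g: "g \<in> rmod_hom R M N" and "right_module R M" "right_module R N"
  shows "submod R M {x \<in> carrier M. f x = g x}"
proof -
  interpret M: right_module R M by fact
  interpret N: right_module R N by fact
  show ?thesis
    by (rule submodI) (auto simp: hom_simps[OF f] hom_zero[OF f] hom_simps[OF g] hom_zero[OF g] assms)
qed

lemma submod_img: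
  assumes f: "f \<in> rmod_hom R M N" and "right_module R M" "right_module R N" and U: "submod R M U"
  shows "submod R N (f ` U)"
proof -
  interpret M: right_module R M by fact
  interpret N: right_module R N by fact
  note U = submodD[OF U]
  have sub: "x \<in> carrier M" if "x \<in> U" for x using that U(1) by auto
  show ?thesis
  proof (rule submodI)
    show "f ` U \<subseteq> carrier N" using sub by (auto simp: hom_simps[OF f])
    show "\<zero>\<^bsub>N\<^esub> \<in> f ` U" using U(2) hom_zero[OF f] assms by (metis image_eqI)
    show "x \<oplus>\<^bsub>N\<^esub> y \<in> f ` U" if xy: "x \<in> f ` U" "y \<in> f ` U" for x y
    proof -
      from xy obtain a b where "x = f a" "a \<in> U" "y = f b" "b \<in> U" by auto
      then show ?thesis using sub U(3)
        by (intro image_eqI[of _ _ "a \<oplus>\<^bsub>M\<^esub> b"]) (auto simp: hom_simps[OF f])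
    qed
    show "x \<cdot>\<^bsub>N\<^esub> a \<in> f ` U" if xy: "x \<in> f ` U" "a \<in> carrier R" for x a
    proof -
      from xy obtain u where "x = f u" "u \<in> U" by auto
      then show ?thesis using sub U(4) xy(2)
        by (intro image_eqI[of _ _ "u \<cdot>\<^bsub>M\<^esub> a"]) (auto simp: hom_simps[OF f])
    qed
  qed
qed

lemma submod_vimg:
  assumes f: "f \<in> rmod_hom R M N" and "right_module R M" "right_module R N" and U: "submod R N U"
  shows "submod R M {x \<in> carrier M. f x \<in> U}"
proof -
  interpret M: right_module R M by fact
  interpret N: right_module R N by fact
  note U = submodD[OF U]
  show ?thesis
    by (rule submodI) (auto simp: hom_simps[OF f] hom_zero[OF f] assms U)
qed

subsection \<open>Constructions\<close>

definition reg_rmod :: "('a, 'r) ring_scheme \<Rightarrow> ('a, 'a) rmod" where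
  "reg_rmod R = \<lparr>carrier = carrier R, mult = undefined, one = undefined,
     zero = \<zero>\<^bsub>R\<^esub>, add = (\<oplus>\<^bsub>R\<^esub>), ract = (\<otimes>\<^bsub>R\<^esub>)\<rparr>"

definition prod_rmod :: "('a, 'b, 'm) rmod_scheme \<Rightarrow> ('a, 'c, 'n) rmod_scheme \<Rightarrow> ('a, 'b \<times> 'c) rmod" where
  "prod_rmod M N = \<lparr>carrier = carrier M \<times> carrier N, mult = undefined, one = undefined,
     zero = (\<zero>\<^bsub>M\<^esub>, \<zero>\<^bsub>N\<^esub>), add = (\<lambda>x y. (fst x \<oplus>\<^bsub>M\<^esub> fst y, snd x \<oplus>\<^bsub>N\<^esub> snd y)),
     ract = (\<lambda>x a. (fst x \<cdot>\<^bsub>M\<^esub> a, snd x \<cdot>\<^bsub>N\<^esub> a))\<rparr>"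

text \<open>Transport of structure along an injection \<open>j\<close>. It changes the type of the
  elements but not the isomorphism class, which is how modules enter the carrier type over which
  resolutions are quantified.\<close>

definition copy_rmod :: "('b \<Rightarrow> 'c) \<Rightarrow> ('a, 'b, 'm) rmod_scheme \<Rightarrow> ('a, 'c) rmod" where
  "copy_rmod j M = (let i = the_inv_into (carrier M) j in
     \<lparr>carrier = j ` carrier M, mult = undefined, one = undefined,
      zero = j \<zero>\<^bsub>M\<^esub>, add = (\<lambda>x y. j (i x \<oplus>\<^bsub>M\<^esub> i y)), ract = (\<lambda>x a. j (i x \<cdot>\<^bsub>M\<^esub> a))\<rparr>)"

text \<open>Restriction of scalars along \<open>\<phi>\<close>. With \<open>\<phi>\<close> equal to
  \<open>fst\<close> it turns modules over \<open>A\<close> into modules over the cover.\<close>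

definition restr_rmod :: "('c \<Rightarrow> 'a) \<Rightarrow> ('a, 'b, 'm) rmod_scheme \<Rightarrow> ('c, 'b) rmod" where
  "restr_rmod \<phi> M = \<lparr>carrier = carrier M, mult = undefined, one = undefined,
     zero = \<zero>\<^bsub>M\<^esub>, add = (\<oplus>\<^bsub>M\<^esub>), ract = (\<lambda>x r. x \<cdot>\<^bsub>M\<^esub> \<phi> r)\<rparr>"

lemma reg_sel [simp]: "carrier (reg_rmod R) = carrier R" "\<zero>\<^bsub>reg_rmod R\<^esub> = \<zero>\<^bsub>R\<^esub>"
  "x \<oplus>\<^bsub>reg_rmod R\<^esub> y = x \<oplus>\<^bsub>R\<^esub> y" "x \<cdot>\<^bsub>reg_rmod R\<^esub> y = x \<otimes>\<^bsub>R\<^esub> y"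
  by (simp_all add: reg_rmod_def)

lemma prod_sel [simp]: "carrier (prod_rmod M N) = carrier M \<times> carrier N"
  "\<zero>\<^bsub>prod_rmod M N\<^esub> = (\<zero>\<^bsub>M\<^esub>, \<zero>\<^bsub>N\<^esub>)"
  "x \<oplus>\<^bsub>prod_rmod M N\<^esub> y = (fst x \<oplus>\<^bsub>M\<^esub> fst y, snd x \<oplus>\<^bsub>N\<^esub> snd y)"
  "x \<cdot>\<^bsub>prod_rmod M N\<^esub> a = (fst x \<cdot>\<^bsub>M\<^esub> a, snd x \<cdot>\<^bsub>N\<^esub> a)"
  by (simp_all add: prod_rmod_def)

lemma restr_sel [simp]: "carrier (restr_rmod \<phi> M) = carrier M" "\<zero>\<^bsub>restr_rmod \<phi> M\<^esub> = \<zero>\<^bsub>M\<^esub>"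
  "x \<oplus>\<^bsub>restr_rmod \<phi> M\<^esub> y = x \<oplus>\<^bsub>M\<^esub> y" "x \<cdot>\<^bsub>restr_rmod \<phi> M\<^esub> r = x \<cdot>\<^bsub>M\<^esub> \<phi> r"
  by (simp_all add: restr_rmod_def)

lemma reg_module: assumes "ring R" shows "right_module R (reg_rmod R)"
proof -
  interpret ring R by fact
  show ?thesis
    by (rule right_moduleI)
      (auto intro!: abelian_groupI bexI[of _ "\<ominus>\<^bsub>R\<^esub> _"]
        simp: a_ac r_neg l_neg l_distr r_distr m_assoc ring_axioms)
qed

lemma prod_module: assumes "right_module R M" "right_module R N" shows "right_module R (prod_rmod M N)"
proof -
  interpret M: right_module R M by fact
  interpret N: right_module R N by fact
  show ?thesis
  proof (rule right_moduleI)
    show "abelian_group (prod_rmod M N)"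
    proof (rule abelian_groupI)
      fix x assume "x \<in> carrier (prod_rmod M N)"
      then show "\<exists>y\<in>carrier (prod_rmod M N). y \<oplus>\<^bsub>prod_rmod M N\<^esub> x = \<zero>\<^bsub>prod_rmod M N\<^esub>"
        by (intro bexI[of _ "(\<ominus>\<^bsub>M\<^esub> fst x, \<ominus>\<^bsub>N\<^esub> snd x)"]) (auto simp: M.M.l_neg N.M.l_neg)
    qed (auto simp: M.M.a_ac N.M.a_ac)
  qed (auto simp: M.R.ring_axioms M.ract_add_left M.ract_add_right M.ract_assoc
      N.ract_add_left N.ract_add_right N.ract_assoc)
qed

lemma restr_module:
  assumes "ring R" "right_module A M" "\<phi> \<in> ring_hom R A"
  shows "right_module R (restr_rmod \<phi> M)"
proof -
  interpret R: ring R by fact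
  interpret M: right_module A M by fact
  note h = ring_hom_memE[OF assms(3)]
  show ?thesis
    by (rule right_moduleI)
      (auto intro!: abelian_groupI bexI[of _ "\<ominus>\<^bsub>M\<^esub> _"]
        simp: M.M.a_ac M.M.r_neg M.M.l_neg M.ract_add_left M.ract_add_right M.ract_assoc h R.ring_axioms)
qed

lemma hom_restr: "\<phi> \<in> ring_hom R A \<Longrightarrow> f \<in> rmod_hom A M N
    \<Longrightarrow> f \<in> rmod_hom R (restr_rmod \<phi> M) (restr_rmod \<phi> N)"
  by (auto simp: rmod_hom_def ring_hom_memE)

text \<open>As \<open>\<phi>\<close> is onto, every scalar of \<open>A\<close> is realised by a
  scalar of \<open>R\<close>, so linearity over the two rings is the same condition.\<close>

lemma hom_restr_iff:
  assumes "\<phi> \<in> ring_hom R A" "\<phi> ` carrier R = carrier A"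
  shows "rmod_hom R (restr_rmod \<phi> M) (restr_rmod \<phi> N) = rmod_hom A M N"
proof -
  have *: "(\<forall>a\<in>carrier A. P a) \<longleftrightarrow> (\<forall>r\<in>carrier R. P (\<phi> r))" for P
    using assms(2)[symmetric] by simp
  show ?thesis unfolding rmod_hom_def * by simp
qed

lemma submod_restr_iff:
  assumes "\<phi> ` carrier R = carrier A"
  shows "submod R (restr_rmod \<phi> M) U \<longleftrightarrow> submod A M U"
proof -
  have *: "(\<forall>a\<in>carrier A. P a) \<longleftrightarrow> (\<forall>r\<in>carrier R. P (\<phi> r))" for P
    using assms[symmetric] by simp
  show ?thesis unfolding submod_def * by simp
qed

lemma fin_gen_restr:
  assumes "\<phi> ` carrier R = carrier A" "fin_gen A M"
  shows "fin_gen R (restr_rmod \<phi> M)"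
  using assms by (simp add: fin_gen_def submod_restr_iff[OF assms(1)])

lemma copy_rmod:
  assumes "right_module R M" "inj_on j (carrier M)"
  shows "right_module R (copy_rmod j M)" "j \<in> rmod_hom R M (copy_rmod j M)"
    "the_inv_into (carrier M) j \<in> rmod_hom R (copy_rmod j M) M" "carrier (copy_rmod j M) = j ` carrier M"
    "bij_betw j (carrier M) (carrier (copy_rmod j M))"
    "\<And>x. x \<in> carrier M \<Longrightarrow> the_inv_into (carrier M) j (j x) = x"
proof -
  interpret M: right_module R M by fact
  have i: "the_inv_into (carrier M) j (j x) = x" if "x \<in> carrier M" for x
    using the_inv_into_f_f[OF assms(2) that] .
  have sel: "carrier (copy_rmod j M) = j ` carrier M" "\<zero>\<^bsub>copy_rmod j M\<^esub> = j \<zero>\<^bsub>M\<^esub>"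
    "\<And>x y. x \<in> carrier M \<Longrightarrow> y \<in> carrier M \<Longrightarrow> j x \<oplus>\<^bsub>copy_rmod j M\<^esub> j y = j (x \<oplus>\<^bsub>M\<^esub> y)"
    "\<And>x a. x \<in> carrier M \<Longrightarrow> j x \<cdot>\<^bsub>copy_rmod j M\<^esub> a = j (x \<cdot>\<^bsub>M\<^esub> a)"
    by (simp_all add: copy_rmod_def Let_def i)
  show "right_module R (copy_rmod j M)"
  proof (rule right_moduleI)
    show "abelian_group (copy_rmod j M)"
    proof (rule abelian_groupI)
      fix x assume "x \<in> carrier (copy_rmod j M)"
      then obtain y where "y \<in> carrier M" "x = j y" by (auto simp: sel)
      then show "\<exists>y\<in>carrier (copy_rmod j M). y \<oplus>\<^bsub>copy_rmod j M\<^esub> x = \<zero>\<^bsub>copy_rmod j M\<^esub>"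
        by (intro bexI[of _ "j (\<ominus>\<^bsub>M\<^esub> y)"]) (auto simp: sel M.M.l_neg)
    qed (auto simp: sel M.M.a_ac)
  qed (auto simp: sel M.R.ring_axioms M.ract_add_left M.ract_add_right M.ract_assoc)
  show "j \<in> rmod_hom R M (copy_rmod j M)"
    by (rule rmod_homI) (auto simp: sel)
  show "the_inv_into (carrier M) j \<in> rmod_hom R (copy_rmod j M) M"
    by (rule rmod_homI) (auto simp: sel i)
  show "carrier (copy_rmod j M) = j ` carrier M" by (rule sel)
  show "bij_betw j (carrier M) (carrier (copy_rmod j M))"
    using assms(2) by (simp add: sel bij_betw_def)
  show "\<And>x. x \<in> carrier M \<Longrightarrow> the_inv_into (carrier M) j (j x) = x" by (rule i)
qed

section \<open>Free, projective and finitely generated modules\<close>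

definition free_unit :: "('a, 'r) ring_scheme \<Rightarrow> 'x set \<Rightarrow> 'x \<Rightarrow> 'x \<Rightarrow> 'a" where
  "free_unit R X x = (\<lambda>i\<in>X. if i = x then \<one>\<^bsub>R\<^esub> else \<zero>\<^bsub>R\<^esub>)"

lemma free_sel:
  "carrier (free_rmod R X) = {f \<in> X \<rightarrow>\<^sub>E carrier R. finite {i \<in> X. f i \<noteq> \<zero>\<^bsub>R\<^esub>}}"
  "\<zero>\<^bsub>free_rmod R X\<^esub> = (\<lambda>i\<in>X. \<zero>\<^bsub>R\<^esub>)"
  "f \<oplus>\<^bsub>free_rmod R X\<^esub> g = (\<lambda>i\<in>X. f i \<oplus>\<^bsub>R\<^esub> g i)"
  "f \<cdot>\<^bsub>free_rmod R X\<^esub> a = (\<lambda>i\<in>X. f i \<otimes>\<^bsub>R\<^esub> a)"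
  by (simp_all add: free_rmod_def)

lemma free_module: assumes "ring R" shows "right_module R (free_rmod R X)"
proof -
  note free_sel [simp]
  interpret ring R by fact
  show ?thesis
  proof (rule right_moduleI)
    show "abelian_group (free_rmod R X)"
    proof (rule abelian_groupI)
      fix f g assume f: "f \<in> carrier (free_rmod R X)" and g: "g \<in> carrier (free_rmod R X)"
      have "finite {i \<in> X. f i \<oplus>\<^bsub>R\<^esub> g i \<noteq> \<zero>\<^bsub>R\<^esub>}"
        by (rule finite_subset[of _ "{i \<in> X. f i \<noteq> \<zero>\<^bsub>R\<^esub>} \<union> {i \<in> X. g i \<noteq> \<zero>\<^bsub>R\<^esub>}"]) (use f g in auto)
      then show "f \<oplus>\<^bsub>free_rmod R X\<^esub> g \<in> carrier (free_rmod R X)"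
        using f g by (auto simp: PiE_iff cong: conj_cong)
    next
      show "\<zero>\<^bsub>free_rmod R X\<^esub> \<in> carrier (free_rmod R X)" by (auto cong: conj_cong)
    next
      fix f g h assume "f \<in> carrier (free_rmod R X)" "g \<in> carrier (free_rmod R X)" "h \<in> carrier (free_rmod R X)"
      then show "f \<oplus>\<^bsub>free_rmod R X\<^esub> g \<oplus>\<^bsub>free_rmod R X\<^esub> h = f \<oplus>\<^bsub>free_rmod R X\<^esub> (g \<oplus>\<^bsub>free_rmod R X\<^esub> h)"
        by (auto simp: PiE_iff a_assoc intro!: restrict_ext)
    next
      fix f g assume "f \<in> carrier (free_rmod R X)" "g \<in> carrier (free_rmod R X)"
      then show "f \<oplus>\<^bsub>free_rmod R X\<^esub> g = g \<oplus>\<^bsub>free_rmod R X\<^esub> f"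
        by (auto simp: PiE_iff a_comm intro!: restrict_ext)
    next
      fix f assume f: "f \<in> carrier (free_rmod R X)"
      then show "\<zero>\<^bsub>free_rmod R X\<^esub> \<oplus>\<^bsub>free_rmod R X\<^esub> f = f"
        by (auto simp: PiE_iff fun_eq_iff extensional_def)
      have "finite {i \<in> X. \<ominus>\<^bsub>R\<^esub> f i \<noteq> \<zero>\<^bsub>R\<^esub>}"
        by (rule finite_subset[of _ "{i \<in> X. f i \<noteq> \<zero>\<^bsub>R\<^esub>}"]) (use f in auto)
      then show "\<exists>g\<in>carrier (free_rmod R X). g \<oplus>\<^bsub>free_rmod R X\<^esub> f = \<zero>\<^bsub>free_rmod R X\<^esub>"
        using f by (intro bexI[of _ "\<lambda>i\<in>X. \<ominus>\<^bsub>R\<^esub> f i"])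
          (auto simp: PiE_iff fun_eq_iff l_neg cong: conj_cong)
    qed
  next
    fix f a assume f: "f \<in> carrier (free_rmod R X)" and a: "a \<in> carrier R"
    have "finite {i \<in> X. f i \<otimes>\<^bsub>R\<^esub> a \<noteq> \<zero>\<^bsub>R\<^esub>}"
      by (rule finite_subset[of _ "{i \<in> X. f i \<noteq> \<zero>\<^bsub>R\<^esub>}"]) (use f a in auto)
    then show "f \<cdot>\<^bsub>free_rmod R X\<^esub> a \<in> carrier (free_rmod R X)"
      using f a by (auto simp: PiE_iff cong: conj_cong)
  qed (auto simp: PiE_iff ring_axioms l_distr r_distr m_assoc fun_eq_iff extensional_def)
qed

lemma free_unit_closed: assumes "ring R" "x \<in> X" shows "free_unit R X x \<in> carrier (free_rmod R X)"
proof -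
  note free_sel [simp]
  interpret ring R by fact
  have "finite {i \<in> X. free_unit R X x i \<noteq> \<zero>\<^bsub>R\<^esub>}"
    by (rule finite_subset[of _ "{x}"]) (auto simp: free_unit_def)
  then show ?thesis by (auto simp: free_unit_def cong: conj_cong)
qed

text \<open>Induction on a finite set containing the support: splitting off the multiple of one
  basis element removes that element from the support.\<close>

lemma free_span:
  assumes "ring R" and U: "submod R (free_rmod R X) U" and u: "\<And>x. x \<in> X \<Longrightarrow> free_unit R X x \<in> U"
  shows "U = carrier (free_rmod R X)"
proof -
  note free_sel [simp]
  interpret ring R by fact
  have "\<forall>f\<in>carrier (free_rmod R X). {i \<in> X. f i \<noteq> \<zero>\<^bsub>R\<^esub>} \<subseteq> S \<longrightarrow> f \<in> U" if "finite S" for S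
    using that
  proof (induction S)
    case empty
    show ?case
    proof (intro ballI impI)
      fix f assume "f \<in> carrier (free_rmod R X)" "{i \<in> X. f i \<noteq> \<zero>\<^bsub>R\<^esub>} \<subseteq> {}"
      then have "f = \<zero>\<^bsub>free_rmod R X\<^esub>"
        by (auto simp: fun_eq_iff PiE_iff extensional_def)
      then show "f \<in> U" using submodD(2)[OF U] by simp
    qed
  next
    case (insert s S)
    show ?case
    proof (intro ballI impI)
      fix f assume f: "f \<in> carrier (free_rmod R X)" and S: "{i \<in> X. f i \<noteq> \<zero>\<^bsub>R\<^esub>} \<subseteq> insert s S"
      show "f \<in> U"
      proof (cases "s \<in> X")
        case False
        then have "{i \<in> X. f i \<noteq> \<zero>\<^bsub>R\<^esub>} \<subseteq> S" using S by auto
        with insert.IH f show ?thesis by blast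
      next
        case True
        let ?g = "\<lambda>i\<in>X. if i = s then \<zero>\<^bsub>R\<^esub> else f i"
        have "finite {i \<in> X. ?g i \<noteq> \<zero>\<^bsub>R\<^esub>}"
          by (rule finite_subset[of _ "{i \<in> X. f i \<noteq> \<zero>\<^bsub>R\<^esub>}"]) (use f in auto)
        then have g: "?g \<in> carrier (free_rmod R X)"
          using f by (auto simp: PiE_iff cong: conj_cong)
        have "{i \<in> X. ?g i \<noteq> \<zero>\<^bsub>R\<^esub>} \<subseteq> S" using S by auto
        with insert.IH g have gU: "?g \<in> U" by blast
        have fs: "f s \<in> carrier R" using f True by auto
        have "f = ?g \<oplus>\<^bsub>free_rmod R X\<^esub> (free_unit R X s \<cdot>\<^bsub>free_rmod R X\<^esub> f s)"
        proof
          fix i show "f i = (?g \<oplus>\<^bsub>free_rmod R X\<^esub> (free_unit R X s \<cdot>\<^bsub>free_rmod R X\<^esub> f s)) i"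
            using f fs by (cases "i \<in> X") (auto simp: free_unit_def PiE_iff extensional_def)
        qed
        moreover have "\<dots> \<in> U"
          using gU u[OF True] fs by (intro submodD(3,4)[OF U])
        ultimately show ?thesis by simp
      qed
    qed
  qed
  then show ?thesis using submodD(1)[OF U] by auto
qed

lemma free_hom_eq:
  assumes "ring R" "right_module R N" and f: "f \<in> rmod_hom R (free_rmod R X) N"
    and g: "g \<in> rmod_hom R (free_rmod R X) N"
    and "\<And>x. x \<in> X \<Longrightarrow> f (free_unit R X x) = g (free_unit R X x)" and v: "v \<in> carrier (free_rmod R X)"
  shows "f v = g v"
proof -
  have "{x \<in> carrier (free_rmod R X). f x = g x} = carrier (free_rmod R X)"
    using submod_eqlz[OF f g free_module[OF assms(1)] assms(2)] assms(5) free_unit_closed[OF assms(1)]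
    by (intro free_span assms(1)) auto
  with v show ?thesis by blast
qed

lemma (in right_module) finsum_ract:
  assumes "finite S" "h \<in> S \<rightarrow> carrier M" "a \<in> carrier R"
  shows "finsum M h S \<cdot>\<^bsub>M\<^esub> a = finsum M (\<lambda>i. h i \<cdot>\<^bsub>M\<^esub> a) S"
  using assms
proof (induction S)
  case (insert s S)
  moreover from insert have "(\<lambda>i. h i \<cdot>\<^bsub>M\<^esub> a) \<in> S \<rightarrow> carrier M" "h s \<cdot>\<^bsub>M\<^esub> a \<in> carrier M" by auto
  ultimately show ?case
    by (simp add: M.finsum_insert ract_add_left)
qed simp

lemma free_lift:
  assumes "ring R" "right_module R N" and e: "\<And>x. x \<in> X \<Longrightarrow> e x \<in> carrier N"
  shows "\<exists>h\<in>rmod_hom R (free_rmod R X) N. \<forall>x\<in>X. h (free_unit R X x) = e x"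
  proof -
  note free_sel [simp]
  interpret N: right_module R N by fact
  let ?F = "free_rmod R X"
  define supp where "supp f = {i \<in> X. f i \<noteq> \<zero>\<^bsub>R\<^esub>}" for f
  define h where "h f = finsum N (\<lambda>i. e i \<cdot>\<^bsub>N\<^esub> f i) (supp f)" for f
  have fin: "finite (supp f)" if "f \<in> carrier ?F" for f using that by (auto simp: supp_def)
  have ev: "f i \<in> carrier R" if "f \<in> carrier ?F" "i \<in> X" for f i using that by auto
  \<comment> \<open>The index set may be enlarged beyond the support. Additivity needs one index set
    for \<open>f\<close>, \<open>g\<close> and their sum, whose support may be smaller by
    cancellation.\<close>
  have hS: "h f = finsum N (\<lambda>i. e i \<cdot>\<^bsub>N\<^esub> f i) S"
    if "f \<in> carrier ?F" "finite S" "supp f \<subseteq> S" "S \<subseteq> X" for f S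
    unfolding h_def
    by (rule N.M.add.finprod_mono_neutral_cong_left)
      (use that e in \<open>auto simp: supp_def subset_iff Pi_def ev\<close>)
  have "h \<in> rmod_hom R ?F N"
  proof (rule rmod_homI)
    show "h f \<in> carrier N" if "f \<in> carrier ?F" for f
      unfolding h_def using that e by (intro N.M.finsum_closed) (auto simp: supp_def)
    interpret F: right_module R ?F by (rule free_module) fact
    show "h (f \<oplus>\<^bsub>?F\<^esub> g) = h f \<oplus>\<^bsub>N\<^esub> h g" if f: "f \<in> carrier ?F" and g: "g \<in> carrier ?F" for f g
    proof -
      let ?S = "supp f \<union> supp g"
      have S: "finite ?S" "?S \<subseteq> X" using fin f g by (auto simp: supp_def)
      have "supp (f \<oplus>\<^bsub>?F\<^esub> g) \<subseteq> ?S" by (auto simp: supp_def)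
      then have "h (f \<oplus>\<^bsub>?F\<^esub> g) = finsum N (\<lambda>i. e i \<cdot>\<^bsub>N\<^esub> ((f \<oplus>\<^bsub>?F\<^esub> g) i)) ?S"
        by (intro hS F.M.a_closed f g S)
      also have "\<dots> = finsum N (\<lambda>i. e i \<cdot>\<^bsub>N\<^esub> f i \<oplus>\<^bsub>N\<^esub> e i \<cdot>\<^bsub>N\<^esub> g i) ?S"
        using S f g e by (intro N.M.finsum_cong') (auto simp: N.ract_add_right[symmetric] ev subset_iff)
      also have "\<dots> = finsum N (\<lambda>i. e i \<cdot>\<^bsub>N\<^esub> f i) ?S \<oplus>\<^bsub>N\<^esub> finsum N (\<lambda>i. e i \<cdot>\<^bsub>N\<^esub> g i) ?S"
        using S f g e by (intro N.M.finsum_addf) (auto simp: ev subset_iff)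
      also have "\<dots> = h f \<oplus>\<^bsub>N\<^esub> h g"
        using hS[OF f S(1) _ S(2)] hS[OF g S(1) _ S(2)] by simp
      finally show ?thesis .
    qed
    show "h (f \<cdot>\<^bsub>?F\<^esub> a) = h f \<cdot>\<^bsub>N\<^esub> a" if f: "f \<in> carrier ?F" and a: "a \<in> carrier R" for f a
    proof -
      have S: "finite (supp f)" "supp f \<subseteq> X" using fin f by (auto simp: supp_def)
      have "supp (f \<cdot>\<^bsub>?F\<^esub> a) \<subseteq> supp f" using a by (auto simp: supp_def)
      then have "h (f \<cdot>\<^bsub>?F\<^esub> a) = finsum N (\<lambda>i. e i \<cdot>\<^bsub>N\<^esub> ((f \<cdot>\<^bsub>?F\<^esub> a) i)) (supp f)"
        by (intro hS F.ract_closed f a S)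
      also have "\<dots> = finsum N (\<lambda>i. (e i \<cdot>\<^bsub>N\<^esub> f i) \<cdot>\<^bsub>N\<^esub> a) (supp f)"
        using S f e a by (intro N.M.finsum_cong') (auto simp: N.ract_assoc ev subset_iff)
      also have "\<dots> = h f \<cdot>\<^bsub>N\<^esub> a"
        unfolding h_def using S f a e by (intro N.finsum_ract[symmetric]) (auto simp: ev subset_iff)
      finally show ?thesis .
    qed
  qed
  moreover have "h (free_unit R X x) = e x" if x: "x \<in> X" for x
  proof -
    have "h (free_unit R X x) = finsum N (\<lambda>i. e i \<cdot>\<^bsub>N\<^esub> free_unit R X x i) {x}"
      using x by (intro hS free_unit_closed assms) (auto simp: supp_def free_unit_def)
    also have "\<dots> = e x" using x e by (simp add: free_unit_def)
    finally show ?thesis .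
  qed
  ultimately show ?thesis by blast
qed

abbreviation epi :: "('a, 'r) ring_scheme \<Rightarrow> ('a, 'b, 'm) rmod_scheme \<Rightarrow> ('a, 'c, 'n) rmod_scheme
    \<Rightarrow> ('b \<Rightarrow> 'c) \<Rightarrow> bool" where
  "epi R M N p \<equiv> p \<in> rmod_hom R M N \<and> p ` carrier M = carrier N"

lemma proj_module: "projective_rmod R P \<Longrightarrow> right_module R P"
  by (simp add: projective_rmod_def)

lemma proj_ring: "projective_rmod R P \<Longrightarrow> ring R"
  by (simp add: projective_rmod_def right_module_def)

lemma module_ring: "right_module R M \<Longrightarrow> ring R"
  by (simp add: right_module_def)

lemma free_lift_along:
  assumes "ring R" "right_module R B" "right_module R C" and p: "epi R B C p"
    and f: "f \<in> rmod_hom R (free_rmod R X) C"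
  shows "\<exists>g\<in>rmod_hom R (free_rmod R X) B. \<forall>x\<in>carrier (free_rmod R X). p (g x) = f x"
proof -
  have "\<exists>b\<in>carrier B. p b = f (free_unit R X x)" if "x \<in> X" for x
    using p hom_closed[OF f free_unit_closed[OF assms(1) that]] by (metis (no_types, lifting) imageE)
  then obtain e where e: "\<And>x. x \<in> X \<Longrightarrow> e x \<in> carrier B \<and> p (e x) = f (free_unit R X x)" by metis
  with free_lift[OF assms(1,2), of X e] obtain g where g: "g \<in> rmod_hom R (free_rmod R X) B"
    "\<forall>x\<in>X. g (free_unit R X x) = e x" by blast
  have "p (g v) = f v" if "v \<in> carrier (free_rmod R X)" for v
    by (rule free_hom_eq[OF assms(1,3) hom_comp[OF g(1)] f _ that]) (use p e g in auto)
  with g show ?thesis by blast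
qed

lemma proj_lift:
  fixes P :: "('a, 'p, 'm) rmod_scheme"
  assumes P: "projective_rmod R P" and "right_module R B" "right_module R C" and p: "epi R B C p"
    and f: "f \<in> rmod_hom R P C"
  obtains g where "g \<in> rmod_hom R P B" "\<forall>x\<in>carrier P. p (g x) = f x"
proof -
  obtain X :: "'p set" and s q where s: "s \<in> rmod_hom R P (free_rmod R X)"
    and q: "q \<in> rmod_hom R (free_rmod R X) P" and qs: "\<forall>x\<in>carrier P. q (s x) = x"
    using P unfolding projective_rmod_def by blast
  obtain g where g: "g \<in> rmod_hom R (free_rmod R X) B" "\<forall>x\<in>carrier (free_rmod R X). p (g x) = f (q x)"
    using free_lift_along[OF proj_ring[OF P] assms(2,3) p hom_comp[OF q f]] by blast
  show thesis
  proof (rule that)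
    show "(\<lambda>x. g (s x)) \<in> rmod_hom R P B" by (rule hom_comp[OF s g(1)])
    show "\<forall>x\<in>carrier P. p (g (s x)) = f x" using g(2) hom_closed[OF s] qs by simp
  qed
qed

text \<open>\<open>projective_rmod\<close> asks for a basis inside the carrier type of
  \<open>M\<close>, whereas \<open>X\<close> has an arbitrary type. Lifting \<open>v\<close> through
  the free module on the elements of \<open>M\<close> moves the retraction to a basis of the
  prescribed type.\<close>

lemma proj_retract_free:
  fixes X :: "'x set"
  assumes M: "right_module R M" and u: "u \<in> rmod_hom R M (free_rmod R X)"
    and v: "v \<in> rmod_hom R (free_rmod R X) M" and vu: "\<And>x. x \<in> carrier M \<Longrightarrow> v (u x) = x"
  shows "projective_rmod R M"
proof -
  have R: "ring R" using module_ring[OF M] .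
  obtain h where h: "h \<in> rmod_hom R (free_rmod R (carrier M)) M"
    "\<forall>x\<in>carrier M. h (free_unit R (carrier M) x) = x"
    using free_lift[OF R M, of "carrier M" "\<lambda>x. x"] by blast
  have e: "epi R (free_rmod R (carrier M)) M h"
    using h free_unit_closed[OF R] by (auto intro!: hom_closed[OF h(1)] image_eqI[OF sym])
  then obtain g where g: "g \<in> rmod_hom R (free_rmod R X) (free_rmod R (carrier M))"
    "\<forall>x\<in>carrier (free_rmod R X). h (g x) = v x"
    using free_lift_along[OF R free_module[OF R] M e v] by auto
  have "\<forall>x\<in>carrier M. h (g (u x)) = x" using g(2) vu hom_closed[OF u] by simp
  then show ?thesis
    unfolding projective_rmod_def using M hom_comp[OF u g(1)] h(1)
    by (intro conjI exI[of _ "carrier M"] bexI[of _ "\<lambda>x. g (u x)"] bexI[of _ h])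
qed

lemma proj_retract:
  fixes Q :: "('a, 'p, 'm) rmod_scheme"
  assumes M: "right_module R M" and Q: "projective_rmod R Q" and u: "u \<in> rmod_hom R M Q"
    and v: "v \<in> rmod_hom R Q M" and vu: "\<And>x. x \<in> carrier M \<Longrightarrow> v (u x) = x"
  shows "projective_rmod R M"
proof -
  obtain X :: "'p set" and s q where s: "s \<in> rmod_hom R Q (free_rmod R X)"
    and q: "q \<in> rmod_hom R (free_rmod R X) Q" and qs: "\<forall>x\<in>carrier Q. q (s x) = x"
    using Q unfolding projective_rmod_def by blast
  show ?thesis
    by (rule proj_retract_free[OF M hom_comp[OF u s] hom_comp[OF q v]])
      (simp add: qs vu hom_closed[OF u])
qed

lemma free_proj: "ring R \<Longrightarrow> projective_rmod R (free_rmod R X)"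
  by (rule proj_retract_free[OF free_module hom_id hom_id]) auto

lemma reg_proj: assumes "ring R" shows "projective_rmod R (reg_rmod R)"
proof -
  note free_sel [simp]
  interpret ring R by fact
  show ?thesis
    by (rule proj_retract_free[OF reg_module[OF assms], of "\<lambda>a. \<lambda>i\<in>{()}. a" "{()}" "\<lambda>f. f ()"])
      (auto intro!: rmod_homI)
qed

lemma copy_proj:
  assumes "projective_rmod R M" "inj_on j (carrier M)" shows "projective_rmod R (copy_rmod j M)"
  using copy_rmod[OF proj_module[OF assms(1)] assms(2)] assms
  by (intro proj_retract[OF _ assms(1), of _ "the_inv_into (carrier M) j" j]) auto

text \<open>Each inclusion of a factor lifts to the free module on the elements of the product. The
  sum of the two lifts, composed with the projections, is a section.\<close>

lemma prod_proj:
  assumes M: "projective_rmod R M" and N: "projective_rmod R N" shows "projective_rmod R (prod_rmod M N)"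
proof -
  interpret M: right_module R M by (rule proj_module) fact
  interpret N: right_module R N by (rule proj_module) fact
  have R: "ring R" using proj_ring[OF M] .
  let ?P = "prod_rmod M N"
  note P = prod_module[OF M.right_module_axioms N.right_module_axioms]
  obtain h where h: "h \<in> rmod_hom R (free_rmod R (carrier ?P)) ?P"
    "\<forall>x\<in>carrier ?P. h (free_unit R (carrier ?P) x) = x"
    using free_lift[OF R P, of "carrier ?P" "\<lambda>x. x"] by blast
  have e: "epi R (free_rmod R (carrier ?P)) ?P h"
    using h free_unit_closed[OF R] by (auto simp del: prod_sel intro!: hom_closed[OF h(1)] image_eqI[OF sym])
  interpret F: right_module R "free_rmod R (carrier ?P)" by (rule free_module[OF R])
  have "(\<lambda>x. (x, \<zero>\<^bsub>N\<^esub>)) \<in> rmod_hom R M ?P" by (rule rmod_homI) auto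
  then obtain g1
    where g1: "g1 \<in> rmod_hom R M (free_rmod R (carrier ?P))" "\<forall>x\<in>carrier M. h (g1 x) = (x, \<zero>\<^bsub>N\<^esub>)"
    by (rule proj_lift[OF M F.right_module_axioms P e])
  have "(\<lambda>x. (\<zero>\<^bsub>M\<^esub>, x)) \<in> rmod_hom R N ?P" by (rule rmod_homI) auto
  then obtain g2
    where g2: "g2 \<in> rmod_hom R N (free_rmod R (carrier ?P))" "\<forall>x\<in>carrier N. h (g2 x) = (\<zero>\<^bsub>M\<^esub>, x)"
    by (rule proj_lift[OF N F.right_module_axioms P e])
  have f: "fst \<in> rmod_hom R ?P M" "snd \<in> rmod_hom R ?P N" by (auto intro!: rmod_homI)
  show ?thesis
  proof (rule proj_retract_free[OF P _ h(1)])
    show "(\<lambda>x. g1 (fst x) \<oplus>\<^bsub>free_rmod R (carrier ?P)\<^esub> g2 (snd x)) \<in> rmod_hom R ?P (free_rmod R (carrier ?P))"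
      by (intro hom_plus hom_comp[OF f(1) g1(1)] hom_comp[OF f(2) g2(1)] F.right_module_axioms)
    fix x assume x: "x \<in> carrier ?P"
    have "h (g1 (fst x) \<oplus>\<^bsub>free_rmod R (carrier ?P)\<^esub> g2 (snd x)) = h (g1 (fst x)) \<oplus>\<^bsub>?P\<^esub> h (g2 (snd x))"
      using x by (intro hom_add[OF h(1)] hom_closed[OF g1(1)] hom_closed[OF g2(1)]) auto
    also have "\<dots> = x" using x g1(2) g2(2) by auto
    finally show "h (g1 (fst x) \<oplus>\<^bsub>free_rmod R (carrier ?P)\<^esub> g2 (snd x)) = x" .
  qed
qed

subsection \<open>Finite generation\<close>

lemma fin_gen_subE:
  assumes "fin_gen R (M\<lparr>carrier := U\<rparr>)"
  obtains G where "finite G" "G \<subseteq> U" "\<forall>V. submod R (M\<lparr>carrier := U\<rparr>) V \<and> G \<subseteq> V \<longrightarrow> V = U"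
proof -
  obtain G where G: "finite G \<and> G \<subseteq> carrier (M\<lparr>carrier := U\<rparr>) \<and>
    (\<forall>V. submod R (M\<lparr>carrier := U\<rparr>) V \<and> G \<subseteq> V \<longrightarrow> V = carrier (M\<lparr>carrier := U\<rparr>))"
    using assms unfolding fin_gen_def by (elim exE)
  show thesis by (rule that[of G]) (use G in simp_all)
qed

lemma fin_gen_img:
  assumes "right_module R M" "right_module R N" and f: "epi R M N f" and "fin_gen R M"
  shows "fin_gen R N"
proof -
  obtain G where G: "finite G" "G \<subseteq> carrier M" "\<And>U. submod R M U \<Longrightarrow> G \<subseteq> U \<Longrightarrow> U = carrier M"
    using assms(4) unfolding fin_gen_def by blast
  have "V = carrier N" if V: "submod R N V" "f ` G \<subseteq> V" for V
  proof -
    have "{x \<in> carrier M. f x \<in> V} = carrier M"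
      using V(2) G(2) f by (intro G(3) submod_vimg[OF _ assms(1,2) V(1)]) auto
    then have "f ` carrier M \<subseteq> V" by blast
    with f submodD(1)[OF V(1)] show ?thesis by auto
  qed
  then show ?thesis unfolding fin_gen_def
    using G(1,2) f by (intro exI[of _ "f ` G"]) blast
qed

lemma free_fin_gen: assumes "ring R" "finite X" shows "fin_gen R (free_rmod R X)"
  unfolding fin_gen_def
proof (intro exI conjI allI impI)
  show "finite (free_unit R X ` X)" using assms by simp
  show "free_unit R X ` X \<subseteq> carrier (free_rmod R X)" by (intro image_subsetI free_unit_closed assms)
  show "U = carrier (free_rmod R X)" if "submod R (free_rmod R X) U \<and> free_unit R X ` X \<subseteq> U" for U
    using that by (intro free_span assms(1)) auto
qed

text \<open>Numbering the generators by \<open>{..<n}\<close> gives the covering free module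
  elements of type \<open>nat \<Rightarrow> 'a\<close>, whatever the type of
  \<open>M\<close>.\<close>

lemma fin_gen_cover:
  assumes M: "right_module R M" and "fin_gen R M"
  obtains n :: nat and p where "epi R (free_rmod R {..<n}) M p"
proof -
  have R: "ring R" using module_ring[OF M] .
  obtain G where G: "finite G" "G \<subseteq> carrier M" "\<And>U. submod R M U \<Longrightarrow> G \<subseteq> U \<Longrightarrow> U = carrier M"
    using assms(2) unfolding fin_gen_def by blast
  obtain n e where e: "bij_betw e {..<n::nat} G"
    using ex_bij_betw_nat_finite[OF G(1)] by (auto simp: atLeast0LessThan)
  obtain p where p: "p \<in> rmod_hom R (free_rmod R {..<n}) M" "\<forall>i\<in>{..<n}. p (free_unit R {..<n} i) = e i"
    using free_lift[OF R M, of "{..<n}" e] bij_betwE[OF e] G(2) by blast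
  have "p ` carrier (free_rmod R {..<n}) = carrier M"
  proof (rule G(3))
    show "submod R M (p ` carrier (free_rmod R {..<n}))"
      by (intro submod_img[OF p(1) free_module[OF R] M] submod_carrier free_module R)
    show "G \<subseteq> p ` carrier (free_rmod R {..<n})"
    proof
      fix g assume "g \<in> G"
      then obtain i where i: "i < n" "g = e i" using e by (auto simp: bij_betw_def)
      then show "g \<in> p ` carrier (free_rmod R {..<n})"
        using p(2) free_unit_closed[OF R, of i "{..<n}"] by (intro image_eqI[of _ _ "free_unit R {..<n} i"]) auto
    qed
  qed
  with p that show thesis by blast
qed

lemma fin_gen_proj_summand:
  assumes P: "projective_rmod R P" "fin_gen R P"
  obtains n :: nat and s p where "s \<in> rmod_hom R P (free_rmod R {..<n})" "p \<in> rmod_hom R (free_rmod R {..<n}) P"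
    "\<forall>x\<in>carrier P. p (s x) = x"
proof -
  obtain n p where p: "epi R (free_rmod R {..<n::nat}) P p"
    using fin_gen_cover[OF proj_module[OF P(1)] P(2)] .
  obtain s where s: "s \<in> rmod_hom R P (free_rmod R {..<n})" "\<forall>x\<in>carrier P. p (s x) = x"
    by (rule proj_lift[OF P(1) free_module[OF proj_ring[OF P(1)]] proj_module[OF P(1)] p hom_id])
  from p have "p \<in> rmod_hom R (free_rmod R {..<n}) P" ..
  from that[OF s(1) this s(2)] show thesis .
qed

lemma copy_fin_gen:
  assumes "right_module R M" "inj_on j (carrier M)" "fin_gen R M" shows "fin_gen R (copy_rmod j M)"
  using copy_rmod[OF assms(1,2)] assms by (intro fin_gen_img[of R M _ j]) auto

lemma prod_fin_gen:
  assumes M: "right_module R M" "fin_gen R M" and N: "right_module R N" "fin_gen R N"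
  shows "fin_gen R (prod_rmod M N)"
proof -
  interpret M: right_module R M by fact
  interpret N: right_module R N by fact
  let ?P = "prod_rmod M N"
  note P = prod_module[OF M(1) N(1)]
  obtain G where G: "finite G" "G \<subseteq> carrier M" "\<And>U. submod R M U \<Longrightarrow> G \<subseteq> U \<Longrightarrow> U = carrier M"
    using M(2) unfolding fin_gen_def by blast
  obtain H where H: "finite H" "H \<subseteq> carrier N" "\<And>U. submod R N U \<Longrightarrow> H \<subseteq> U \<Longrightarrow> U = carrier N"
    using N(2) unfolding fin_gen_def by blast
  have f: "(\<lambda>x. (x, \<zero>\<^bsub>N\<^esub>)) \<in> rmod_hom R M ?P" "(\<lambda>x. (\<zero>\<^bsub>M\<^esub>, x)) \<in> rmod_hom R N ?P"
    by (auto intro!: rmod_homI)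
  have "U = carrier ?P" if U: "submod R ?P U" "(\<lambda>x. (x, \<zero>\<^bsub>N\<^esub>)) ` G \<union> (\<lambda>x. (\<zero>\<^bsub>M\<^esub>, x)) ` H \<subseteq> U" for U
  proof -
    have 1: "{x \<in> carrier M. (x, \<zero>\<^bsub>N\<^esub>) \<in> U} = carrier M"
      using U(2) G(2) by (intro G(3) submod_vimg[OF f(1) M(1) P U(1)]) auto
    have 2: "{x \<in> carrier N. (\<zero>\<^bsub>M\<^esub>, x) \<in> U} = carrier N"
      using U(2) H(2) by (intro H(3) submod_vimg[OF f(2) N(1) P U(1)]) auto
    have "(x, y) \<in> U" if "x \<in> carrier M" "y \<in> carrier N" for x y
      using 1 2 that submodD(3)[OF U(1), of "(x, \<zero>\<^bsub>N\<^esub>)" "(\<zero>\<^bsub>M\<^esub>, y)"] by auto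
    with submodD(1)[OF U(1)] show ?thesis by auto
  qed
  then show ?thesis unfolding fin_gen_def
    using G(1,2) H(1,2) by (intro exI[of _ "(\<lambda>x. (x, \<zero>\<^bsub>N\<^esub>)) ` G \<union> (\<lambda>x. (\<zero>\<^bsub>M\<^esub>, x)) ` H"]) auto
qed

subsection \<open>Noetherian modules\<close>

definition noeth_rmod :: "('a, 'r) ring_scheme \<Rightarrow> ('a, 'b, 'm) rmod_scheme \<Rightarrow> bool" where
  "noeth_rmod R M \<longleftrightarrow> right_module R M \<and> (\<forall>U. submod R M U \<longrightarrow> fin_gen R (M\<lparr>carrier := U\<rparr>))"

lemma noeth_inj:
  assumes M: "right_module R M" and N: "noeth_rmod R N" and f: "f \<in> rmod_hom R M N" "inj_on f (carrier M)"
  shows "noeth_rmod R M"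
  unfolding noeth_rmod_def
proof (intro conjI allI impI M)
  fix U assume U: "submod R M U"
  have Nm: "right_module R N" using N by (simp add: noeth_rmod_def)
  have V: "submod R N (f ` U)" by (rule submod_img[OF f(1) M Nm U])
  then have fg: "fin_gen R (N\<lparr>carrier := f ` U\<rparr>)" using N by (simp add: noeth_rmod_def)
  have sub: "U \<subseteq> carrier M" by (rule submodD[OF U])
  have "f \<in> rmod_hom R (M\<lparr>carrier := U\<rparr>) (N\<lparr>carrier := f ` U\<rparr>)"
    by (rule hom_into_sub[OF hom_comp[OF submod_incl[OF U] f(1)]]) auto
  moreover have "bij_betw f (carrier (M\<lparr>carrier := U\<rparr>)) (carrier (N\<lparr>carrier := f ` U\<rparr>))"
    using inj_on_subset[OF f(2) sub] by (simp add: bij_betw_def)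
  ultimately have g: "the_inv_into U f \<in> rmod_hom R (N\<lparr>carrier := f ` U\<rparr>) (M\<lparr>carrier := U\<rparr>)"
    using inv_hom[OF _ submod_module[OF M U]] by fastforce
  show "fin_gen R (M\<lparr>carrier := U\<rparr>)"
    by (rule fin_gen_img[OF submod_module[OF Nm V] submod_module[OF M U] _ fg, of "the_inv_into U f"])
      (use g inj_on_subset[OF f(2) sub] in \<open>simp add: the_inv_into_onto\<close>)
qed

text \<open>Submodules \<open>V \<subseteq> U\<close> with the same image under \<open>f\<close> and
  the same intersection with its kernel coincide. Hence \<open>U\<close> is generated by generators
  of its part in the kernel together with preimages of generators of its image.\<close>

lemma noeth_ext:
  assumes M: "right_module R M" and N: "noeth_rmod R N" and f: "f \<in> rmod_hom R M N"
    and K: "noeth_rmod R (M\<lparr>carrier := {x \<in> carrier M. f x = \<zero>\<^bsub>N\<^esub>}\<rparr>)"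
  shows "noeth_rmod R M"
  unfolding noeth_rmod_def
proof (intro conjI allI impI M)
  fix U assume U: "submod R M U"
  interpret M: right_module R M by fact
  have Nm: "right_module R N" using N by (simp add: noeth_rmod_def)
  interpret N: right_module R N by fact
  define L where "L = {x \<in> carrier M. f x = \<zero>\<^bsub>N\<^esub>}"
  have Ks: "submod R M L" unfolding L_def by (rule submod_ker[OF f M Nm])
  have KU: "submod R M (L \<inter> U)" using submodD[OF Ks] submodD[OF U] by (intro submodI) auto
  then have "submod R (M\<lparr>carrier := L\<rparr>) (L \<inter> U)" by (simp add: submod_sub[OF Ks])
  then have "fin_gen R (M\<lparr>carrier := L \<inter> U\<rparr>)" using K unfolding noeth_rmod_def L_def[symmetric] by fastforce
  then obtain G where G: "finite G" "G \<subseteq> L \<inter> U"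
    "\<forall>V. submod R (M\<lparr>carrier := L \<inter> U\<rparr>) V \<and> G \<subseteq> V \<longrightarrow> V = L \<inter> U"
    by (elim fin_gen_subE) blast
  have fU: "submod R N (f ` U)" by (rule submod_img[OF f M Nm U])
  have "fin_gen R (N\<lparr>carrier := f ` U\<rparr>)" using N fU by (simp add: noeth_rmod_def)
  then obtain H where H: "finite H" "H \<subseteq> f ` U"
    "\<forall>V. submod R (N\<lparr>carrier := f ` U\<rparr>) V \<and> H \<subseteq> V \<longrightarrow> V = f ` U"
    by (elim fin_gen_subE) blast
  obtain H' where H': "finite H'" "H' \<subseteq> U" "f ` H' = H"
    using finite_subset_image[OF H(1,2)] by blast
  have "V = U" if V: "submod R (M\<lparr>carrier := U\<rparr>) V" and GV: "G \<union> H' \<subseteq> V" for V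
  proof
    have V': "submod R M V" and VU: "V \<subseteq> U" using V by (simp_all add: submod_sub[OF U])
    show "V \<subseteq> U" by fact
    have KV: "L \<inter> V = L \<inter> U"
    proof (rule G(3)[rule_format], rule conjI)
      have "submod R M (L \<inter> V)" using submodD[OF Ks] submodD[OF V'] by (intro submodI) auto
      then show "submod R (M\<lparr>carrier := L \<inter> U\<rparr>) (L \<inter> V)" using VU by (auto simp: submod_sub[OF KU])
      show "G \<subseteq> L \<inter> V" using G GV by auto
    qed
    have fV: "f ` V = f ` U"
    proof (rule H(3)[rule_format], rule conjI)
      show "submod R (N\<lparr>carrier := f ` U\<rparr>) (f ` V)"
        using submod_img[OF f M Nm V'] VU by (auto simp: submod_sub[OF fU])
      show "H \<subseteq> f ` V" using H' GV by auto
    qed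
    show "U \<subseteq> V"
    proof
      fix u assume u: "u \<in> U"
      then have "f u \<in> f ` V" using fV by auto
      then obtain v where v: "v \<in> V" "f u = f v" by auto
      have c: "u \<in> carrier M" "v \<in> carrier M" using u v submodD(1)[OF U] VU by auto
      then have "f (u \<ominus>\<^bsub>M\<^esub> v) = \<zero>\<^bsub>N\<^esub>"
        using v hom_closed[OF f] by (simp add: hom_minus[OF f M Nm] N.diff_eq_zero_iff)
      moreover have "u \<ominus>\<^bsub>M\<^esub> v \<in> U" using submod_diff[OF M U u] v VU by auto
      ultimately have "u \<ominus>\<^bsub>M\<^esub> v \<in> L \<inter> V" using KV c by (auto simp: L_def)
      then have "u \<ominus>\<^bsub>M\<^esub> v \<oplus>\<^bsub>M\<^esub> v \<in> V" using v submodD(3)[OF V'] by auto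
      then show "u \<in> V" using c by (simp add: a_minus_def M.M.a_assoc M.M.l_neg)
    qed
  qed
  then show "fin_gen R (M\<lparr>carrier := U\<rparr>)"
    unfolding fin_gen_def using G(1,2) H'(1,2) by (intro exI[of _ "G \<union> H'"]) auto
qed

lemma submod_reg_iff:
  assumes "cring R" shows "submod R (reg_rmod R) V \<longleftrightarrow> ideal V R"
proof
  interpret cring R by fact
  assume V: "submod R (reg_rmod R) V"
  have V': "V \<subseteq> carrier R" "\<zero>\<^bsub>R\<^esub> \<in> V" "\<And>x y. x \<in> V \<Longrightarrow> y \<in> V \<Longrightarrow> x \<oplus>\<^bsub>R\<^esub> y \<in> V"
    "\<And>x a. x \<in> V \<Longrightarrow> a \<in> carrier R \<Longrightarrow> x \<otimes>\<^bsub>R\<^esub> a \<in> V" using submodD[OF V] by auto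
  have neg: "\<ominus>\<^bsub>R\<^esub> x \<in> V" if "x \<in> V" for x
  proof -
    have "x \<otimes>\<^bsub>R\<^esub> (\<ominus>\<^bsub>R\<^esub> \<one>\<^bsub>R\<^esub>) \<in> V" using V'(4)[OF that] by simp
    moreover have "x \<in> carrier R" using that V'(1) by auto
    ultimately show ?thesis by (simp add: r_minus)
  qed
  show "ideal V R"
  proof (rule idealI[OF ring_axioms])
    show "subgroup V (add_monoid R)"
      by (rule subgroup.intro) (use V' neg in \<open>auto simp: a_inv_def[symmetric]\<close>)
    show "x \<otimes>\<^bsub>R\<^esub> a \<in> V" if "a \<in> V" "x \<in> carrier R" for a x
      using that V'(1,4) that m_comm[of x a] by auto
  qed (use V' in auto)
next
  assume "ideal V R"
  then interpret ideal V R .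
  show "submod R (reg_rmod R) V"
    by (rule submodI) (auto simp: a_subset I_r_closed)
qed

lemma reg_noeth:
  assumes "cring R" "noetherian_ring R" shows "noeth_rmod R (reg_rmod R)"
  unfolding noeth_rmod_def
proof (intro conjI allI impI)
  interpret cring R by fact
  interpret noetherian_ring R by fact
  show "right_module R (reg_rmod R)" by (rule reg_module) (rule ring_axioms)
  fix U assume U: "submod R (reg_rmod R) U"
  note * = submod_reg_iff[OF assms(1)]
  obtain G where G: "G \<subseteq> carrier R" "finite G" "U = Idl\<^bsub>R\<^esub> G" using finetely_gen U * by blast
  show "fin_gen R ((reg_rmod R)\<lparr>carrier := U\<rparr>)"
    unfolding fin_gen_def
  proof (intro exI conjI allI impI)
    show "finite G" by fact
    show "G \<subseteq> carrier ((reg_rmod R)\<lparr>carrier := U\<rparr>)" using genideal_self[OF G(1)] G(3) by simp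
    show "V = carrier ((reg_rmod R)\<lparr>carrier := U\<rparr>)"
      if "submod R ((reg_rmod R)\<lparr>carrier := U\<rparr>) V \<and> G \<subseteq> V" for V
    proof -
      have "ideal V R" "V \<subseteq> U" "G \<subseteq> V" using that submod_sub[OF U, of V] * by auto
      then show ?thesis using genideal_minimal[of V G] G(3) by simp
    qed
  qed
qed

lemma zero_noeth:
  assumes "right_module R M" "carrier M = {\<zero>\<^bsub>M\<^esub>}" shows "noeth_rmod R M"
  unfolding noeth_rmod_def fin_gen_def
proof (intro conjI allI impI assms(1))
  fix U assume U: "submod R M U"
  show "\<exists>G. finite G \<and> G \<subseteq> carrier (M\<lparr>carrier := U\<rparr>) \<and>
        (\<forall>N. submod R (M\<lparr>carrier := U\<rparr>) N \<and> G \<subseteq> N \<longrightarrow> N = carrier (M\<lparr>carrier := U\<rparr>))"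
    using submodD(1,2)[OF U] assms(2) by (intro exI[of _ "{}"]) (auto simp: submod_def)
qed

text \<open>Induction on the rank: evaluation at \<open>x\<close> maps to the regular module, and
  its kernel embeds into the free module on the remaining basis elements.\<close>

lemma free_noeth:
  assumes "cring R" "noetherian_ring R" "finite X" shows "noeth_rmod R (free_rmod R X)"
  using assms(3)
proof (induction X)
  interpret cring R by fact
  note free_sel [simp]
  case empty
  show ?case by (rule zero_noeth[OF free_module[OF ring_axioms]]) auto
next
  interpret cring R by fact
  note free_sel [simp]
  case (insert x X)
  let ?F = "free_rmod R (insert x X)"
  have F: "right_module R ?F" by (rule free_module[OF ring_axioms])
  have e: "(\<lambda>f. f x) \<in> rmod_hom R ?F (reg_rmod R)" by (rule rmod_homI) (auto simp: PiE_iff)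
  let ?K = "{f \<in> carrier ?F. f x = \<zero>\<^bsub>reg_rmod R\<^esub>}"
  have K: "submod R ?F ?K" by (rule submod_ker[OF e F reg_module[OF ring_axioms]])
  show ?case
  proof (rule noeth_ext[OF F reg_noeth[OF assms(1,2)] e])
    show "noeth_rmod R (?F\<lparr>carrier := ?K\<rparr>)"
    proof (rule noeth_inj[OF submod_module[OF F K] insert.IH])
      show "(\<lambda>f. restrict f X) \<in> rmod_hom R (?F\<lparr>carrier := ?K\<rparr>) (free_rmod R X)"
        by (rule rmod_homI) (auto simp: PiE_iff insert.hyps fun_eq_iff)
      show "inj_on (\<lambda>f. restrict f X) (carrier (?F\<lparr>carrier := ?K\<rparr>))"
      proof (rule inj_onI, rule ext)
        fix f g i
        assume "f \<in> carrier (?F\<lparr>carrier := ?K\<rparr>)" "g \<in> carrier (?F\<lparr>carrier := ?K\<rparr>)"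
          and eq: "restrict f X = restrict g X"
        moreover have "f i = g i" if "i \<in> X" using fun_cong[OF eq, of i] that by simp
        ultimately show "f i = g i"
          by (cases "i = x"; cases "i \<in> X") (auto simp: PiE_iff extensional_def)
      qed
    qed
  qed
qed

lemma noeth_fin_gen_sub:
  "noeth_rmod R M \<Longrightarrow> submod R M U \<Longrightarrow> fin_gen R (M\<lparr>carrier := U\<rparr>)"
  by (simp add: noeth_rmod_def)

lemma noeth_fin_gen: assumes "noeth_rmod R M" shows "fin_gen R M"
proof -
  have "submod R M (carrier M)" using assms by (simp add: noeth_rmod_def submod_carrier)
  then show ?thesis using assms by (fastforce simp: noeth_rmod_def)
qed

lemma noeth_epi:
  assumes M: "noeth_rmod R M" and N: "right_module R N" and f: "epi R M N f"
  shows "noeth_rmod R N"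
  unfolding noeth_rmod_def
proof (intro conjI allI impI N)
  fix U assume U: "submod R N U"
  have Mm: "right_module R M" using M by (simp add: noeth_rmod_def)
  let ?V = "{x \<in> carrier M. f x \<in> U}"
  have fh: "f \<in> rmod_hom R M N" using f by simp
  have V: "submod R M ?V" by (rule submod_vimg[OF fh Mm N U])
  show "fin_gen R (N\<lparr>carrier := U\<rparr>)"
  proof (rule fin_gen_img[OF submod_module[OF Mm V] submod_module[OF N U] _ noeth_fin_gen_sub[OF M V]])
    have "f \<in> rmod_hom R (M\<lparr>carrier := ?V\<rparr>) (N\<lparr>carrier := U\<rparr>)"
      by (rule hom_into_sub[OF hom_comp[OF submod_incl[OF V] fh]]) auto
    moreover have "f ` ?V = U"
    proof
      show "U \<subseteq> f ` ?V"
      proof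
        fix u assume u: "u \<in> U"
        then have "u \<in> f ` carrier M" using f submodD(1)[OF U] by auto
        with u show "u \<in> f ` ?V" by auto
      qed
    qed auto
    ultimately show "epi R (M\<lparr>carrier := ?V\<rparr>) (N\<lparr>carrier := U\<rparr>) f" by simp
  qed
qed

lemma fin_gen_noeth:
  assumes "cring R" "noetherian_ring R" "right_module R M" "fin_gen R M" shows "noeth_rmod R M"
proof -
  obtain n p where "epi R (free_rmod R {..<n::nat}) M p" by (rule fin_gen_cover[OF assms(3,4)])
  from noeth_epi[OF free_noeth[OF assms(1,2) finite_lessThan] assms(3) this] show ?thesis .
qed

section \<open>Short exact sequences and syzygies\<close>

text \<open>Both maps of the short exact sequence are explicit. The kernel is given only up to
  isomorphism, through the injection \<open>i\<close>, so that \<open>K\<close> may have another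
  element type than \<open>P\<close>.\<close>

definition ses :: "('a, 'r) ring_scheme \<Rightarrow> ('a, 'k, 'm) rmod_scheme \<Rightarrow> ('a, 'p, 'n) rmod_scheme
    \<Rightarrow> ('a, 'b, 'o) rmod_scheme \<Rightarrow> ('k \<Rightarrow> 'p) \<Rightarrow> ('p \<Rightarrow> 'b) \<Rightarrow> bool" where
  "ses R K P N i p \<longleftrightarrow> right_module R K \<and> right_module R P \<and> right_module R N \<and>
     i \<in> rmod_hom R K P \<and> inj_on i (carrier K) \<and> epi R P N p \<and>
     i ` carrier K = {x \<in> carrier P. p x = \<zero>\<^bsub>N\<^esub>}"

lemma sesD:
  assumes "ses R K P N i p"
  shows "right_module R K" "right_module R P" "right_module R N" "i \<in> rmod_hom R K P"
    "inj_on i (carrier K)" "p \<in> rmod_hom R P N" "p ` carrier P = carrier N" "epi R P N p"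
    "i ` carrier K = {x \<in> carrier P. p x = \<zero>\<^bsub>N\<^esub>}"
  using assms by (simp_all add: ses_def)

lemma ses_zero: "ses R K P N i p \<Longrightarrow> x \<in> carrier K \<Longrightarrow> p (i x) = \<zero>\<^bsub>N\<^esub>"
  using sesD(9) by blast

lemma ses_ker: "ses R K P N i p \<Longrightarrow> x \<in> carrier P \<Longrightarrow> p x = \<zero>\<^bsub>N\<^esub> \<Longrightarrow> \<exists>y\<in>carrier K. x = i y"
  using sesD(9) by blast

lemma epiE: "epi R P N p \<Longrightarrow> y \<in> carrier N \<Longrightarrow> \<exists>x\<in>carrier P. y = p x"
  by auto

lemma ses_sub:
  assumes "right_module R P" "right_module R N" "epi R P N p"
  shows "ses R (P\<lparr>carrier := {x \<in> carrier P. p x = \<zero>\<^bsub>N\<^esub>}\<rparr>) P N (\<lambda>x. x) p"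
proof -
  have s: "submod R P {x \<in> carrier P. p x = \<zero>\<^bsub>N\<^esub>}" using submod_ker assms by blast
  show ?thesis
    unfolding ses_def using submod_module[OF assms(1) s] submod_incl[OF s] assms by simp
qed

lemma ses_factor:
  assumes s: "ses R K P N i p" and f: "f \<in> rmod_hom R M P" and M: "right_module R M"
    and z: "\<And>x. x \<in> carrier M \<Longrightarrow> p (f x) = \<zero>\<^bsub>N\<^esub>"
  obtains g where "g \<in> rmod_hom R M K" "\<forall>x\<in>carrier M. i (g x) = f x"
proof -
  interpret M: right_module R M by fact
  note i = sesD(4)[OF s]
  interpret K: right_module R K using sesD(1)[OF s] .
  have "\<exists>y\<in>carrier K. f x = i y" if "x \<in> carrier M" for x
    using ses_ker[OF s, OF hom_closed[OF f that] z[OF that]] .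
  then obtain g where g: "\<And>x. x \<in> carrier M \<Longrightarrow> g x \<in> carrier K \<and> i (g x) = f x" by metis
  note inj = inj_onD[OF sesD(5)[OF s]]
  show thesis
  proof (rule that)
    show "\<forall>x\<in>carrier M. i (g x) = f x" using g by blast
    show "g \<in> rmod_hom R M K"
    proof (rule rmod_homI)
      show "g x \<in> carrier K" if "x \<in> carrier M" for x using g that by blast
      show "g (x \<oplus>\<^bsub>M\<^esub> y) = g x \<oplus>\<^bsub>K\<^esub> g y" if "x \<in> carrier M" "y \<in> carrier M" for x y
        using that g by (intro inj) (simp_all add: hom_add[OF i] hom_add[OF f])
      show "g (x \<cdot>\<^bsub>M\<^esub> a) = g x \<cdot>\<^bsub>K\<^esub> a" if "x \<in> carrier M" "a \<in> carrier R" for x a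
        using that g by (intro inj) (simp_all add: hom_ract[OF i] hom_ract[OF f])
    qed
  qed
qed

lemma epi_factor:
  assumes P: "right_module R P" and N: "right_module R N" and Q: "right_module R Q" and p: "epi R P N p"
    and f: "f \<in> rmod_hom R P Q"
    and z: "\<And>x. x \<in> carrier P \<Longrightarrow> p x = \<zero>\<^bsub>N\<^esub> \<Longrightarrow> f x = \<zero>\<^bsub>Q\<^esub>"
  obtains g where "g \<in> rmod_hom R N Q" "\<forall>x\<in>carrier P. g (p x) = f x"
proof -
  interpret P: right_module R P by fact
  interpret N: right_module R N by fact
  interpret Q: right_module R Q by fact
  have ph: "p \<in> rmod_hom R P N" using p ..
  have "\<exists>x\<in>carrier P. y = p x" if "y \<in> carrier N" for y using epiE[OF p that] .
  then obtain e where e: "\<And>y. y \<in> carrier N \<Longrightarrow> e y \<in> carrier P \<and> p (e y) = y" by metis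
  have eq: "f x = f y" if "x \<in> carrier P" "y \<in> carrier P" "p x = p y" for x y
  proof -
    have "p (x \<ominus>\<^bsub>P\<^esub> y) = \<zero>\<^bsub>N\<^esub>"
      using that hom_closed[OF ph] by (simp add: hom_minus[OF ph P N] N.diff_eq_zero_iff)
    then have "f (x \<ominus>\<^bsub>P\<^esub> y) = \<zero>\<^bsub>Q\<^esub>" using z that by simp
    then show ?thesis using that hom_closed[OF f] by (simp add: hom_minus[OF f P Q] Q.diff_eq_zero_iff)
  qed
  show thesis
  proof (rule that[of "\<lambda>y. f (e y)"])
    show "\<forall>x\<in>carrier P. f (e (p x)) = f x"
      using e hom_closed[OF ph] by (auto intro!: eq)
    show "(\<lambda>y. f (e y)) \<in> rmod_hom R N Q"
    proof (rule rmod_homI)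
      show "f (e y) \<in> carrier Q" if "y \<in> carrier N" for y using e that hom_closed[OF f] by blast
      show "f (e (x \<oplus>\<^bsub>N\<^esub> y)) = f (e x) \<oplus>\<^bsub>Q\<^esub> f (e y)" if "x \<in> carrier N" "y \<in> carrier N" for x y
        using that e eq[of "e (x \<oplus>\<^bsub>N\<^esub> y)" "e x \<oplus>\<^bsub>P\<^esub> e y"] by (simp add: hom_add[OF f] hom_add[OF ph])
      show "f (e (x \<cdot>\<^bsub>N\<^esub> a)) = f (e x) \<cdot>\<^bsub>Q\<^esub> a" if "x \<in> carrier N" "a \<in> carrier R" for x a
        using that e eq[of "e (x \<cdot>\<^bsub>N\<^esub> a)" "e x \<cdot>\<^bsub>P\<^esub> a"] by (simp add: hom_ract[OF f] hom_ract[OF ph])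
    qed
  qed
qed

text \<open>
  A pair of maps \<open>f\<close>, \<open>g\<close> with \<open>g f\<close> equal to the identity up to a map factoring through a
  projective module induces such a pair on syzygies. This is a one-sided form of Schanuel's lemma.
\<close>

lemma syzygy_retract:
  assumes s: "ses R L P M i p" and t: "ses R K F N j q"
    and P: "projective_rmod R P" and F: "projective_rmod R F" and Q: "projective_rmod R Q"
    and f: "f \<in> rmod_hom R M N" and g: "g \<in> rmod_hom R N M"
    and u: "u \<in> rmod_hom R M Q" and v: "v \<in> rmod_hom R Q M"
    and gf: "\<And>x. x \<in> carrier M \<Longrightarrow> g (f x) = x \<oplus>\<^bsub>M\<^esub> v (u x)"
  obtains f' g' h where "f' \<in> rmod_hom R L K" "g' \<in> rmod_hom R K L" "h \<in> rmod_hom R P L"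
    "\<forall>x\<in>carrier L. g' (f' x) = x \<oplus>\<^bsub>L\<^esub> h (i x)"
proof -
  note s' = sesD[OF s] and t' = sesD[OF t]
  interpret L: right_module R L by (rule s')
  interpret P: right_module R P by (rule s')
  interpret M: right_module R M by (rule s')
  interpret K: right_module R K by (rule t')
  interpret F: right_module R F by (rule t')
  interpret N: right_module R N by (rule t')
  obtain fl where fl: "fl \<in> rmod_hom R P F" "\<forall>x\<in>carrier P. q (fl x) = f (p x)"
    by (rule proj_lift[OF P t'(2,3,8) hom_comp[OF s'(6) f]])
  obtain gl where gl: "gl \<in> rmod_hom R F P" "\<forall>x\<in>carrier F. p (gl x) = g (q x)"
    by (rule proj_lift[OF F s'(2,3,8) hom_comp[OF t'(6) g]])
  obtain vl where vl: "vl \<in> rmod_hom R Q P" "\<forall>x\<in>carrier Q. p (vl x) = v x"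
    by (rule proj_lift[OF Q s'(2,3,8) v])
  note c = hom_closed[OF s'(4)] hom_closed[OF s'(6)] hom_closed[OF t'(4)] hom_closed[OF t'(6)]
    hom_closed[OF f] hom_closed[OF g] hom_closed[OF u] hom_closed[OF v]
    hom_closed[OF fl(1)] hom_closed[OF gl(1)] hom_closed[OF vl(1)]
  obtain f' where f': "f' \<in> rmod_hom R L K" "\<forall>x\<in>carrier L. j (f' x) = fl (i x)"
  proof (rule ses_factor[OF t hom_comp[OF s'(4) fl(1)] s'(1)])
    fix x assume "x \<in> carrier L"
    then show "q (fl (i x)) = \<zero>\<^bsub>N\<^esub>"
      using fl(2) c ses_zero[OF s] by (simp add: hom_zero[OF f] s'(3) t'(3))
  qed
  obtain g' where g': "g' \<in> rmod_hom R K L" "\<forall>x\<in>carrier K. i (g' x) = gl (j x)"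
  proof (rule ses_factor[OF s hom_comp[OF t'(4) gl(1)] t'(1)])
    fix x assume "x \<in> carrier K"
    then show "p (gl (j x)) = \<zero>\<^bsub>M\<^esub>"
      using gl(2) c ses_zero[OF t] by (simp add: hom_zero[OF g] s'(3) t'(3))
  qed
  \<comment> \<open>On \<open>P\<close> the composite of the two lifts satisfies the given relation
    up to an error \<open>?H\<close> in the kernel of \<open>p\<close>, and its factorisation
    through \<open>L\<close> is the correction \<open>h\<close>. On the image of \<open>i\<close>
    the summand \<open>vl (u (p x))\<close> vanishes.\<close>
  let ?H = "\<lambda>x. gl (fl x) \<ominus>\<^bsub>P\<^esub> (x \<oplus>\<^bsub>P\<^esub> vl (u (p x)))"
  have H: "?H \<in> rmod_hom R P P"
    by (intro hom_diff hom_plus hom_comp[OF fl(1) gl(1)] hom_id hom_comp[OF s'(6) hom_comp[OF u vl(1)]] s')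
  obtain h where h: "h \<in> rmod_hom R P L" "\<forall>x\<in>carrier P. i (h x) = ?H x"
  proof (rule ses_factor[OF s H s'(2)])
    fix x assume x: "x \<in> carrier P"
    have "p (?H x) = p (gl (fl x)) \<ominus>\<^bsub>M\<^esub> (p x \<oplus>\<^bsub>M\<^esub> p (vl (u (p x))))"
      using x c by (simp add: hom_minus[OF s'(6)] s' hom_add[OF s'(6)])
    also have "\<dots> = \<zero>\<^bsub>M\<^esub>"
      using x c fl(2) gl(2) vl(2) gf by (simp add: M.diff_eq_zero_iff)
    finally show "p (?H x) = \<zero>\<^bsub>M\<^esub>" .
  qed
  have hc: "h x \<in> carrier L" if "x \<in> carrier P" for x using hom_closed[OF h(1) that] .
  have "g' (f' x) = x \<oplus>\<^bsub>L\<^esub> h (i x)" if x: "x \<in> carrier L" for x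
  proof (rule inj_onD[OF s'(5)])
    have "vl (u (p (i x))) = \<zero>\<^bsub>P\<^esub>"
      using x ses_zero[OF s x] hom_zero[OF u s'(3) proj_module[OF Q]] hom_zero[OF vl(1) proj_module[OF Q] s'(2)] by simp
    then have "i (x \<oplus>\<^bsub>L\<^esub> h (i x)) = i x \<oplus>\<^bsub>P\<^esub> (gl (fl (i x)) \<ominus>\<^bsub>P\<^esub> i x)"
      using x c hc h(2) by (simp add: hom_add[OF s'(4)])
    also have "\<dots> = gl (fl (i x))"
      using x c by (simp add: a_minus_def P.M.a_ac P.M.r_neg2)
    finally show "i (g' (f' x)) = i (x \<oplus>\<^bsub>L\<^esub> h (i x))"
      using x g'(2) f'(2) hom_closed[OF f'(1)] by simp
    show "g' (f' x) \<in> carrier L" using x hom_closed[OF g'(1)] hom_closed[OF f'(1)] by simp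
    show "x \<oplus>\<^bsub>L\<^esub> h (i x) \<in> carrier L" using x c hc by simp
  qed
  with f'(1) g'(1) h(1) that show thesis by blast
qed

section \<open>Localised projective dimension\<close>

text \<open>
  For a multiplicatively closed set \<open>T\<close> of a commutative ring, \<open>loc_proj A T N\<close> says that some
  element of \<open>T\<close> annihilates the identity of \<open>N\<close> modulo maps factoring through free modules.
  If \<open>T\<close> is the complement of a prime ideal \<open>q\<close> and \<open>N\<close> is finitely presented, then this is
  projectivity of the localisation at \<open>q\<close>, and \<open>loc_pd A T n N\<close> bounds the projective dimension
  of this localisation by \<open>n\<close>; no localised ring or module needs to be formed. The case
  \<open>T = {\<one>}\<close> is the ordinary projective dimension.

  Every finitely generated module has a copy with elements of type \<^typ>\<open>nat \<Rightarrow> 'a\<close>.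
\<close>

definition loc_proj :: "('a, 'r) ring_scheme \<Rightarrow> 'a set \<Rightarrow> ('a, 'b) rmod \<Rightarrow> bool" where
  "loc_proj A T N \<longleftrightarrow> (\<exists>s\<in>T. \<exists>n::nat. \<exists>u\<in>rmod_hom A N (free_rmod A {..<n}).
     \<exists>v\<in>rmod_hom A (free_rmod A {..<n}) N. \<forall>x\<in>carrier N. v (u x) = x \<cdot>\<^bsub>N\<^esub> s)"

primrec loc_pd :: "('a, 'r) ring_scheme \<Rightarrow> 'a set \<Rightarrow> nat \<Rightarrow> ('a, nat \<Rightarrow> 'a) rmod \<Rightarrow> bool" where
  "loc_pd A T 0 N \<longleftrightarrow> loc_proj A T N"
| "loc_pd A T (Suc n) N \<longleftrightarrow> (\<exists>K i (m::nat) p. ses A K (free_rmod A {..<m}) N i p \<and> loc_pd A T n K)"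

section \<open>Finitely generated modules over a commutative noetherian ring\<close>

locale comm_noeth =
  fixes A :: "('a, 'r) ring_scheme"
  assumes A_cring: "cring A" and A_noeth: "noetherian_ring A"
begin

sublocale A: cring A by (rule A_cring)

lemma A_ring: "ring A" by (rule A.ring_axioms)

lemma noethI: "right_module A M \<Longrightarrow> fin_gen A M \<Longrightarrow> noeth_rmod A M"
  by (rule fin_gen_noeth[OF A_cring A_noeth])

lemma ses_fin_gen:
  assumes s: "ses A K P N i p" and P: "fin_gen A P"
  shows "fin_gen A K" "fin_gen A N"
proof -
  note s = sesD[OF s]
  show "fin_gen A K" by (rule noeth_fin_gen[OF noeth_inj[OF s(1) noethI[OF s(2) P] s(4,5)]])
  show "fin_gen A N" by (rule fin_gen_img[OF s(2,3,8) P])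
qed

text \<open>The syzygy is a kernel inside \<open>free_rmod A {..<n}\<close> and so keeps the element
  type \<open>nat \<Rightarrow> 'a\<close>. This is what lets \<open>loc_pd\<close> recurse within a
  single type.\<close>

lemma fin_gen_ses:
  assumes "right_module A N" "fin_gen A N"
  obtains K and n :: nat and i p where "ses A (K :: ('a, nat \<Rightarrow> 'a) rmod) (free_rmod A {..<n}) N i p"
proof -
  obtain n p where p: "epi A (free_rmod A {..<n::nat}) N p" by (rule fin_gen_cover[OF assms])
  from that[OF ses_sub[OF free_module[OF A_ring] assms(1) p]] show thesis .
qed

text \<open>A choice of preimages under a finite free cover embeds the elements of \<open>N\<close>
  into \<open>nat \<Rightarrow> 'a\<close>, and the module structure is transported along this
  embedding.\<close>

lemma fin_gen_copy:
  assumes N: "right_module A N" "fin_gen A N"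
  obtains N' :: "('a, nat \<Rightarrow> 'a) rmod" and f g where "right_module A N'" "f \<in> rmod_hom A N N'" "g \<in> rmod_hom A N' N"
    "bij_betw f (carrier N) (carrier N')" "bij_betw g (carrier N') (carrier N)"
    "\<forall>x\<in>carrier N. g (f x) = x" "\<forall>x\<in>carrier N'. f (g x) = x" "fin_gen A N'"
proof -
  obtain n p where p: "epi A (free_rmod A {..<n::nat}) N p" by (rule fin_gen_cover[OF assms])
  have "\<exists>x\<in>carrier (free_rmod A {..<n}). y = p x" if "y \<in> carrier N" for y using epiE[OF p that] .
  then obtain j where j: "\<And>y. y \<in> carrier N \<Longrightarrow> j y \<in> carrier (free_rmod A {..<n}) \<and> p (j y) = y" by metis
  have inj: "inj_on j (carrier N)" by (rule inj_on_inverseI[of _ p]) (use j in auto)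
  note c = copy_rmod[OF N(1) inj]
  let ?g = "the_inv_into (carrier N) j"
  show thesis
  proof (rule that[OF c(1,2,3,5)])
    show "bij_betw ?g (carrier (copy_rmod j N)) (carrier N)"
      using bij_betw_the_inv_into[OF c(5)] .
    show "\<forall>x\<in>carrier N. ?g (j x) = x" using c(6) by blast
    show "\<forall>x\<in>carrier (copy_rmod j N). j (?g x) = x" using f_the_inv_into_f[OF inj] c(4) by auto
    show "fin_gen A (copy_rmod j N)" by (rule copy_fin_gen[OF N(1) inj N(2)])
  qed
qed

text \<open>A factorisation through any projective \<open>Q\<close> suffices: \<open>v\<close> lifts
  through a finite free cover of \<open>N\<close>, which replaces \<open>Q\<close> by a free module
  of finite rank.\<close>

lemma loc_projI:
  assumes N: "right_module A N" "fin_gen A N" and Q: "projective_rmod A Q" and "s \<in> T"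
    and u: "u \<in> rmod_hom A N Q" and v: "v \<in> rmod_hom A Q N" and vu: "\<And>x. x \<in> carrier N \<Longrightarrow> v (u x) = x \<cdot>\<^bsub>N\<^esub> s"
  shows "loc_proj A T N"
proof -
  obtain n p where p: "epi A (free_rmod A {..<n::nat}) N p" by (rule fin_gen_cover[OF N])
  obtain w where w: "w \<in> rmod_hom A Q (free_rmod A {..<n})" "\<forall>x\<in>carrier Q. p (w x) = v x"
    by (rule proj_lift[OF Q free_module[OF A_ring] N(1) p v])
  show ?thesis
    unfolding loc_proj_def
    using assms(4) hom_comp[OF u w(1)] p w(2) hom_closed[OF u] vu
    by (intro bexI[of _ s] exI[of _ n] bexI[of _ "\<lambda>x. w (u x)"] bexI[of _ p]) auto
qed

text \<open>A direct summand of \<open>N'\<close> up to projective modules inherits the bound. The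
  weak hypothesis, identity plus a map through \<open>Q\<close>, is the form that survives the
  passage to syzygies: even an honest retraction yields on syzygies only the identity plus a map
  through the free cover. The element type of \<open>Q\<close> is fixed so that the induction can
  choose \<open>Q\<close> afresh.\<close>

lemma loc_pd_retract_aux:
  fixes N N' Q :: "('a, nat \<Rightarrow> 'a) rmod"
  assumes T: "T \<subseteq> carrier A" and "loc_pd A T k N'"
    and "right_module A N" "fin_gen A N" and "right_module A N'" "fin_gen A N'"
    and "f \<in> rmod_hom A N N'" "g \<in> rmod_hom A N' N"
    and "projective_rmod A Q" "u \<in> rmod_hom A N Q" "v \<in> rmod_hom A Q N"
    and "\<And>x. x \<in> carrier N \<Longrightarrow> g (f x) = x \<oplus>\<^bsub>N\<^esub> v (u x)"
  shows "loc_pd A T k N"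
  using assms(2-)
proof (induction k arbitrary: N N' f g Q u v)
  case 0
  note f = \<open>f \<in> rmod_hom A N N'\<close> and g = \<open>g \<in> rmod_hom A N' N\<close> and u = \<open>u \<in> rmod_hom A N Q\<close>
    and v = \<open>v \<in> rmod_hom A Q N\<close> and Q = \<open>projective_rmod A Q\<close>
    and N = \<open>right_module A N\<close> \<open>fin_gen A N\<close> and N' = \<open>right_module A N'\<close>
  interpret N: right_module A N by (rule N)
  interpret N': right_module A N' by fact
  from 0(1) obtain s n u' v' where s: "s \<in> T" and u': "u' \<in> rmod_hom A N' (free_rmod A {..<n::nat})"
    and v': "v' \<in> rmod_hom A (free_rmod A {..<n}) N'" and vu: "\<forall>x\<in>carrier N'. v' (u' x) = x \<cdot>\<^bsub>N'\<^esub> s"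
    by (auto simp: loc_proj_def)
  have sA: "s \<in> carrier A" using s T by auto
  obtain m p where p: "epi A (free_rmod A {..<m::nat}) N p" by (rule fin_gen_cover[OF N])
  have ph: "p \<in> rmod_hom A (free_rmod A {..<m}) N" using p ..
  interpret F: right_module A "free_rmod A {..<m}" by (rule free_module[OF A_ring])
  obtain w where w: "w \<in> rmod_hom A (free_rmod A {..<n}) (free_rmod A {..<m})"
    "\<forall>x\<in>carrier (free_rmod A {..<n}). p (w x) = g (v' x)"
    by (rule proj_lift[OF free_proj[OF A_ring] free_module[OF A_ring] N(1) p hom_comp[OF v' g]])
  obtain w2 where w2: "w2 \<in> rmod_hom A Q (free_rmod A {..<m})" "\<forall>x\<in>carrier Q. p (w2 x) = v x"
    by (rule proj_lift[OF Q free_module[OF A_ring] N(1) p v])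
  note c = hom_closed[OF f] hom_closed[OF g] hom_closed[OF u] hom_closed[OF v] hom_closed[OF u'] hom_closed[OF v']
    hom_closed[OF w(1)] hom_closed[OF w2(1)]
  \<comment> \<open>After application of \<open>p\<close>, the first term gives
    \<open>g (f x)\<close> times \<open>s\<close>; the second removes the surplus
    \<open>v (u x)\<close> times \<open>s\<close>.\<close>
  let ?W = "\<lambda>x. w (u' (f x)) \<ominus>\<^bsub>free_rmod A {..<m}\<^esub> w2 (u x) \<cdot>\<^bsub>free_rmod A {..<m}\<^esub> s"
  have W: "?W \<in> rmod_hom A N (free_rmod A {..<m})"
    by (intro hom_diff hom_scale hom_comp[OF f hom_comp[OF u' w(1)]] hom_comp[OF u w2(1)]
        F.right_module_axioms A_cring sA)
  have "p (?W x) = x \<cdot>\<^bsub>N\<^esub> s" if x: "x \<in> carrier N" for x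
  proof -
    have "p (?W x) = p (w (u' (f x))) \<ominus>\<^bsub>N\<^esub> p (w2 (u x)) \<cdot>\<^bsub>N\<^esub> s"
      using x c sA by (simp add: hom_minus[OF ph F.right_module_axioms N(1)] hom_ract[OF ph])
    also have "\<dots> = g (f x \<cdot>\<^bsub>N'\<^esub> s) \<ominus>\<^bsub>N\<^esub> v (u x) \<cdot>\<^bsub>N\<^esub> s"
      using x c w(2) w2(2) vu by simp
    also have "\<dots> = (x \<oplus>\<^bsub>N\<^esub> v (u x)) \<cdot>\<^bsub>N\<^esub> s \<ominus>\<^bsub>N\<^esub> v (u x) \<cdot>\<^bsub>N\<^esub> s"
      using x c sA 0 by (simp add: hom_ract[OF g])
    also have "\<dots> = x \<cdot>\<^bsub>N\<^esub> s"
      using x c sA by (simp add: N.ract_add_left a_minus_def N.M.a_assoc N.M.r_neg)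
    finally show ?thesis .
  qed
  then show ?case
    using loc_projI[OF N free_proj[OF A_ring] s W ph] by simp
next
  case (Suc k)
  note N = \<open>right_module A N\<close> \<open>fin_gen A N\<close>
  from Suc(2) obtain K' i' m' p' where s': "ses A K' (free_rmod A {..<m'::nat}) N' i' p'" and pd: "loc_pd A T k K'"
    by auto
  obtain K n i p where s: "ses A (K :: ('a, nat \<Rightarrow> 'a) rmod) (free_rmod A {..<n::nat}) N i p"
    by (rule fin_gen_ses[OF N])
  obtain f' g' h where f': "f' \<in> rmod_hom A K K'" "g' \<in> rmod_hom A K' K" "h \<in> rmod_hom A (free_rmod A {..<n}) K"
    "\<forall>x\<in>carrier K. g' (f' x) = x \<oplus>\<^bsub>K\<^esub> h (i x)"
  proof (rule syzygy_retract[OF s s' free_proj[OF A_ring] free_proj[OF A_ring] Suc.prems(8,6,7,9,10)])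
    show "g (f x) = x \<oplus>\<^bsub>N\<^esub> v (u x)" if "x \<in> carrier N" for x by (rule Suc.prems(11)[OF that])
  qed
  have fr: "fin_gen A (free_rmod A {..<n})" for n :: nat by (rule free_fin_gen[OF A_ring finite_lessThan])
  have "loc_pd A T k K"
    by (rule Suc.IH[OF pd sesD(1)[OF s] ses_fin_gen(1)[OF s fr] sesD(1)[OF s'] ses_fin_gen(1)[OF s' fr] f'(1,2)
          free_proj[OF A_ring] sesD(4)[OF s] f'(3)])
      (use f'(4) in auto)
  with s show ?case by auto
qed

text \<open>The element type of \<open>Q\<close> is now arbitrary: lifting \<open>v\<close> through
  a finite free cover of \<open>N\<close> replaces \<open>Q\<close> by a module of the type used in
  the induction.\<close>

lemma loc_pd_retract:
  assumes T: "T \<subseteq> carrier A" and pd: "loc_pd A T k N'"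
    and N: "right_module A N" "fin_gen A N" and N': "right_module A N'" "fin_gen A N'"
    and f: "f \<in> rmod_hom A N N'" "g \<in> rmod_hom A N' N"
    and Q: "projective_rmod A Q" and u: "u \<in> rmod_hom A N Q" and v: "v \<in> rmod_hom A Q N"
    and gf: "\<And>x. x \<in> carrier N \<Longrightarrow> g (f x) = x \<oplus>\<^bsub>N\<^esub> v (u x)"
  shows "loc_pd A T k N"
proof -
  obtain n p where p: "epi A (free_rmod A {..<n::nat}) N p" by (rule fin_gen_cover[OF N])
  have ph: "p \<in> rmod_hom A (free_rmod A {..<n}) N" using p ..
  obtain w where w: "w \<in> rmod_hom A Q (free_rmod A {..<n})" "\<forall>x\<in>carrier Q. p (w x) = v x"
    by (rule proj_lift[OF Q free_module[OF A_ring] N(1) p v])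
  show ?thesis
    by (rule loc_pd_retract_aux[OF T pd N N' f free_proj[OF A_ring] hom_comp[OF u w(1)] ph])
      (use w(2) gf hom_closed[OF u] in simp)
qed

lemma loc_pd_retract_id:
  assumes T: "T \<subseteq> carrier A" and pd: "loc_pd A T k N'"
    and N: "right_module A N" "fin_gen A N" and N': "right_module A N'" "fin_gen A N'"
    and f: "f \<in> rmod_hom A N N'" "g \<in> rmod_hom A N' N" and gf: "\<And>x. x \<in> carrier N \<Longrightarrow> g (f x) = x"
  shows "loc_pd A T k N"
proof -
  interpret N: right_module A N by (rule N)
  interpret F: right_module A "reg_rmod A" by (rule reg_module[OF A_ring])
  show ?thesis
    by (rule loc_pd_retract[OF T pd N N' f reg_proj[OF A_ring] hom_const_zero[OF F.right_module_axioms]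
          hom_const_zero[OF N(1)]]) (simp add: gf)
qed

lemma ses_syzygy_retract:
  assumes s: "ses R L P N i p" and t: "ses R K F N j q"
    and P: "projective_rmod R P" and F: "projective_rmod R F"
  obtains f' g' h where "f' \<in> rmod_hom R L K" "g' \<in> rmod_hom R K L" "h \<in> rmod_hom R P L"
    "\<forall>x\<in>carrier L. g' (f' x) = x \<oplus>\<^bsub>L\<^esub> h (i x)"
proof -
  note N = sesD(3)[OF s]
  interpret N: right_module R N by (rule N)
  show thesis
    by (rule syzygy_retract[OF s t P F P hom_id hom_id hom_const_zero[OF sesD(2)[OF s]] hom_const_zero[OF N]])
      (use that in auto)
qed

text \<open>\<open>loc_pd\<close> speaks of one free cover of its own choice. By Schanuel's lemma
  the syzygies of two covers are retracts of each other up to projective modules, so any finitely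
  generated projective cover may be used.\<close>

lemma loc_pd_SucI:
  assumes T: "T \<subseteq> carrier A" and s: "ses A K P N i p" and P: "projective_rmod A P" "fin_gen A P"
    and pd: "loc_pd A T k K"
  shows "loc_pd A T (Suc k) N"
proof -
  note N = sesD(3)[OF s] ses_fin_gen(2)[OF s P(2)]
  obtain L n j q where t: "ses A (L :: ('a, nat \<Rightarrow> 'a) rmod) (free_rmod A {..<n::nat}) N j q"
    by (rule fin_gen_ses[OF N])
  note fr = free_proj[OF A_ring] free_fin_gen[OF A_ring]
  obtain f' g' h where f': "f' \<in> rmod_hom A L K" "g' \<in> rmod_hom A K L" "h \<in> rmod_hom A (free_rmod A {..<n}) L"
    "\<forall>x\<in>carrier L. g' (f' x) = x \<oplus>\<^bsub>L\<^esub> h (j x)"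
    by (rule ses_syzygy_retract[OF t s fr(1) P(1)])
  have "loc_pd A T k L"
    by (rule loc_pd_retract[OF T pd sesD(1)[OF t] ses_fin_gen(1)[OF t] sesD(1)[OF s] ses_fin_gen(1)[OF s]
          f'(1,2) fr(1) sesD(4)[OF t] f'(3)]) (use P fr f'(4) in auto)
  with t show ?thesis by auto
qed

text \<open>The same comparison in the other direction: the syzygy of a prescribed cover inherits
  the bound from the syzygy of the unknown one.\<close>

lemma loc_pd_SucD:
  assumes T: "T \<subseteq> carrier A" and s: "ses A K P N i p" and P: "projective_rmod A P" "fin_gen A P"
    and pd: "loc_pd A T (Suc k) N"
  shows "loc_pd A T k K"
proof -
  from pd obtain L n j q where t: "ses A L (free_rmod A {..<n::nat}) N j q" and pd': "loc_pd A T k L"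
    by auto
  note fr = free_proj[OF A_ring] free_fin_gen[OF A_ring]
  obtain f' g' h where f': "f' \<in> rmod_hom A K L" "g' \<in> rmod_hom A L K" "h \<in> rmod_hom A P K"
    "\<forall>x\<in>carrier K. g' (f' x) = x \<oplus>\<^bsub>K\<^esub> h (i x)"
    by (rule ses_syzygy_retract[OF s t P(1) fr(1)])
  show ?thesis
    by (rule loc_pd_retract[OF T pd' sesD(1)[OF s] ses_fin_gen(1)[OF s] sesD(1)[OF t] ses_fin_gen(1)[OF t]
          f'(1,2) P(1) sesD(4)[OF s] f'(3)]) (use P fr f'(4) in auto)
qed

lemma loc_pd_mono_Suc:
  assumes T: "T \<subseteq> carrier A" and "loc_pd A T k N" "right_module A N" "fin_gen A N"
  shows "loc_pd A T (Suc k) N"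
  using assms(2-)
proof (induction k arbitrary: N)
  case 0
  note N = 0(2,3)
  from 0(1) obtain s n u v where s: "s \<in> T" and u: "u \<in> rmod_hom A N (free_rmod A {..<n::nat})"
    and v: "v \<in> rmod_hom A (free_rmod A {..<n}) N" and vu: "\<forall>x\<in>carrier N. v (u x) = x \<cdot>\<^bsub>N\<^esub> s"
    by (auto simp: loc_proj_def)
  have sA: "s \<in> carrier A" using s T by auto
  obtain K m i p where k: "ses A (K :: ('a, nat \<Rightarrow> 'a) rmod) (free_rmod A {..<m::nat}) N i p"
    by (rule fin_gen_ses[OF N])
  note k' = sesD[OF k]
  let ?F = "free_rmod A {..<m}"
  interpret F: right_module A ?F by (rule free_module[OF A_ring])
  interpret N: right_module A N by (rule N)
  obtain w where w: "w \<in> rmod_hom A (free_rmod A {..<n}) ?F"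
    "\<forall>x\<in>carrier (free_rmod A {..<n}). p (w x) = v x"
    by (rule proj_lift[OF free_proj[OF A_ring] k'(2,3,8) v])
  note c = hom_closed[OF u] hom_closed[OF v] hom_closed[OF w(1)] hom_closed[OF k'(4)] hom_closed[OF k'(6)]
  \<comment> \<open>Multiplication by \<open>s\<close> on the cover and \<open>w (u (p x))\<close>
    have the same image under \<open>p\<close>, so their difference lands in \<open>K\<close>. On
    \<open>K\<close>, where \<open>p\<close> vanishes, it is multiplication by \<open>s\<close>;
    hence the syzygy is projective with the same denominator.\<close>
  let ?H = "\<lambda>x. x \<cdot>\<^bsub>?F\<^esub> s \<ominus>\<^bsub>?F\<^esub> w (u (p x))"
  have H: "?H \<in> rmod_hom A ?F ?F"
    by (intro hom_diff hom_scale hom_id hom_comp[OF k'(6) hom_comp[OF u w(1)]] F.right_module_axioms A_cring sA)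
  obtain h where h: "h \<in> rmod_hom A ?F K" "\<forall>x\<in>carrier ?F. i (h x) = ?H x"
  proof (rule ses_factor[OF k H k'(2)])
    fix x assume x: "x \<in> carrier ?F"
    show "p (?H x) = \<zero>\<^bsub>N\<^esub>"
      using x c sA w(2) vu by (simp add: hom_minus[OF k'(6)] k' hom_ract[OF k'(6)] N.diff_eq_zero_iff)
  qed
  have "h (i x) = x \<cdot>\<^bsub>K\<^esub> s" if x: "x \<in> carrier K" for x
  proof (rule inj_onD[OF k'(5)])
    interpret K: right_module A K by (rule k')
    have "w (u (p (i x))) = \<zero>\<^bsub>?F\<^esub>"
      using x ses_zero[OF k x] hom_zero[OF hom_comp[OF u w(1)] N(1) F.right_module_axioms] by simp
    then show "i (h (i x)) = i (x \<cdot>\<^bsub>K\<^esub> s)"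
      using x c sA h(2) by (simp add: hom_ract[OF k'(4)] a_minus_def)
    show "h (i x) \<in> carrier K" "x \<cdot>\<^bsub>K\<^esub> s \<in> carrier K" using x c sA hom_closed[OF h(1)] by auto
  qed
  then have "loc_proj A T K"
    unfolding loc_proj_def using s k'(4) h(1)
    by (intro bexI[of _ s] exI[of _ m] bexI[of _ i] bexI[of _ h]) auto
  with k show ?case by auto
next
  case (Suc k)
  from Suc(2) obtain K i m p where s: "ses A K (free_rmod A {..<m::nat}) N i p" and pd: "loc_pd A T k K"
    by auto
  have "loc_pd A T (Suc k) K"
    by (rule Suc.IH[OF pd sesD(1)[OF s] ses_fin_gen(1)[OF s free_fin_gen[OF A_ring finite_lessThan]]])
  with s show ?case unfolding loc_pd.simps(2)[of A T "Suc k"] by blast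
qed

lemma loc_pd_mono:
  assumes "T \<subseteq> carrier A" "loc_pd A T k N" "right_module A N" "fin_gen A N" "k \<le> l"
  shows "loc_pd A T l N"
  using assms(5)
proof (induction l rule: dec_induct)
  case (step n) then show ?case using loc_pd_mono_Suc[OF assms(1)] assms(3,4) by blast
qed (rule assms(2))

text \<open>Enlarging the set of denominators is a further localisation.\<close>

lemma loc_pd_subset: "S \<subseteq> T \<Longrightarrow> loc_pd A S k N \<Longrightarrow> loc_pd A T k N"
proof (induction k arbitrary: N)
  case 0 then show ?case unfolding loc_pd.simps loc_proj_def by blast
next
  case (Suc k) then show ?case unfolding loc_pd.simps by blast
qed

text \<open>The localisation is the zero module, so zero maps through the regular module are
  sufficient witnesses.\<close>

lemma loc_proj_killed:
  assumes "right_module A N" "fin_gen A N" "s \<in> T" "\<And>x. x \<in> carrier N \<Longrightarrow> x \<cdot>\<^bsub>N\<^esub> s = \<zero>\<^bsub>N\<^esub>"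
  shows "loc_proj A T N"
  by (rule loc_projI[OF assms(1,2) reg_proj[OF A_ring] assms(3) hom_const_zero[OF reg_module[OF A_ring]]
        hom_const_zero[OF assms(1)]]) (simp add: assms(4))

end

lemma (in abelian_group) diff_cancel:
  assumes "x \<in> carrier G" "y \<in> carrier G"
  shows "(x \<oplus> y) \<ominus> y = x" "(x \<oplus> y) \<ominus> x = y" "(x \<ominus> y) \<oplus> y = x"
proof -
  have *: "(x \<oplus> y) \<ominus> y = x" if "x \<in> carrier G" "y \<in> carrier G" for x y
    using that by (simp add: a_minus_def a_assoc r_neg)
  from *[OF assms] show "(x \<oplus> y) \<ominus> y = x" .
  from *[OF assms(2,1)] show "(x \<oplus> y) \<ominus> x = y" by (simp add: a_comm assms)
  show "(x \<ominus> y) \<oplus> y = x" using assms by (simp add: a_minus_def a_assoc l_neg)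
qed

lemma primeideal_complement:
  assumes "cring A" "primeideal q A"
  shows "carrier A - q \<subseteq> carrier A" "\<one>\<^bsub>A\<^esub> \<in> carrier A - q"
    "\<And>s t. s \<in> carrier A - q \<Longrightarrow> t \<in> carrier A - q \<Longrightarrow> s \<otimes>\<^bsub>A\<^esub> t \<in> carrier A - q"
proof -
  interpret cring A by fact
  interpret primeideal q A by fact
  show "carrier A - q \<subseteq> carrier A" by auto
  show "\<one>\<^bsub>A\<^esub> \<in> carrier A - q" using one_imp_carrier I_notcarr by auto
  show "s \<otimes>\<^bsub>A\<^esub> t \<in> carrier A - q" if "s \<in> carrier A - q" "t \<in> carrier A - q" for s t
    using that I_prime by auto
qed

section \<open>Extensions of modules\<close>

context comm_noeth
begin

text \<open>The horseshoe lemma. In degree zero the denominators for \<open>X\<close> and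
  \<open>Z\<close> are multiplied, which is why \<open>T\<close> is closed under products. In higher
  degree the covers of \<open>X\<close> and \<open>Z\<close> combine to a cover of \<open>Y\<close>
  whose kernel is an extension of \<open>L\<close> by \<open>K\<close>.\<close>

lemma loc_pd_extension:
  assumes T: "T \<subseteq> carrier A" "\<And>s t. s \<in> T \<Longrightarrow> t \<in> T \<Longrightarrow> s \<otimes>\<^bsub>A\<^esub> t \<in> T"
    and "ses A X Y Z \<alpha> \<beta>" "fin_gen A Y" "loc_pd A T k X" "loc_pd A T k Z"
  shows "loc_pd A T k Y"
  using assms(3-)
proof (induction k arbitrary: X Y Z \<alpha> \<beta>)
  case 0
  note e = sesD[OF 0(1)]
  interpret X: right_module A X by (rule e)
  interpret Y: right_module A Y by (rule e)
  interpret Z: right_module A Z by (rule e)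
  from 0(3) obtain s m u v where s: "s \<in> T" and u: "u \<in> rmod_hom A X (free_rmod A {..<m::nat})"
    and v: "v \<in> rmod_hom A (free_rmod A {..<m}) X" and vu: "\<forall>x\<in>carrier X. v (u x) = x \<cdot>\<^bsub>X\<^esub> s"
    by (auto simp: loc_proj_def)
  from 0(4) obtain s' n u' v' where s': "s' \<in> T" and u': "u' \<in> rmod_hom A Z (free_rmod A {..<n::nat})"
    and v': "v' \<in> rmod_hom A (free_rmod A {..<n}) Z" and vu': "\<forall>x\<in>carrier Z. v' (u' x) = x \<cdot>\<^bsub>Z\<^esub> s'"
    by (auto simp: loc_proj_def)
  have sA: "s \<in> carrier A" "s' \<in> carrier A" using s s' T by auto
  let ?F = "free_rmod A {..<m}" and ?G = "free_rmod A {..<n}"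
  obtain w where w: "w \<in> rmod_hom A ?G Y" "\<forall>x\<in>carrier ?G. \<beta> (w x) = v' x"
    by (rule proj_lift[OF free_proj[OF A_ring] e(2,3,8) v'])
  note c = hom_closed[OF u] hom_closed[OF v] hom_closed[OF u'] hom_closed[OF v'] hom_closed[OF w(1)]
    hom_closed[OF e(4)] hom_closed[OF e(6)]
  \<comment> \<open>Subtracting the lift of the splitting of \<open>Z\<close> moves the
    \<open>s'\<close>-multiple of \<open>y\<close> into the image of \<open>X\<close>; there the
    splitting of \<open>X\<close> applies, at the cost of a further factor \<open>s\<close>.\<close>
  let ?H = "\<lambda>y. y \<cdot>\<^bsub>Y\<^esub> s' \<ominus>\<^bsub>Y\<^esub> w (u' (\<beta> y))"
  have H: "?H \<in> rmod_hom A Y Y"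
    by (intro hom_diff hom_scale hom_id hom_comp[OF e(6) hom_comp[OF u' w(1)]] e A_cring sA)
  obtain \<theta> where \<theta>: "\<theta> \<in> rmod_hom A Y X" "\<forall>y\<in>carrier Y. \<alpha> (\<theta> y) = ?H y"
  proof (rule ses_factor[OF 0(1) H e(2)])
    fix y assume "y \<in> carrier Y"
    then show "\<beta> (?H y) = \<zero>\<^bsub>Z\<^esub>"
      using c sA w(2) vu' by (simp add: hom_minus[OF e(6)] e hom_ract[OF e(6)] Z.diff_eq_zero_iff)
  qed
  let ?P = "prod_rmod ?F ?G"
  interpret F: right_module A ?F by (rule free_module[OF A_ring])
  interpret G: right_module A ?G by (rule free_module[OF A_ring])
  have P: "projective_rmod A ?P" by (intro prod_proj free_proj A_ring)
  have f: "fst \<in> rmod_hom A ?P ?F" "snd \<in> rmod_hom A ?P ?G" by (auto intro!: rmod_homI)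
  have U: "(\<lambda>y. (u (\<theta> y), u' (\<beta> y) \<cdot>\<^bsub>?G\<^esub> s)) \<in> rmod_hom A Y ?P"
  proof -
    have 1: "(\<lambda>y. u (\<theta> y)) \<in> rmod_hom A Y ?F" by (rule hom_comp[OF \<theta>(1) u])
    have 2: "(\<lambda>y. u' (\<beta> y) \<cdot>\<^bsub>?G\<^esub> s) \<in> rmod_hom A Y ?G"
      by (intro hom_scale hom_comp[OF e(6) u'] G.right_module_axioms A_cring sA)
    show ?thesis
      by (rule rmod_homI) (simp_all add: hom_simps[OF 1] hom_simps[OF 2])
  qed
  have V: "(\<lambda>z. \<alpha> (v (fst z)) \<oplus>\<^bsub>Y\<^esub> w (snd z)) \<in> rmod_hom A ?P Y"
    by (intro hom_plus hom_comp[OF f(1) hom_comp[OF v e(4)]] hom_comp[OF f(2) w(1)] e)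
  have "loc_proj A T Y"
  proof (rule loc_projI[OF e(2) 0(2) P T(2)[OF s' s] U V])
    fix y assume y: "y \<in> carrier Y"
    have t: "\<theta> y \<in> carrier X" using hom_closed[OF \<theta>(1) y] .
    have "\<alpha> (v (u (\<theta> y))) \<oplus>\<^bsub>Y\<^esub> w (u' (\<beta> y) \<cdot>\<^bsub>?G\<^esub> s)
      = (\<alpha> (\<theta> y) \<oplus>\<^bsub>Y\<^esub> w (u' (\<beta> y))) \<cdot>\<^bsub>Y\<^esub> s"
      using y t vu c sA by (simp add: hom_ract[OF e(4)] hom_ract[OF w(1)] Y.ract_add_left)
    also have "\<dots> = y \<cdot>\<^bsub>Y\<^esub> (s' \<otimes>\<^bsub>A\<^esub> s)"
      using y \<theta>(2) c sA by (simp add: a_minus_def Y.M.a_assoc Y.M.l_neg Y.ract_assoc)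
    finally show "\<alpha> (v (fst (u (\<theta> y), u' (\<beta> y) \<cdot>\<^bsub>?G\<^esub> s))) \<oplus>\<^bsub>Y\<^esub> w (snd (u (\<theta> y), u' (\<beta> y) \<cdot>\<^bsub>?G\<^esub> s))
      = y \<cdot>\<^bsub>Y\<^esub> (s' \<otimes>\<^bsub>A\<^esub> s)" by simp
  qed
  then show ?case by simp
next
  case (Suc k)
  note e = sesD[OF Suc(2)]
  interpret X: right_module A X by (rule e)
  interpret Y: right_module A Y by (rule e)
  interpret Z: right_module A Z by (rule e)
  from Suc(4) obtain K i m p where x: "ses A K (free_rmod A {..<m::nat}) X i p" and pdK: "loc_pd A T k K"
    by auto
  from Suc(5) obtain L j n q where z: "ses A L (free_rmod A {..<n::nat}) Z j q" and pdL: "loc_pd A T k L"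
    by auto
  note x' = sesD[OF x] and z' = sesD[OF z]
  let ?F = "free_rmod A {..<m}" and ?G = "free_rmod A {..<n}"
  interpret F: right_module A ?F by (rule x')
  interpret G: right_module A ?G by (rule z')
  interpret K: right_module A K by (rule x')
  interpret L: right_module A L by (rule z')
  obtain w where w: "w \<in> rmod_hom A ?G Y" "\<forall>x\<in>carrier ?G. \<beta> (w x) = q x"
    by (rule proj_lift[OF free_proj[OF A_ring] e(2,3,8) z'(6)])
  note c = hom_closed[OF w(1)] hom_closed[OF e(4)] hom_closed[OF e(6)] hom_closed[OF x'(4)] hom_closed[OF x'(6)]
    hom_closed[OF z'(4)] hom_closed[OF z'(6)]
  let ?P = "prod_rmod ?F ?G"
  have P: "projective_rmod A ?P" "fin_gen A ?P"
    using prod_proj[OF free_proj free_proj] prod_fin_gen[OF free_module free_fin_gen free_module free_fin_gen] A_ring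
    by blast+
  interpret P: right_module A ?P by (rule proj_module[OF P(1)])
  have f: "fst \<in> rmod_hom A ?P ?F" "snd \<in> rmod_hom A ?P ?G" by (auto intro!: rmod_homI)
  let ?\<pi> = "\<lambda>z. \<alpha> (p (fst z)) \<oplus>\<^bsub>Y\<^esub> w (snd z)"
  have \<pi>: "?\<pi> \<in> rmod_hom A ?P Y"
    by (intro hom_plus hom_comp[OF f(1) hom_comp[OF x'(6) e(4)]] hom_comp[OF f(2) w(1)] e)
  \<comment> \<open>Any preimage \<open>b\<close> of \<open>\<beta> y\<close> extends to a preimage
    of \<open>y\<close> under the combined cover. With \<open>y\<close> arbitrary this makes
    \<open>?\<pi>\<close> onto; with \<open>y\<close> zero it makes the map between the kernels onto
    \<open>L\<close>.\<close>
  have lift: "\<exists>a\<in>carrier ?F. y = ?\<pi> (a, b)" if y: "y \<in> carrier Y" and b: "b \<in> carrier ?G" "q b = \<beta> y" for y b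
  proof -
    have "\<beta> (y \<ominus>\<^bsub>Y\<^esub> w b) = \<zero>\<^bsub>Z\<^esub>" using y b w(2) c by (simp add: hom_minus[OF e(6)] e Z.diff_eq_zero_iff)
    then obtain t where t: "t \<in> carrier X" "y \<ominus>\<^bsub>Y\<^esub> w b = \<alpha> t"
      using ses_ker[OF Suc(2), of "y \<ominus>\<^bsub>Y\<^esub> w b"] y b c by auto
    obtain a where a: "a \<in> carrier ?F" "t = p a" using epiE[OF x'(8) t(1)] by blast
    have "?\<pi> (a, b) = (y \<ominus>\<^bsub>Y\<^esub> w b) \<oplus>\<^bsub>Y\<^esub> w b" using t a by simp
    also have "\<dots> = y" using y b c by (simp add: a_minus_def Y.M.a_assoc Y.M.l_neg)
    finally show ?thesis using a(1) by metis
  qed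
  have "?\<pi> ` carrier ?P = carrier Y"
  proof
    show "carrier Y \<subseteq> ?\<pi> ` carrier ?P"
    proof
      fix y assume y: "y \<in> carrier Y"
      obtain b where b: "b \<in> carrier ?G" "\<beta> y = q b" using epiE[OF z'(8)] c(3)[OF y] by blast
      then obtain a where "a \<in> carrier ?F" "y = ?\<pi> (a, b)" using lift[OF y b(1)] by auto
      then show "y \<in> ?\<pi> ` carrier ?P" using b by (intro image_eqI[of _ _ "(a, b)"]) auto
    qed
  qed (use hom_closed[OF \<pi>] in blast)
  with \<pi> have ep: "epi A ?P Y ?\<pi>" by simp
  let ?M = "?P\<lparr>carrier := {x \<in> carrier ?P. ?\<pi> x = \<zero>\<^bsub>Y\<^esub>}\<rparr>"
  have m: "ses A ?M ?P Y (\<lambda>x. x) ?\<pi>" by (rule ses_sub[OF P.right_module_axioms e(2) ep])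
  \<comment> \<open>The elements of the kernel are pairs; a copy with elements of type
    \<open>nat \<Rightarrow> 'a\<close> is needed for the induction hypothesis.\<close>
  obtain M f g where M: "right_module A (M :: ('a, nat \<Rightarrow> 'a) rmod)" "f \<in> rmod_hom A ?M M" "g \<in> rmod_hom A M ?M"
    "bij_betw g (carrier M) (carrier ?M)" "\<forall>x\<in>carrier ?M. g (f x) = x" "\<forall>x\<in>carrier M. f (g x) = x" "fin_gen A M"
    by (rule fin_gen_copy[OF sesD(1)[OF m] ses_fin_gen(1)[OF m P(2)]])
  have gi: "inj_on g (carrier M)" and gs: "g ` carrier M = carrier ?M" using M(4) by (auto simp: bij_betw_def)
  have gP: "g \<in> rmod_hom A M ?P" using hom_comp[OF M(3) sesD(4)[OF m]] by simp
  have g\<pi>: "?\<pi> (g x) = \<zero>\<^bsub>Y\<^esub>" if "x \<in> carrier M" for x using hom_closed[OF M(3) that] by simp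
  have my: "ses A M ?P Y g ?\<pi>"
    unfolding ses_def using M(1) P.right_module_axioms e(2) gP gi ep gs by simp
  have snd_g: "(\<lambda>x. snd (g x)) \<in> rmod_hom A M ?G" by (rule hom_comp[OF gP f(2)])
  obtain \<beta>' where \<beta>': "\<beta>' \<in> rmod_hom A M L" "\<forall>x\<in>carrier M. j (\<beta>' x) = snd (g x)"
  proof (rule ses_factor[OF z snd_g M(1)])
    fix x assume x: "x \<in> carrier M"
    have gx: "fst (g x) \<in> carrier ?F" "snd (g x) \<in> carrier ?G" using hom_closed[OF gP x] by auto
    have "q (snd (g x)) = \<beta> (?\<pi> (g x))"
      using gx c w(2) ses_zero[OF Suc(2)] by (simp add: hom_add[OF e(6)])
    then show "q (snd (g x)) = \<zero>\<^bsub>Z\<^esub>" using g\<pi>[OF x] hom_zero[OF e(6,2,3)] by simp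
  qed
  have w0: "w \<zero>\<^bsub>?G\<^esub> = \<zero>\<^bsub>Y\<^esub>" by (rule hom_zero[OF w(1) z'(2) e(2)])
  have \<alpha>0: "\<alpha> \<zero>\<^bsub>X\<^esub> = \<zero>\<^bsub>Y\<^esub>" by (rule hom_zero[OF e(4,1,2)])
  have "(\<lambda>x. (i x, \<zero>\<^bsub>?G\<^esub>)) \<in> rmod_hom A K ?P"
    using c by (intro rmod_homI) (simp_all add: hom_simps[OF x'(4)])
  then obtain \<alpha>' where \<alpha>': "\<alpha>' \<in> rmod_hom A K M" "\<forall>x\<in>carrier K. g (\<alpha>' x) = (i x, \<zero>\<^bsub>?G\<^esub>)"
  proof (rule ses_factor[OF my _ x'(1)])
    fix t assume "t \<in> carrier K"
    then show "?\<pi> (i t, \<zero>\<^bsub>?G\<^esub>) = \<zero>\<^bsub>Y\<^esub>" using ses_zero[OF x] w0 \<alpha>0 by simp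
  qed
  have "ses A K M L \<alpha>' \<beta>'"
    unfolding ses_def
  proof (intro conjI x'(1) M(1) z'(1) \<alpha>'(1) \<beta>'(1))
    show "inj_on \<alpha>' (carrier K)"
    proof (rule inj_onI)
      fix t t' assume t: "t \<in> carrier K" "t' \<in> carrier K" "\<alpha>' t = \<alpha>' t'"
      then have "(i t, \<zero>\<^bsub>?G\<^esub>) = (i t', \<zero>\<^bsub>?G\<^esub>)" using \<alpha>'(2) by metis
      then show "t = t'" using inj_onD[OF x'(5)] t by auto
    qed
    show "\<beta>' ` carrier M = carrier L"
    proof
      show "carrier L \<subseteq> \<beta>' ` carrier M"
      proof
        fix l assume l: "l \<in> carrier L"
        have "q (j l) = \<beta> \<zero>\<^bsub>Y\<^esub>" using ses_zero[OF z l] hom_zero[OF e(6,2,3)] by simp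
        then obtain a where a: "a \<in> carrier ?F" "\<zero>\<^bsub>Y\<^esub> = ?\<pi> (a, j l)" using lift[OF _ c(6)[OF l]] by auto
        then obtain y where y: "y \<in> carrier M" "(a, j l) = g y"
          using ses_ker[OF my, of "(a, j l)"] c(6)[OF l] by auto
        have "j (\<beta>' y) = j l" using \<beta>'(2) y by (metis snd_conv)
        then have "\<beta>' y = l" using inj_onD[OF z'(5)] hom_closed[OF \<beta>'(1) y(1)] l by auto
        then show "l \<in> \<beta>' ` carrier M" using y(1) by blast
      qed
    qed (use hom_closed[OF \<beta>'(1)] in blast)
    show "\<alpha>' ` carrier K = {y \<in> carrier M. \<beta>' y = \<zero>\<^bsub>L\<^esub>}"
    proof (intro equalityI subsetI)
      fix y assume "y \<in> \<alpha>' ` carrier K"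
      then obtain t where t: "t \<in> carrier K" "y = \<alpha>' t" by blast
      have y: "y \<in> carrier M" using t hom_closed[OF \<alpha>'(1)] by simp
      have "j (\<beta>' y) = j \<zero>\<^bsub>L\<^esub>" using \<beta>'(2) y t \<alpha>'(2) hom_zero[OF z'(4,1,2)] by simp
      then have "\<beta>' y = \<zero>\<^bsub>L\<^esub>" using inj_onD[OF z'(5)] hom_closed[OF \<beta>'(1) y] by auto
      with y show "y \<in> {y \<in> carrier M. \<beta>' y = \<zero>\<^bsub>L\<^esub>}" by simp
    next
      fix y assume "y \<in> {y \<in> carrier M. \<beta>' y = \<zero>\<^bsub>L\<^esub>}"
      then have y: "y \<in> carrier M" "\<beta>' y = \<zero>\<^bsub>L\<^esub>" by auto
      have s0: "snd (g y) = \<zero>\<^bsub>?G\<^esub>" using \<beta>'(2) y hom_zero[OF z'(4,1,2)] by metis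
      have gy: "fst (g y) \<in> carrier ?F" using hom_closed[OF gP y(1)] by auto
      have "\<alpha> (p (fst (g y))) = \<alpha> \<zero>\<^bsub>X\<^esub>"
        using g\<pi>[OF y(1)] s0 w0 gy c \<alpha>0 by simp
      then have "p (fst (g y)) = \<zero>\<^bsub>X\<^esub>" using inj_onD[OF e(5)] c gy by auto
      then obtain t where t: "t \<in> carrier K" "fst (g y) = i t" using ses_ker[OF x, OF gy] by blast
      have "g y = g (\<alpha>' t)" using t s0 \<alpha>'(2) by (simp add: prod_eq_iff)
      then have "y = \<alpha>' t" using inj_onD[OF gi] y hom_closed[OF \<alpha>'(1) t(1)] by auto
      with t show "y \<in> \<alpha>' ` carrier K" by blast
    qed
  qed
  then have "loc_pd A T k M" by (rule Suc.IH[OF _ M(7) pdK pdL])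
  then show ?case by (rule loc_pd_SucI[OF T(1) my P])
qed

subsection \<open>Nakayama's lemma\<close>

text \<open>\<open>h\<close> is a polynomial in \<open>\<theta>\<close> with coefficients in
  \<open>A\<close> and degree less than \<open>m\<close>, written in Horner form: constant term plus
  \<open>\<theta>\<close> times a polynomial with one coefficient fewer.\<close>

primrec poly_map :: "('a, 'k, 'm) rmod_scheme \<Rightarrow> ('k \<Rightarrow> 'k) \<Rightarrow> nat \<Rightarrow> ('k \<Rightarrow> 'k) \<Rightarrow> bool" where
  "poly_map K \<theta> 0 h \<longleftrightarrow> (\<forall>k\<in>carrier K. h k = \<zero>\<^bsub>K\<^esub>)"
| "poly_map K \<theta> (Suc m) h \<longleftrightarrow> (\<exists>c\<in>carrier A. \<exists>g\<in>rmod_hom A K K. poly_map K \<theta> m g \<and>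
     (\<forall>k\<in>carrier K. h k = k \<cdot>\<^bsub>K\<^esub> c \<oplus>\<^bsub>K\<^esub> \<theta> (g k)))"

lemma poly_map_add:
  assumes "right_module A K" "\<theta> \<in> rmod_hom A K K"
  shows "poly_map K \<theta> m h \<Longrightarrow> poly_map K \<theta> m h' \<Longrightarrow> poly_map K \<theta> m (\<lambda>k. h k \<oplus>\<^bsub>K\<^esub> h' k)"
proof (induction m arbitrary: h h')
  interpret K: right_module A K by fact
  case 0 then show ?case by simp
next
  interpret K: right_module A K by fact
  case (Suc m)
  then obtain c g c' g' where g: "c \<in> carrier A" "g \<in> rmod_hom A K K" "poly_map K \<theta> m g"
      "\<forall>k\<in>carrier K. h k = k \<cdot>\<^bsub>K\<^esub> c \<oplus>\<^bsub>K\<^esub> \<theta> (g k)"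
    and g': "c' \<in> carrier A" "g' \<in> rmod_hom A K K" "poly_map K \<theta> m g'"
      "\<forall>k\<in>carrier K. h' k = k \<cdot>\<^bsub>K\<^esub> c' \<oplus>\<^bsub>K\<^esub> \<theta> (g' k)" by auto
  show ?case
    unfolding poly_map.simps
  proof (intro bexI conjI ballI)
    show "poly_map K \<theta> m (\<lambda>k. g k \<oplus>\<^bsub>K\<^esub> g' k)" by (rule Suc.IH[OF g(3) g'(3)])
    show "(\<lambda>k. g k \<oplus>\<^bsub>K\<^esub> g' k) \<in> rmod_hom A K K" by (intro hom_plus g g' assms)
    show "c \<oplus>\<^bsub>A\<^esub> c' \<in> carrier A" using g g' by simp
    fix k assume k: "k \<in> carrier K"
    then show "h k \<oplus>\<^bsub>K\<^esub> h' k = k \<cdot>\<^bsub>K\<^esub> (c \<oplus>\<^bsub>A\<^esub> c') \<oplus>\<^bsub>K\<^esub> \<theta> (g k \<oplus>\<^bsub>K\<^esub> g' k)"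
      using g(1,4) g'(1,4) hom_closed[OF g(2)] hom_closed[OF g'(2)] hom_closed[OF assms(2)]
      by (simp add: hom_add[OF assms(2)] K.ract_add_right K.M.a_ac)
  qed
qed

lemma poly_map_scale:
  assumes "right_module A K" "\<theta> \<in> rmod_hom A K K" "a \<in> carrier A"
  shows "poly_map K \<theta> m h \<Longrightarrow> poly_map K \<theta> m (\<lambda>k. h k \<cdot>\<^bsub>K\<^esub> a)"
proof (induction m arbitrary: h)
  interpret K: right_module A K by fact
  case 0 then show ?case using assms by simp
next
  interpret K: right_module A K by fact
  case (Suc m)
  then obtain c g where g: "c \<in> carrier A" "g \<in> rmod_hom A K K" "poly_map K \<theta> m g"
      "\<forall>k\<in>carrier K. h k = k \<cdot>\<^bsub>K\<^esub> c \<oplus>\<^bsub>K\<^esub> \<theta> (g k)" by auto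
  show ?case
    unfolding poly_map.simps
  proof (intro bexI conjI ballI)
    show "poly_map K \<theta> m (\<lambda>k. g k \<cdot>\<^bsub>K\<^esub> a)" by (rule Suc.IH[OF g(3)])
    show "(\<lambda>k. g k \<cdot>\<^bsub>K\<^esub> a) \<in> rmod_hom A K K" by (intro hom_scale g assms A_cring)
    show "c \<otimes>\<^bsub>A\<^esub> a \<in> carrier A" using g assms by simp
    fix k assume k: "k \<in> carrier K"
    then show "h k \<cdot>\<^bsub>K\<^esub> a = k \<cdot>\<^bsub>K\<^esub> (c \<otimes>\<^bsub>A\<^esub> a) \<oplus>\<^bsub>K\<^esub> \<theta> (g k \<cdot>\<^bsub>K\<^esub> a)"
      using g(1,4) hom_closed[OF g(2)] hom_closed[OF assms(2)] assms(3)
      by (simp add: hom_ract[OF assms(2)] K.ract_add_left K.ract_assoc)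
  qed
qed

lemma poly_map_mono:
  assumes "right_module A K" "\<theta> \<in> rmod_hom A K K"
  shows "poly_map K \<theta> m h \<Longrightarrow> m \<le> n \<Longrightarrow> poly_map K \<theta> n h"
proof -
  interpret K: right_module A K by fact
  have step: "poly_map K \<theta> m h \<Longrightarrow> poly_map K \<theta> (Suc m) h" for m h
  proof (induction m arbitrary: h)
    case 0
    then show ?case
      using hom_zero[OF assms(2,1,1)]
      by (auto intro!: bexI[of _ "\<zero>\<^bsub>A\<^esub>"] bexI[of _ "\<lambda>k. \<zero>\<^bsub>K\<^esub>"] hom_const_zero[OF assms(1)])
  next
    case (Suc m)
    then show ?case unfolding poly_map.simps(2)[of K \<theta> m] poly_map.simps(2)[of K \<theta> "Suc m"] by blast
  qed
  show "poly_map K \<theta> n h" if "poly_map K \<theta> m h" "m \<le> n"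
    using that(2,1) by (induction n rule: dec_induct) (blast intro: step)+
qed

lemma funpow_hom:
  assumes "right_module A K" "\<theta> \<in> rmod_hom A K K" shows "\<theta> ^^ m \<in> rmod_hom A K K"
proof (induction m)
  case 0 then show ?case using hom_id by (simp add: id_def)
next
  case (Suc m) then show ?case using hom_comp[OF Suc assms(2)] by (simp add: comp_def)
qed

lemma poly_map_funpow:
  assumes "right_module A K" "\<theta> \<in> rmod_hom A K K" shows "poly_map K \<theta> (Suc m) (\<theta> ^^ m)"
proof (induction m)
  interpret K: right_module A K by fact
  case 0
  show ?case
    using hom_zero[OF assms(2,1,1)]
    by (auto intro!: bexI[of _ "\<one>\<^bsub>A\<^esub>"] bexI[of _ "\<lambda>k. \<zero>\<^bsub>K\<^esub>"] hom_const_zero[OF assms(1)])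
next
  interpret K: right_module A K by fact
  case (Suc m)
  show ?case
    unfolding poly_map.simps(2)[of K \<theta> "Suc m"]
  proof (intro bexI conjI ballI)
    show "poly_map K \<theta> (Suc m) (\<theta> ^^ m)" by fact
    show "\<theta> ^^ m \<in> rmod_hom A K K" by (rule funpow_hom[OF assms])
    show "\<zero>\<^bsub>A\<^esub> \<in> carrier A" by simp
    fix k assume "k \<in> carrier K"
    then show "(\<theta> ^^ Suc m) k = k \<cdot>\<^bsub>K\<^esub> \<zero>\<^bsub>A\<^esub> \<oplus>\<^bsub>K\<^esub> \<theta> ((\<theta> ^^ m) k)"
      using hom_closed[OF funpow_hom[OF assms]] hom_closed[OF assms(2)] by simp
  qed
qed

text \<open>The polynomial on \<open>K\<close> has the same coefficients; \<open>p\<close>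
  intertwines \<open>\<Theta>\<close> and \<open>\<theta>\<close> and hence all polynomials in
  them.\<close>

lemma poly_map_transport:
  assumes F: "right_module A F" and K: "right_module A K" and p: "epi A F K p"
    and \<Theta>: "\<Theta> \<in> rmod_hom A F F" and \<theta>: "\<theta> \<in> rmod_hom A K K"
    and "\<And>x. x \<in> carrier F \<Longrightarrow> p (\<Theta> x) = \<theta> (p x)"
  shows "poly_map F \<Theta> m h \<Longrightarrow> \<exists>g\<in>rmod_hom A K K. poly_map K \<theta> m g \<and> (\<forall>x\<in>carrier F. p (h x) = g (p x))"
proof (induction m arbitrary: h)
  interpret F: right_module A F by fact
  interpret K: right_module A K by fact
  have ph: "p \<in> rmod_hom A F K" using p ..
  case 0
  then show ?case
    using hom_zero[OF ph F K] by (auto intro!: bexI[of _ "\<lambda>k. \<zero>\<^bsub>K\<^esub>"] hom_const_zero[OF K])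
next
  interpret F: right_module A F by fact
  interpret K: right_module A K by fact
  have ph: "p \<in> rmod_hom A F K" using p ..
  case (Suc m)
  then obtain c h' where h': "c \<in> carrier A" "h' \<in> rmod_hom A F F" "poly_map F \<Theta> m h'"
      "\<forall>k\<in>carrier F. h k = k \<cdot>\<^bsub>F\<^esub> c \<oplus>\<^bsub>F\<^esub> \<Theta> (h' k)" by auto
  from Suc.IH[OF h'(3)] obtain g where g: "g \<in> rmod_hom A K K" "poly_map K \<theta> m g"
    "\<forall>x\<in>carrier F. p (h' x) = g (p x)" by blast
  show ?case
  proof (intro bexI conjI ballI)
    show "(\<lambda>k. k \<cdot>\<^bsub>K\<^esub> c \<oplus>\<^bsub>K\<^esub> \<theta> (g k)) \<in> rmod_hom A K K"
      by (intro hom_plus hom_scale hom_id K A_cring h'(1) hom_comp[OF g(1) \<theta>])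
    show "poly_map K \<theta> (Suc m) (\<lambda>k. k \<cdot>\<^bsub>K\<^esub> c \<oplus>\<^bsub>K\<^esub> \<theta> (g k))" using g h'(1) by auto
    fix x assume x: "x \<in> carrier F"
    then show "p (h x) = p x \<cdot>\<^bsub>K\<^esub> c \<oplus>\<^bsub>K\<^esub> \<theta> (g (p x))"
      using h'(1,4) hom_closed[OF h'(2)] hom_closed[OF \<Theta>] assms(6) g(3)
      by (simp add: hom_add[OF ph] hom_ract[OF ph])
  qed
qed

text \<open>
  Noetherianity of a module of matrices replaces the Cayley--Hamilton theorem.
\<close>

lemma free_integral:
  assumes \<Theta>: "\<Theta> \<in> rmod_hom A (free_rmod A {..<r::nat}) (free_rmod A {..<r})"
  shows "\<exists>m h. poly_map (free_rmod A {..<r}) \<Theta> m h \<and> (\<forall>x\<in>carrier (free_rmod A {..<r}). (\<Theta> ^^ m) x = h x)"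
proof -
  let ?F = "free_rmod A {..<r}" and ?X = "{..<r} \<times> {..<r}"
  let ?E = "free_rmod A ?X"
  have F: "right_module A ?F" by (rule free_module[OF A_ring])
  have E: "right_module A ?E" by (rule free_module[OF A_ring])
  interpret F: right_module A ?F by (rule F)
  interpret E: right_module A ?E by (rule E)
  \<comment> \<open>An endomorphism of the free module is determined by its matrix, which is an
    element of a finite free, hence noetherian, module.\<close>
  define mat where "mat h = (\<lambda>(i, j)\<in>?X. h (free_unit A {..<r} i) j)" for h :: "(nat \<Rightarrow> 'a) \<Rightarrow> nat \<Rightarrow> 'a"
  note un = free_unit_closed[OF A_ring, of _ "{..<r}"]
  have ent: "v i \<in> carrier A" if "v \<in> carrier ?F" "i < r" for v i using that by (auto simp: free_sel)
  have mat_c: "mat h \<in> carrier ?E" if "h \<in> rmod_hom A ?F ?F" for h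
  proof -
    have "finite {i \<in> ?X. mat h i \<noteq> \<zero>\<^bsub>A\<^esub>}" by (rule finite_subset[of _ ?X]) auto
    then show ?thesis
      using ent[OF hom_closed[OF that un]] by (auto simp: free_sel mat_def cong: conj_cong split: if_splits)
  qed
  have mat_eq: "h x = h' x" if h: "h \<in> rmod_hom A ?F ?F" "h' \<in> rmod_hom A ?F ?F" and eq: "mat h = mat h'"
    and x: "x \<in> carrier ?F" for h h' x
  proof (rule free_hom_eq[OF A_ring F h _ x])
    fix i assume i: "i \<in> {..<r}"
    show "h (free_unit A {..<r} i) = h' (free_unit A {..<r} i)"
    proof
      fix j
      show "h (free_unit A {..<r} i) j = h' (free_unit A {..<r} i) j"
        using fun_cong[OF eq, of "(i, j)"] i hom_closed[OF h(1) un[OF i]] hom_closed[OF h(2) un[OF i]]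
        by (cases "j < r") (auto simp: mat_def free_sel PiE_iff extensional_def)
    qed
  qed
  \<comment> \<open>Matrices of polynomials of degree less than \<open>m\<close> form an increasing
    chain of submodules. Once it is stationary at \<open>m\<close>, the matrix of
    \<open>\<Theta> ^^ m\<close>, a member of the next submodule, is that of a polynomial of smaller
    degree: a monic equation for \<open>\<Theta>\<close>.\<close>
  define U where "U m = {mat h | h. h \<in> rmod_hom A ?F ?F \<and> poly_map ?F \<Theta> m h}" for m
  have U: "submod A ?E (U m)" for m
  proof (rule submodI)
    show "U m \<subseteq> carrier ?E" using mat_c by (auto simp: U_def)
    have "poly_map ?F \<Theta> m (\<lambda>k. \<zero>\<^bsub>?F\<^esub>)"
      by (rule poly_map_mono[OF F \<Theta>, of 0]) auto
    moreover have "mat (\<lambda>k. \<zero>\<^bsub>?F\<^esub>) = \<zero>\<^bsub>?E\<^esub>" by (auto simp: mat_def free_sel fun_eq_iff)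
    ultimately show "\<zero>\<^bsub>?E\<^esub> \<in> U m" using hom_const_zero[OF F] by (force simp: U_def)
    show "x \<oplus>\<^bsub>?E\<^esub> y \<in> U m" if xy: "x \<in> U m" "y \<in> U m" for x y
    proof -
      from xy obtain h h' where h: "x = mat h" "h \<in> rmod_hom A ?F ?F" "poly_map ?F \<Theta> m h"
        and h': "y = mat h'" "h' \<in> rmod_hom A ?F ?F" "poly_map ?F \<Theta> m h'" by (auto simp: U_def)
      have "x \<oplus>\<^bsub>?E\<^esub> y = mat (\<lambda>k. h k \<oplus>\<^bsub>?F\<^esub> h' k)" by (auto simp: h h' mat_def free_sel fun_eq_iff)
      then show ?thesis
        using hom_plus[OF h(2) h'(2) F] poly_map_add[OF F \<Theta> h(3) h'(3)] unfolding U_def by blast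
    qed
    show "x \<cdot>\<^bsub>?E\<^esub> a \<in> U m" if xa: "x \<in> U m" "a \<in> carrier A" for x a
    proof -
      from xa obtain h where h: "x = mat h" "h \<in> rmod_hom A ?F ?F" "poly_map ?F \<Theta> m h" by (auto simp: U_def)
      have "x \<cdot>\<^bsub>?E\<^esub> a = mat (\<lambda>k. h k \<cdot>\<^bsub>?F\<^esub> a)" by (auto simp: h mat_def free_sel fun_eq_iff)
      then show ?thesis
        using hom_scale[OF h(2) F A_cring xa(2)] poly_map_scale[OF F \<Theta> xa(2) h(3)] unfolding U_def by blast
    qed
  qed
  have mono: "U m \<subseteq> U n" if "m \<le> n" for m n
    using poly_map_mono[OF F \<Theta> _ that] unfolding U_def by blast
  let ?V = "\<Union>m. U m"
  have V: "submod A ?E ?V"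
  proof (rule submodI)
    show "?V \<subseteq> carrier ?E" "\<zero>\<^bsub>?E\<^esub> \<in> ?V" using submodD(1,2)[OF U] by auto
    show "x \<cdot>\<^bsub>?E\<^esub> a \<in> ?V" if "x \<in> ?V" "a \<in> carrier A" for x a using that submodD(4)[OF U] by blast
    show "x \<oplus>\<^bsub>?E\<^esub> y \<in> ?V" if xy: "x \<in> ?V" "y \<in> ?V" for x y
    proof -
      from xy obtain m n where "x \<in> U m" "y \<in> U n" by auto
      then have "x \<in> U (max m n)" "y \<in> U (max m n)" using mono by (meson max.cobounded1 max.cobounded2 subsetD)+
      then show ?thesis using submodD(3)[OF U] by blast
    qed
  qed
  have "fin_gen A (?E\<lparr>carrier := ?V\<rparr>)"
    by (rule noeth_fin_gen_sub[OF free_noeth[OF A_cring A_noeth] V]) simp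
  then obtain G where G: "finite G" "G \<subseteq> ?V"
    "\<forall>W. submod A (?E\<lparr>carrier := ?V\<rparr>) W \<and> G \<subseteq> W \<longrightarrow> W = ?V"
    by (rule fin_gen_subE)
  have "\<exists>m. G \<subseteq> U m" using G(1,2)
  proof (induction G)
    case (insert x G)
    then obtain m n where "G \<subseteq> U m" "x \<in> U n" by auto
    then have "insert x G \<subseteq> U (max m n)"
      using mono[of m "max m n"] mono[of n "max m n"] by auto
    then show ?case ..
  qed auto
  then obtain m where m: "G \<subseteq> U m" ..
  have "submod A (?E\<lparr>carrier := ?V\<rparr>) (U m)" unfolding submod_sub[OF V] using U by auto
  then have "U m = ?V" using m G(3) by blast
  moreover have "mat (\<Theta> ^^ m) \<in> U (Suc m)"
    unfolding U_def using funpow_hom[OF F \<Theta>] poly_map_funpow[OF F \<Theta>] by blast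
  ultimately have "mat (\<Theta> ^^ m) \<in> U m" by blast
  then obtain h where h: "h \<in> rmod_hom A ?F ?F" "poly_map ?F \<Theta> m h" "mat (\<Theta> ^^ m) = mat h" by (auto simp: U_def)
  then show ?thesis using mat_eq[OF funpow_hom[OF F \<Theta>] h(1,3)] by blast
qed

text \<open>\<open>\<theta>\<close> lifts to an endomorphism of a finite free cover, and the monic
  equation found there descends along the cover.\<close>

lemma fin_gen_integral:
  assumes K: "right_module A K" "fin_gen A K" and \<theta>: "\<theta> \<in> rmod_hom A K K"
  shows "\<exists>m h. h \<in> rmod_hom A K K \<and> poly_map K \<theta> m h \<and> (\<forall>x\<in>carrier K. (\<theta> ^^ m) x = h x)"
proof -
  obtain r p where p: "epi A (free_rmod A {..<r::nat}) K p" by (rule fin_gen_cover[OF K])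
  let ?F = "free_rmod A {..<r}"
  have F: "right_module A ?F" by (rule free_module[OF A_ring])
  have ph: "p \<in> rmod_hom A ?F K" using p ..
  obtain \<Theta> where \<Theta>: "\<Theta> \<in> rmod_hom A ?F ?F" "\<forall>x\<in>carrier ?F. p (\<Theta> x) = \<theta> (p x)"
    by (rule proj_lift[OF free_proj[OF A_ring] F K(1) p hom_comp[OF ph \<theta>]])
  obtain m h where h: "poly_map ?F \<Theta> m h" "\<forall>x\<in>carrier ?F. (\<Theta> ^^ m) x = h x"
    using free_integral[OF \<Theta>(1)] by blast
  obtain g where g: "g \<in> rmod_hom A K K" "poly_map K \<theta> m g" "\<forall>x\<in>carrier ?F. p (h x) = g (p x)"
    using poly_map_transport[OF F K(1) p \<Theta>(1) \<theta> _ h(1)] \<Theta>(2) by blast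
  have pow: "p ((\<Theta> ^^ n) x) = (\<theta> ^^ n) (p x)" if "x \<in> carrier ?F" for n x
  proof (induction n)
    case (Suc n)
    then show ?case using \<Theta>(2) hom_closed[OF funpow_hom[OF F \<Theta>(1)] that] by simp
  qed simp
  have "(\<theta> ^^ m) y = g y" if y: "y \<in> carrier K" for y
  proof -
    obtain x where "x \<in> carrier ?F" "y = p x" using epiE[OF p y] by blast
    then show ?thesis using pow h(2) g(3) by metis
  qed
  with g show ?thesis by blast
qed

text \<open>Call endomorphisms of \<open>K\<close> congruent if they differ by a map that factors
  through \<open>i\<close>. The hypothesis says that \<open>x\<close> times \<open>\<theta>\<close>
  is congruent to \<open>s\<close>. Eliminating \<open>\<theta>\<close> by means of a monic equation
  leaves a scalar \<open>t\<close> outside \<open>q\<close> that is congruent to zero. This plays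
  the part of the determinant trick.\<close>

lemma nakayama_extension:
  assumes q: "primeideal q A" and K: "right_module A K" "fin_gen A K" and F: "right_module A F"
    and i: "i \<in> rmod_hom A K F" and \<theta>: "\<theta> \<in> rmod_hom A K K" and \<rho>: "\<rho> \<in> rmod_hom A F K"
    and s: "s \<in> carrier A - q" and x: "x \<in> q"
    and eq: "\<forall>k\<in>carrier K. \<rho> (i k) \<oplus>\<^bsub>K\<^esub> \<theta> k \<cdot>\<^bsub>K\<^esub> x = k \<cdot>\<^bsub>K\<^esub> s"
  shows "\<exists>t\<in>carrier A - q. \<exists>\<tau>\<in>rmod_hom A F K. \<forall>k\<in>carrier K. \<tau> (i k) = k \<cdot>\<^bsub>K\<^esub> t"
proof -
  interpret K: right_module A K by (rule K)
  interpret F: right_module A F by (rule F)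
  interpret q: primeideal q A by (rule q)
  have sA: "s \<in> carrier A" and xA: "x \<in> carrier A" using s x q.a_subset by auto
  note c = hom_closed[OF i] hom_closed[OF \<theta>] hom_closed[OF \<rho>]
  have \<theta>x: "\<theta> k \<cdot>\<^bsub>K\<^esub> x = k \<cdot>\<^bsub>K\<^esub> s \<ominus>\<^bsub>K\<^esub> \<rho> (i k)" if "k \<in> carrier K" for k
    using bspec[OF eq that, symmetric] that c xA by (simp add: K.M.diff_cancel)
  \<comment> \<open>The congruence between \<open>x\<close> times \<open>\<theta>\<close> and
    \<open>s\<close>, raised to the \<open>m\<close>-th power.\<close>
  have pow: "\<exists>\<tau>\<in>rmod_hom A F K. \<forall>k\<in>carrier K. (\<theta> ^^ m) k \<cdot>\<^bsub>K\<^esub> (x [^]\<^bsub>A\<^esub> m) = k \<cdot>\<^bsub>K\<^esub> (s [^]\<^bsub>A\<^esub> m) \<oplus>\<^bsub>K\<^esub> \<tau> (i k)"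
    for m :: nat
  proof (induction m)
    case 0
    show ?case using hom_const_zero[OF K(1)] by (intro bexI[of _ "\<lambda>k. \<zero>\<^bsub>K\<^esub>"]) auto
  next
    case (Suc m)
    then obtain \<tau> where \<tau>: "\<tau> \<in> rmod_hom A F K"
      "\<forall>k\<in>carrier K. (\<theta> ^^ m) k \<cdot>\<^bsub>K\<^esub> (x [^]\<^bsub>A\<^esub> m) = k \<cdot>\<^bsub>K\<^esub> (s [^]\<^bsub>A\<^esub> m) \<oplus>\<^bsub>K\<^esub> \<tau> (i k)" by blast
    show ?case
    proof (intro bexI ballI)
      show "(\<lambda>f. \<theta> (\<tau> f) \<cdot>\<^bsub>K\<^esub> x \<ominus>\<^bsub>K\<^esub> \<rho> f \<cdot>\<^bsub>K\<^esub> (s [^]\<^bsub>A\<^esub> m)) \<in> rmod_hom A F K"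
        using sA by (intro hom_diff hom_scale hom_comp[OF \<tau>(1) \<theta>] \<rho> K A_cring xA) simp
      fix k assume k: "k \<in> carrier K"
      note cc = c hom_closed[OF \<tau>(1)] hom_closed[OF funpow_hom[OF K(1) \<theta>]]
      have "(\<theta> ^^ Suc m) k \<cdot>\<^bsub>K\<^esub> (x [^]\<^bsub>A\<^esub> Suc m) = \<theta> ((\<theta> ^^ m) k \<cdot>\<^bsub>K\<^esub> (x [^]\<^bsub>A\<^esub> m)) \<cdot>\<^bsub>K\<^esub> x"
        using k cc xA by (simp add: hom_ract[OF \<theta>] K.ract_assoc)
      also have "\<dots> = (\<theta> k \<cdot>\<^bsub>K\<^esub> x) \<cdot>\<^bsub>K\<^esub> (s [^]\<^bsub>A\<^esub> m) \<oplus>\<^bsub>K\<^esub> \<theta> (\<tau> (i k)) \<cdot>\<^bsub>K\<^esub> x"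
        using k cc xA sA \<tau>(2) by (simp add: hom_add[OF \<theta>] hom_ract[OF \<theta>] K.ract_add_left K.ract_assoc[symmetric] A.m_comm)
      also have "\<dots> = k \<cdot>\<^bsub>K\<^esub> (s [^]\<^bsub>A\<^esub> Suc m) \<oplus>\<^bsub>K\<^esub> (\<theta> (\<tau> (i k)) \<cdot>\<^bsub>K\<^esub> x \<ominus>\<^bsub>K\<^esub> \<rho> (i k) \<cdot>\<^bsub>K\<^esub> (s [^]\<^bsub>A\<^esub> m))"
        using k cc xA sA
        by (simp add: \<theta>x a_minus_def K.ract_add_left K.ract_minus_left K.ract_assoc[symmetric] A.m_comm K.M.a_ac)
      finally show "(\<theta> ^^ Suc m) k \<cdot>\<^bsub>K\<^esub> (x [^]\<^bsub>A\<^esub> Suc m)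
        = k \<cdot>\<^bsub>K\<^esub> (s [^]\<^bsub>A\<^esub> Suc m) \<oplus>\<^bsub>K\<^esub> (\<theta> (\<tau> (i k)) \<cdot>\<^bsub>K\<^esub> x \<ominus>\<^bsub>K\<^esub> \<rho> (i k) \<cdot>\<^bsub>K\<^esub> (s [^]\<^bsub>A\<^esub> m))" .
    qed
  qed
  \<comment> \<open>A power of \<open>\<theta>\<close> below the \<open>m\<close>-th uses up fewer
    than \<open>m\<close> factors \<open>x\<close> when \<open>x\<close> times
    \<open>\<theta>\<close> is replaced by \<open>s\<close>, so a factor \<open>x\<close> is left
    over. Here the strict bound on the degree matters.\<close>
  have low: "\<exists>a\<in>carrier A. \<exists>\<tau>\<in>rmod_hom A F K. \<forall>k\<in>carrier K.
      h k \<cdot>\<^bsub>K\<^esub> (x [^]\<^bsub>A\<^esub> m) = k \<cdot>\<^bsub>K\<^esub> (x \<otimes>\<^bsub>A\<^esub> a) \<oplus>\<^bsub>K\<^esub> \<tau> (i k)"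
    if "h \<in> rmod_hom A K K" "poly_map K \<theta> m h" for m :: nat and h
    using that
  proof (induction m arbitrary: h)
    case 0
    then show ?case using hom_const_zero[OF K(1)] xA
      by (intro bexI[of _ "\<zero>\<^bsub>A\<^esub>"] bexI[of _ "\<lambda>k. \<zero>\<^bsub>K\<^esub>"]) auto
  next
    case (Suc m)
    then obtain b g where g: "b \<in> carrier A" "g \<in> rmod_hom A K K" "poly_map K \<theta> m g"
      "\<forall>k\<in>carrier K. h k = k \<cdot>\<^bsub>K\<^esub> b \<oplus>\<^bsub>K\<^esub> \<theta> (g k)" by auto
    from Suc.IH[OF g(2,3)] obtain a \<tau> where a: "a \<in> carrier A" and \<tau>: "\<tau> \<in> rmod_hom A F K"
      "\<forall>k\<in>carrier K. g k \<cdot>\<^bsub>K\<^esub> (x [^]\<^bsub>A\<^esub> m) = k \<cdot>\<^bsub>K\<^esub> (x \<otimes>\<^bsub>A\<^esub> a) \<oplus>\<^bsub>K\<^esub> \<tau> (i k)" by blast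
    show ?case
    proof (intro bexI ballI)
      show "(\<lambda>f. \<theta> (\<tau> f) \<cdot>\<^bsub>K\<^esub> x \<ominus>\<^bsub>K\<^esub> \<rho> f \<cdot>\<^bsub>K\<^esub> (x \<otimes>\<^bsub>A\<^esub> a)) \<in> rmod_hom A F K"
        using a xA by (intro hom_diff hom_scale hom_comp[OF \<tau>(1) \<theta>] \<rho> K A_cring xA) simp
      show "b \<otimes>\<^bsub>A\<^esub> x [^]\<^bsub>A\<^esub> m \<oplus>\<^bsub>A\<^esub> s \<otimes>\<^bsub>A\<^esub> a \<in> carrier A" using g a xA sA by simp
      fix k assume k: "k \<in> carrier K"
      note cc = c hom_closed[OF \<tau>(1)] hom_closed[OF g(2)]
      have "h k \<cdot>\<^bsub>K\<^esub> (x [^]\<^bsub>A\<^esub> Suc m) = k \<cdot>\<^bsub>K\<^esub> (b \<otimes>\<^bsub>A\<^esub> x [^]\<^bsub>A\<^esub> Suc m) \<oplus>\<^bsub>K\<^esub> \<theta> (g k \<cdot>\<^bsub>K\<^esub> (x [^]\<^bsub>A\<^esub> m)) \<cdot>\<^bsub>K\<^esub> x"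
        using k cc xA g by (simp add: hom_ract[OF \<theta>] K.ract_assoc K.ract_add_left)
      also have "\<dots> = k \<cdot>\<^bsub>K\<^esub> (b \<otimes>\<^bsub>A\<^esub> x [^]\<^bsub>A\<^esub> Suc m) \<oplus>\<^bsub>K\<^esub> ((\<theta> k \<cdot>\<^bsub>K\<^esub> x) \<cdot>\<^bsub>K\<^esub> (x \<otimes>\<^bsub>A\<^esub> a) \<oplus>\<^bsub>K\<^esub> \<theta> (\<tau> (i k)) \<cdot>\<^bsub>K\<^esub> x)"
        using k cc xA a \<tau>(2) by (simp add: hom_add[OF \<theta>] hom_ract[OF \<theta>] K.ract_add_left K.ract_assoc[symmetric] A.m_ac)
      also have "\<dots> = (k \<cdot>\<^bsub>K\<^esub> (b \<otimes>\<^bsub>A\<^esub> x [^]\<^bsub>A\<^esub> Suc m) \<oplus>\<^bsub>K\<^esub> k \<cdot>\<^bsub>K\<^esub> (s \<otimes>\<^bsub>A\<^esub> (x \<otimes>\<^bsub>A\<^esub> a))) \<oplus>\<^bsub>K\<^esub>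
          (\<theta> (\<tau> (i k)) \<cdot>\<^bsub>K\<^esub> x \<ominus>\<^bsub>K\<^esub> \<rho> (i k) \<cdot>\<^bsub>K\<^esub> (x \<otimes>\<^bsub>A\<^esub> a))"
        using k cc xA a g(1) sA
        by (simp add: \<theta>x a_minus_def K.ract_add_left K.ract_minus_left K.ract_assoc[symmetric] K.M.a_ac)
      also have "k \<cdot>\<^bsub>K\<^esub> (b \<otimes>\<^bsub>A\<^esub> x [^]\<^bsub>A\<^esub> Suc m) \<oplus>\<^bsub>K\<^esub> k \<cdot>\<^bsub>K\<^esub> (s \<otimes>\<^bsub>A\<^esub> (x \<otimes>\<^bsub>A\<^esub> a))
          = k \<cdot>\<^bsub>K\<^esub> (x \<otimes>\<^bsub>A\<^esub> (b \<otimes>\<^bsub>A\<^esub> x [^]\<^bsub>A\<^esub> m \<oplus>\<^bsub>A\<^esub> s \<otimes>\<^bsub>A\<^esub> a))"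
        using k xA a g(1) sA by (simp add: K.ract_add_right[symmetric] A.r_distr A.m_ac)
      finally show "h k \<cdot>\<^bsub>K\<^esub> (x [^]\<^bsub>A\<^esub> Suc m)
        = k \<cdot>\<^bsub>K\<^esub> (x \<otimes>\<^bsub>A\<^esub> (b \<otimes>\<^bsub>A\<^esub> x [^]\<^bsub>A\<^esub> m \<oplus>\<^bsub>A\<^esub> s \<otimes>\<^bsub>A\<^esub> a)) \<oplus>\<^bsub>K\<^esub>
          (\<theta> (\<tau> (i k)) \<cdot>\<^bsub>K\<^esub> x \<ominus>\<^bsub>K\<^esub> \<rho> (i k) \<cdot>\<^bsub>K\<^esub> (x \<otimes>\<^bsub>A\<^esub> a))" .
    qed
  qed
  obtain m h where h: "h \<in> rmod_hom A K K" "poly_map K \<theta> m h" "\<forall>x\<in>carrier K. (\<theta> ^^ m) x = h x"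
    using fin_gen_integral[OF K \<theta>] by blast
  obtain \<tau> where \<tau>: "\<tau> \<in> rmod_hom A F K"
    "\<forall>k\<in>carrier K. (\<theta> ^^ m) k \<cdot>\<^bsub>K\<^esub> (x [^]\<^bsub>A\<^esub> m) = k \<cdot>\<^bsub>K\<^esub> (s [^]\<^bsub>A\<^esub> m) \<oplus>\<^bsub>K\<^esub> \<tau> (i k)" using pow by blast
  obtain a \<tau>' where a: "a \<in> carrier A" and \<tau>': "\<tau>' \<in> rmod_hom A F K"
    "\<forall>k\<in>carrier K. h k \<cdot>\<^bsub>K\<^esub> (x [^]\<^bsub>A\<^esub> m) = k \<cdot>\<^bsub>K\<^esub> (x \<otimes>\<^bsub>A\<^esub> a) \<oplus>\<^bsub>K\<^esub> \<tau>' (i k)" using low[OF h(1,2)] by blast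
  \<comment> \<open>The monic equation equates the two expressions above. Modulo \<open>q\<close>
    only the power of \<open>s\<close> survives in the difference of the scalars, as
    \<open>x\<close> lies in \<open>q\<close>.\<close>
  let ?t = "s [^]\<^bsub>A\<^esub> m \<ominus>\<^bsub>A\<^esub> x \<otimes>\<^bsub>A\<^esub> a"
  have sm: "s [^]\<^bsub>A\<^esub> m \<in> carrier A - q" for m :: nat
    by (induction m) (use primeideal_complement[OF A_cring q] s in auto)
  have xa: "x \<otimes>\<^bsub>A\<^esub> a \<in> q" using x a by (rule q.I_r_closed)
  have "?t \<notin> q"
  proof
    assume "?t \<in> q"
    then have "?t \<oplus>\<^bsub>A\<^esub> x \<otimes>\<^bsub>A\<^esub> a \<in> q" using xa q.a_closed by blast
    then show False using sm[of m] xA a by (simp add: a_minus_def A.a_assoc A.l_neg)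
  qed
  moreover have "?t \<in> carrier A" using sA xA a by simp
  moreover have "(\<lambda>f. \<tau>' f \<ominus>\<^bsub>K\<^esub> \<tau> f) \<in> rmod_hom A F K" by (intro hom_diff \<tau> \<tau>' K)
  moreover have "\<tau>' (i k) \<ominus>\<^bsub>K\<^esub> \<tau> (i k) = k \<cdot>\<^bsub>K\<^esub> ?t" if k: "k \<in> carrier K" for k
  proof -
    note cc = c hom_closed[OF \<tau>(1)] hom_closed[OF \<tau>'(1)]
    have "k \<cdot>\<^bsub>K\<^esub> (s [^]\<^bsub>A\<^esub> m) \<oplus>\<^bsub>K\<^esub> \<tau> (i k) = k \<cdot>\<^bsub>K\<^esub> (x \<otimes>\<^bsub>A\<^esub> a) \<oplus>\<^bsub>K\<^esub> \<tau>' (i k)"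
      using k \<tau>(2) \<tau>'(2) h(3) by metis
    then have "k \<cdot>\<^bsub>K\<^esub> (s [^]\<^bsub>A\<^esub> m) = (k \<cdot>\<^bsub>K\<^esub> (x \<otimes>\<^bsub>A\<^esub> a) \<oplus>\<^bsub>K\<^esub> \<tau>' (i k)) \<ominus>\<^bsub>K\<^esub> \<tau> (i k)"
      using k cc sA K.M.diff_cancel(1)[of "k \<cdot>\<^bsub>K\<^esub> (s [^]\<^bsub>A\<^esub> m)" "\<tau> (i k)"] by simp
    then have "k \<cdot>\<^bsub>K\<^esub> (s [^]\<^bsub>A\<^esub> m) = (\<tau>' (i k) \<ominus>\<^bsub>K\<^esub> \<tau> (i k)) \<oplus>\<^bsub>K\<^esub> k \<cdot>\<^bsub>K\<^esub> (x \<otimes>\<^bsub>A\<^esub> a)"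
      using k cc sA xA a by (simp add: a_minus_def K.M.a_ac)
    moreover have "k \<cdot>\<^bsub>K\<^esub> ?t = k \<cdot>\<^bsub>K\<^esub> (s [^]\<^bsub>A\<^esub> m) \<ominus>\<^bsub>K\<^esub> k \<cdot>\<^bsub>K\<^esub> (x \<otimes>\<^bsub>A\<^esub> a)"
      using k sA xA a by (simp add: a_minus_def K.ract_add_right K.ract_minus_right)
    ultimately show ?thesis
      using k cc xA a K.M.diff_cancel(1) by simp
  qed
  ultimately show ?thesis
    by (intro bexI[of _ ?t] bexI[of _ "\<lambda>f. \<tau>' f \<ominus>\<^bsub>K\<^esub> \<tau> f"]) auto
qed

end

section \<open>Pullbacks and quotients by a regular element\<close>

lemma reg_fin_gen: assumes "ring R" shows "fin_gen R (reg_rmod R)"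
proof -
  interpret ring R by fact
  have "U = carrier R" if U: "submod R (reg_rmod R) U" "\<one>\<^bsub>R\<^esub> \<in> U" for U
  proof
    show "U \<subseteq> carrier R" using submodD(1)[OF U(1)] by simp
    show "carrier R \<subseteq> U"
    proof
      fix a assume "a \<in> carrier R"
      then show "a \<in> U" using submodD(4)[OF U(1) U(2), of a] by simp
    qed
  qed
  then show ?thesis unfolding fin_gen_def by (intro exI[of _ "{\<one>\<^bsub>R\<^esub>}"]) simp
qed

lemma reg_hom: assumes "right_module R M" "x \<in> carrier M" shows "(\<lambda>a. x \<cdot>\<^bsub>M\<^esub> a) \<in> rmod_hom R (reg_rmod R) M"
proof -
  interpret right_module R M by fact
  show ?thesis using assms(2) by (intro rmod_homI) (simp_all add: ract_add_right ract_assoc)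
qed

context comm_noeth
begin

lemma hom_ract_left: assumes "right_module A M" "x \<in> carrier A" shows "(\<lambda>y. y \<cdot>\<^bsub>M\<^esub> x) \<in> rmod_hom A M M"
  by (rule hom_scale[OF hom_id assms(1) A_cring assms(2)])

text \<open>The pairs \<open>(f, n)\<close> with \<open>\<pi> f\<close> equal to \<open>n\<close>
  times \<open>x\<close>, given as the kernel of a map onto \<open>N\<close>. Since
  \<open>ses\<close> describes a kernel up to isomorphism, \<open>L\<close> need not consist of
  pairs and can have the element type that \<open>loc_pd\<close> expects.\<close>

definition pullback :: "('a, 'l) rmod \<Rightarrow> ('a, 'f) rmod \<Rightarrow> ('a, 'n) rmod \<Rightarrow> ('f \<Rightarrow> 'n) \<Rightarrow> 'a \<Rightarrow> ('l \<Rightarrow> 'f \<times> 'n) \<Rightarrow> bool" where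
  "pullback L F N \<pi> x i \<longleftrightarrow> ses A L (prod_rmod F N) N i (\<lambda>z. \<pi> (fst z) \<ominus>\<^bsub>N\<^esub> snd z \<cdot>\<^bsub>N\<^esub> x)"

lemma pullback_epi:
  assumes F: "right_module A F" and N: "right_module A N" and p: "epi A F N \<pi>" and x: "x \<in> carrier A"
  shows "epi A (prod_rmod F N) N (\<lambda>z. \<pi> (fst z) \<ominus>\<^bsub>N\<^esub> snd z \<cdot>\<^bsub>N\<^esub> x)"
proof -
  interpret F: right_module A F by fact
  interpret N: right_module A N by fact
  have f: "fst \<in> rmod_hom A (prod_rmod F N) F" "snd \<in> rmod_hom A (prod_rmod F N) N"
    by (auto intro!: rmod_homI)
  have ph: "\<pi> \<in> rmod_hom A F N" using p ..
  let ?g = "\<lambda>z. \<pi> (fst z) \<ominus>\<^bsub>N\<^esub> snd z \<cdot>\<^bsub>N\<^esub> x"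
  have g: "?g \<in> rmod_hom A (prod_rmod F N) N"
    by (intro hom_diff hom_scale hom_comp[OF f(1) ph] f(2) N A_cring x)
  moreover have "carrier N \<subseteq> ?g ` carrier (prod_rmod F N)"
  proof
    fix y assume y: "y \<in> carrier N"
    then obtain a where a: "a \<in> carrier F" "y = \<pi> a" using epiE[OF p] by blast
    then have "y = ?g (a, \<zero>\<^bsub>N\<^esub>)" using x y by (simp add: a_minus_def)
    then show "y \<in> ?g ` carrier (prod_rmod F N)" using a by (intro image_eqI[of _ _ "(a, \<zero>\<^bsub>N\<^esub>)"]) auto
  qed
  moreover have "?g ` carrier (prod_rmod F N) \<subseteq> carrier N" using hom_closed[OF g] by blast
  ultimately show ?thesis by auto
qed

lemma pullback_exists:
  assumes F: "right_module A F" "fin_gen A F" and N: "right_module A N" and p: "epi A F N \<pi>" and x: "x \<in> carrier A"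
  obtains L :: "('a, nat \<Rightarrow> 'a) rmod" and i where "pullback L F N \<pi> x i" "fin_gen A L"
proof -
  have N': "fin_gen A N" by (rule fin_gen_img[OF F(1) N p F(2)])
  have P: "right_module A (prod_rmod F N)" "fin_gen A (prod_rmod F N)"
    using prod_module[OF F(1) N] prod_fin_gen[OF F N N'] by auto
  note s = ses_sub[OF P(1) N pullback_epi[OF F(1) N p x]]
  note s' = sesD[OF s]
  let ?\<pi> = "\<lambda>z. \<pi> (fst z) \<ominus>\<^bsub>N\<^esub> snd z \<cdot>\<^bsub>N\<^esub> x"
  let ?M = "(prod_rmod F N)\<lparr>carrier := {z \<in> carrier (prod_rmod F N). ?\<pi> z = \<zero>\<^bsub>N\<^esub>}\<rparr>"
  obtain M f g where M: "right_module A (M :: ('a, nat \<Rightarrow> 'a) rmod)" "f \<in> rmod_hom A ?M M" "g \<in> rmod_hom A M ?M"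
    "bij_betw f (carrier ?M) (carrier M)" "bij_betw g (carrier M) (carrier ?M)"
    "\<forall>x\<in>carrier ?M. g (f x) = x" "\<forall>x\<in>carrier M. f (g x) = x" "fin_gen A M"
    by (rule fin_gen_copy[OF s'(1) ses_fin_gen(1)[OF s P(2)]])
  have gi: "inj_on g (carrier M)" and gs: "g ` carrier M = carrier ?M" using M(5) by (auto simp: bij_betw_def)
  have gP: "g \<in> rmod_hom A M (prod_rmod F N)" using hom_comp[OF M(3) s'(4)] by simp
  have "pullback M F N \<pi> x g"
    unfolding pullback_def ses_def
    by (intro conjI M(1) P(1) N gP gi s'(6,7)) (use gs in simp)
  from that[OF this M(8)] show thesis .
qed

lemma pullback_props:
  assumes pb: "pullback L F N \<pi> x i" and F: "right_module A F"
  shows "right_module A L" "right_module A N"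
    "(\<lambda>l. fst (i l)) \<in> rmod_hom A L F" "(\<lambda>l. snd (i l)) \<in> rmod_hom A L N" "inj_on i (carrier L)"
    "\<And>l. l \<in> carrier L \<Longrightarrow> \<pi> (fst (i l)) \<ominus>\<^bsub>N\<^esub> snd (i l) \<cdot>\<^bsub>N\<^esub> x = \<zero>\<^bsub>N\<^esub>"
proof -
  note p = sesD[OF pb[unfolded pullback_def]]
  interpret N: right_module A N by (rule p)
  interpret F: right_module A F by fact
  have f: "fst \<in> rmod_hom A (prod_rmod F N) F" "snd \<in> rmod_hom A (prod_rmod F N) N"
    by (auto intro!: rmod_homI)
  show "right_module A L" "right_module A N" "inj_on i (carrier L)" by (rule p)+
  show "(\<lambda>l. fst (i l)) \<in> rmod_hom A L F" "(\<lambda>l. snd (i l)) \<in> rmod_hom A L N"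
    by (rule hom_comp[OF p(4) f(1)], rule hom_comp[OF p(4) f(2)])
  show "\<And>l. l \<in> carrier L \<Longrightarrow> \<pi> (fst (i l)) \<ominus>\<^bsub>N\<^esub> snd (i l) \<cdot>\<^bsub>N\<^esub> x = \<zero>\<^bsub>N\<^esub>"
    by (rule ses_zero[OF pb[unfolded pullback_def]])
qed

lemma pullback_eq:
  assumes pb: "pullback L F N \<pi> x i" and F: "right_module A F" and p: "\<pi> \<in> rmod_hom A F N" and x: "x \<in> carrier A"
    and l: "l \<in> carrier L"
  shows "\<pi> (fst (i l)) = snd (i l) \<cdot>\<^bsub>N\<^esub> x"
proof -
  note q = pullback_props[OF pb F]
  interpret N: right_module A N by (rule q)
  show ?thesis
    using q(6)[OF l] l x hom_closed[OF q(3) l] hom_closed[OF q(4) l] hom_closed[OF p]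
    by (simp add: N.diff_eq_zero_iff)
qed

lemma pullback_lift:
  assumes pb: "pullback L F N \<pi> x i" and F: "right_module A F" and M: "right_module A M"
    and p: "\<pi> \<in> rmod_hom A F N" and x: "x \<in> carrier A"
    and f: "f \<in> rmod_hom A M F" and g: "g \<in> rmod_hom A M N"
    and eq: "\<And>m. m \<in> carrier M \<Longrightarrow> \<pi> (f m) = g m \<cdot>\<^bsub>N\<^esub> x"
  obtains h where "h \<in> rmod_hom A M L" "\<forall>m\<in>carrier M. i (h m) = (f m, g m)"
proof -
  note q = pullback_props[OF pb F]
  interpret N: right_module A N by (rule q)
  have fg: "(\<lambda>m. (f m, g m)) \<in> rmod_hom A M (prod_rmod F N)"
    by (rule rmod_homI) (simp_all add: hom_simps[OF f] hom_simps[OF g])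
  show thesis
  proof (rule ses_factor[OF pb[unfolded pullback_def] fg M])
    show "\<pi> (fst (f m, g m)) \<ominus>\<^bsub>N\<^esub> snd (f m, g m) \<cdot>\<^bsub>N\<^esub> x = \<zero>\<^bsub>N\<^esub>" if "m \<in> carrier M" for m
      using that eq x hom_closed[OF g] hom_closed[OF f] hom_closed[OF p] by (simp add: N.diff_eq_zero_iff)
  qed (rule that)
qed

text \<open>
  The pullback of a free cover \<open>\<pi> : F \<rightarrow> N\<close> and of multiplication by \<open>x\<close> on \<open>N\<close> is a
  syzygy of \<open>N / N x\<close> if \<open>x\<close> is regular on \<open>N\<close>, and its own syzygy is the pullback of the next
  cover and multiplication by \<open>- x\<close> (mapping cone). In degree zero, a splitting of the pullback
  up to \<open>s \<in> A - q\<close> lifts the identity of \<open>N\<close> to \<open>F\<close> up to a multiple of \<open>x\<close>, which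
  Nakayama's lemma removes.
\<close>

lemma loc_pd_pullback:
  fixes K L F N :: "('a, nat \<Rightarrow> 'a) rmod"
  assumes q: "primeideal q A"
  shows "loc_pd A (carrier A - q) k L \<Longrightarrow> fin_gen A L \<Longrightarrow> pullback L F N \<pi> x i \<Longrightarrow> ses A K F N \<iota> \<pi>
    \<Longrightarrow> projective_rmod A F \<Longrightarrow> fin_gen A F \<Longrightarrow> x \<in> q
    \<Longrightarrow> loc_pd A (carrier A - q) k N"
proof (induction k arbitrary: L F N \<pi> x i K \<iota>)
  interpret q: primeideal q A by (rule q)
  case 0
  have pdL: "loc_proj A (carrier A - q) L" using 0(1) by simp
  note pb = 0(3) and s = 0(4) and F = 0(5,6) and xq = 0(7)
  note s' = sesD[OF s]
  note pp = pullback_props[OF pb s'(2)]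
  have x: "x \<in> carrier A" using xq q.a_subset by auto
  interpret F: right_module A F by (rule s')
  interpret N: right_module A N by (rule s')
  interpret K: right_module A K by (rule s')
  interpret L: right_module A L by (rule pp)
  from pdL obtain s n u v where s: "s \<in> carrier A - q" and u: "u \<in> rmod_hom A L (free_rmod A {..<n::nat})"
    and v: "v \<in> rmod_hom A (free_rmod A {..<n}) L" and vu: "\<forall>x\<in>carrier L. v (u x) = x \<cdot>\<^bsub>L\<^esub> s"
    by (auto simp: loc_proj_def)
  have sA: "s \<in> carrier A" using s by simp
  let ?G = "free_rmod A {..<n}"
  obtain w where w: "w \<in> rmod_hom A ?G F" "\<forall>a\<in>carrier ?G. \<pi> (w a) = snd (i (v a))"
    by (rule proj_lift[OF free_proj[OF A_ring] s'(2,3,8) hom_comp[OF v pp(4)]])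
  note c = hom_closed[OF s'(4)] hom_closed[OF s'(6)] hom_closed[OF u] hom_closed[OF v] hom_closed[OF w(1)]
    hom_closed[OF pp(3)] hom_closed[OF pp(4)]
  \<comment> \<open>As \<open>L\<close> is projective up to \<open>s\<close>, the second projection
    times \<open>s\<close> lifts from \<open>N\<close> to \<open>F\<close>; \<open>\<mu>\<close> is
    this lift.\<close>
  define \<mu> where "\<mu> l = w (u l)" for l
  have \<mu>: "\<mu> \<in> rmod_hom A L F" unfolding \<mu>_def by (rule hom_comp[OF u w(1)])
  have \<pi>\<mu>: "\<pi> (\<mu> l) = snd (i l) \<cdot>\<^bsub>N\<^esub> s" if l: "l \<in> carrier L" for l
    unfolding \<mu>_def using l c w(2) vu sA by (simp add: hom_ract[OF pp(4)])
  \<comment> \<open>Two maps into the pullback are compared: \<open>\<xi>\<close>, with components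
    multiplication by \<open>x\<close> and \<open>\<pi>\<close>, and \<open>\<eta>\<close>, which
    embeds the syzygy with second component zero. On the syzygy \<open>\<xi>\<close> is
    \<open>x\<close> times \<open>\<eta>\<close>.\<close>
  obtain \<xi> where \<xi>: "\<xi> \<in> rmod_hom A F L" "\<forall>f\<in>carrier F. i (\<xi> f) = (f \<cdot>\<^bsub>F\<^esub> x, \<pi> f)"
  proof (rule pullback_lift[OF pb s'(2) s'(2) s'(6) x hom_ract_left[OF s'(2) x] s'(6)])
    show "\<pi> (f \<cdot>\<^bsub>F\<^esub> x) = \<pi> f \<cdot>\<^bsub>N\<^esub> x" if "f \<in> carrier F" for f by (rule hom_ract[OF s'(6) that x])
  qed
  obtain \<eta> where \<eta>: "\<eta> \<in> rmod_hom A K L" "\<forall>k\<in>carrier K. i (\<eta> k) = (\<iota> k, \<zero>\<^bsub>N\<^esub>)"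
  proof (rule pullback_lift[OF pb s'(2) s'(1) s'(6) x s'(4) hom_const_zero[OF s'(3)]])
    show "\<pi> (\<iota> k) = \<zero>\<^bsub>N\<^esub> \<cdot>\<^bsub>N\<^esub> x" if "k \<in> carrier K" for k using ses_zero[OF 0(4) that] x by simp
  qed
  have c': "\<xi> f \<in> carrier L" "\<mu> l \<in> carrier F" "\<eta> k \<in> carrier L"
    if "f \<in> carrier F" "l \<in> carrier L" "k \<in> carrier K" for f l k
    using that hom_closed[OF \<xi>(1)] hom_closed[OF \<mu>] hom_closed[OF \<eta>(1)] by auto
  \<comment> \<open>Both multiplication by \<open>s\<close> on \<open>F\<close> and the composite of
    \<open>\<xi>\<close> with \<open>\<mu>\<close> lift \<open>s\<close> times \<open>\<pi>\<close>,
    so their difference maps into the syzygy.\<close>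
  let ?\<rho> = "\<lambda>f. f \<cdot>\<^bsub>F\<^esub> s \<ominus>\<^bsub>F\<^esub> \<mu> (\<xi> f)"
  have \<rho>: "?\<rho> \<in> rmod_hom A F F"
    by (intro hom_diff hom_ract_left hom_comp[OF \<xi>(1) \<mu>] s' sA)
  obtain \<rho>' where \<rho>': "\<rho>' \<in> rmod_hom A F K" "\<forall>f\<in>carrier F. \<iota> (\<rho>' f) = ?\<rho> f"
  proof (rule ses_factor[OF 0(4) \<rho> s'(2)])
    fix f assume f: "f \<in> carrier F"
    have m: "\<mu> (\<xi> f) \<in> carrier F" using hom_closed[OF \<mu> hom_closed[OF \<xi>(1) f]] .
    show "\<pi> (?\<rho> f) = \<zero>\<^bsub>N\<^esub>"
      using f sA m \<pi>\<mu>[OF hom_closed[OF \<xi>(1) f]] \<xi>(2) c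
      by (simp add: hom_minus[OF s'(6,2,3)] hom_ract[OF s'(6)] N.diff_eq_zero_iff)
  qed
  obtain \<theta> where \<theta>: "\<theta> \<in> rmod_hom A K K" "\<forall>k\<in>carrier K. \<iota> (\<theta> k) = \<mu> (\<eta> k)"
  proof (rule ses_factor[OF 0(4) hom_comp[OF \<eta>(1) \<mu>] s'(1)])
    fix k assume k: "k \<in> carrier K"
    show "\<pi> (\<mu> (\<eta> k)) = \<zero>\<^bsub>N\<^esub>" using \<pi>\<mu>[OF hom_closed[OF \<eta>(1) k]] \<eta>(2) k sA by simp
  qed
  \<comment> \<open>Multiplication by \<open>s\<close> on the syzygy is thus a map that extends to
    \<open>F\<close> plus a multiple of \<open>x\<close>, the situation of
    \<open>nakayama_extension\<close>.\<close>
  have eq: "\<rho>' (\<iota> k) \<oplus>\<^bsub>K\<^esub> \<theta> k \<cdot>\<^bsub>K\<^esub> x = k \<cdot>\<^bsub>K\<^esub> s" if k: "k \<in> carrier K" for k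
  proof (rule inj_onD[OF s'(5)])
    have i: "\<iota> k \<in> carrier F" using c k by simp
    have ek: "\<eta> k \<in> carrier L" using hom_closed[OF \<eta>(1) k] .
    have "\<xi> (\<iota> k) = \<eta> k \<cdot>\<^bsub>L\<^esub> x"
    proof (rule inj_onD[OF pp(5)])
      have "i (\<eta> k \<cdot>\<^bsub>L\<^esub> x) = (\<iota> k \<cdot>\<^bsub>F\<^esub> x, \<zero>\<^bsub>N\<^esub>)"
        using hom_ract[OF pp(3) ek x] hom_ract[OF pp(4) ek x] \<eta>(2) k x by (simp add: prod_eq_iff)
      then show "i (\<xi> (\<iota> k)) = i (\<eta> k \<cdot>\<^bsub>L\<^esub> x)" using \<xi>(2) i ses_zero[OF 0(4) k] by simp
    qed (use i ek x hom_closed[OF \<xi>(1)] in auto)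
    then have m: "\<mu> (\<xi> (\<iota> k)) = \<iota> (\<theta> k) \<cdot>\<^bsub>F\<^esub> x" using hom_ract[OF \<mu> ek x] \<theta>(2) k by simp
    have t: "\<theta> k \<in> carrier K" "\<rho>' (\<iota> k) \<in> carrier K" using hom_closed[OF \<theta>(1) k] hom_closed[OF \<rho>'(1) i] .
    have "\<iota> (\<rho>' (\<iota> k) \<oplus>\<^bsub>K\<^esub> \<theta> k \<cdot>\<^bsub>K\<^esub> x) = (\<iota> k \<cdot>\<^bsub>F\<^esub> s \<ominus>\<^bsub>F\<^esub> \<iota> (\<theta> k) \<cdot>\<^bsub>F\<^esub> x) \<oplus>\<^bsub>F\<^esub> \<iota> (\<theta> k) \<cdot>\<^bsub>F\<^esub> x"
      using t x \<rho>'(2) i m by (simp add: hom_add[OF s'(4)] hom_ract[OF s'(4)])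
    also have "\<dots> = \<iota> (k \<cdot>\<^bsub>K\<^esub> s)"
      using i c(1)[OF t(1)] x sA k by (simp add: F.M.diff_cancel hom_ract[OF s'(4)])
    finally show "\<iota> (\<rho>' (\<iota> k) \<oplus>\<^bsub>K\<^esub> \<theta> k \<cdot>\<^bsub>K\<^esub> x) = \<iota> (k \<cdot>\<^bsub>K\<^esub> s)" .
    show "\<rho>' (\<iota> k) \<oplus>\<^bsub>K\<^esub> \<theta> k \<cdot>\<^bsub>K\<^esub> x \<in> carrier K" "k \<cdot>\<^bsub>K\<^esub> s \<in> carrier K" using t x k sA by auto
  qed
  have eq': "\<forall>k\<in>carrier K. \<rho>' (\<iota> k) \<oplus>\<^bsub>K\<^esub> \<theta> k \<cdot>\<^bsub>K\<^esub> x = k \<cdot>\<^bsub>K\<^esub> s" using eq by blast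
  obtain t \<tau> where t: "t \<in> carrier A - q" and \<tau>: "\<tau> \<in> rmod_hom A F K" "\<forall>k\<in>carrier K. \<tau> (\<iota> k) = k \<cdot>\<^bsub>K\<^esub> t"
    using nakayama_extension[OF q s'(1) ses_fin_gen(1)[OF 0(4) F(2)] s'(2,4) \<theta>(1) \<rho>'(1) s xq, OF eq'] by blast
  have tA: "t \<in> carrier A" using t by simp
  \<comment> \<open>\<open>\<tau>\<close> splits the syzygy off \<open>F\<close> up to
    \<open>t\<close>. The complementary map kills the syzygy and so descends to \<open>N\<close>,
    where it lifts multiplication by \<open>t\<close>.\<close>
  let ?\<sigma> = "\<lambda>f. f \<cdot>\<^bsub>F\<^esub> t \<ominus>\<^bsub>F\<^esub> \<iota> (\<tau> f)"
  have \<sigma>: "?\<sigma> \<in> rmod_hom A F F" by (intro hom_diff hom_ract_left hom_comp[OF \<tau>(1) s'(4)] s' tA)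
  have c\<tau>: "\<iota> (\<tau> f) \<in> carrier F" if "f \<in> carrier F" for f using c(1)[OF hom_closed[OF \<tau>(1) that]] .
  obtain \<psi> where \<psi>: "\<psi> \<in> rmod_hom A N F" "\<forall>f\<in>carrier F. \<psi> (\<pi> f) = ?\<sigma> f"
  proof (rule epi_factor[OF s'(2,3,2,8) \<sigma>])
    fix f assume f: "f \<in> carrier F" "\<pi> f = \<zero>\<^bsub>N\<^esub>"
    obtain k where k: "k \<in> carrier K" "f = \<iota> k" using ses_ker[OF 0(4), OF f] by blast
    show "?\<sigma> f = \<zero>\<^bsub>F\<^esub>" using k \<tau>(2) tA c by (simp add: hom_ract[OF s'(4)] F.diff_eq_zero_iff)
  qed
  have "\<pi> (\<psi> y) = y \<cdot>\<^bsub>N\<^esub> t" if y: "y \<in> carrier N" for y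
  proof -
    obtain f where f: "f \<in> carrier F" "y = \<pi> f" using epiE[OF s'(8) y] by blast
    show ?thesis
      using f c\<tau>[OF f(1)] \<psi>(2) tA ses_zero[OF 0(4) hom_closed[OF \<tau>(1) f(1)]] c
      by (simp add: hom_add[OF s'(6)] hom_neg[OF s'(6,2,3)] hom_ract[OF s'(6)] a_minus_def)
  qed
  then show ?case
    using loc_projI[OF s'(3) ses_fin_gen(2)[OF 0(4) F(2)] F(1) t \<psi>(1) s'(6)] by simp
next
  interpret q: primeideal q A by (rule q)
  case (Suc k)
  note pb = Suc(4) and s = Suc(5) and F = Suc(6,7) and xq = Suc(8)
  note s' = sesD[OF s]
  note pp = pullback_props[OF pb s'(2)]
  have x: "x \<in> carrier A" using xq q.a_subset by auto
  note T = primeideal_complement(1)[OF A_cring q]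
  interpret F: right_module A F by (rule s')
  interpret N: right_module A N by (rule s')
  interpret K: right_module A K by (rule s')
  interpret L: right_module A L by (rule pp)
  obtain K' n \<iota>' \<pi>' where t: "ses A (K' :: ('a, nat \<Rightarrow> 'a) rmod) (free_rmod A {..<n::nat}) K \<iota>' \<pi>'"
    by (rule fin_gen_ses[OF s'(1) ses_fin_gen(1)[OF s F(2)]])
  let ?G = "free_rmod A {..<n}"
  note t' = sesD[OF t]
  have G: "projective_rmod A ?G" "fin_gen A ?G" using free_proj[OF A_ring] free_fin_gen[OF A_ring] by auto
  interpret G: right_module A ?G by (rule t')
  note c = hom_closed[OF s'(4)] hom_closed[OF s'(6)] hom_closed[OF t'(6)] hom_closed[OF pp(3)] hom_closed[OF pp(4)]
  \<comment> \<open>The sign comes from the kernel of the cover of \<open>L\<close> by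
    \<open>?G\<close> and \<open>F\<close>: in \<open>\<iota> (\<pi>' a)\<close> plus
    \<open>x\<close> times \<open>b\<close> equal to zero, \<open>b\<close> is
    \<open>\<iota> y\<close> for some \<open>y\<close>, and then \<open>\<pi>' a\<close> is the
    multiple of \<open>y\<close> by \<open>\<ominus> x\<close>. So the kernel is again a pullback,
    with \<open>K\<close> in place of \<open>N\<close>.\<close>
  have mx: "\<ominus>\<^bsub>A\<^esub> x \<in> q" "\<ominus>\<^bsub>A\<^esub> x \<in> carrier A" using xq x by auto
  obtain L' j where pb': "pullback (L' :: ('a, nat \<Rightarrow> 'a) rmod) ?G K \<pi>' (\<ominus>\<^bsub>A\<^esub> x) j" and L': "fin_gen A L'"
    by (rule pullback_exists[OF t'(2) G(2) s'(1) t'(8) mx(2)])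
  note pp' = pullback_props[OF pb' t'(2)]
  let ?P = "prod_rmod ?G F"
  have P: "projective_rmod A ?P" "fin_gen A ?P"
    using prod_proj[OF G(1) F(1)] prod_fin_gen[OF t'(2) G(2) s'(2) F(2)] by auto
  have Pm: "right_module A ?P" by (rule proj_module[OF P(1)])
  have fs: "fst \<in> rmod_hom A ?P ?G" "snd \<in> rmod_hom A ?P F" by (auto intro!: rmod_homI)
  have a1: "(\<lambda>z. \<iota> (\<pi>' (fst z)) \<oplus>\<^bsub>F\<^esub> snd z \<cdot>\<^bsub>F\<^esub> x) \<in> rmod_hom A ?P F"
    by (intro hom_plus hom_scale hom_comp[OF fs(1) hom_comp[OF t'(6) s'(4)]] fs(2) s' A_cring x)
  have a2: "(\<lambda>z. \<pi> (snd z)) \<in> rmod_hom A ?P N" by (rule hom_comp[OF fs(2) s'(6)])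
  have a3: "\<pi> (\<iota> (\<pi>' (fst z)) \<oplus>\<^bsub>F\<^esub> snd z \<cdot>\<^bsub>F\<^esub> x) = \<pi> (snd z) \<cdot>\<^bsub>N\<^esub> x" if "z \<in> carrier ?P" for z
    using that c x ses_zero[OF s] by (auto simp: hom_add[OF s'(6)] hom_ract[OF s'(6)])
  obtain p where p: "p \<in> rmod_hom A ?P L"
    "\<forall>z\<in>carrier ?P. i (p z) = (\<iota> (\<pi>' (fst z)) \<oplus>\<^bsub>F\<^esub> snd z \<cdot>\<^bsub>F\<^esub> x, \<pi> (snd z))"
  proof (rule pullback_lift[OF pb s'(2) Pm s'(6) x a1 a2])
    show "\<pi> (\<iota> (\<pi>' (fst z)) \<oplus>\<^bsub>F\<^esub> snd z \<cdot>\<^bsub>F\<^esub> x) = \<pi> (snd z) \<cdot>\<^bsub>N\<^esub> x" if "z \<in> carrier ?P" for z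
      by (rule a3[OF that])
  qed
  have "carrier L \<subseteq> p ` carrier ?P"
  proof
    fix l assume l: "l \<in> carrier L"
    obtain b where b: "b \<in> carrier F" "snd (i l) = \<pi> b" using epiE[OF s'(8)] c(5)[OF l] by blast
    let ?d = "fst (i l) \<ominus>\<^bsub>F\<^esub> b \<cdot>\<^bsub>F\<^esub> x"
    have d: "?d \<in> carrier F" using b x c(4)[OF l] by simp
    have "\<pi> ?d = \<zero>\<^bsub>N\<^esub>"
      using b x c(2) c(4)[OF l] pullback_eq[OF pb s'(2,6) x l]
      by (simp add: hom_minus[OF s'(6,2,3)] hom_ract[OF s'(6)] N.diff_eq_zero_iff)
    then obtain y where y: "y \<in> carrier K" "?d = \<iota> y" using ses_ker[OF s, OF d] by blast
    obtain a where a: "a \<in> carrier ?G" "y = \<pi>' a" using epiE[OF t'(8) y(1)] by blast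
    have "i (p (a, b)) = (?d \<oplus>\<^bsub>F\<^esub> b \<cdot>\<^bsub>F\<^esub> x, snd (i l))" using p(2) a b y by simp
    also have "\<dots> = i l" using b x c(4)[OF l] by (simp add: F.M.diff_cancel prod_eq_iff)
    finally have "p (a, b) = l" using inj_onD[OF pp(5)] l hom_closed[OF p(1)] a b by auto
    then show "l \<in> p ` carrier ?P" using a b by (intro image_eqI[of _ _ "(a, b)"]) auto
  qed
  then have ep: "epi A ?P L p" using p(1) hom_closed[OF p(1)] by auto
  let ?j = "\<lambda>l. (fst (j l), \<iota> (snd (j l)))"
  note c' = hom_closed[OF pp'(3)] hom_closed[OF pp'(4)]
  have "ses A L' ?P L ?j p"
    unfolding ses_def
  proof (intro conjI pp'(1) Pm pp(1) p(1) ep[THEN conjunct2])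
    have h2: "(\<lambda>l. \<iota> (snd (j l))) \<in> rmod_hom A L' F" by (rule hom_comp[OF pp'(4) s'(4)])
    show "?j \<in> rmod_hom A L' ?P"
      by (rule rmod_homI) (simp_all add: hom_simps[OF pp'(3)] hom_simps[OF h2])
    show "inj_on ?j (carrier L')"
    proof (rule inj_onI)
      fix l l' assume l: "l \<in> carrier L'" "l' \<in> carrier L'" "?j l = ?j l'"
      then have "snd (j l) = snd (j l')" using inj_onD[OF s'(5)] c'(2) by auto
      then have "j l = j l'" using l(3) by (simp add: prod_eq_iff)
      then show "l = l'" using inj_onD[OF pp'(5)] l by auto
    qed
    show "?j ` carrier L' = {z \<in> carrier ?P. p z = \<zero>\<^bsub>L\<^esub>}"
    proof (intro equalityI subsetI)
      fix z assume "z \<in> ?j ` carrier L'"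
      then obtain l where l: "l \<in> carrier L'" "z = ?j l" by blast
      have z: "z \<in> carrier ?P" using l c'(1)[OF l(1)] c(1)[OF c'(2)[OF l(1)]] by simp
      have "\<pi>' (fst (j l)) = snd (j l) \<cdot>\<^bsub>K\<^esub> (\<ominus>\<^bsub>A\<^esub> x)" by (rule pullback_eq[OF pb' t'(2,6) mx(2) l(1)])
      then have "i (p z) = (\<zero>\<^bsub>F\<^esub>, \<zero>\<^bsub>N\<^esub>)"
        using p(2) z l c'(2)[OF l(1)] c(1)[OF c'(2)[OF l(1)]] x mx ses_zero[OF s c'(2)[OF l(1)]]
        by (simp add: hom_ract[OF s'(4)] F.ract_minus_right F.M.l_neg)
      also have "\<dots> = i \<zero>\<^bsub>L\<^esub>"
        using hom_zero[OF pp(3) pp(1) s'(2)] hom_zero[OF pp(4) pp(1) s'(3)] by (simp add: prod_eq_iff)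
      finally have "p z = \<zero>\<^bsub>L\<^esub>" using inj_onD[OF pp(5)] hom_closed[OF p(1) z] by auto
      with z show "z \<in> {z \<in> carrier ?P. p z = \<zero>\<^bsub>L\<^esub>}" by simp
    next
      fix z assume "z \<in> {z \<in> carrier ?P. p z = \<zero>\<^bsub>L\<^esub>}"
      then have z: "z \<in> carrier ?P" "p z = \<zero>\<^bsub>L\<^esub>" by auto
      have zz: "fst z \<in> carrier ?G" "snd z \<in> carrier F" using z(1) by auto
      have "i (p z) = (\<zero>\<^bsub>F\<^esub>, \<zero>\<^bsub>N\<^esub>)"
        using z(2) hom_zero[OF pp(3) pp(1) s'(2)] hom_zero[OF pp(4) pp(1) s'(3)] by (simp add: prod_eq_iff)
      then have e: "\<iota> (\<pi>' (fst z)) \<oplus>\<^bsub>F\<^esub> snd z \<cdot>\<^bsub>F\<^esub> x = \<zero>\<^bsub>F\<^esub>" "\<pi> (snd z) = \<zero>\<^bsub>N\<^esub>" using p(2) z(1) by auto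
      obtain y where y: "y \<in> carrier K" "snd z = \<iota> y" using ses_ker[OF s, OF zz(2) e(2)] by blast
      have "\<iota> (\<pi>' (fst z)) = \<ominus>\<^bsub>F\<^esub> (snd z \<cdot>\<^bsub>F\<^esub> x)"
        using e(1) zz c x by (intro F.M.minus_equality[symmetric]) auto
      also have "\<dots> = \<iota> (y \<cdot>\<^bsub>K\<^esub> (\<ominus>\<^bsub>A\<^esub> x))"
        using y x mx c by (simp add: hom_ract[OF s'(4)] F.ract_minus_right)
      finally have yy: "\<pi>' (fst z) = y \<cdot>\<^bsub>K\<^esub> (\<ominus>\<^bsub>A\<^esub> x)"
        using inj_onD[OF s'(5)] c(3)[OF zz(1)] y(1) mx by auto
      have "(fst z, y) \<in> carrier (prod_rmod ?G K)" using zz y by simp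
      moreover have "\<pi>' (fst (fst z, y)) \<ominus>\<^bsub>K\<^esub> snd (fst z, y) \<cdot>\<^bsub>K\<^esub> (\<ominus>\<^bsub>A\<^esub> x) = \<zero>\<^bsub>K\<^esub>"
        using yy y mx by (simp add: K.diff_eq_zero_iff)
      ultimately obtain l where l: "l \<in> carrier L'" "(fst z, y) = j l"
        using ses_ker[OF pb'[unfolded pullback_def]] by blast
      have "z = ?j l" using l(2) y(2) by (metis fst_conv snd_conv prod.collapse)
      with l show "z \<in> ?j ` carrier L'" by blast
    qed
  qed
  from loc_pd_SucD[OF T this P Suc(2)] have "loc_pd A (carrier A - q) k L'" .
  from Suc.IH[OF this L' pb' t G mx(1)] have "loc_pd A (carrier A - q) k K" .
  from loc_pd_SucI[OF T s F this] show ?case .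
qed

text \<open>This is the inequality that loses one degree. Injectivity of \<open>\<alpha>\<close>
  makes the first projection from the pullback to the cover of \<open>N\<close> injective, with
  image the kernel of the composite cover of \<open>Z\<close>; the pullback is therefore a syzygy of
  \<open>Z\<close>, and \<open>loc_pd_pullback\<close> carries its bound over to
  \<open>N\<close>.\<close>

lemma loc_pd_regular_quotient:
  assumes q: "primeideal q A" and x: "x \<in> q"
    and s: "ses A N N Z \<alpha> \<gamma>" and \<alpha>: "\<And>n. n \<in> carrier N \<Longrightarrow> \<alpha> n = n \<cdot>\<^bsub>N\<^esub> x"
    and N: "fin_gen A N" and pd: "loc_pd A (carrier A - q) (Suc k) Z"
  shows "loc_pd A (carrier A - q) k N"
proof -
  interpret q: primeideal q A by (rule q)
  have xA: "x \<in> carrier A" using x q.a_subset by auto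
  note s' = sesD[OF s]
  interpret N: right_module A N by (rule s')
  interpret Z: right_module A Z by (rule s')
  obtain K n i p where t: "ses A (K :: ('a, nat \<Rightarrow> 'a) rmod) (free_rmod A {..<n::nat}) N i p"
    by (rule fin_gen_ses[OF s'(1) N])
  let ?F = "free_rmod A {..<n}"
  note t' = sesD[OF t]
  have F: "projective_rmod A ?F" "fin_gen A ?F" using free_proj[OF A_ring] free_fin_gen[OF A_ring] by auto
  interpret F: right_module A ?F by (rule t')
  obtain L j where pb: "pullback (L :: ('a, nat \<Rightarrow> 'a) rmod) ?F N p x j" and L: "fin_gen A L"
    by (rule pullback_exists[OF t'(2) F(2) s'(1) t'(8) xA])
  note pp = pullback_props[OF pb t'(2)]
  interpret L: right_module A L by (rule pp)
  note c = hom_closed[OF t'(6)] hom_closed[OF s'(6)] hom_closed[OF pp(3)] hom_closed[OF pp(4)]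
  have \<gamma>p: "(\<lambda>f. \<gamma> (p f)) \<in> rmod_hom A ?F Z" by (rule hom_comp[OF t'(6) s'(6)])
  have x0: "y = \<zero>\<^bsub>N\<^esub>" if "y \<in> carrier N" "y \<cdot>\<^bsub>N\<^esub> x = \<zero>\<^bsub>N\<^esub>" for y
    using inj_onD[OF s'(5), of y "\<zero>\<^bsub>N\<^esub>"] that \<alpha> xA by simp
  have "ses A L ?F Z (\<lambda>l. fst (j l)) (\<lambda>f. \<gamma> (p f))"
    unfolding ses_def
  proof (intro conjI pp(1) t'(2) s'(3) pp(3) \<gamma>p)
    show "inj_on (\<lambda>l. fst (j l)) (carrier L)"
    proof (rule hom_inj[OF pp(3) pp(1) t'(2)])
      fix l assume l: "l \<in> carrier L" "fst (j l) = \<zero>\<^bsub>?F\<^esub>"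
      then have "snd (j l) \<cdot>\<^bsub>N\<^esub> x = \<zero>\<^bsub>N\<^esub>"
        using pullback_eq[OF pb t'(2,6) xA l(1)] hom_zero[OF t'(6,2,3)] by simp
      then have "snd (j l) = \<zero>\<^bsub>N\<^esub>" using x0 c(4)[OF l(1)] by blast
      then have "j l = j \<zero>\<^bsub>L\<^esub>"
        using l hom_zero[OF pp(3) pp(1) t'(2)] hom_zero[OF pp(4) pp(1) t'(3)] by (simp add: prod_eq_iff)
      then show "l = \<zero>\<^bsub>L\<^esub>" using inj_onD[OF pp(5)] l by auto
    qed
    show "(\<lambda>f. \<gamma> (p f)) ` carrier ?F = carrier Z"
      using t'(7) s'(7) by (metis image_image)
    show "(\<lambda>l. fst (j l)) ` carrier L = {f \<in> carrier ?F. \<gamma> (p f) = \<zero>\<^bsub>Z\<^esub>}"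
    proof (intro equalityI subsetI)
      fix f assume "f \<in> (\<lambda>l. fst (j l)) ` carrier L"
      then obtain l where l: "l \<in> carrier L" "f = fst (j l)" by blast
      have "p f = \<alpha> (snd (j l))" using pullback_eq[OF pb t'(2,6) xA l(1)] l \<alpha> c(4)[OF l(1)] by simp
      then show "f \<in> {f \<in> carrier ?F. \<gamma> (p f) = \<zero>\<^bsub>Z\<^esub>}"
        using l c(3)[OF l(1)] ses_zero[OF s c(4)[OF l(1)]] by simp
    next
      fix f assume "f \<in> {f \<in> carrier ?F. \<gamma> (p f) = \<zero>\<^bsub>Z\<^esub>}"
      then have f: "f \<in> carrier ?F" "\<gamma> (p f) = \<zero>\<^bsub>Z\<^esub>" by auto
      obtain y where y: "y \<in> carrier N" "p f = \<alpha> y" using ses_ker[OF s, of "p f"] c(1)[OF f(1)] f(2) by blast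
      have "(f, y) \<in> carrier (prod_rmod ?F N)" using f y by simp
      moreover have "p (fst (f, y)) \<ominus>\<^bsub>N\<^esub> snd (f, y) \<cdot>\<^bsub>N\<^esub> x = \<zero>\<^bsub>N\<^esub>"
        using y \<alpha> xA by (simp add: N.diff_eq_zero_iff)
      ultimately obtain l where "l \<in> carrier L" "(f, y) = j l"
        using ses_ker[OF pb[unfolded pullback_def]] by blast
      then show "f \<in> (\<lambda>l. fst (j l)) ` carrier L" by (metis fst_conv image_eqI)
    qed
  qed
  from loc_pd_SucD[OF primeideal_complement(1)[OF A_cring q] this F pd]
  show ?thesis by (rule loc_pd_pullback[OF q _ L pb t F x])
qed

end

section \<open>Krull dimension\<close>

lemma quotient_rmod:
  assumes "ideal I R"
  shows "right_module R (restr_rmod ((+>\<^bsub>R\<^esub>) I) (reg_rmod (R Quot I)))"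
    "epi R (reg_rmod R) (restr_rmod ((+>\<^bsub>R\<^esub>) I) (reg_rmod (R Quot I))) ((+>\<^bsub>R\<^esub>) I)"
    "{a \<in> carrier R. I +>\<^bsub>R\<^esub> a = \<zero>\<^bsub>restr_rmod ((+>\<^bsub>R\<^esub>) I) (reg_rmod (R Quot I))\<^esub>} = I"
proof -
  interpret ideal I R by fact
  note h = rcos_ring_hom
  show "right_module R (restr_rmod ((+>\<^bsub>R\<^esub>) I) (reg_rmod (R Quot I)))"
    by (rule restr_module[OF ring_axioms reg_module[OF quotient_is_ring] h])
  have "(+>\<^bsub>R\<^esub>) I ` carrier R = carrier (R Quot I)"
    by (auto simp: FactRing_def A_RCOSETS_def')
  then show "epi R (reg_rmod R) (restr_rmod ((+>\<^bsub>R\<^esub>) I) (reg_rmod (R Quot I))) ((+>\<^bsub>R\<^esub>) I)"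
    using ring_hom_memE[OF h] by (auto intro!: rmod_homI)
  show "{a \<in> carrier R. I +>\<^bsub>R\<^esub> a = \<zero>\<^bsub>restr_rmod ((+>\<^bsub>R\<^esub>) I) (reg_rmod (R Quot I))\<^esub>} = I"
    using rcos_const_imp_mem a_rcos_zero[OF is_ideal] a_subset by (auto simp: FactRing_def)
qed

text \<open>A nonempty chain of ideals in a noetherian ring contains its union, so Zorn's lemma
  applies to any nonempty family of ideals.\<close>

lemma (in noetherian_ring) maximal_ideal_in:
  assumes "S \<noteq> {}" "\<And>I. I \<in> S \<Longrightarrow> ideal I R"
  shows "\<exists>M\<in>S. \<forall>I\<in>S. M \<subseteq> I \<longrightarrow> I = M"
proof (rule subset_Zorn_nonempty[OF assms(1)])
  fix C assume C: "C \<noteq> {}" "subset.chain S C"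
  then have "subset.chain {I. ideal I R} C" "C \<subseteq> S" using assms(2) by (auto simp: subset.chain_def)
  then show "\<Union>C \<in> S" using ideal_chain_is_trivial[OF C(1)] by blast
qed

section \<open>Cyclic modules and chains of primes\<close>

context comm_noeth
begin

text \<open>\<open>N\<close> is a copy of \<open>A / I\<close> with projection \<open>\<pi>\<close>.
  Leaving the carrier open permits copies with elements of type \<open>nat \<Rightarrow> 'a\<close>,
  which cosets do not have.\<close>

definition cyclic :: "'a set \<Rightarrow> ('a, 'n) rmod \<Rightarrow> ('a \<Rightarrow> 'n) \<Rightarrow> bool" where
  "cyclic I N \<pi> \<longleftrightarrow> right_module A N \<and> epi A (reg_rmod A) N \<pi> \<and> I = {a \<in> carrier A. \<pi> a = \<zero>\<^bsub>N\<^esub>}"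

lemma cyclicD:
  assumes "cyclic I N \<pi>"
  shows "right_module A N" "\<pi> \<in> rmod_hom A (reg_rmod A) N" "epi A (reg_rmod A) N \<pi>"
    "\<And>a. a \<in> carrier A \<Longrightarrow> \<pi> a = \<zero>\<^bsub>N\<^esub> \<longleftrightarrow> a \<in> I" "I \<subseteq> carrier A" "fin_gen A N"
proof -
  show "right_module A N" "\<pi> \<in> rmod_hom A (reg_rmod A) N" "epi A (reg_rmod A) N \<pi>"
    "\<And>a. a \<in> carrier A \<Longrightarrow> \<pi> a = \<zero>\<^bsub>N\<^esub> \<longleftrightarrow> a \<in> I" "I \<subseteq> carrier A"
    using assms by (auto simp: cyclic_def)
  show "fin_gen A N"
    using assms fin_gen_img[OF reg_module[OF A_ring] _ _ reg_fin_gen[OF A_ring]] by (auto simp: cyclic_def)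
qed

lemma cyclic_elem: assumes "cyclic I N \<pi>" "n \<in> carrier N" obtains a where "a \<in> carrier A" "n = \<pi> a"
  using epiE[OF cyclicD(3)[OF assms(1)] assms(2)] by auto

lemma reg_A: "right_module A (reg_rmod A)"
  by (rule reg_module[OF A_ring])

lemma cyclic_exists:
  assumes "ideal I A"
  obtains N :: "('a, nat \<Rightarrow> 'a) rmod" and \<pi> where "cyclic I N \<pi>"
proof -
  let ?Q = "restr_rmod ((+>\<^bsub>A\<^esub>) I) (reg_rmod (A Quot I))"
  note q = quotient_rmod[OF assms]
  have fg: "fin_gen A ?Q" by (rule fin_gen_img[OF reg_A q(1,2) reg_fin_gen[OF A_ring]])
  obtain N f g where N: "right_module A (N :: ('a, nat \<Rightarrow> 'a) rmod)" "f \<in> rmod_hom A ?Q N" "g \<in> rmod_hom A N ?Q"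
    "bij_betw f (carrier ?Q) (carrier N)" "bij_betw g (carrier N) (carrier ?Q)"
    "\<forall>x\<in>carrier ?Q. g (f x) = x" "\<forall>x\<in>carrier N. f (g x) = x" "fin_gen A N"
    by (rule fin_gen_copy[OF q(1) fg])
  have c: "I +>\<^bsub>A\<^esub> a \<in> carrier ?Q" if "a \<in> carrier A" for a
    using q(2) that by (auto simp: rmod_hom_def)
  have "f (I +>\<^bsub>A\<^esub> a) = \<zero>\<^bsub>N\<^esub> \<longleftrightarrow> I +>\<^bsub>A\<^esub> a = \<zero>\<^bsub>?Q\<^esub>" if "a \<in> carrier A" for a
    using c[OF that] N(6) hom_zero[OF N(2) q(1) N(1)] hom_zero[OF N(3) N(1) q(1)] by metis
  then have "{a \<in> carrier A. f (I +>\<^bsub>A\<^esub> a) = \<zero>\<^bsub>N\<^esub>} = I" using q(3) by blast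
  moreover have "(\<lambda>a. f (I +>\<^bsub>A\<^esub> a)) ` carrier (reg_rmod A) = carrier N"
    using q(2) N(4) by (metis bij_betw_imp_surj_on image_image)
  moreover have "(\<lambda>a. f (I +>\<^bsub>A\<^esub> a)) \<in> rmod_hom A (reg_rmod A) N"
    using q(2) N(2) by (blast intro: hom_comp)
  ultimately have "cyclic I N (\<lambda>a. f (I +>\<^bsub>A\<^esub> a))" unfolding cyclic_def using N(1) by simp
  then show thesis by (rule that)
qed

lemma cyclic_map:
  assumes N: "cyclic I N \<pi>" and Z: "cyclic J Z \<zeta>" and a: "a \<in> carrier A" and "\<And>r. r \<in> I \<Longrightarrow> a \<otimes>\<^bsub>A\<^esub> r \<in> J"
  obtains \<alpha> where "\<alpha> \<in> rmod_hom A N Z" "\<forall>r\<in>carrier A. \<alpha> (\<pi> r) = \<zeta> (a \<otimes>\<^bsub>A\<^esub> r)"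
proof -
  note N' = cyclicD[OF N] and Z' = cyclicD[OF Z]
  have h: "(\<lambda>r. \<zeta> (a \<otimes>\<^bsub>A\<^esub> r)) \<in> rmod_hom A (reg_rmod A) Z"
    using hom_comp[OF reg_hom[OF reg_A] Z'(2), of a] a by simp
  show thesis
  proof (rule epi_factor[OF reg_A N'(1) Z'(1) N'(3) h])
    show "\<zeta> (a \<otimes>\<^bsub>A\<^esub> r) = \<zero>\<^bsub>Z\<^esub>" if "r \<in> carrier (reg_rmod A)" "\<pi> r = \<zero>\<^bsub>N\<^esub>" for r
      using that a N'(4) Z'(4) assms(4) by simp
  qed (use that in simp)
qed

lemma cyclic_ideal: assumes "cyclic I N \<pi>" shows "ideal I A"
proof -
  note N' = cyclicD[OF assms]
  have "I = {a \<in> carrier (reg_rmod A). \<pi> a = \<zero>\<^bsub>N\<^esub>}" using assms by (simp add: cyclic_def)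
  with submod_ker[OF N'(2) reg_A N'(1)] show ?thesis by (simp add: submod_reg_iff[OF A_cring])
qed

text \<open>The exact sequence from \<open>A / (I : a)\<close> through \<open>A / I\<close> to
  \<open>A / (I + a A)\<close>, the first map being multiplication by \<open>a\<close>. The set
  \<open>K\<close> is \<open>I + a A\<close>, written as the preimage of the multiples of
  \<open>\<pi> a\<close>.\<close>

lemma cyclic_colon:
  assumes N: "cyclic I N \<pi>" and a: "a \<in> carrier A"
  defines "J \<equiv> {r \<in> carrier A. a \<otimes>\<^bsub>A\<^esub> r \<in> I}"
  defines "K \<equiv> {b \<in> carrier A. \<exists>r\<in>carrier A. \<pi> b = \<pi> (a \<otimes>\<^bsub>A\<^esub> r)}"
  shows "ideal J A" "ideal K A" "I \<subseteq> J" "I \<subseteq> K" "a \<in> K"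
    and "cyclic J X \<chi> \<Longrightarrow> cyclic K Z \<zeta> \<Longrightarrow>
      \<exists>\<alpha> \<gamma>. ses A X N Z \<alpha> \<gamma> \<and> (\<forall>r\<in>carrier A. \<alpha> (\<chi> r) = \<pi> (a \<otimes>\<^bsub>A\<^esub> r))"
proof -
  note N' = cyclicD[OF N]
  interpret N: right_module A N by (rule N')
  have ah: "(\<lambda>r. a \<otimes>\<^bsub>A\<^esub> r) \<in> rmod_hom A (reg_rmod A) (reg_rmod A)" using reg_hom[OF reg_A, of a] a by simp
  have h: "(\<lambda>r. \<pi> (a \<otimes>\<^bsub>A\<^esub> r)) \<in> rmod_hom A (reg_rmod A) N" by (rule hom_comp[OF ah N'(2)])
  have J: "J = {r \<in> carrier (reg_rmod A). \<pi> (a \<otimes>\<^bsub>A\<^esub> r) = \<zero>\<^bsub>N\<^esub>}" using a N'(4) by (auto simp: J_def)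
  show Ji: "ideal J A" using submod_ker[OF h reg_A N'(1)] unfolding J submod_reg_iff[OF A_cring] .
  have K: "K = {b \<in> carrier (reg_rmod A). \<pi> b \<in> (\<lambda>r. \<pi> (a \<otimes>\<^bsub>A\<^esub> r)) ` carrier (reg_rmod A)}"
    by (auto simp: K_def)
  show "ideal K A"
    using submod_vimg[OF N'(2) reg_A N'(1) submod_img[OF h reg_A N'(1) submod_carrier[OF reg_A]]]
    unfolding K submod_reg_iff[OF A_cring] .
  have I: "ideal I A" by (rule cyclic_ideal[OF N])
  show "I \<subseteq> J" using ideal.I_l_closed[OF I] a N'(5) by (auto simp: J_def)
  have z: "\<pi> \<zero>\<^bsub>A\<^esub> = \<zero>\<^bsub>N\<^esub>" using hom_zero[OF N'(2) reg_A N'(1)] by simp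
  show IK: "I \<subseteq> K"
  proof
    fix b assume b: "b \<in> I"
    then have bA: "b \<in> carrier A" using N'(5) by auto
    have "\<pi> b = \<zero>\<^bsub>N\<^esub>" using N'(4)[OF bA] b by blast
    then have "\<pi> b = \<pi> (a \<otimes>\<^bsub>A\<^esub> \<zero>\<^bsub>A\<^esub>)" using z a by simp
    with bA show "b \<in> K" unfolding K_def by blast
  qed
  have "\<pi> a = \<pi> (a \<otimes>\<^bsub>A\<^esub> \<one>\<^bsub>A\<^esub>)" using a by simp
  then show "a \<in> K" unfolding K_def using a by blast
  assume X: "cyclic J X \<chi>" and Z: "cyclic K Z \<zeta>"
  note X' = cyclicD[OF X] and Z' = cyclicD[OF Z]
  obtain \<alpha> where \<alpha>: "\<alpha> \<in> rmod_hom A X N" "\<forall>r\<in>carrier A. \<alpha> (\<chi> r) = \<pi> (a \<otimes>\<^bsub>A\<^esub> r)"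
    by (rule cyclic_map[OF X N a]) (auto simp: J_def)
  obtain \<gamma> where \<gamma>: "\<gamma> \<in> rmod_hom A N Z" "\<forall>r\<in>carrier A. \<gamma> (\<pi> r) = \<zeta> (\<one>\<^bsub>A\<^esub> \<otimes>\<^bsub>A\<^esub> r)"
    by (rule cyclic_map[OF N Z A.one_closed]) (use IK N'(5) in \<open>auto simp: subset_iff\<close>)
  have \<gamma>': "\<gamma> (\<pi> r) = \<zeta> r" if "r \<in> carrier A" for r using \<gamma>(2) that by simp
  have "ses A X N Z \<alpha> \<gamma>"
    unfolding ses_def
  proof (intro conjI X'(1) N'(1) Z'(1) \<alpha>(1) \<gamma>(1))
    show "inj_on \<alpha> (carrier X)"
    proof (rule hom_inj[OF \<alpha>(1) X'(1) N'(1)])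
      fix x assume x: "x \<in> carrier X" "\<alpha> x = \<zero>\<^bsub>N\<^esub>"
      obtain r where r: "r \<in> carrier A" "x = \<chi> r" by (rule cyclic_elem[OF X x(1)])
      then have "a \<otimes>\<^bsub>A\<^esub> r \<in> I" using x \<alpha>(2) N'(4) a by simp
      then show "x = \<zero>\<^bsub>X\<^esub>" using r X'(4) by (simp add: J_def)
    qed
    have "\<zeta> ` carrier A = carrier Z" using Z'(3) by simp
    moreover have "\<gamma> ` carrier N = \<gamma> ` \<pi> ` carrier A" using N'(3) by simp
    ultimately show "\<gamma> ` carrier N = carrier Z" using \<gamma>' by (simp add: image_image)
    show "\<alpha> ` carrier X = {n \<in> carrier N. \<gamma> n = \<zero>\<^bsub>Z\<^esub>}"
    proof (intro equalityI subsetI)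
      fix n assume "n \<in> \<alpha> ` carrier X"
      then obtain x where x: "x \<in> carrier X" "n = \<alpha> x" by blast
      obtain r where r: "r \<in> carrier A" "x = \<chi> r" by (rule cyclic_elem[OF X x(1)])
      then have n: "n = \<pi> (a \<otimes>\<^bsub>A\<^esub> r)" using x \<alpha>(2) by simp
      have "a \<otimes>\<^bsub>A\<^esub> r \<in> K" using r a unfolding K_def by blast
      then show "n \<in> {n \<in> carrier N. \<gamma> n = \<zero>\<^bsub>Z\<^esub>}"
        using n r a \<gamma>' Z'(4) hom_closed[OF N'(2)] by simp
    next
      fix n assume "n \<in> {n \<in> carrier N. \<gamma> n = \<zero>\<^bsub>Z\<^esub>}"
      then have n: "n \<in> carrier N" "\<gamma> n = \<zero>\<^bsub>Z\<^esub>" by auto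
      obtain b where b: "b \<in> carrier A" "n = \<pi> b" by (rule cyclic_elem[OF N n(1)])
      then have "b \<in> K" using n \<gamma>' Z'(4) by simp
      then obtain r where r: "r \<in> carrier A" "n = \<pi> (a \<otimes>\<^bsub>A\<^esub> r)" using b unfolding K_def by auto
      then have "n = \<alpha> (\<chi> r)" using \<alpha>(2) by simp
      moreover have "\<chi> r \<in> carrier X" using hom_closed[OF X'(2)] r by simp
      ultimately show "n \<in> \<alpha> ` carrier X" by blast
    qed
  qed
  with \<alpha>(2) show "\<exists>\<alpha> \<gamma>. ses A X N Z \<alpha> \<gamma> \<and> (\<forall>r\<in>carrier A. \<alpha> (\<chi> r) = \<pi> (a \<otimes>\<^bsub>A\<^esub> r))" by blast
qed

lemma loc_pd_cyclic_cong:
  assumes T: "T \<subseteq> carrier A" and N: "cyclic I N \<pi>" and N': "cyclic I N' \<pi>'" and pd: "loc_pd A T k N'"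
  shows "loc_pd A T k N"
proof -
  have I: "I \<subseteq> carrier A" using cyclicD(5)[OF N] .
  obtain f where f: "f \<in> rmod_hom A N N'" "\<forall>r\<in>carrier A. f (\<pi> r) = \<pi>' (\<one>\<^bsub>A\<^esub> \<otimes>\<^bsub>A\<^esub> r)"
    by (rule cyclic_map[OF N N' A.one_closed]) (use I in \<open>auto simp: subset_iff\<close>)
  obtain g where g: "g \<in> rmod_hom A N' N" "\<forall>r\<in>carrier A. g (\<pi>' r) = \<pi> (\<one>\<^bsub>A\<^esub> \<otimes>\<^bsub>A\<^esub> r)"
    by (rule cyclic_map[OF N' N A.one_closed]) (use I in \<open>auto simp: subset_iff\<close>)
  show ?thesis
  proof (rule loc_pd_retract_id[OF T pd cyclicD(1,6)[OF N] cyclicD(1,6)[OF N'] f(1) g(1)])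
    fix n assume "n \<in> carrier N"
    then obtain r where "r \<in> carrier A" "n = \<pi> r" by (rule cyclic_elem[OF N])
    then show "g (f n) = n" using f(2) g(2) by simp
  qed
qed

text \<open>For a prime \<open>p\<close> not containing \<open>x\<close> the colon ideal
  \<open>(p : x)\<close> is \<open>p\<close> itself, so \<open>x\<close> is regular on
  \<open>A / p\<close> and \<open>Z\<close> is the quotient by it.\<close>

lemma loc_pd_drop_aux:
  assumes q: "primeideal q A" and p: "primeideal p A" and N: "cyclic p N \<pi>" and x: "x \<in> q" "x \<notin> p"
    and Z: "cyclic {b \<in> carrier A. \<exists>r\<in>carrier A. \<pi> b = \<pi> (x \<otimes>\<^bsub>A\<^esub> r)} Z \<zeta>"
    and pd: "loc_pd A (carrier A - q) (Suc k) Z"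
  shows "loc_pd A (carrier A - q) k N"
proof -
  interpret q: primeideal q A by (rule q)
  interpret p: primeideal p A by (rule p)
  note N' = cyclicD[OF N]
  have xA: "x \<in> carrier A" using x q.a_subset by auto
  have J: "{r \<in> carrier A. x \<otimes>\<^bsub>A\<^esub> r \<in> p} = p"
    using p.I_prime[OF xA] x(2) p.I_l_closed[OF _ xA] p.a_subset by auto
  obtain \<alpha> \<gamma> where s: "ses A N N Z \<alpha> \<gamma>" and \<alpha>: "\<forall>r\<in>carrier A. \<alpha> (\<pi> r) = \<pi> (x \<otimes>\<^bsub>A\<^esub> r)"
    using cyclic_colon(6)[OF N xA, unfolded J, OF N Z] by blast
  have "\<alpha> n = n \<cdot>\<^bsub>N\<^esub> x" if n: "n \<in> carrier N" for n
  proof -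
    obtain r where r: "r \<in> carrier A" "n = \<pi> r" by (rule cyclic_elem[OF N n])
    then have "\<alpha> n = \<pi> (r \<otimes>\<^bsub>A\<^esub> x)" using \<alpha> xA by (simp add: A.m_comm)
    also have "\<dots> = n \<cdot>\<^bsub>N\<^esub> x" using hom_ract[OF N'(2), of r x] r xA by simp
    finally show ?thesis .
  qed
  from loc_pd_regular_quotient[OF q x(1) s this N'(6) pd] show ?thesis .
qed

text \<open>The residue field at \<open>q\<close> controls all cyclic modules. The proof takes an
  ideal \<open>M\<close> that is maximal among those whose quotient violates the bound, and compares
  \<open>A / M\<close> with quotients by strictly larger ideals.\<close>

lemma loc_pd_all_cyclic:
  assumes q: "primeideal q A" and Q: "cyclic q Nq \<pi>q" and pd: "loc_pd A (carrier A - q) (Suc k) Nq"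
    and "cyclic I N \<pi>"
  shows "loc_pd A (carrier A - q) (Suc k) N"
proof (rule ccontr)
  assume bad: "\<not> loc_pd A (carrier A - q) (Suc k) N"
  let ?T = "carrier A - q"
  note T = primeideal_complement[OF A_cring q]
  interpret q: primeideal q A by (rule q)
  interpret noetherian_ring A by (rule A_noeth)
  define S where "S = {I. \<exists>N \<pi>. cyclic I N \<pi> \<and> \<not> loc_pd A ?T (Suc k) N}"
  have "S \<noteq> {}" using bad assms(4) by (auto simp: S_def)
  moreover have "ideal I A" if "I \<in> S" for I using that cyclic_ideal by (auto simp: S_def)
  ultimately obtain M where M: "M \<in> S" and max: "\<forall>I\<in>S. M \<subseteq> I \<longrightarrow> I = M"
    using maximal_ideal_in by blast
  obtain L \<kappa> where L: "cyclic M L \<kappa>" "\<not> loc_pd A ?T (Suc k) L" using M by (auto simp: S_def)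
  note L' = cyclicD[OF L(1)]
  have good: "loc_pd A ?T (Suc k) X" if "cyclic J X \<chi>" "M \<subseteq> J" "J \<noteq> M" for J X \<chi>
    using that max unfolding S_def by blast
  have Mi: "ideal M A" by (rule cyclic_ideal[OF L(1)])
  interpret M: ideal M A by (rule Mi)
  \<comment> \<open>An element of \<open>M\<close> outside \<open>q\<close> is a denominator that
    annihilates \<open>A / M\<close>, whose localisation is then zero.\<close>
  have Mq: "M \<subseteq> q"
  proof (rule ccontr)
    assume "\<not> M \<subseteq> q"
    then obtain s where s: "s \<in> M" "s \<notin> q" by blast
    have sA: "s \<in> carrier A" using s L'(5) by auto
    have "loc_proj A ?T L"
    proof (rule loc_proj_killed[OF L'(1,6)])
      show "s \<in> ?T" using s sA by simp
      fix y assume "y \<in> carrier L"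
      then obtain r where r: "r \<in> carrier A" "y = \<kappa> r" by (rule cyclic_elem[OF L(1)])
      have "\<kappa> (r \<otimes>\<^bsub>A\<^esub> s) = \<zero>\<^bsub>L\<^esub>" using M.I_l_closed[OF s(1) r(1)] L'(4) r(1) sA by simp
      then show "y \<cdot>\<^bsub>L\<^esub> s = \<zero>\<^bsub>L\<^esub>" using hom_ract[OF L'(2), of r s] r sA by simp
    qed
    then have "loc_pd A ?T 0 L" by simp
    from loc_pd_mono[OF T(1) this L'(1,6), of "Suc k"] L(2) show False by simp
  qed
  show False
  proof (cases "primeideal M A")
    case True
    \<comment> \<open>A prime \<open>M\<close> is strictly contained in \<open>q\<close>; dividing
      \<open>A / M\<close> by a regular element of \<open>q\<close> leads to a larger ideal, and the
      loss of one degree even improves the bound.\<close>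
    have "M \<noteq> q" using loc_pd_cyclic_cong[OF T(1) L(1) _ pd] Q L(2) by blast
    then obtain x where x: "x \<in> q" "x \<notin> M" using Mq by blast
    have xA: "x \<in> carrier A" using x q.a_subset by auto
    let ?K = "{b \<in> carrier A. \<exists>r\<in>carrier A. \<kappa> b = \<kappa> (x \<otimes>\<^bsub>A\<^esub> r)}"
    note K = cyclic_colon[OF L(1) xA]
    obtain Z \<zeta> where Z: "cyclic ?K (Z :: ('a, nat \<Rightarrow> 'a) rmod) \<zeta>" by (rule cyclic_exists[OF K(2)])
    have "loc_pd A ?T (Suc k) Z" by (rule good[OF Z K(4)]) (use K(5) x in blast)
    from loc_pd_drop_aux[OF q True L(1) x Z this] have "loc_pd A ?T k L" .
    from loc_pd_mono_Suc[OF T(1) this L'(1,6)] L(2) show False by simp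
  next
    case False
    have "carrier A \<noteq> M" using Mq q.I_notcarr q.a_subset by auto
    then obtain a b where ab: "a \<in> carrier A" "b \<in> carrier A" "a \<otimes>\<^bsub>A\<^esub> b \<in> M" "a \<notin> M" "b \<notin> M"
      using M.primeidealCD[OF A_cring False] by auto
    \<comment> \<open>The colon ideal contains \<open>b\<close> and \<open>?K\<close> contains
      \<open>a\<close>, so both are strictly larger than \<open>M\<close>, and \<open>A / M\<close>
      is an extension of quotients that satisfy the bound.\<close>
    let ?J = "{r \<in> carrier A. a \<otimes>\<^bsub>A\<^esub> r \<in> M}"
    let ?K = "{b \<in> carrier A. \<exists>r\<in>carrier A. \<kappa> b = \<kappa> (a \<otimes>\<^bsub>A\<^esub> r)}"
    note K = cyclic_colon[OF L(1) ab(1)]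
    obtain X \<chi> where X: "cyclic ?J (X :: ('a, nat \<Rightarrow> 'a) rmod) \<chi>" by (rule cyclic_exists[OF K(1)])
    obtain Z \<zeta> where Z: "cyclic ?K (Z :: ('a, nat \<Rightarrow> 'a) rmod) \<zeta>" by (rule cyclic_exists[OF K(2)])
    have pX: "loc_pd A ?T (Suc k) X" by (rule good[OF X K(3)]) (use ab in blast)
    have pZ: "loc_pd A ?T (Suc k) Z" by (rule good[OF Z K(4)]) (use K(5) ab in blast)
    obtain \<alpha> \<gamma> where "ses A X L Z \<alpha> \<gamma>" using K(6)[OF X Z] by blast
    from loc_pd_extension[OF T(1,3) this L'(6) pX pZ] L(2) show False by simp
  qed
qed

text \<open>One step down a chain of primes. With \<open>x\<close> in \<open>q\<close> but not in
  \<open>p\<close>, the bound at \<open>q\<close> reaches \<open>A / (p + x A)\<close> and, one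
  degree lower, \<open>A / p\<close>; localising further from \<open>q\<close> to \<open>p\<close>
  returns to a residue field.\<close>

lemma loc_pd_drop:
  assumes q: "primeideal q A" and p: "primeideal p A" and pq: "p \<subset> q" and N: "cyclic p N \<pi>"
    and Q: "cyclic q Nq \<pi>q" and pd: "loc_pd A (carrier A - q) (Suc k) Nq"
  shows "loc_pd A (carrier A - p) k N"
proof -
  interpret q: primeideal q A by (rule q)
  obtain x where x: "x \<in> q" "x \<notin> p" using pq by blast
  have xA: "x \<in> carrier A" using x q.a_subset by auto
  note K = cyclic_colon[OF N xA]
  let ?K = "{b \<in> carrier A. \<exists>r\<in>carrier A. \<pi> b = \<pi> (x \<otimes>\<^bsub>A\<^esub> r)}"
  obtain Z \<zeta> where Z: "cyclic ?K (Z :: ('a, nat \<Rightarrow> 'a) rmod) \<zeta>" by (rule cyclic_exists[OF K(2)])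
  have "loc_pd A (carrier A - q) k N"
    by (rule loc_pd_drop_aux[OF q p N x Z loc_pd_all_cyclic[OF q Q pd Z]])
  then show ?thesis by (rule loc_pd_subset[rotated]) (use pq in blast)
qed

text \<open>If the residue field at \<open>q\<close> were projective, the generator would lift, up
  to a denominator \<open>s\<close>, to a ring element \<open>c\<close> with \<open>c y\<close> zero
  for some \<open>y\<close> in \<open>q\<close> outside \<open>p\<close>. Then \<open>c\<close> lies
  in \<open>p\<close> and hence in \<open>q\<close>, so \<open>s\<close> vanishes in
  \<open>A / q\<close>, contradicting the choice of \<open>s\<close>.\<close>

lemma not_loc_proj_nonminimal:
  assumes q: "primeideal q A" and p: "primeideal p A" and pq: "p \<subset> q" and Q: "cyclic q N \<pi>"
  shows "\<not> loc_proj A (carrier A - q) N"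
proof
  assume lp: "loc_proj A (carrier A - q) N"
  interpret q: primeideal q A by (rule q)
  interpret p: primeideal p A by (rule p)
  note N = cyclicD[OF Q]
  interpret N: right_module A N by (rule N)
  from lp obtain s n u v where s: "s \<in> carrier A" "s \<notin> q" and u: "u \<in> rmod_hom A N (free_rmod A {..<n::nat})"
    and v: "v \<in> rmod_hom A (free_rmod A {..<n}) N" and vu: "\<forall>x\<in>carrier N. v (u x) = x \<cdot>\<^bsub>N\<^esub> s"
    by (auto simp: loc_proj_def)
  let ?F = "free_rmod A {..<n}"
  have Fm: "right_module A ?F" by (rule free_module[OF A_ring])
  obtain w where w: "w \<in> rmod_hom A ?F (reg_rmod A)" "\<forall>f\<in>carrier ?F. \<pi> (w f) = v f"
    by (rule proj_lift[OF free_proj[OF A_ring] reg_A N(1,3) v])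
  obtain y where y: "y \<in> q" "y \<notin> p" using pq by blast
  have yA: "y \<in> carrier A" using y q.a_subset by auto
  have p1: "\<pi> \<one>\<^bsub>A\<^esub> \<in> carrier N" using hom_closed[OF N(2)] by simp
  have up: "u (\<pi> \<one>\<^bsub>A\<^esub>) \<in> carrier ?F" using hom_closed[OF u p1] .
  let ?c = "w (u (\<pi> \<one>\<^bsub>A\<^esub>))"
  have c: "?c \<in> carrier A" using hom_closed[OF w(1) up] by simp
  have "\<pi> y = \<zero>\<^bsub>N\<^esub>" using N(4) y yA by blast
  then have "\<pi> \<one>\<^bsub>A\<^esub> \<cdot>\<^bsub>N\<^esub> y = \<zero>\<^bsub>N\<^esub>" using hom_ract[OF N(2), of "\<one>\<^bsub>A\<^esub>" y] yA by simp
  then have "u (\<pi> \<one>\<^bsub>A\<^esub>) \<cdot>\<^bsub>?F\<^esub> y = \<zero>\<^bsub>?F\<^esub>" using hom_ract[OF u p1 yA] hom_zero[OF u N(1) Fm] by simp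
  then have "?c \<otimes>\<^bsub>A\<^esub> y = \<zero>\<^bsub>A\<^esub>" using hom_ract[OF w(1) up yA] hom_zero[OF w(1) Fm reg_A] by simp
  then have "?c \<in> p" using p.I_prime[OF c yA] y(2) by simp
  then have "?c \<in> q" using pq by blast
  then have "v (u (\<pi> \<one>\<^bsub>A\<^esub>)) = \<zero>\<^bsub>N\<^esub>" using w(2) up N(4) c by metis
  then have "\<pi> s = \<zero>\<^bsub>N\<^esub>" using vu p1 hom_ract[OF N(2), of "\<one>\<^bsub>A\<^esub>" s] s by simp
  then show False using N(4) s by simp
qed

text \<open>A uniform bound \<open>d\<close> loses one degree at every inclusion of a chain,
  starting from its largest prime, and a chain longer than \<open>d\<close> would exhaust it above a
  smaller prime.\<close>

theorem krull_dim_le: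
  assumes "\<And>N :: ('a, nat \<Rightarrow> 'a) rmod. right_module A N \<Longrightarrow> fin_gen A N \<Longrightarrow> loc_pd A {\<one>\<^bsub>A\<^esub>} d N"
  shows "krull_dim A \<le> enat d"
  unfolding krull_dim_def
proof (rule Sup_least)
  fix e assume "e \<in> {enat n |n. \<exists>p. (\<forall>i\<le>n. primeideal (p i) A) \<and> (\<forall>i<n. p i \<subset> p (Suc i))}"
  then obtain n p where e: "e = enat n" and p: "\<And>i. i \<le> n \<Longrightarrow> primeideal (p i) A"
    and chain: "\<And>i. i < n \<Longrightarrow> p i \<subset> p (Suc i)" by auto
  have "\<not> d < n"
  proof
    assume dn: "d < n"
    \<comment> \<open>The primes are visited from the top: \<open>j\<close> counts the steps
      downwards, and each lowers the bound by one.\<close>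
    have *: "j \<le> d \<Longrightarrow> cyclic (p (n - j)) N \<pi> \<Longrightarrow> loc_pd A (carrier A - p (n - j)) (d - j) N"
      for j and N :: "('a, nat \<Rightarrow> 'a) rmod" and \<pi>
    proof (induction j arbitrary: N \<pi>)
      case 0
      have "loc_pd A {\<one>\<^bsub>A\<^esub>} d N" by (rule assms[OF cyclicD(1,6)[OF 0(2)]])
      then show ?case
        using loc_pd_subset[of "{\<one>\<^bsub>A\<^esub>}" "carrier A - p n"] primeideal_complement(2)[OF A_cring p[of n]] by simp
    next
      case (Suc j)
      have sub: "p (n - Suc j) \<subset> p (n - j)" using chain[of "n - Suc j"] Suc(2) dn by (simp add: Suc_diff_Suc)
      obtain N' \<pi>' where N': "cyclic (p (n - j)) (N' :: ('a, nat \<Rightarrow> 'a) rmod) \<pi>'"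
        using cyclic_exists[OF primeideal.axioms(1)[OF p[of "n - j"]]] by auto
      have "loc_pd A (carrier A - p (n - j)) (Suc (d - Suc j)) N'"
        using Suc.IH[OF _ N'] Suc(2) by (simp add: Suc_diff_Suc)
      from loc_pd_drop[OF p p sub Suc(3) N' this] show ?case by simp
    qed
    obtain N \<pi> where N: "cyclic (p (n - d)) (N :: ('a, nat \<Rightarrow> 'a) rmod) \<pi>"
      using cyclic_exists[OF primeideal.axioms(1)[OF p[of "n - d"]]] by auto
    have "loc_proj A (carrier A - p (n - d)) N" using *[OF _ N] by simp
    \<comment> \<open>After \<open>d\<close> steps the bound is zero, while \<open>d < n\<close>
      leaves at least one more prime below the one reached.\<close>
    moreover have "p (n - Suc d) \<subset> p (n - d)" using chain[of "n - Suc d"] dn by (simp add: Suc_diff_Suc)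
    ultimately show False using not_loc_proj_nonminimal[OF p p _ N, of "n - Suc d"] by simp
  qed
  then show "e \<le> enat d" by (simp add: e)
qed

end

section \<open>Comparison with projective resolutions\<close>

lemma proj_resolutionD:
  assumes "proj_resolution R M n P d"
  shows "\<And>i. i \<le> n \<Longrightarrow> projective_rmod R (P i)" "d 0 \<in> rmod_hom R (P 0) M"
    "\<And>i. i < n \<Longrightarrow> d (Suc i) \<in> rmod_hom R (P (Suc i)) (P i)"
    "d 0 ` carrier (P 0) = carrier M"
    "0 < n \<Longrightarrow> d 1 ` carrier (P 1) = {x \<in> carrier (P 0). d 0 x = \<zero>\<^bsub>M\<^esub>}"
    "\<And>i. Suc i < n \<Longrightarrow> d (Suc (Suc i)) ` carrier (P (Suc (Suc i))) =
        {x \<in> carrier (P (Suc i)). d (Suc i) x = \<zero>\<^bsub>P i\<^esub>}"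
    "inj_on (d n) (carrier (P n))"
  using assms by (auto simp: proj_resolution_def)

text \<open>Removing \<open>P 0\<close> leaves a resolution of the kernel of the augmentation, so
  lengths can be handled by induction through syzygies.\<close>

lemma proj_resolution_syzygy:
  assumes M: "right_module R M" and r: "proj_resolution R M (Suc n) P d"
  defines "K \<equiv> (P 0)\<lparr>carrier := {x \<in> carrier (P 0). d 0 x = \<zero>\<^bsub>M\<^esub>}\<rparr>"
  shows "ses R K (P 0) M (\<lambda>x. x) (d 0)" "proj_resolution R K n (\<lambda>i. P (Suc i)) (\<lambda>i. d (Suc i))"
proof -
  note r' = proj_resolutionD[OF r]
  have P0: "right_module R (P 0)" using r'(1)[of 0] by (simp add: proj_module)
  show "ses R K (P 0) M (\<lambda>x. x) (d 0)"
    unfolding K_def using r'(2,4) by (intro ses_sub P0 M) simp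
  have d1: "d 1 ` carrier (P 1) = carrier K" using r'(5) by (simp add: K_def)
  have "d 1 \<in> rmod_hom R (P 1) K"
    unfolding K_def using r'(3)[of 0] d1 by (intro hom_into_sub) (auto simp: K_def)
  moreover have "{x \<in> carrier (P 1). d 1 x = \<zero>\<^bsub>K\<^esub>} = {x \<in> carrier (P 1). d 1 x = \<zero>\<^bsub>P 0\<^esub>}"
    by (simp add: K_def)
  ultimately show "proj_resolution R K n (\<lambda>i. P (Suc i)) (\<lambda>i. d (Suc i))"
    unfolding proj_resolution_def using r'(1,3,6,7) r'(6)[of 0] d1 by auto
qed

section \<open>Change of rings along a surjection\<close>

context comm_noeth
begin

text \<open>Since finite free modules over \<open>A\<close> become projective over \<open>R\<close>,
  a syzygy of \<open>N\<close> over \<open>A\<close> is also one over \<open>R\<close> and can be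
  compared with the kernels of the given resolution. As in \<open>loc_pd_retract\<close>,
  \<open>N\<close> is only assumed to be a summand of \<open>M\<close> up to projective modules,
  because the comparison of syzygies gives no more.\<close>

lemma loc_pd_le_resolution:
  fixes R :: "('c, 'q) ring_scheme" and N :: "('a, nat \<Rightarrow> 'a) rmod" and Q :: "('c, nat \<Rightarrow> 'a) rmod"
    and M :: "('c, 'b) rmod"
  assumes R: "ring R" and \<phi>: "\<phi> \<in> ring_hom R A" "\<phi> ` carrier R = carrier A"
    and free: "\<And>m::nat. projective_rmod R (restr_rmod \<phi> (free_rmod A {..<m}))"
  shows "proj_resolution R M n P d \<Longrightarrow> right_module R M \<Longrightarrow> right_module A N \<Longrightarrow> fin_gen A N
    \<Longrightarrow> f \<in> rmod_hom R (restr_rmod \<phi> N) M \<Longrightarrow> g \<in> rmod_hom R M (restr_rmod \<phi> N)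
    \<Longrightarrow> projective_rmod R Q \<Longrightarrow> u \<in> rmod_hom R (restr_rmod \<phi> N) Q \<Longrightarrow> v \<in> rmod_hom R Q (restr_rmod \<phi> N)
    \<Longrightarrow> (\<forall>x\<in>carrier N. g (f x) = x \<oplus>\<^bsub>N\<^esub> v (u x))
    \<Longrightarrow> loc_pd A {\<one>\<^bsub>A\<^esub>} n N"
proof (induction n arbitrary: M P d N f g u v Q)
  case 0
  note r = proj_resolutionD[OF 0(1)] and M = 0(2) and N = 0(3,4) and f = 0(5) and g = 0(6)
    and Q = 0(7) and u = 0(8) and v = 0(9) and gf = 0(10)
  interpret N: right_module A N by (rule N)
  note RN = restr_module[OF R N(1) \<phi>(1)]
  have P0: "projective_rmod R (P 0)" using r(1) by simp
  have b: "bij_betw (d 0) (carrier (P 0)) (carrier M)" using r(4,7) by (simp add: bij_betw_def)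
  let ?e = "the_inv_into (carrier (P 0)) (d 0)"
  have e: "?e \<in> rmod_hom R M (P 0)" by (rule inv_hom[OF r(2) proj_module[OF P0] b])
  have de: "d 0 (?e y) = y" if "y \<in> carrier M" for y
    using f_the_inv_into_f[OF r(7)] r(4) that by simp
  obtain m p where p: "epi A (free_rmod A {..<m::nat}) N p" by (rule fin_gen_cover[OF N])
  have ph: "p \<in> rmod_hom A (free_rmod A {..<m}) N" using p ..
  let ?F = "free_rmod A {..<m}"
  have pR: "epi R (restr_rmod \<phi> ?F) (restr_rmod \<phi> N) p" using hom_restr[OF \<phi>(1) ph] p by simp
  note F = free_module[OF A_ring, of "{..<m}"]
  interpret F: right_module A ?F by (rule F)
  note RF = restr_module[OF R F \<phi>(1)]
  obtain w where w: "w \<in> rmod_hom R (P 0) (restr_rmod \<phi> ?F)" "\<forall>x\<in>carrier (P 0). p (w x) = g (d 0 x)"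
    by (rule proj_lift[OF P0 RF RN pR hom_comp[OF r(2) g]])
  obtain z where z: "z \<in> rmod_hom R Q (restr_rmod \<phi> ?F)" "\<forall>x\<in>carrier Q. p (z x) = v x"
    by (rule proj_lift[OF Q RF RN pR v])
  let ?W = "\<lambda>x. w (?e (f x)) \<ominus>\<^bsub>?F\<^esub> z (u x)"
  \<comment> \<open>The composites run through modules over \<open>R\<close>, but their ends are
    restrictions along a surjection, so they are linear over \<open>A\<close>.\<close>
  have 1: "(\<lambda>x. w (?e (f x))) \<in> rmod_hom A N ?F" "(\<lambda>x. z (u x)) \<in> rmod_hom A N ?F"
    using hom_comp[OF f hom_comp[OF e w(1)]] hom_comp[OF u z(1)] hom_restr_iff[OF \<phi>] by auto
  have W: "?W \<in> rmod_hom A N ?F" by (rule hom_diff[OF 1 F])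
  have "p (?W x) = x" if x: "x \<in> carrier N" for x
  proof -
    have cf: "f x \<in> carrier M" "u x \<in> carrier Q" using hom_closed[OF f] hom_closed[OF u] x by auto
    have vu: "v (u x) \<in> carrier N" using hom_closed[OF v cf(2)] by simp
    have "p (?W x) = g (f x) \<ominus>\<^bsub>N\<^esub> v (u x)"
      using hom_minus[OF ph F N(1) hom_closed[OF 1(1) x] hom_closed[OF 1(2) x]] w(2) z(2) cf
        hom_closed[OF e cf(1)] de by simp
    then show ?thesis using gf x vu by (simp add: N.M.diff_cancel)
  qed
  then show ?case
    using loc_projI[OF N free_proj[OF A_ring] singletonI W ph] by simp
next
  case (Suc n)
  note M = Suc(3) and N = Suc(4,5) and f = Suc(6) and g = Suc(7) and Q = Suc(8) and u = Suc(9) and v = Suc(10)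
    and gf = Suc(11)
  note r = proj_resolution_syzygy[OF M Suc(2)]
  have P0: "projective_rmod R (P 0)" using proj_resolutionD(1)[OF Suc(2)] by simp
  obtain K m i p where s: "ses A (K :: ('a, nat \<Rightarrow> 'a) rmod) (free_rmod A {..<m::nat}) N i p"
    by (rule fin_gen_ses[OF N])
  note s' = sesD[OF s]
  have sR: "ses R (restr_rmod \<phi> K) (restr_rmod \<phi> (free_rmod A {..<m})) (restr_rmod \<phi> N) i p"
    unfolding ses_def
    by (intro conjI restr_module[OF R _ \<phi>(1)] hom_restr[OF \<phi>(1)] s') (use s'(5,7,9) in simp_all)
  obtain f' g' h where f': "f' \<in> rmod_hom R (restr_rmod \<phi> K) ((P 0)\<lparr>carrier := {x \<in> carrier (P 0). d 0 x = \<zero>\<^bsub>M\<^esub>}\<rparr>)"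
    "g' \<in> rmod_hom R ((P 0)\<lparr>carrier := {x \<in> carrier (P 0). d 0 x = \<zero>\<^bsub>M\<^esub>}\<rparr>) (restr_rmod \<phi> K)"
    "h \<in> rmod_hom R (restr_rmod \<phi> (free_rmod A {..<m})) (restr_rmod \<phi> K)"
    "\<forall>x\<in>carrier (restr_rmod \<phi> K). g' (f' x) = x \<oplus>\<^bsub>restr_rmod \<phi> K\<^esub> h (i x)"
    by (rule syzygy_retract[OF sR r(1) free P0 Q f g u v]) (use gf in auto)
  have "loc_pd A {\<one>\<^bsub>A\<^esub>} n K"
    by (rule Suc.IH[OF r(2) sesD(1)[OF r(1)] s'(1) ses_fin_gen(1)[OF s free_fin_gen[OF A_ring finite_lessThan]]
          f'(1,2) free sesD(4)[OF sR] f'(3)]) (use f'(4) in simp)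
  with s show ?case by auto
qed

lemma loc_pd_le_proj_dim:
  fixes R :: "('c, 'q) ring_scheme" and N :: "('a, nat \<Rightarrow> 'a) rmod"
  assumes R: "ring R" and \<phi>: "\<phi> \<in> ring_hom R A" "\<phi> ` carrier R = carrier A"
    and free: "\<And>m::nat. projective_rmod R (restr_rmod \<phi> (free_rmod A {..<m}))"
    and N: "right_module A N" "fin_gen A N" and j: "inj j"
    and "proj_resolution R (copy_rmod j (restr_rmod \<phi> N)) n P d"
  shows "loc_pd A {\<one>\<^bsub>A\<^esub>} n N"
proof -
  interpret N: right_module A N by (rule N)
  note RN = restr_module[OF R N(1) \<phi>(1)]
  note c = copy_rmod[OF RN inj_on_subset[OF j subset_UNIV]]
  \<comment> \<open>At the start the retraction is exact and the correction zero. The free module of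
    rank zero provides a \<open>Q\<close> of the element type required by the induction.\<close>
  let ?Q = "restr_rmod \<phi> (free_rmod A {..<0::nat})"
  note Q = free[of 0]
  show ?thesis
    by (rule loc_pd_le_resolution[OF R \<phi> free assms(8) c(1) N c(2,3) Q
          hom_const_zero[OF proj_module[OF Q]] hom_const_zero[OF RN]])
      (use c(6) in simp)
qed

text \<open>Conversely, the iterated finite free covers of \<open>N\<close> are restricted to
  \<open>R\<close> and spliced. All terms are copied along the same \<open>j\<close>, as a
  resolution has one element type throughout.\<close>

lemma loc_pd_resolution:
  fixes R :: "('c, 'q) ring_scheme" and j :: "(nat \<Rightarrow> 'a) \<Rightarrow> 'u"
  assumes R: "ring R" and \<phi>: "\<phi> \<in> ring_hom R A" "\<phi> ` carrier R = carrier A"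
    and free: "\<And>m::nat. projective_rmod R (restr_rmod \<phi> (free_rmod A {..<m}))" and j: "inj j"
  shows "loc_pd A {\<one>\<^bsub>A\<^esub>} n N \<Longrightarrow> right_module A N \<Longrightarrow> fin_gen A N
    \<Longrightarrow> \<exists>P d. proj_resolution R (copy_rmod j (restr_rmod \<phi> N)) n P d \<and> (\<forall>i\<le>n. fin_gen R (P i))"
proof (induction n arbitrary: N)
  case 0
  note N = 0(2,3)
  note RN = restr_module[OF R N(1) \<phi>(1)]
  have ji: "inj_on j X" for X using inj_on_subset[OF j subset_UNIV] .
  interpret N: right_module A N by (rule N)
  from 0(1) obtain m u v where u: "u \<in> rmod_hom A N (free_rmod A {..<m::nat})"
    and v: "v \<in> rmod_hom A (free_rmod A {..<m}) N" and vu: "\<forall>x\<in>carrier N. v (u x) = x"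
    by (auto simp: loc_proj_def)
  have "projective_rmod R (restr_rmod \<phi> N)"
    by (rule proj_retract[OF RN free hom_restr[OF \<phi>(1) u] hom_restr[OF \<phi>(1) v]]) (use vu in simp)
  then have "projective_rmod R (copy_rmod j (restr_rmod \<phi> N))" by (rule copy_proj[OF _ ji])
  then have "proj_resolution R (copy_rmod j (restr_rmod \<phi> N)) 0 (\<lambda>_. copy_rmod j (restr_rmod \<phi> N)) (\<lambda>_ x. x)"
    by (simp add: proj_resolution_def hom_id)
  moreover have "fin_gen R (copy_rmod j (restr_rmod \<phi> N))"
    by (rule copy_fin_gen[OF RN ji fin_gen_restr[OF \<phi>(2) N(2)]])
  ultimately show ?case by blast
next
  case (Suc n)
  note N = Suc(3,4)
  have ji: "inj_on j X" for X using inj_on_subset[OF j subset_UNIV] .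
  from Suc(2) obtain K m i p where s: "ses A K (free_rmod A {..<m::nat}) N i p" and pd: "loc_pd A {\<one>\<^bsub>A\<^esub>} n K"
    by auto
  note s' = sesD[OF s]
  let ?C = "\<lambda>X. copy_rmod j (restr_rmod \<phi> X)" and ?F = "free_rmod A {..<m}"
  have RX: "right_module R (restr_rmod \<phi> X)" if "right_module A X" for X :: "('a, nat \<Rightarrow> 'a) rmod"
    by (rule restr_module[OF R that \<phi>(1)])
  have C: "right_module R (?C X)" "carrier (?C X) = j ` carrier X" "\<zero>\<^bsub>?C X\<^esub> = j \<zero>\<^bsub>X\<^esub>"
    if "right_module A X" for X :: "('a, nat \<Rightarrow> 'a) rmod"
    using copy_rmod(1,4)[OF RX[OF that] ji] by (simp_all add: copy_rmod_def Let_def)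
  \<comment> \<open>\<open>j\<close> is injective on the whole type, so \<open>the_inv j\<close>
    serves as inverse for the copies of all modules at once.\<close>
  have inv: "the_inv j (j x) = x" for x by (rule the_inv_f_f[OF j])
  have Ch: "(\<lambda>x. j (f (the_inv j x))) \<in> rmod_hom R (?C X) (?C Y)"
    if X: "right_module A X" and Y: "right_module A Y" and f: "f \<in> rmod_hom A X Y"
    for X Y :: "('a, nat \<Rightarrow> 'a) rmod" and f
  proof -
    note cX = copy_rmod[OF RX[OF X] ji] and cY = copy_rmod[OF RX[OF Y] ji]
    have "(\<lambda>x. j (f (the_inv_into (carrier X) j x))) \<in> rmod_hom R (?C X) (?C Y)"
      using hom_comp[OF cX(3) hom_comp[OF hom_restr[OF \<phi>(1) f] cY(2)]] by simp
    then show ?thesis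
      by (rule hom_cong[OF _ cX(1)]) (use cX(4,6) inv in auto)
  qed
  obtain P d where r: "proj_resolution R (?C K) n P d" and fg: "\<forall>i\<le>n. fin_gen R (P i)"
    using Suc.IH[OF pd s'(1) ses_fin_gen(1)[OF s free_fin_gen[OF A_ring finite_lessThan]]] by blast
  note r' = proj_resolutionD[OF r]
  \<comment> \<open>\<open>e\<close> is the inclusion of the syzygy into the free cover. Following
    the augmentation of the resolution of the syzygy by \<open>e\<close> gives the differential that
    joins the two pieces.\<close>
  define e where "e = (\<lambda>x. j (i (the_inv j x)))"
  define P' where "P' = case_nat (?C ?F) P"
  define d' where "d' = case_nat (\<lambda>x. j (p (the_inv j x))) (case_nat (\<lambda>x. e (d 0 x)) (\<lambda>k. d (Suc k)))"
  have P's: "P' 0 = ?C ?F" "P' (Suc k) = P k" for k by (simp_all add: P'_def)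
  have d's: "d' 0 = (\<lambda>x. j (p (the_inv j x)))" "d' (Suc 0) = (\<lambda>x. e (d 0 x))" "d' (Suc (Suc k)) = d (Suc k)" for k
    by (simp_all add: d'_def)
  have eh: "e \<in> rmod_hom R (?C K) (?C ?F)" unfolding e_def by (rule Ch[OF s'(1,2,4)])
  have ei: "inj_on e (carrier (?C K))"
    using inj_onD[OF s'(5)] injD[OF j] by (auto simp: inj_on_def e_def C[OF s'(1)] inv)
  have ei': "e x = \<zero>\<^bsub>?C ?F\<^esub> \<longleftrightarrow> x = \<zero>\<^bsub>?C K\<^esub>" if "x \<in> carrier (?C K)" for x
    using inj_onD[OF ei, of x "\<zero>\<^bsub>?C K\<^esub>"] hom_zero[OF eh C(1)[OF s'(1)] C(1)[OF s'(2)]] that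
      abelian_monoid.zero_closed[of "?C K"] C(1)[OF s'(1)]
    by (auto simp: right_module_def abelian_group_def)
  have FP: "projective_rmod R (?C ?F)" by (rule copy_proj[OF free ji])
  have "proj_resolution R (?C N) (Suc n) P' d'"
    unfolding proj_resolution_def
  proof (intro conjI allI impI)
    show "projective_rmod R (P' k)" if "k \<le> Suc n" for k
      using that r'(1) FP by (cases k) (auto simp: P's)
    show "d' 0 \<in> rmod_hom R (P' 0) (?C N)" unfolding d's P's by (rule Ch[OF s'(2,3,6)])
    show "d' (Suc k) \<in> rmod_hom R (P' (Suc k)) (P' k)" if "k < Suc n" for k
      using that r'(3) hom_comp[OF r'(2) eh] by (cases k) (auto simp: P's d's)
    show "d' 0 ` carrier (P' 0) = carrier (?C N)"
      unfolding d's P's C[OF s'(2)] C[OF s'(3)] s'(7)[symmetric] by (simp add: image_image inv)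
    have "d' 1 ` carrier (P' 1) = e ` carrier (?C K)"
      using r'(4) by (simp add: d's P's image_image[symmetric])
    also have "\<dots> = j ` (i ` carrier K)" unfolding C[OF s'(1)] by (simp add: e_def image_image inv)
    also have "\<dots> = {x \<in> carrier (P' 0). d' 0 x = \<zero>\<^bsub>?C N\<^esub>}"
      unfolding s'(9) d's P's C[OF s'(2)] C[OF s'(3)] using injD[OF j] by (auto simp: inv)
    finally show "d' 1 ` carrier (P' 1) = {x \<in> carrier (P' 0). d' 0 x = \<zero>\<^bsub>?C N\<^esub>}" .
    show "d' (Suc (Suc k)) ` carrier (P' (Suc (Suc k))) = {x \<in> carrier (P' (Suc k)). d' (Suc k) x = \<zero>\<^bsub>P' k\<^esub>}"
      if "Suc k < Suc n" for k
    proof (cases k)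
      case 0
      have "{x \<in> carrier (P 0). e (d 0 x) = \<zero>\<^bsub>?C ?F\<^esub>} = {x \<in> carrier (P 0). d 0 x = \<zero>\<^bsub>?C K\<^esub>}"
        using ei' hom_closed[OF r'(2)] by auto
      then show ?thesis using that r'(5) 0 by (simp add: P's d's)
    next
      case (Suc k')
      then show ?thesis using that r'(6) by (simp add: P's d's)
    qed
    show "inj_on (d' (Suc n)) (carrier (P' (Suc n)))"
    proof (cases n)
      case 0
      have "inj_on (e \<circ> d 0) (carrier (P 0))"
        using r'(4,7) ei 0 by (intro comp_inj_on) auto
      then show ?thesis using 0 by (simp add: P's d's comp_def)
    next
      case (Suc k)
      then show ?thesis using r'(7) by (simp add: P's d's)
    qed
  qed
  moreover have "fin_gen R (P' k)" if "k \<le> Suc n" for k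
  proof (cases k)
    case 0
    then show ?thesis
      using copy_fin_gen[OF RX[OF s'(2)] ji fin_gen_restr[OF \<phi>(2) free_fin_gen[OF A_ring finite_lessThan]]]
      by (simp add: P's)
  qed (use that fg in \<open>simp add: P's\<close>)
  ultimately show ?case by blast
qed

text \<open>The comparison with resolutions is applied to the identity of \<open>A\<close>;
  singletons embed \<open>nat \<Rightarrow> 'a\<close> into the type of modules in
  \<open>regular_ring\<close>.\<close>

lemma regular_loc_pd:
  assumes reg: "regular_ring A" and N: "right_module A N" "fin_gen A N"
  shows "\<exists>n. loc_pd A {\<one>\<^bsub>A\<^esub>} n (N :: ('a, nat \<Rightarrow> 'a) rmod)"
proof -
  define j where "j = (\<lambda>x :: nat \<Rightarrow> 'a. {x})"
  have j: "inj j" by (auto simp: j_def inj_on_def)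
  have ji: "inj_on j X" for X using inj_on_subset[OF j subset_UNIV] .
  have id: "(\<lambda>x. x) \<in> ring_hom A A" "(\<lambda>x. x) ` carrier A = carrier A" by (auto intro!: ring_hom_memI)
  have free: "projective_rmod A (restr_rmod (\<lambda>x. x) (free_rmod A {..<m}))" for m :: nat
  proof (rule proj_retract[OF restr_module[OF A_ring free_module[OF A_ring] id(1)] free_proj[OF A_ring, of "{..<m}"]])
    show "(\<lambda>x. x) \<in> rmod_hom A (restr_rmod (\<lambda>x. x) (free_rmod A {..<m})) (free_rmod A {..<m})"
      "(\<lambda>x. x) \<in> rmod_hom A (free_rmod A {..<m}) (restr_rmod (\<lambda>x. x) (free_rmod A {..<m}))"
      by (auto simp: rmod_hom_def)
  qed simp
  let ?M = "copy_rmod j (restr_rmod (\<lambda>x. x) N)"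
  note RN = restr_module[OF A_ring N(1) id(1)]
  have "proj_dim A ?M \<noteq> \<infinity>"
    using reg copy_rmod(1)[OF RN ji] copy_fin_gen[OF RN ji fin_gen_restr[OF id(2) N(2)]]
    unfolding regular_ring_def by blast
  then have "{enat n | n. \<exists>P d. proj_resolution A ?M n P d} \<noteq> {}"
    unfolding proj_dim_def by (metis Inf_empty top_enat_def)
  then obtain n P d where "proj_resolution A ?M n P d" by auto
  from loc_pd_le_proj_dim[OF A_ring id free N j this] show ?thesis by blast
qed

text \<open>Regularity gives each finitely generated module over \<open>A\<close> a finite
  resolution of unspecified length, which places its restriction in \<open>fin_proj_class R\<close>.
  A finite value of \<open>fin_dim R\<close> would turn these into uniform bounds and so bound the
  Krull dimension.\<close>

theorem fin_dim_split_quotient_infinite: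
  fixes R :: "('c, 'q) ring_scheme" and emb :: "'a \<Rightarrow> 'c"
  assumes R: "ring R" and \<phi>: "\<phi> \<in> ring_hom R A" "\<phi> ` carrier R = carrier A"
    and free: "\<And>m::nat. projective_rmod R (restr_rmod \<phi> (free_rmod A {..<m}))" and emb: "inj emb"
    and reg: "regular_ring A" and krull: "krull_dim A = \<infinity>"
  shows "fin_dim R = \<infinity>"
proof (rule ccontr)
  assume "fin_dim R \<noteq> \<infinity>"
  then obtain d where d: "fin_dim R = enat d" by auto
  \<comment> \<open>Modules over \<open>R\<close> have elements in
    \<open>(nat \<Rightarrow> 'c) set\<close>; \<open>emb\<close> is applied to each coordinate and
    is used only as an injection between types.\<close>
  define j where "j = (\<lambda>x :: nat \<Rightarrow> 'a. {\<lambda>i. emb (x i)})"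
  have j: "inj j"
  proof (rule injI)
    fix x y assume "j x = j y"
    then have "\<forall>i. emb (x i) = emb (y i)" by (auto simp: j_def dest: fun_cong)
    then show "x = y" using injD[OF emb] by blast
  qed
  have ji: "inj_on j X" for X using inj_on_subset[OF j subset_UNIV] .
  have "loc_pd A {\<one>\<^bsub>A\<^esub>} d N" if N: "right_module A N" "fin_gen A N" for N :: "('a, nat \<Rightarrow> 'a) rmod"
  proof -
    let ?M = "copy_rmod j (restr_rmod \<phi> N)"
    obtain n where n: "loc_pd A {\<one>\<^bsub>A\<^esub>} n N" using regular_loc_pd[OF reg N] by blast
    obtain P dd where "proj_resolution R ?M n P dd" "\<forall>i\<le>n. fin_gen R (P i)"
      using loc_pd_resolution[OF R \<phi> free j n N] by blast
    moreover have "right_module R ?M" by (rule copy_rmod(1)[OF restr_module[OF R N(1) \<phi>(1)] ji])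
    ultimately have "?M \<in> fin_proj_class R" unfolding fin_proj_class_def by blast
    then have "proj_dim R ?M \<le> enat d" unfolding d[symmetric] fin_dim_def by (intro Sup_upper imageI)
    \<comment> \<open>\<open>proj_dim\<close> is an infimum; a strict inequality yields an actual
      resolution, of length at most \<open>d\<close>.\<close>
    then have "proj_dim R ?M < enat (Suc d)" by (meson enat_ord_simps(2) le_less_trans lessI)
    then obtain m P' d' where m: "m \<le> d" "proj_resolution R ?M m P' d'"
      unfolding proj_dim_def Inf_less_iff by (auto simp: less_Suc_eq_le)
    from loc_pd_le_proj_dim[OF R \<phi> free N j m(2)] have "loc_pd A {\<one>\<^bsub>A\<^esub>} m N" .
    then show ?thesis by (rule loc_pd_mono[OF _ _ N m(1), rotated]) simp
  qed
  then have "krull_dim A \<le> enat d" by (rule krull_dim_le)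
  with krull show False by simp
qed

end

section \<open>The cover\<close>

lemma trivial_ext_sel [simp]:
  "carrier (trivial_ext B) = carrier B \<times> carrier B"
  "x \<otimes>\<^bsub>trivial_ext B\<^esub> y = (fst x \<otimes>\<^bsub>B\<^esub> fst y, fst x \<otimes>\<^bsub>B\<^esub> snd y \<oplus>\<^bsub>B\<^esub> snd x \<otimes>\<^bsub>B\<^esub> fst y)"
  "\<one>\<^bsub>trivial_ext B\<^esub> = (\<one>\<^bsub>B\<^esub>, \<zero>\<^bsub>B\<^esub>)" "\<zero>\<^bsub>trivial_ext B\<^esub> = (\<zero>\<^bsub>B\<^esub>, \<zero>\<^bsub>B\<^esub>)"
  "x \<oplus>\<^bsub>trivial_ext B\<^esub> y = (fst x \<oplus>\<^bsub>B\<^esub> fst y, snd x \<oplus>\<^bsub>B\<^esub> snd y)"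
  by (simp_all add: trivial_ext_def split_beta)

lemma trivial_ext_ring: assumes "ring B" shows "ring (trivial_ext B)"
proof -
  interpret ring B by fact
  show ?thesis
  proof (rule ringI)
    show "abelian_group (trivial_ext B)"
    proof (rule abelian_groupI)
      fix x assume "x \<in> carrier (trivial_ext B)"
      then show "\<exists>y\<in>carrier (trivial_ext B). y \<oplus>\<^bsub>trivial_ext B\<^esub> x = \<zero>\<^bsub>trivial_ext B\<^esub>"
        by (intro bexI[of _ "(\<ominus>\<^bsub>B\<^esub> fst x, \<ominus>\<^bsub>B\<^esub> snd x)"]) (auto simp: l_neg)
    qed (auto simp: a_ac)
    show "Group.monoid (trivial_ext B)"
      by (rule monoidI) (auto simp: m_assoc l_distr r_distr a_ac)
  qed (auto simp: l_distr r_distr a_ac)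
qed

lemma ring_product_sel [simp]:
  "carrier (ring_product I B) = (\<Pi>\<^sub>E i\<in>I. carrier (B i))"
  "f \<otimes>\<^bsub>ring_product I B\<^esub> g = (\<lambda>i\<in>I. f i \<otimes>\<^bsub>B i\<^esub> g i)"
  "\<one>\<^bsub>ring_product I B\<^esub> = (\<lambda>i\<in>I. \<one>\<^bsub>B i\<^esub>)" "\<zero>\<^bsub>ring_product I B\<^esub> = (\<lambda>i\<in>I. \<zero>\<^bsub>B i\<^esub>)"
  "f \<oplus>\<^bsub>ring_product I B\<^esub> g = (\<lambda>i\<in>I. f i \<oplus>\<^bsub>B i\<^esub> g i)"
  by (simp_all add: ring_product_def)

lemma ring_product_ring:
  assumes "\<And>i. i \<in> I \<Longrightarrow> ring (B i)" shows "ring (ring_product I B)"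
proof -
  note r = ring.ring_simprules[OF assms] monoid.r_one[OF ring.is_monoid[OF assms]]
  show ?thesis
  proof (rule ringI)
    show "abelian_group (ring_product I B)"
    proof (rule abelian_groupI)
      fix x assume "x \<in> carrier (ring_product I B)"
      then show "\<exists>y\<in>carrier (ring_product I B). y \<oplus>\<^bsub>ring_product I B\<^esub> x = \<zero>\<^bsub>ring_product I B\<^esub>"
        by (intro bexI[of _ "\<lambda>i\<in>I. \<ominus>\<^bsub>B i\<^esub> x i"]) (auto simp: r PiE_iff fun_eq_iff)
    qed (auto simp: r PiE_iff fun_eq_iff extensional_def)
    show "Group.monoid (ring_product I B)"
      by (rule monoidI) (auto simp: r PiE_iff fun_eq_iff extensional_def)
  qed (auto simp: r PiE_iff fun_eq_iff extensional_def)
qed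

lemma end_ring_sel [simp]:
  "carrier (end_ring R M) = rmod_hom R M M \<inter> extensional (carrier M)"
  "f \<otimes>\<^bsub>end_ring R M\<^esub> g = compose (carrier M) f g"
  "\<one>\<^bsub>end_ring R M\<^esub> = (\<lambda>x\<in>carrier M. x)" "\<zero>\<^bsub>end_ring R M\<^esub> = (\<lambda>x\<in>carrier M. \<zero>\<^bsub>M\<^esub>)"
  "f \<oplus>\<^bsub>end_ring R M\<^esub> g = (\<lambda>x\<in>carrier M. f x \<oplus>\<^bsub>M\<^esub> g x)"
  by (simp_all add: end_ring_def)

lemma hom_restrict:
  assumes "right_module R M" "f \<in> rmod_hom R M N" shows "restrict f (carrier M) \<in> rmod_hom R M N"
  by (rule hom_cong[OF assms(2,1)]) simp

lemma end_ring_ring: assumes M: "right_module R M" shows "ring (end_ring R M)"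
proof -
  interpret M: right_module R M by fact
  show ?thesis
  proof (rule ringI)
    show "abelian_group (end_ring R M)"
    proof (rule abelian_groupI)
      fix f g assume "f \<in> carrier (end_ring R M)" "g \<in> carrier (end_ring R M)"
      then show "f \<oplus>\<^bsub>end_ring R M\<^esub> g \<in> carrier (end_ring R M)"
        using hom_restrict[OF M hom_plus[OF _ _ M]] by auto
    next
      show "\<zero>\<^bsub>end_ring R M\<^esub> \<in> carrier (end_ring R M)" using hom_restrict[OF M hom_const_zero[OF M]] by simp
    next
      fix f assume f: "f \<in> carrier (end_ring R M)"
      then have "restrict (\<lambda>x. \<ominus>\<^bsub>M\<^esub> f x) (carrier M) \<in> carrier (end_ring R M)"
        using hom_restrict[OF M hom_uminus[OF _ M]] by auto
      then show "\<exists>g\<in>carrier (end_ring R M). g \<oplus>\<^bsub>end_ring R M\<^esub> f = \<zero>\<^bsub>end_ring R M\<^esub>"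
        by (rule bexI[rotated]) (use f hom_closed[of f R M M] in \<open>auto simp: fun_eq_iff M.M.l_neg\<close>)
    qed (auto simp: fun_eq_iff extensional_def hom_closed M.M.a_ac)
    show "Group.monoid (end_ring R M)"
    proof (rule monoidI)
      fix f g assume "f \<in> carrier (end_ring R M)" "g \<in> carrier (end_ring R M)"
      then show "f \<otimes>\<^bsub>end_ring R M\<^esub> g \<in> carrier (end_ring R M)"
        using hom_restrict[OF M hom_comp[of g R M M f M]] by (auto simp: compose_def)
    next
      show "\<one>\<^bsub>end_ring R M\<^esub> \<in> carrier (end_ring R M)" using hom_restrict[OF M hom_id] by simp
    qed (auto simp: fun_eq_iff extensional_def compose_def hom_closed)
  qed (auto simp: fun_eq_iff extensional_def compose_def hom_closed hom_add)
qed

lemma direct_sum_sel: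
  "carrier (direct_sum I S) = {f \<in> (\<Pi>\<^sub>E i\<in>I. carrier (S i)). finite {i \<in> I. f i \<noteq> \<zero>\<^bsub>S i\<^esub>}}"
  "\<zero>\<^bsub>direct_sum I S\<^esub> = (\<lambda>i\<in>I. \<zero>\<^bsub>S i\<^esub>)"
  "f \<oplus>\<^bsub>direct_sum I S\<^esub> g = (\<lambda>i\<in>I. f i \<oplus>\<^bsub>S i\<^esub> g i)"
  "f \<cdot>\<^bsub>direct_sum I S\<^esub> a = (\<lambda>i\<in>I. f i \<cdot>\<^bsub>S i\<^esub> a)"
  by (simp_all add: direct_sum_def)

lemma direct_sum_module:
  assumes "ring R" and S: "\<And>i. i \<in> I \<Longrightarrow> right_module R (S i)" shows "right_module R (direct_sum I S)"
proof -
  interpret ring R by fact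
  have ag: "abelian_group (S i)" if "i \<in> I" for i using S[OF that] by (simp add: right_module_def)
  have am: "abelian_monoid (S i)" if "i \<in> I" for i using ag[OF that] by (simp add: abelian_group_def)
  note s = abelian_monoid.a_closed[OF am] abelian_monoid.a_lcomm[OF am] abelian_monoid.r_zero[OF am] abelian_monoid.zero_closed[OF am] abelian_monoid.l_zero[OF am]
    abelian_monoid.a_assoc[OF am] abelian_monoid.a_comm[OF am] abelian_group.a_inv_closed[OF ag] abelian_group.l_neg[OF ag] abelian_group.r_neg[OF ag]
    right_module.ract_closed[OF S] right_module.ract_add_left[OF S] right_module.ract_add_right[OF S]
    right_module.ract_assoc[OF S] right_module.ract_one[OF S] right_module.ract_zero_left[OF S]
  have fin: "finite {i \<in> I. g i \<noteq> \<zero>\<^bsub>S i\<^esub>}"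
    if "finite {i \<in> I. f i \<noteq> \<zero>\<^bsub>S i\<^esub>}" "\<And>i. i \<in> I \<Longrightarrow> f i = \<zero>\<^bsub>S i\<^esub> \<Longrightarrow> g i = \<zero>\<^bsub>S i\<^esub>" for f g
    by (rule finite_subset[OF _ that(1)]) (use that(2) in auto)
  show ?thesis
  proof (rule right_moduleI)
    show "abelian_group (direct_sum I S)"
    proof (rule abelian_groupI)
      fix f g assume f: "f \<in> carrier (direct_sum I S)" and g: "g \<in> carrier (direct_sum I S)"
      have "finite {i \<in> I. f i \<oplus>\<^bsub>S i\<^esub> g i \<noteq> \<zero>\<^bsub>S i\<^esub>}"
        by (rule finite_subset[of _ "{i \<in> I. f i \<noteq> \<zero>\<^bsub>S i\<^esub>} \<union> {i \<in> I. g i \<noteq> \<zero>\<^bsub>S i\<^esub>}"])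
          (use f g in \<open>auto simp: direct_sum_sel s\<close>)
      then show "f \<oplus>\<^bsub>direct_sum I S\<^esub> g \<in> carrier (direct_sum I S)"
        using f g by (auto simp: direct_sum_sel s PiE_iff cong: conj_cong)
    next
      show "\<zero>\<^bsub>direct_sum I S\<^esub> \<in> carrier (direct_sum I S)" by (auto simp: direct_sum_sel s cong: conj_cong)
    next
      fix f assume f: "f \<in> carrier (direct_sum I S)"
      have "finite {i \<in> I. \<ominus>\<^bsub>S i\<^esub> f i \<noteq> \<zero>\<^bsub>S i\<^esub>}"
        by (rule fin[of f]) (use f in \<open>auto simp: direct_sum_sel intro: abelian_group.minus_equality[OF ag] simp: s\<close>)
      then show "\<exists>g\<in>carrier (direct_sum I S). g \<oplus>\<^bsub>direct_sum I S\<^esub> f = \<zero>\<^bsub>direct_sum I S\<^esub>"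
        using f by (intro bexI[of _ "\<lambda>i\<in>I. \<ominus>\<^bsub>S i\<^esub> f i"])
          (auto simp: direct_sum_sel s PiE_iff fun_eq_iff cong: conj_cong)
    qed (auto simp: direct_sum_sel s PiE_iff fun_eq_iff extensional_def)
  next
    fix f a assume f: "f \<in> carrier (direct_sum I S)" and a: "a \<in> carrier R"
    have "finite {i \<in> I. f i \<cdot>\<^bsub>S i\<^esub> a \<noteq> \<zero>\<^bsub>S i\<^esub>}"
      by (rule fin[of f]) (use f a in \<open>auto simp: direct_sum_sel s\<close>)
    then show "f \<cdot>\<^bsub>direct_sum I S\<^esub> a \<in> carrier (direct_sum I S)"
      using f a by (auto simp: direct_sum_sel s PiE_iff cong: conj_cong)
  qed (auto simp: direct_sum_sel s PiE_iff ring_axioms fun_eq_iff extensional_def)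
qed

lemma triangular_sel [simp]:
  "carrier (triangular_ring A B S l) = carrier A \<times> carrier S \<times> carrier B"
  "x \<otimes>\<^bsub>triangular_ring A B S l\<^esub> y = (fst x \<otimes>\<^bsub>A\<^esub> fst y,
     fst (snd x) \<cdot>\<^bsub>S\<^esub> fst y \<oplus>\<^bsub>S\<^esub> l (snd (snd x)) (fst (snd y)), snd (snd x) \<otimes>\<^bsub>B\<^esub> snd (snd y))"
  "\<one>\<^bsub>triangular_ring A B S l\<^esub> = (\<one>\<^bsub>A\<^esub>, \<zero>\<^bsub>S\<^esub>, \<one>\<^bsub>B\<^esub>)" "\<zero>\<^bsub>triangular_ring A B S l\<^esub> = (\<zero>\<^bsub>A\<^esub>, \<zero>\<^bsub>S\<^esub>, \<zero>\<^bsub>B\<^esub>)"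
  "x \<oplus>\<^bsub>triangular_ring A B S l\<^esub> y = (fst x \<oplus>\<^bsub>A\<^esub> fst y, fst (snd x) \<oplus>\<^bsub>S\<^esub> fst (snd y), snd (snd x) \<oplus>\<^bsub>B\<^esub> snd (snd y))"
  by (simp_all add: triangular_ring_def split_beta)

lemma triangular_ring_ring:
  assumes "ring A" "ring B" "right_module A S"
    and l: "\<And>b s. b \<in> carrier B \<Longrightarrow> s \<in> carrier S \<Longrightarrow> l b s \<in> carrier S"
    "\<And>b s t. b \<in> carrier B \<Longrightarrow> s \<in> carrier S \<Longrightarrow> t \<in> carrier S \<Longrightarrow> l b (s \<oplus>\<^bsub>S\<^esub> t) = l b s \<oplus>\<^bsub>S\<^esub> l b t"
    "\<And>b c s. b \<in> carrier B \<Longrightarrow> c \<in> carrier B \<Longrightarrow> s \<in> carrier S \<Longrightarrow> l (b \<oplus>\<^bsub>B\<^esub> c) s = l b s \<oplus>\<^bsub>S\<^esub> l c s"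
    "\<And>b c s. b \<in> carrier B \<Longrightarrow> c \<in> carrier B \<Longrightarrow> s \<in> carrier S \<Longrightarrow> l (b \<otimes>\<^bsub>B\<^esub> c) s = l b (l c s)"
    "\<And>b s a. b \<in> carrier B \<Longrightarrow> s \<in> carrier S \<Longrightarrow> a \<in> carrier A \<Longrightarrow> l b (s \<cdot>\<^bsub>S\<^esub> a) = l b s \<cdot>\<^bsub>S\<^esub> a"
    "\<And>s. s \<in> carrier S \<Longrightarrow> l \<one>\<^bsub>B\<^esub> s = s"
  shows "ring (triangular_ring A B S l)"
proof -
  interpret A: ring A by fact
  interpret B: ring B by fact
  interpret S: right_module A S by fact
  have l0: "l b \<zero>\<^bsub>S\<^esub> = \<zero>\<^bsub>S\<^esub>" if "b \<in> carrier B" for b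
    using l(5)[OF that S.M.zero_closed A.zero_closed] l(1)[OF that S.M.zero_closed] by simp
  show ?thesis
  proof (rule ringI)
    show "abelian_group (triangular_ring A B S l)"
    proof (rule abelian_groupI)
      fix x assume "x \<in> carrier (triangular_ring A B S l)"
      then show "\<exists>y\<in>carrier (triangular_ring A B S l). y \<oplus>\<^bsub>triangular_ring A B S l\<^esub> x = \<zero>\<^bsub>triangular_ring A B S l\<^esub>"
        by (intro bexI[of _ "(\<ominus>\<^bsub>A\<^esub> fst x, \<ominus>\<^bsub>S\<^esub> fst (snd x), \<ominus>\<^bsub>B\<^esub> snd (snd x))"])
          (auto simp: A.l_neg B.l_neg S.M.l_neg)
    qed (auto simp: A.a_ac B.a_ac S.M.a_ac)
    show "Group.monoid (triangular_ring A B S l)"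
      by (rule monoidI) (auto simp: A.m_assoc B.m_assoc l l0 S.ract_assoc S.ract_add_left S.M.a_ac)
  qed (auto simp: A.l_distr A.r_distr B.l_distr B.r_distr l S.ract_add_left S.ract_add_right S.M.a_ac)
qed

section \<open>The cover and its projection onto \<open>A\<close>\<close>

lemma simple_class_rep:
  fixes A :: "('a, 'r) ring_scheme"
  assumes "c \<in> simple_classes A"
  shows "class_rep c \<in> c" "simple_rmod A (class_rep c)" "right_module A (class_rep c)"
proof -
  let ?r = "{(M, N). simple_rmod A M \<and> simple_rmod A N \<and> rmod_iso A M N}"
  obtain M :: "('a, 'a set) rmod" where M: "simple_rmod A M" "c = ?r `` {M}"
    using assms unfolding simple_classes_def by (auto elim!: quotientE)
  have "rmod_iso A M M" unfolding rmod_iso_def using hom_id by (intro bexI[of _ "\<lambda>x. x"]) (auto simp: bij_betw_def)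
  then have "M \<in> c" using M by auto
  then show "class_rep c \<in> c" unfolding class_rep_def by (rule someI)
  then show "simple_rmod A (class_rep c)" using M(2) by auto
  then show "right_module A (class_rep c)" by (simp add: simple_rmod_def)
qed

lemma cover_corner_ring: "ring (cover_corner A)"
  unfolding cover_corner_def
  by (intro ring_product_ring trivial_ext_ring end_ring_ring simple_class_rep)

lemma cover_bimodule_module: "ring A \<Longrightarrow> right_module A (cover_bimodule A)"
  unfolding cover_bimodule_def by (intro direct_sum_module simple_class_rep)

abbreviation cover_act :: "('a, 'r) ring_scheme \<Rightarrow>
    (('a, 'a set) rmod set \<Rightarrow> ('a set \<Rightarrow> 'a set) \<times> ('a set \<Rightarrow> 'a set)) \<Rightarrow>
    (('a, 'a set) rmod set \<Rightarrow> 'a set) \<Rightarrow> ('a, 'a set) rmod set \<Rightarrow> 'a set" where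
  "cover_act A b s \<equiv> \<lambda>c\<in>simple_classes A. fst (b c) (s c)"

lemma corner_comp_hom:
  assumes "b \<in> carrier (cover_corner A)" "c \<in> simple_classes A"
  shows "fst (b c) \<in> rmod_hom A (class_rep c) (class_rep c)"
proof -
  have "b c \<in> carrier (trivial_ext (end_ring A (class_rep c)))"
    using assms by (auto simp: cover_corner_def simp del: trivial_ext_sel)
  then show ?thesis by auto
qed

lemma cover_ring: assumes "ring A" shows "ring (cover A)"
  unfolding cover_def
proof (rule triangular_ring_ring[OF assms cover_corner_ring cover_bimodule_module[OF assms]])
  let ?S = "cover_bimodule A" and ?B = "cover_corner A"
  note sel = direct_sum_sel[of "simple_classes A" class_rep, folded cover_bimodule_def]
  note hom = corner_comp_hom
  have zero: "fst (b c) \<zero>\<^bsub>class_rep c\<^esub> = \<zero>\<^bsub>class_rep c\<^esub>"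
    if "b \<in> carrier ?B" "c \<in> simple_classes A" for b c
    by (rule hom_zero[OF hom[OF that] simple_class_rep(3,3)[OF that(2)]])
  have comp: "s c \<in> carrier (class_rep c)" if "s \<in> carrier ?S" "c \<in> simple_classes A" for s c
    using that by (auto simp: sel)
  show "cover_act A b s \<in> carrier ?S" if b: "b \<in> carrier ?B" and s: "s \<in> carrier ?S" for b s
  proof -
    have "finite {c \<in> simple_classes A. fst (b c) (s c) \<noteq> \<zero>\<^bsub>class_rep c\<^esub>}"
      by (rule finite_subset[of _ "{c \<in> simple_classes A. s c \<noteq> \<zero>\<^bsub>class_rep c\<^esub>}"])
        (use s zero[OF b] in \<open>auto simp: sel\<close>)
    then show ?thesis
      using hom_closed[OF hom[OF b] comp[OF s]] by (auto simp: sel cong: conj_cong)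
  qed
  show "cover_act A b (s \<oplus>\<^bsub>?S\<^esub> t) = cover_act A b s \<oplus>\<^bsub>?S\<^esub> cover_act A b t"
    if "b \<in> carrier ?B" "s \<in> carrier ?S" "t \<in> carrier ?S" for b s t
    using hom_add[OF hom[OF that(1)] comp[OF that(2)] comp[OF that(3)]] by (auto simp: sel fun_eq_iff)
  show "cover_act A (b \<oplus>\<^bsub>?B\<^esub> b') s = cover_act A b s \<oplus>\<^bsub>?S\<^esub> cover_act A b' s"
    if "b \<in> carrier ?B" "b' \<in> carrier ?B" "s \<in> carrier ?S" for b b' s
    using comp[OF that(3)] by (auto simp: sel fun_eq_iff cover_corner_def)
  show "cover_act A (b \<otimes>\<^bsub>?B\<^esub> b') s = cover_act A b (cover_act A b' s)"
    if "b \<in> carrier ?B" "b' \<in> carrier ?B" "s \<in> carrier ?S" for b b' s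
    using comp[OF that(3)] by (auto simp: fun_eq_iff cover_corner_def compose_def)
  show "cover_act A b (s \<cdot>\<^bsub>?S\<^esub> a) = cover_act A b s \<cdot>\<^bsub>?S\<^esub> a"
    if "b \<in> carrier ?B" "s \<in> carrier ?S" "a \<in> carrier A" for b s a
    using hom_ract[OF hom[OF that(1)] comp[OF that(2)] that(3)] by (auto simp: sel fun_eq_iff)
  show "cover_act A \<one>\<^bsub>?B\<^esub> s = s" if "s \<in> carrier ?S" for s
    using comp[OF that] that by (auto simp: fun_eq_iff cover_corner_def sel PiE_iff extensional_def)
qed

lemma cover_fst_hom:
  assumes "ring A"
  shows "fst \<in> ring_hom (cover A) A" "fst ` carrier (cover A) = carrier A"
proof -
  interpret ring A by fact
  interpret S: right_module A "cover_bimodule A" by (rule cover_bimodule_module[OF assms])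
  interpret B: ring "cover_corner A" by (rule cover_corner_ring)
  show "fst \<in> ring_hom (cover A) A" by (rule ring_hom_memI) (auto simp: cover_def)
  show "fst ` carrier (cover A) = carrier A"
    unfolding cover_def using S.M.zero_closed B.zero_closed by (auto simp: fst_image_times)
qed

text \<open>The right ideal generated by the idempotent \<open>(\<one>, \<zero>, \<zero>)\<close>
  consists of the elements \<open>(a, \<zero>, \<zero>)\<close>, so it is \<open>A\<close>
  restricted along \<open>fst\<close>, and it is a direct summand of the cover. Finite free modules
  follow coordinatewise.\<close>

lemma cover_free_proj:
  assumes "ring A"
  shows "projective_rmod (cover A) (restr_rmod fst (free_rmod A {..<m::nat}))"
proof -
  interpret ring A by fact
  interpret S: right_module A "cover_bimodule A" by (rule cover_bimodule_module[OF assms])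
  interpret B: ring "cover_corner A" by (rule cover_corner_ring)
  interpret C: ring "cover A" by (rule cover_ring[OF assms])
  note f = cover_fst_hom[OF assms]
  let ?F = "free_rmod A {..<m}" and ?G = "free_rmod (cover A) {..<m}"
  let ?i = "\<lambda>a. (a, \<zero>\<^bsub>cover_bimodule A\<^esub>, \<zero>\<^bsub>cover_corner A\<^esub>)"
  note sel = direct_sum_sel[of "simple_classes A" class_rep, folded cover_bimodule_def]
  have act: "cover_act A \<zero>\<^bsub>cover_corner A\<^esub> s = \<zero>\<^bsub>cover_bimodule A\<^esub>" if "s \<in> carrier (cover_bimodule A)" for s
    using that by (auto simp: sel cover_corner_def fun_eq_iff PiE_iff)
  have ic: "?i a \<in> carrier (cover A)" if "a \<in> carrier A" for a using that by (simp add: cover_def)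
  have i: "?i (a \<oplus>\<^bsub>A\<^esub> b) = ?i a \<oplus>\<^bsub>cover A\<^esub> ?i b"
    if "a \<in> carrier A" "b \<in> carrier A" for a b using that by (simp_all add: cover_def)
  have im: "?i (a \<otimes>\<^bsub>A\<^esub> fst r) = ?i a \<otimes>\<^bsub>cover A\<^esub> r" if "a \<in> carrier A" "r \<in> carrier (cover A)" for a r
    using that act by (auto simp: cover_def)
  show ?thesis
  proof (rule proj_retract_free[OF restr_module[OF C.ring_axioms free_module[OF assms] f(1)]])
    show "(\<lambda>v. \<lambda>k\<in>{..<m}. ?i (v k)) \<in> rmod_hom (cover A) (restr_rmod fst ?F) ?G"
      by (rule rmod_homI) (auto simp: free_sel PiE_iff fun_eq_iff ic i im)
    show "(\<lambda>w. \<lambda>k\<in>{..<m}. fst (w k)) \<in> rmod_hom (cover A) ?G (restr_rmod fst ?F)"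
      using ring_hom_memE[OF f(1)] by (intro rmod_homI) (auto simp: free_sel PiE_iff fun_eq_iff)
    show "(\<lambda>k\<in>{..<m}. fst ((\<lambda>k\<in>{..<m}. ?i (v k)) k)) = v" if "v \<in> carrier (restr_rmod fst ?F)" for v
      using that by (auto simp: free_sel PiE_iff fun_eq_iff extensional_def)
  qed
qed

theorem fin_dim_cover_infinite:
  fixes A :: "('a, 'r) ring_scheme"
  assumes "cring A" "noetherian_ring A" "regular_ring A" "krull_dim A = \<infinity>"
  shows "fin_dim (cover A) = \<infinity>"
proof -
  interpret comm_noeth A by (rule comm_noeth.intro) fact+
  \<comment> \<open>The last argument only has to embed the type of \<open>A\<close> into that of
    the cover, so its remaining entries may be any fixed values.\<close>
  show ?thesis
    by (rule fin_dim_split_quotient_infinite[OF cover_ring[OF A_ring] cover_fst_hom[OF A_ring]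
          cover_free_proj[OF A_ring] _ assms(3,4), of "\<lambda>a. (a, undefined, undefined)"])
      (auto simp: inj_on_def)
qed

section \<open>Splitting of injections between finitely generated projective modules\<close>

definition left_ideal :: "('a, 'r) ring_scheme \<Rightarrow> 'a set \<Rightarrow> bool" where
  "left_ideal B L \<longleftrightarrow> L \<subseteq> carrier B \<and> \<zero>\<^bsub>B\<^esub> \<in> L \<and> (\<forall>x\<in>L. \<forall>y\<in>L. x \<oplus>\<^bsub>B\<^esub> y \<in> L) \<and>
     (\<forall>b\<in>carrier B. \<forall>x\<in>L. b \<otimes>\<^bsub>B\<^esub> x \<in> L)"

text \<open>Bass's condition on finitely generated left ideals, stated without forming the ideal generated by \<open>G\<close>.\<close>

definition left_ideals_annihilated :: "('a, 'r) ring_scheme \<Rightarrow> bool" where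
  "left_ideals_annihilated B \<longleftrightarrow> (\<forall>G. finite G \<and> G \<subseteq> carrier B \<longrightarrow>
     (\<exists>r\<in>carrier B. r \<noteq> \<zero>\<^bsub>B\<^esub> \<and> (\<forall>g\<in>G. g \<otimes>\<^bsub>B\<^esub> r = \<zero>\<^bsub>B\<^esub>)) \<or>
     (\<forall>L. left_ideal B L \<and> G \<subseteq> L \<longrightarrow> \<one>\<^bsub>B\<^esub> \<in> L))"

lemma left_ideals_annihilatedD:
  assumes "left_ideals_annihilated B" "finite G" "G \<subseteq> carrier B" "left_ideal B L" "G \<subseteq> L"
    and "\<And>r. r \<in> carrier B \<Longrightarrow> \<forall>g\<in>G. g \<otimes>\<^bsub>B\<^esub> r = \<zero>\<^bsub>B\<^esub> \<Longrightarrow> r = \<zero>\<^bsub>B\<^esub>"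
  shows "\<one>\<^bsub>B\<^esub> \<in> L"
  using assms unfolding left_ideals_annihilated_def by metis

abbreviation dual :: "('a, 'r) ring_scheme \<Rightarrow> ('a, 'b, 'm) rmod_scheme \<Rightarrow> ('b \<Rightarrow> 'a) set" where
  "dual B M \<equiv> rmod_hom B M (reg_rmod B)"

text \<open>Functionals on a right module form a left module, and \<open>W\<close> is a submodule of
  it. Functionals are total functions, so the last clause makes membership depend only on the values
  on the carrier.\<close>

definition dual_space :: "('a, 'r) ring_scheme \<Rightarrow> ('a, 'b, 'm) rmod_scheme \<Rightarrow> ('b \<Rightarrow> 'a) set \<Rightarrow> bool" where
  "dual_space B M W \<longleftrightarrow> W \<subseteq> dual B M \<and> (\<lambda>_. \<zero>\<^bsub>B\<^esub>) \<in> W \<and>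
     (\<forall>f\<in>W. \<forall>g\<in>W. (\<lambda>x. f x \<oplus>\<^bsub>B\<^esub> g x) \<in> W) \<and> (\<forall>b\<in>carrier B. \<forall>f\<in>W. (\<lambda>x. b \<otimes>\<^bsub>B\<^esub> f x) \<in> W) \<and>
     (\<forall>f\<in>W. \<forall>g. (\<forall>x\<in>carrier M. g x = f x) \<longrightarrow> g \<in> W)"

lemma dual_spaceD:
  assumes "dual_space B M W"
  shows "W \<subseteq> dual B M" "(\<lambda>_. \<zero>\<^bsub>B\<^esub>) \<in> W" "\<And>f g. f \<in> W \<Longrightarrow> g \<in> W \<Longrightarrow> (\<lambda>x. f x \<oplus>\<^bsub>B\<^esub> g x) \<in> W"
    "\<And>b f. b \<in> carrier B \<Longrightarrow> f \<in> W \<Longrightarrow> (\<lambda>x. b \<otimes>\<^bsub>B\<^esub> f x) \<in> W"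
    "\<And>f g. f \<in> W \<Longrightarrow> (\<And>x. x \<in> carrier M \<Longrightarrow> g x = f x) \<Longrightarrow> g \<in> W"
  using assms by (auto simp: dual_space_def)

lemma dual_scale:
  assumes "ring B" "f \<in> dual B M" "b \<in> carrier B" shows "(\<lambda>x. b \<otimes>\<^bsub>B\<^esub> f x) \<in> dual B M"
  using hom_comp[OF assms(2) reg_hom[OF reg_module[OF assms(1)], of b]] assms(3) by simp

lemma dual_plus:
  assumes "ring B" "f \<in> dual B M" "g \<in> dual B M" shows "(\<lambda>x. f x \<oplus>\<^bsub>B\<^esub> g x) \<in> dual B M"
  using hom_plus[OF assms(2,3) reg_module[OF assms(1)]] by simp

text \<open>These are the functionals on \<open>M\<close> that come from \<open>W\<close> by
  restriction along \<open>i\<close>. Once they are known to be a submodule, a spanning result shows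
  that \<open>W\<close> restricts onto the whole dual of \<open>M\<close>.\<close>

lemma dual_space_pull:
  assumes "ring B" and M: "right_module B M" and i: "i \<in> rmod_hom B M N" and W: "dual_space B N W"
  shows "dual_space B M {f \<in> dual B M. \<exists>w\<in>W. \<forall>x\<in>carrier M. f x = w (i x)}"
proof -
  interpret ring B by fact
  note W = dual_spaceD[OF W]
  have z: "(\<lambda>_. \<zero>\<^bsub>B\<^esub>) \<in> dual B M" using hom_const_zero[OF reg_module[OF assms(1)], of M] by simp
  show ?thesis
    unfolding dual_space_def
  proof (intro conjI ballI allI impI)
    show "(\<lambda>_. \<zero>\<^bsub>B\<^esub>) \<in> {f \<in> dual B M. \<exists>w\<in>W. \<forall>x\<in>carrier M. f x = w (i x)}" using z W(2) by auto
  next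
    fix f g
    assume "f \<in> {f \<in> dual B M. \<exists>w\<in>W. \<forall>x\<in>carrier M. f x = w (i x)}" "g \<in> {f \<in> dual B M. \<exists>w\<in>W. \<forall>x\<in>carrier M. f x = w (i x)}"
    then obtain u v where "f \<in> dual B M" "g \<in> dual B M" "u \<in> W" "\<forall>x\<in>carrier M. f x = u (i x)" "v \<in> W"
      "\<forall>x\<in>carrier M. g x = v (i x)" by blast
    then show "(\<lambda>x. f x \<oplus>\<^bsub>B\<^esub> g x) \<in> {f \<in> dual B M. \<exists>w\<in>W. \<forall>x\<in>carrier M. f x = w (i x)}"
      using W(3)[of u v] dual_plus[OF assms(1)] by (auto intro!: bexI[of _ "\<lambda>x. u x \<oplus>\<^bsub>B\<^esub> v x"])
  next
    fix b f assume "b \<in> carrier B" "f \<in> {f \<in> dual B M. \<exists>w\<in>W. \<forall>x\<in>carrier M. f x = w (i x)}"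
    then obtain u where "f \<in> dual B M" "u \<in> W" "\<forall>x\<in>carrier M. f x = u (i x)" "b \<in> carrier B" by blast
    then show "(\<lambda>x. b \<otimes>\<^bsub>B\<^esub> f x) \<in> {f \<in> dual B M. \<exists>w\<in>W. \<forall>x\<in>carrier M. f x = w (i x)}"
      using W(4)[of b u] dual_scale[OF assms(1)] by (auto intro!: bexI[of _ "\<lambda>x. b \<otimes>\<^bsub>B\<^esub> u x"])
  next
    fix f g assume f: "f \<in> {f \<in> dual B M. \<exists>w\<in>W. \<forall>x\<in>carrier M. f x = w (i x)}" and "\<forall>x\<in>carrier M. g x = f x"
    then show "g \<in> {f \<in> dual B M. \<exists>w\<in>W. \<forall>x\<in>carrier M. f x = w (i x)}"
      using hom_cong[OF _ M, of f "reg_rmod B" g] by auto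
  qed auto
qed

text \<open>
  Finitely many functionals on a free module of finite rank that have no common nonzero zero span
  the dual. In the induction step, the functionals in the span that vanish at a suitable vector
  \<open>v0\<close> already restrict onto the dual of the smaller free module, and the condition on left ideals
  is applied to the values at \<open>v0\<close>.
\<close>

definition separating_spans :: "('a, 'r) ring_scheme \<Rightarrow> ('a, 'b, 'm) rmod_scheme \<Rightarrow> bool" where
  "separating_spans B M \<longleftrightarrow> (\<forall>G W. finite G \<and> G \<subseteq> dual B M \<and> dual_space B M W \<and> G \<subseteq> W \<and>
     (\<forall>v\<in>carrier M. (\<forall>g\<in>G. g v = \<zero>\<^bsub>B\<^esub>) \<longrightarrow> v = \<zero>\<^bsub>M\<^esub>) \<longrightarrow> dual B M \<subseteq> W)"

lemma separating_spansD:
  assumes "separating_spans B M" "finite G" "G \<subseteq> dual B M" "dual_space B M W" "G \<subseteq> W"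
    and "\<And>v. v \<in> carrier M \<Longrightarrow> (\<forall>g\<in>G. g v = \<zero>\<^bsub>B\<^esub>) \<Longrightarrow> v = \<zero>\<^bsub>M\<^esub>"
  shows "dual B M \<subseteq> W"
  by (rule assms(1)[unfolded separating_spans_def, THEN spec[of _ G], THEN spec[of _ W], THEN mp])
    (intro conjI assms(2-5), rule ballI, rule impI, rule assms(6))

lemma free_separating_spans:
  fixes X :: "'x set"
  assumes B: "ring B" and H: "left_ideals_annihilated B" and "finite X"
  shows "separating_spans B (free_rmod B X)"
  using assms(3)
proof (induction X)
  case empty
  let ?Z = "free_rmod B ({} :: 'x set)"
  have F: "right_module B ?Z" by (rule free_module[OF B])
  have c: "carrier ?Z = {\<zero>\<^bsub>?Z\<^esub>}" by (auto simp: free_sel)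
  have "dual B ?Z \<subseteq> W" if W: "dual_space B ?Z W" for W
  proof
    fix f assume "f \<in> dual B ?Z"
    then have "f \<zero>\<^bsub>?Z\<^esub> = \<zero>\<^bsub>B\<^esub>" using hom_zero[OF _ F reg_module[OF B], of f] by simp
    then show "f \<in> W" using dual_spaceD(2)[OF W] dual_spaceD(5)[OF W, of "\<lambda>_. \<zero>\<^bsub>B\<^esub>" f] c by auto
  qed
  then show ?case unfolding separating_spans_def by blast
next
  case (insert x X)
  interpret B: ring B by (rule B)
  let ?F = "free_rmod B X" and ?E = "free_rmod B (insert x X)"
  have F: "right_module B ?F" and E: "right_module B ?E" by (rule free_module[OF B])+
  interpret E: right_module B ?E by (rule E)
  let ?\<iota> = "\<lambda>v. \<lambda>i\<in>insert x X. if i = x then \<zero>\<^bsub>B\<^esub> else v i"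
  have \<iota>: "?\<iota> \<in> rmod_hom B ?F ?E"
    using insert.hyps by (intro rmod_homI) (auto simp: free_sel PiE_iff fun_eq_iff)
  have crd: "(\<lambda>v. v i) \<in> dual B (free_rmod B Y)" if "i \<in> Y" for i and Y :: "'x set"
    using that by (intro rmod_homI) (auto simp: free_sel PiE_iff)
  have cx: "v x \<in> carrier B" if "v \<in> carrier ?E" for v using that by (auto simp: free_sel)
  have \<delta>: "free_unit B (insert x X) x \<in> carrier ?E" by (rule free_unit_closed[OF B]) simp
  let ?\<delta> = "free_unit B (insert x X) x"
  have rst: "restrict v X \<in> carrier ?F" if "v \<in> carrier ?E" for v
    using that insert.hyps by (auto simp: free_sel PiE_iff)
  have dec: "v = ?\<iota> (restrict v X) \<oplus>\<^bsub>?E\<^esub> ?\<delta> \<cdot>\<^bsub>?E\<^esub> v x" if "v \<in> carrier ?E" for v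
    using that insert.hyps by (auto simp: free_sel free_unit_def PiE_iff fun_eq_iff extensional_def)
  have decf: "f v = f (?\<iota> (restrict v X)) \<oplus>\<^bsub>B\<^esub> f ?\<delta> \<otimes>\<^bsub>B\<^esub> v x" if f: "f \<in> dual B ?E" and v: "v \<in> carrier ?E" for f v
  proof -
    have "f v = f (?\<iota> (restrict v X) \<oplus>\<^bsub>?E\<^esub> ?\<delta> \<cdot>\<^bsub>?E\<^esub> v x)" using dec[OF v] by simp
    also have "\<dots> = f (?\<iota> (restrict v X)) \<oplus>\<^bsub>B\<^esub> f (?\<delta> \<cdot>\<^bsub>?E\<^esub> v x)"
      using hom_add[OF f hom_closed[OF \<iota> rst[OF v]] E.ract_closed[OF \<delta> cx[OF v]]] by simp
    also have "f (?\<delta> \<cdot>\<^bsub>?E\<^esub> v x) = f ?\<delta> \<otimes>\<^bsub>B\<^esub> v x" using hom_ract[OF f \<delta> cx[OF v]] by simp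
    finally show ?thesis .
  qed
  have coords: "dual B ?F \<subseteq> W" if W: "dual_space B ?F W" and Wj: "\<And>j. j \<in> X \<Longrightarrow> (\<lambda>v. v j) \<in> W" for W
  proof (rule separating_spansD[OF insert.IH _ _ W])
    let ?C = "(\<lambda>j v. v j) ` X"
    show "finite ?C" "?C \<subseteq> dual B ?F" "?C \<subseteq> W" using insert.hyps crd Wj by auto
    show "v = \<zero>\<^bsub>?F\<^esub>" if "v \<in> carrier ?F" "\<forall>g\<in>?C. g v = \<zero>\<^bsub>B\<^esub>" for v
      using that by (auto simp: free_sel PiE_iff fun_eq_iff extensional_def)
  qed
  show ?case
    unfolding separating_spans_def
  proof (intro allI impI, elim conjE)
    fix G W
    assume G: "finite G" "G \<subseteq> dual B ?E" "dual_space B ?E W" "G \<subseteq> W"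
      and sep: "\<forall>v\<in>carrier ?E. (\<forall>g\<in>G. g v = \<zero>\<^bsub>B\<^esub>) \<longrightarrow> v = \<zero>\<^bsub>?E\<^esub>"
    note W' = dual_spaceD[OF G(3)]
    let ?G' = "(\<lambda>g v. g (?\<iota> v)) ` G"
    \<comment> \<open>Restricted to the smaller free module, the functionals in \<open>G\<close>
      still have no common nonzero zero, so the induction hypothesis applies to them.\<close>
    have all: "dual B ?F \<subseteq> V" if V: "dual_space B ?F V" "?G' \<subseteq> V" for V
    proof (rule separating_spansD[OF insert.IH _ _ V])
      show "finite ?G'" "?G' \<subseteq> dual B ?F" using G hom_comp[OF \<iota>] by auto
      fix v assume v: "v \<in> carrier ?F" "\<forall>g\<in>?G'. g v = \<zero>\<^bsub>B\<^esub>"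
      then have iv: "?\<iota> v = \<zero>\<^bsub>?E\<^esub>" using sep hom_closed[OF \<iota> v(1)] by simp
      have "v i = \<zero>\<^bsub>B\<^esub>" if "i \<in> X" for i using fun_cong[OF iv, of i] that insert.hyps by (auto simp: free_sel split: if_splits)
      then show "v = \<zero>\<^bsub>?F\<^esub>" using v(1) by (auto simp: free_sel PiE_iff fun_eq_iff extensional_def)
    qed
    have "dual B ?F \<subseteq> {f \<in> dual B ?F. \<exists>w\<in>W. \<forall>x\<in>carrier ?F. f x = w (?\<iota> x)}"
      by (rule all[OF dual_space_pull[OF B F \<iota> G(3)]]) (use G hom_comp[OF \<iota>] in auto)
    then have lift: "\<exists>w\<in>W. \<forall>x\<in>carrier ?F. f x = w (?\<iota> x)" if "f \<in> dual B ?F" for f using that by blast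
    have "\<exists>w\<in>W. \<forall>v\<in>carrier ?F. v j = w (?\<iota> v)" if "j \<in> X" for j using lift[OF crd[OF that]] .
    \<comment> \<open>\<open>w j\<close> in \<open>W\<close> restricts to the \<open>j\<close>-th
      coordinate; its value at the new basis vector \<open>?\<delta>\<close> is not under
      control.\<close>
    then obtain w where w: "\<And>j. j \<in> X \<Longrightarrow> w j \<in> W \<and> (\<forall>v\<in>carrier ?F. v j = w j (?\<iota> v))" by metis
    have wd: "w j \<in> dual B ?E" if "j \<in> X" for j using w[OF that] W'(1) by blast
    define c where "c j = w j ?\<delta>" for j
    have cB: "c j \<in> carrier B" if "j \<in> X" for j using hom_closed[OF wd[OF that] \<delta>] by (simp add: c_def)
    \<comment> \<open>\<open>v0\<close> is the new basis vector corrected by the values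
      \<open>c j\<close>, so that every \<open>w j\<close> vanishes at it while its coordinate at
      \<open>x\<close> stays \<open>\<one>\<close>.\<close>
    define v0 where "v0 = (\<lambda>i\<in>insert x X. if i = x then \<one>\<^bsub>B\<^esub> else \<ominus>\<^bsub>B\<^esub> c i)"
    have v0: "v0 \<in> carrier ?E" using cB insert.hyps by (auto simp: free_sel v0_def)
    have v0x: "v0 x = \<one>\<^bsub>B\<^esub>" by (simp add: v0_def)
    have wv0: "w j v0 = \<zero>\<^bsub>B\<^esub>" if j: "j \<in> X" for j
    proof -
      have "restrict v0 X j = w j (?\<iota> (restrict v0 X))" using bspec[OF conjunct2[OF w[OF j]] rst[OF v0]] .
      then have "w j v0 = restrict v0 X j \<oplus>\<^bsub>B\<^esub> c j"
        using decf[OF wd[OF j] v0] v0x cB[OF j] by (simp only: c_def[symmetric] B.r_one)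
      also have "\<dots> = \<zero>\<^bsub>B\<^esub>" using j insert.hyps cB[OF j] by (auto simp: v0_def B.l_neg)
      finally show ?thesis .
    qed
    \<comment> \<open>The functionals \<open>w j\<close> lie in \<open>W1\<close>, so functionals
      vanishing at \<open>v0\<close> can still be prescribed freely on the smaller free
      module.\<close>
    define W1 where "W1 = {f \<in> W. f v0 = \<zero>\<^bsub>B\<^esub>}"
    have W1: "dual_space B ?E W1"
      unfolding dual_space_def
    proof (intro conjI ballI allI impI)
      show "W1 \<subseteq> dual B ?E" using W'(1) by (auto simp: W1_def)
      show "(\<lambda>_. \<zero>\<^bsub>B\<^esub>) \<in> W1" using W'(2) by (auto simp: W1_def)
      show "(\<lambda>x. f x \<oplus>\<^bsub>B\<^esub> g x) \<in> W1" if "f \<in> W1" "g \<in> W1" for f g using that W'(3) by (auto simp: W1_def)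
      show "(\<lambda>x. b \<otimes>\<^bsub>B\<^esub> f x) \<in> W1" if "b \<in> carrier B" "f \<in> W1" for b f using that W'(4) by (auto simp: W1_def)
      show "g \<in> W1" if "f \<in> W1" "\<forall>x\<in>carrier ?E. g x = f x" for f g
        using that W'(5)[of f g] v0 by (auto simp: W1_def)
    qed
    have "dual B ?F \<subseteq> {f \<in> dual B ?F. \<exists>w\<in>W1. \<forall>x\<in>carrier ?F. f x = w (?\<iota> x)}"
      by (rule coords[OF dual_space_pull[OF B F \<iota> W1]]) (use w wv0 crd in \<open>auto simp: W1_def\<close>)
    then have lift1: "\<exists>w\<in>W1. \<forall>x\<in>carrier ?F. f x = w (?\<iota> x)" if "f \<in> dual B ?F" for f using that by blast
    let ?G'' = "(\<lambda>g. g v0) ` G"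
    have G'': "finite ?G'' \<and> ?G'' \<subseteq> carrier B" using G hom_closed[OF _ v0] by fastforce
    \<comment> \<open>If \<open>r\<close> is killed by all values at \<open>v0\<close>, then all of
      \<open>G\<close> vanishes at the \<open>r\<close>-multiple of \<open>v0\<close>, which is
      therefore zero; its coordinate at \<open>x\<close> is \<open>r\<close>.\<close>
    have ann: "r = \<zero>\<^bsub>B\<^esub>" if r: "r \<in> carrier B" "\<forall>g\<in>?G''. g \<otimes>\<^bsub>B\<^esub> r = \<zero>\<^bsub>B\<^esub>" for r
    proof -
      have "g (v0 \<cdot>\<^bsub>?E\<^esub> r) = \<zero>\<^bsub>B\<^esub>" if "g \<in> G" for g
        using hom_ract[of g B ?E "reg_rmod B", OF _ v0 r(1)] G(2) that r(2) by auto
      then have "v0 \<cdot>\<^bsub>?E\<^esub> r = \<zero>\<^bsub>?E\<^esub>" using sep E.ract_closed[OF v0 r(1)] by blast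
      then have "(v0 \<cdot>\<^bsub>?E\<^esub> r) x = \<zero>\<^bsub>?E\<^esub> x" by simp
      then show ?thesis using r(1) v0x by (simp add: free_sel)
    qed
    have one: "\<one>\<^bsub>B\<^esub> \<in> L" if "left_ideal B L" "?G'' \<subseteq> L" for L
      by (rule left_ideals_annihilatedD[OF H G''[THEN conjunct1] G''[THEN conjunct2] that]) (rule ann)
    have "left_ideal B ((\<lambda>f. f v0) ` W)"
      unfolding left_ideal_def
    proof (intro conjI ballI)
      show "(\<lambda>f. f v0) ` W \<subseteq> carrier B" using W'(1) hom_closed[OF _ v0] by fastforce
      show "\<zero>\<^bsub>B\<^esub> \<in> (\<lambda>f. f v0) ` W" using W'(2) by (rule image_eqI[rotated]) simp
      show "y \<oplus>\<^bsub>B\<^esub> z \<in> (\<lambda>f. f v0) ` W" if yz: "y \<in> (\<lambda>f. f v0) ` W" "z \<in> (\<lambda>f. f v0) ` W" for y z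
      proof -
        from yz obtain f g where "f \<in> W" "g \<in> W" "y = f v0" "z = g v0" by blast
        then show ?thesis using W'(3)[of f g] by (intro image_eqI[of _ _ "\<lambda>x. f x \<oplus>\<^bsub>B\<^esub> g x"]) auto
      qed
      show "b \<otimes>\<^bsub>B\<^esub> y \<in> (\<lambda>f. f v0) ` W" if bz: "b \<in> carrier B" "y \<in> (\<lambda>f. f v0) ` W" for b y
      proof -
        from bz obtain f where "f \<in> W" "y = f v0" by blast
        then show ?thesis using W'(4)[OF bz(1), of f] by (intro image_eqI[of _ _ "\<lambda>x. b \<otimes>\<^bsub>B\<^esub> f x"]) auto
      qed
    qed
    moreover have "?G'' \<subseteq> (\<lambda>f. f v0) ` W" using G(4) by blast
    ultimately have "\<one>\<^bsub>B\<^esub> \<in> (\<lambda>f. f v0) ` W" by (rule one)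
    then obtain f where f: "f \<in> W" "f v0 = \<one>\<^bsub>B\<^esub>" by auto
    have fd: "f \<in> dual B ?E" using f W'(1) by blast
    obtain u where u: "u \<in> W1" "\<forall>v\<in>carrier ?F. f (?\<iota> v) = u (?\<iota> v)" using lift1[OF hom_comp[OF \<iota> fd]] by blast
    have uW: "u \<in> W" "u v0 = \<zero>\<^bsub>B\<^esub>" using u(1) by (auto simp: W1_def)
    have ud: "u \<in> dual B ?E" using uW(1) W'(1) by blast
    \<comment> \<open>\<open>f\<close> has value \<open>\<one>\<close> at \<open>v0\<close>, and
      \<open>u\<close> agrees with it on the smaller free module but vanishes at \<open>v0\<close>.
      Their difference is the missing coordinate at \<open>x\<close>.\<close>
    define e where "e v = f v \<oplus>\<^bsub>B\<^esub> (\<ominus>\<^bsub>B\<^esub> \<one>\<^bsub>B\<^esub>) \<otimes>\<^bsub>B\<^esub> u v" for v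
    have eW: "e \<in> W" unfolding e_def using W'(3)[OF f(1) W'(4)[OF _ uW(1)], of "\<ominus>\<^bsub>B\<^esub> \<one>\<^bsub>B\<^esub>"] by simp
    have ed: "e \<in> dual B ?E" using eW W'(1) by blast
    have e0: "e (?\<iota> v) = \<zero>\<^bsub>B\<^esub>" if v: "v \<in> carrier ?F" for v
      using u(2) v hom_closed[OF ud hom_closed[OF \<iota> v]] by (simp add: e_def B.l_minus B.r_neg)
    have ev: "e v = e ?\<delta> \<otimes>\<^bsub>B\<^esub> v x" if "v \<in> carrier ?E" for v
      using decf[OF ed that] e0[OF rst[OF that]] hom_closed[OF ed \<delta>] cx[OF that] by simp
    have "e ?\<delta> = \<one>\<^bsub>B\<^esub>"
      using ev[OF v0] v0x f(2) uW(2) hom_closed[OF ed \<delta>] by (simp add: e_def)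
    then have ex: "e v = v x" if "v \<in> carrier ?E" for v using ev[OF that] cx[OF that] by simp
    have "h \<in> W" if h: "h \<in> dual B ?E" for h
    proof -
      obtain h' where h': "h' \<in> W" "\<forall>v\<in>carrier ?F. h (?\<iota> v) = h' (?\<iota> v)" using lift[OF hom_comp[OF \<iota> h]] by blast
      have hd: "h' \<in> dual B ?E" using h' W'(1) by blast
      have hc: "h ?\<delta> \<in> carrier B" "h' ?\<delta> \<in> carrier B" using hom_closed[OF h \<delta>] hom_closed[OF hd \<delta>] by auto
      let ?d = "h ?\<delta> \<ominus>\<^bsub>B\<^esub> h' ?\<delta>"
      have d: "?d \<in> carrier B" using hc by simp
      \<comment> \<open>A functional from \<open>W\<close> with the right restriction is corrected
        at the new basis vector by a multiple of the coordinate \<open>e\<close>.\<close>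
      have "(\<lambda>v. h' v \<oplus>\<^bsub>B\<^esub> ?d \<otimes>\<^bsub>B\<^esub> e v) \<in> W" by (intro W'(3,4) h'(1) d eW)
      then show "h \<in> W"
      proof (rule W'(5))
        fix v assume v: "v \<in> carrier ?E"
        have i: "h' (?\<iota> (restrict v X)) \<in> carrier B"
          using hom_closed[OF hd hom_closed[OF \<iota> rst[OF v]]] by simp
        have "h' ?\<delta> \<otimes>\<^bsub>B\<^esub> v x \<oplus>\<^bsub>B\<^esub> ?d \<otimes>\<^bsub>B\<^esub> v x = h ?\<delta> \<otimes>\<^bsub>B\<^esub> v x"
          using hc d cx[OF v] by (simp add: B.l_distr[symmetric] B.a_comm[of _ ?d] B.diff_cancel)
        then show "h v = h' v \<oplus>\<^bsub>B\<^esub> ?d \<otimes>\<^bsub>B\<^esub> e v"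
          using decf[OF h v] decf[OF hd v] bspec[OF h'(2) rst[OF v]] ex[OF v] i hc d cx[OF v]
          by (simp add: B.a_assoc)
      qed
    qed
    then show "dual B ?E \<subseteq> W" by blast
  qed
qed

text \<open>Bass's argument. A retraction of \<open>f\<close> amounts to extending the coordinate
  functionals of \<open>P\<close> along \<open>f\<close> to \<open>Q\<close>. The functionals that
  extend form a submodule of the dual of a finite free module, and injectivity of \<open>f\<close>
  supplies enough of them to separate vectors.\<close>

lemma injective_splits:
  assumes H: "left_ideals_annihilated B"
    and P: "projective_rmod B P" "fin_gen B P" and Q: "projective_rmod B Q" "fin_gen B Q"
    and f: "f \<in> rmod_hom B P Q" "inj_on f (carrier P)"
  obtains g where "g \<in> rmod_hom B Q P" "\<forall>x\<in>carrier P. g (f x) = x"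
proof -
  have B: "ring B" by (rule proj_ring[OF P(1)])
  interpret B: ring B by (rule B)
  note Pm = proj_module[OF P(1)] and Qm = proj_module[OF Q(1)]
  interpret P: right_module B P by (rule Pm)
  interpret Q: right_module B Q by (rule Qm)
  obtain n s p where s: "s \<in> rmod_hom B P (free_rmod B {..<n::nat})" and p: "p \<in> rmod_hom B (free_rmod B {..<n}) P"
    and ps: "\<forall>x\<in>carrier P. p (s x) = x" by (rule fin_gen_proj_summand[OF P])
  obtain m t q where t: "t \<in> rmod_hom B Q (free_rmod B {..<m::nat})" and q: "q \<in> rmod_hom B (free_rmod B {..<m}) Q"
    and qt: "\<forall>x\<in>carrier Q. q (t x) = x" by (rule fin_gen_proj_summand[OF Q])
  let ?F = "free_rmod B {..<n}" and ?E = "free_rmod B {..<m}"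
  have F: "right_module B ?F" and E: "right_module B ?E" by (rule free_module[OF B])+
  interpret F: right_module B ?F by (rule F)
  interpret E: right_module B ?E by (rule E)
  have crd: "(\<lambda>v. v i) \<in> dual B (free_rmod B Y)" if "i \<in> Y" for i and Y :: "nat set"
    using that by (intro rmod_homI) (auto simp: free_sel PiE_iff)
  let ?g1 = "\<lambda>i v. t (f (p v)) i" and ?g2 = "\<lambda>i v. (v \<ominus>\<^bsub>?F\<^esub> s (p v)) i"
  have h1: "(\<lambda>v. t (f (p v))) \<in> rmod_hom B ?F ?E" by (rule hom_comp[OF hom_comp[OF p f(1)] t])
  have h2: "(\<lambda>v. v \<ominus>\<^bsub>?F\<^esub> s (p v)) \<in> rmod_hom B ?F ?F" by (intro hom_diff hom_id hom_comp[OF p s] F)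
  have g1: "?g1 i \<in> dual B ?F" if "i < m" for i using hom_comp[OF h1 crd[of i "{..<m}"]] that by simp
  have g2: "?g2 i \<in> dual B ?F" if "i < n" for i using hom_comp[OF h2 crd[of i "{..<n}"]] that by simp
  \<comment> \<open>The first family sees \<open>f\<close> in the coordinates of \<open>Q\<close>,
    the second sees the complement of \<open>P\<close> in the free module. A common zero has its
    \<open>P\<close>-part killed by the injective \<open>f\<close> and no complementary
    part.\<close>
  let ?G = "?g1 ` {..<m} \<union> ?g2 ` {..<n}"
  have G: "finite ?G \<and> ?G \<subseteq> dual B ?F" using g1 g2 by auto
  have zero: "w = \<zero>\<^bsub>free_rmod B Y\<^esub>" if "w \<in> carrier (free_rmod B Y)" "\<And>i. i \<in> Y \<Longrightarrow> w i = \<zero>\<^bsub>B\<^esub>" for w and Y :: "nat set"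
    using that by (auto simp: free_sel PiE_iff fun_eq_iff extensional_def)
  have "v = \<zero>\<^bsub>?F\<^esub>" if v: "v \<in> carrier ?F" and g: "\<forall>g\<in>?G. g v = \<zero>\<^bsub>B\<^esub>" for v
  proof -
    have pv: "p v \<in> carrier P" and spv: "s (p v) \<in> carrier ?F" using hom_closed[OF p v] hom_closed[OF s] by auto
    have fp: "f (p v) \<in> carrier Q" using hom_closed[OF f(1) pv] .
    have "t (f (p v)) = \<zero>\<^bsub>?E\<^esub>" by (rule zero[OF hom_closed[OF h1 v]]) (use g in auto)
    then have "f (p v) = \<zero>\<^bsub>Q\<^esub>" using bspec[OF qt fp] hom_zero[OF q E Qm] by simp
    then have "p v = \<zero>\<^bsub>P\<^esub>" using inj_onD[OF f(2), of "p v" "\<zero>\<^bsub>P\<^esub>"] pv hom_zero[OF f(1) Pm Qm] by simp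
    then have s0: "s (p v) = \<zero>\<^bsub>?F\<^esub>" using hom_zero[OF s Pm F] by simp
    have "v \<ominus>\<^bsub>?F\<^esub> s (p v) = \<zero>\<^bsub>?F\<^esub>" by (rule zero[OF hom_closed[OF h2 v]]) (use g in auto)
    then show ?thesis using s0 v spv F.diff_eq_zero_iff by metis
  qed
  note sep = this
  have span: "dual B ?F \<subseteq> W" if "dual_space B ?F W" "?G \<subseteq> W" for W
    by (rule separating_spansD[OF free_separating_spans[OF B H finite_lessThan] G[THEN conjunct1] G[THEN conjunct2] that])
      (rule sep)
  \<comment> \<open>Only the restriction to \<open>P\<close> has to extend along \<open>f\<close>;
    the second family restricts to zero there and extends by zero.\<close>
  let ?W = "{h \<in> dual B ?F. \<exists>\<gamma>\<in>dual B Q. \<forall>x\<in>carrier P. h (s x) = \<gamma> (f x)}"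
  have "dual_space B ?F ?W"
    unfolding dual_space_def
  proof (intro conjI ballI allI impI)
    have z1: "(\<lambda>_. \<zero>\<^bsub>B\<^esub>) \<in> dual B ?F" and z2: "(\<lambda>_. \<zero>\<^bsub>B\<^esub>) \<in> dual B Q"
      using hom_const_zero[OF reg_module[OF B], of ?F] hom_const_zero[OF reg_module[OF B], of Q] by simp_all
    show "(\<lambda>_. \<zero>\<^bsub>B\<^esub>) \<in> ?W" using z1 z2 by auto
  next
    fix h k assume "h \<in> ?W" "k \<in> ?W"
    then obtain \<gamma> \<eta> where "h \<in> dual B ?F" "k \<in> dual B ?F" "\<gamma> \<in> dual B Q" "\<forall>x\<in>carrier P. h (s x) = \<gamma> (f x)"
      "\<eta> \<in> dual B Q" "\<forall>x\<in>carrier P. k (s x) = \<eta> (f x)" by blast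
    then show "(\<lambda>x. h x \<oplus>\<^bsub>B\<^esub> k x) \<in> ?W"
      by (auto intro!: bexI[of _ "\<lambda>x. \<gamma> x \<oplus>\<^bsub>B\<^esub> \<eta> x"] dual_plus[OF B])
  next
    fix b h assume "b \<in> carrier B" "h \<in> ?W"
    then obtain \<gamma> where "h \<in> dual B ?F" "\<gamma> \<in> dual B Q" "\<forall>x\<in>carrier P. h (s x) = \<gamma> (f x)" "b \<in> carrier B" by blast
    then show "(\<lambda>x. b \<otimes>\<^bsub>B\<^esub> h x) \<in> ?W"
      by (auto intro!: bexI[of _ "\<lambda>x. b \<otimes>\<^bsub>B\<^esub> \<gamma> x"] dual_scale[OF B])
  next
    fix h k assume "h \<in> ?W" "\<forall>x\<in>carrier ?F. k x = h x"
    then show "k \<in> ?W" using hom_cong[OF _ F, of h "reg_rmod B" k] hom_closed[OF s] by auto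
  qed auto
  moreover have "?G \<subseteq> ?W"
  proof (intro Un_least image_subsetI)
    fix i assume i: "i \<in> {..<m}"
    have "(\<lambda>y. t y i) \<in> dual B Q" using hom_comp[OF t crd[OF i]] .
    then show "?g1 i \<in> ?W" using g1 i ps by (auto intro!: bexI[of _ "\<lambda>y. t y i"])
  next
    fix i assume i: "i \<in> {..<n}"
    have "(\<lambda>_. \<zero>\<^bsub>B\<^esub>) \<in> dual B Q" using hom_const_zero[OF reg_module[OF B], of Q] by simp
    moreover have "?g2 i (s x) = \<zero>\<^bsub>B\<^esub>" if x: "x \<in> carrier P" for x
    proof -
      have "s x \<ominus>\<^bsub>?F\<^esub> s (p (s x)) = \<zero>\<^bsub>?F\<^esub>" using ps x hom_closed[OF s x] by (simp add: F.diff_eq_zero_iff)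
      then show ?thesis using i by (simp add: free_sel)
    qed
    ultimately show "?g2 i \<in> ?W" using g2 i by (auto intro!: bexI[of _ "\<lambda>_. \<zero>\<^bsub>B\<^esub>"])
  qed
  ultimately have "dual B ?F \<subseteq> ?W" by (rule span)
  then have "\<exists>\<gamma>\<in>dual B Q. \<forall>x\<in>carrier P. s x j = \<gamma> (f x)" if "j < n" for j
    using crd[of j "{..<n}"] that by blast
  then obtain \<gamma> where \<gamma>: "\<And>j. j < n \<Longrightarrow> \<gamma> j \<in> dual B Q \<and> (\<forall>x\<in>carrier P. s x j = \<gamma> j (f x))" by metis
  have \<gamma>h: "\<gamma> j \<in> dual B Q" if "j < n" for j using \<gamma> that by blast
  have \<Gamma>: "(\<lambda>y. \<lambda>j\<in>{..<n}. \<gamma> j y) \<in> rmod_hom B Q ?F"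
    using hom_closed[OF \<gamma>h] hom_add[OF \<gamma>h] hom_ract[OF \<gamma>h]
    by (intro rmod_homI) (auto simp: free_sel fun_eq_iff)
  show thesis
  proof (rule that[OF hom_comp[OF \<Gamma> p]], rule ballI)
    fix x assume x: "x \<in> carrier P"
    have "(\<lambda>j\<in>{..<n}. \<gamma> j (f x)) = s x"
      using \<gamma> x hom_closed[OF s x] by (auto simp: free_sel fun_eq_iff PiE_iff extensional_def)
    then show "p (\<lambda>j\<in>{..<n}. \<gamma> j (f x)) = x" using ps x by simp
  qed
qed

text \<open>The leftmost map of the resolution is injective and hence splits. Replacing its target
  by a complement of its image shortens the resolution by one, until \<open>M\<close> is isomorphic
  to a projective module.\<close>

lemma resolution_collapse:
  fixes M :: "('a, 'b) rmod"
  assumes H: "left_ideals_annihilated B"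
  shows "proj_resolution B M n P d \<Longrightarrow> (\<forall>i\<le>n. fin_gen B (P i)) \<Longrightarrow> right_module B M \<Longrightarrow> projective_rmod B M"
proof (induction n arbitrary: P)
  case 0
  note r = proj_resolutionD[OF 0(1)]
  have P0: "projective_rmod B (P 0)" using r(1) by simp
  have b: "bij_betw (d 0) (carrier (P 0)) (carrier M)" using r(4,7) by (simp add: bij_betw_def)
  show ?case
    by (rule proj_retract[OF 0(3) P0 inv_hom[OF r(2) proj_module[OF P0] b] r(2)])
      (use f_the_inv_into_f[OF r(7)] r(4) in auto)
next
  case (Suc k)
  note r = proj_resolutionD[OF Suc(2)] and M = Suc(4)
  have Pk: "projective_rmod B (P k)" "fin_gen B (P k)" and Pk': "projective_rmod B (P (Suc k))" "fin_gen B (P (Suc k))"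
    using r(1) Suc(3) by auto
  note m = proj_module[OF Pk(1)] and m' = proj_module[OF Pk'(1)]
  interpret Pk: right_module B "P k" by (rule m)
  interpret Pk': right_module B "P (Suc k)" by (rule m')
  let ?e = "d (Suc k)"
  have e: "?e \<in> rmod_hom B (P (Suc k)) (P k)" using r(3) by simp
  obtain g where g: "g \<in> rmod_hom B (P k) (P (Suc k))" "\<forall>x\<in>carrier (P (Suc k)). g (?e x) = x"
    by (rule injective_splits[OF H Pk' Pk e r(7)])
  \<comment> \<open>\<open>T\<close> is the target of \<open>d k\<close>, which is \<open>M\<close>
    itself when \<open>k\<close> is zero.\<close>
  define T where "T = (case k of 0 \<Rightarrow> M | Suc j \<Rightarrow> P j)"
  have T: "right_module B T" "d k \<in> rmod_hom B (P k) T"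
    "?e ` carrier (P (Suc k)) = {x \<in> carrier (P k). d k x = \<zero>\<^bsub>T\<^esub>}"
    using M r(1,2,3,5,6) by (auto simp: T_def proj_module split: nat.split)
  interpret T: right_module B T by (rule T)
  define U where "U = {y \<in> carrier (P k). g y = \<zero>\<^bsub>P (Suc k)\<^esub>}"
  have U: "submod B (P k) U" unfolding U_def by (rule submod_ker[OF g(1) m m'])
  let ?Q = "(P k)\<lparr>carrier := U\<rparr>"
  have Q: "right_module B ?Q" by (rule submod_module[OF m U])
  \<comment> \<open>The projection onto the complement along the image of the split map. It changes
    an element only by something in the kernel of \<open>d k\<close>, so \<open>d k\<close> keeps
    its image on \<open>U\<close>.\<close>
  let ?\<pi> = "\<lambda>y. y \<ominus>\<^bsub>P k\<^esub> ?e (g y)"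
  have eg: "?e (g y) \<in> carrier (P k)" "g y \<in> carrier (P (Suc k))" if "y \<in> carrier (P k)" for y
    using hom_closed[OF g(1) that] hom_closed[OF e] by auto
  have \<pi>: "?\<pi> \<in> rmod_hom B (P k) ?Q"
  proof (rule hom_into_sub)
    show "?\<pi> \<in> rmod_hom B (P k) (P k)" by (intro hom_diff hom_id hom_comp[OF g(1) e] m)
    show "?\<pi> y \<in> U" if "y \<in> carrier (P k)" for y
      using that eg[OF that] g(2) by (simp add: U_def hom_minus[OF g(1) m m'] Pk'.diff_eq_zero_iff)
  qed
  have fix_U: "?\<pi> y = y" if "y \<in> U" for y
    using that hom_zero[OF e m' m] by (simp add: U_def a_minus_def)
  have Qp: "projective_rmod B ?Q" by (rule proj_retract[OF Q Pk(1) submod_incl[OF U] \<pi>]) (use fix_U in simp)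
  have "?\<pi> ` carrier (P k) = U"
    using hom_closed[OF \<pi>] fix_U submodD(1)[OF U] by (auto intro!: image_eqI[of _ ?\<pi>, OF fix_U[symmetric]])
  then have Qf: "fin_gen B ?Q" using \<pi> by (intro fin_gen_img[OF m Q _ Pk(2)]) simp
  have dU: "d k ` U = d k ` carrier (P k)"
  proof
    show "d k ` U \<subseteq> d k ` carrier (P k)" using submodD(1)[OF U] by blast
    show "d k ` carrier (P k) \<subseteq> d k ` U"
    proof
      fix z assume "z \<in> d k ` carrier (P k)"
      then obtain y where y: "y \<in> carrier (P k)" "z = d k y" by blast
      have "d k (?e (g y)) = \<zero>\<^bsub>T\<^esub>" using T(3) eg(2)[OF y(1)] by blast
      then have "d k (?\<pi> y) = z" using y eg[OF y(1)] hom_closed[OF T(2)] by (simp add: hom_add[OF T(2)] hom_neg[OF T(2) m T(1)] a_minus_def)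
      then show "z \<in> d k ` U" using hom_closed[OF \<pi> y(1)] by auto
    qed
  qed
  have inj: "inj_on (d k) U"
  proof -
    have "d k \<in> rmod_hom B ?Q T" by (rule hom_comp[OF submod_incl[OF U] T(2), simplified])
    then have "inj_on (d k) (carrier ?Q)"
    proof (rule hom_inj[OF _ Q T(1)])
      fix y assume "y \<in> carrier ?Q" "d k y = \<zero>\<^bsub>T\<^esub>"
      then have y: "y \<in> U" "y \<in> carrier (P k)" "d k y = \<zero>\<^bsub>T\<^esub>" using submodD(1)[OF U] by auto
      then obtain z where z: "z \<in> carrier (P (Suc k))" "y = ?e z" using T(3) by blast
      then have "z = \<zero>\<^bsub>P (Suc k)\<^esub>" using g(2) y(1) by (simp add: U_def)
      then show "y = \<zero>\<^bsub>?Q\<^esub>" using z hom_zero[OF e m' m] by simp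
    qed
    then show ?thesis by simp
  qed
  define P' where "P' = P(k := ?Q)"
  have P'k: "P' k = ?Q" and P'i: "P' i = P i" if "i \<noteq> k" for i using that by (simp_all add: P'_def)
  have P'k: "P' k = ?Q" by (simp add: P'_def)
  have im: "f ` carrier (P' i) = f ` carrier (P i)" if "f = d i" for f i
    using that dU by (cases "i = k") (auto simp: P'k P'i)
  have hm: "f \<in> rmod_hom B (P' i) N" if "f \<in> rmod_hom B (P i) N" for f i and N :: "('a, 'b) rmod"
    using that hom_comp[OF submod_incl[OF U], of f N] by (cases "i = k") (auto simp: P'k P'i)
  have "proj_resolution B M k P' d"
    unfolding proj_resolution_def
  proof (intro conjI allI impI)
    show "projective_rmod B (P' i)" if "i \<le> k" for i using that Qp r(1) by (cases "i = k") (auto simp: P'k P'i)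
    show "d 0 \<in> rmod_hom B (P' 0) M" by (rule hm[OF r(2)])
    show "d (Suc i) \<in> rmod_hom B (P' (Suc i)) (P' i)" if "i < k" for i
      using hm[OF r(3), of i] that by (simp add: P'i)
    show "d 0 ` carrier (P' 0) = carrier M" using im[of "d 0" 0] r(4) by simp
    show "d 1 ` carrier (P' 1) = {x \<in> carrier (P' 0). d 0 x = \<zero>\<^bsub>M\<^esub>}" if "0 < k"
      using im[of "d 1" 1] r(5) that by (simp add: P'i)
    show "d (Suc (Suc i)) ` carrier (P' (Suc (Suc i))) = {x \<in> carrier (P' (Suc i)). d (Suc i) x = \<zero>\<^bsub>P' i\<^esub>}"
      if "Suc i < k" for i
      using im[of "d (Suc (Suc i))" "Suc (Suc i)"] r(6)[of i] that by (simp add: P'i)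
    show "inj_on (d k) (carrier (P' k))" using inj by (simp add: P'k)
  qed
  moreover have "\<forall>i\<le>k. fin_gen B (P' i)"
    using Qf Suc(3) by (auto simp: P'_def)
  ultimately show ?case using Suc.IH M by blast
qed

theorem fin_dim_zero:
  fixes B :: "('a, 'r) ring_scheme"
  assumes H: "left_ideals_annihilated B"
  shows "fin_dim B = 0"
proof -
  have "proj_dim B M \<le> 0" if "M \<in> fin_proj_class B" for M
  proof -
    have "projective_rmod B M"
      using that resolution_collapse[OF H] unfolding fin_proj_class_def by blast
    then have "proj_resolution B M 0 (\<lambda>_. M) (\<lambda>_ x. x)" by (simp add: proj_resolution_def hom_id)
    then have "proj_dim B M \<le> enat 0" unfolding proj_dim_def by (intro Inf_lower) blast
    then show ?thesis by (simp add: zero_enat_def)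
  qed
  then have "fin_dim B \<le> 0" unfolding fin_dim_def by (intro Sup_least) auto
  then show ?thesis by simp
qed

section \<open>Annihilators in the cover\<close>

text \<open>Schur's lemma: kernel and image are submodules of a simple module.\<close>

lemma simple_endo_inverse:
  assumes S: "simple_rmod R M" and f: "f \<in> carrier (end_ring R M)" "f \<noteq> \<zero>\<^bsub>end_ring R M\<^esub>"
  obtains g where "g \<in> carrier (end_ring R M)" "f \<otimes>\<^bsub>end_ring R M\<^esub> g = \<one>\<^bsub>end_ring R M\<^esub>"
proof -
  have M: "right_module R M" using S by (simp add: simple_rmod_def)
  have sub: "U = {\<zero>\<^bsub>M\<^esub>} \<or> U = carrier M" if "submod R M U" for U using S that by (simp add: simple_rmod_def)
  have fh: "f \<in> rmod_hom R M M" using f(1) by simp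
  have "\<exists>x\<in>carrier M. f x \<noteq> \<zero>\<^bsub>M\<^esub>"
  proof (rule ccontr)
    assume "\<not> ?thesis"
    then have "f = \<zero>\<^bsub>end_ring R M\<^esub>" using f(1) by (auto simp: fun_eq_iff extensional_def)
    with f(2) show False ..
  qed
  then obtain x where x: "x \<in> carrier M" "f x \<noteq> \<zero>\<^bsub>M\<^esub>" by blast
  have "{x \<in> carrier M. f x = \<zero>\<^bsub>M\<^esub>} = {\<zero>\<^bsub>M\<^esub>}" using sub[OF submod_ker[OF fh M M]] x by blast
  then have i: "inj_on f (carrier M)" by (intro hom_inj[OF fh M M]) blast
  have "f ` carrier M = carrier M" using sub[OF submod_img[OF fh M M submod_carrier[OF M]]] x by blast
  with i have b: "bij_betw f (carrier M) (carrier M)" by (simp add: bij_betw_def)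
  let ?g = "restrict (the_inv_into (carrier M) f) (carrier M)"
  show thesis
  proof (rule that)
    show "?g \<in> carrier (end_ring R M)" using hom_restrict[OF M inv_hom[OF fh M b]] by simp
    show "f \<otimes>\<^bsub>end_ring R M\<^esub> ?g = \<one>\<^bsub>end_ring R M\<^esub>"
      using f_the_inv_into_f_bij_betw[OF b] by (auto simp: fun_eq_iff compose_def)
  qed
qed

lemma trivial_ext_right_inverse:
  assumes "ring B" and x: "x \<in> carrier (trivial_ext B)" and y: "y \<in> carrier B" "fst x \<otimes>\<^bsub>B\<^esub> y = \<one>\<^bsub>B\<^esub>"
  obtains u where "u \<in> carrier (trivial_ext B)" "x \<otimes>\<^bsub>trivial_ext B\<^esub> u = \<one>\<^bsub>trivial_ext B\<^esub>"
proof -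
  interpret ring B by fact
  have xc: "fst x \<in> carrier B" "snd x \<in> carrier B" using x by auto
  \<comment> \<open>The second component solves the equation that makes the square-zero part of the
    product vanish; right inverses lift along the square-zero ideal.\<close>
  let ?z = "\<ominus>\<^bsub>B\<^esub> (y \<otimes>\<^bsub>B\<^esub> (snd x \<otimes>\<^bsub>B\<^esub> y))"
  have "fst x \<otimes>\<^bsub>B\<^esub> ?z = \<ominus>\<^bsub>B\<^esub> (snd x \<otimes>\<^bsub>B\<^esub> y)"
    using xc y by (simp add: r_minus m_assoc[symmetric])
  then show thesis using xc y by (intro that[of "(y, ?z)"]) (auto simp: l_neg)
qed

section \<open>Right ideals of the cover and their left annihilators\<close>

lemma opposite_sel [simp]:
  "carrier (opposite_ring R) = carrier R" "x \<otimes>\<^bsub>opposite_ring R\<^esub> y = y \<otimes>\<^bsub>R\<^esub> x"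
  "\<one>\<^bsub>opposite_ring R\<^esub> = \<one>\<^bsub>R\<^esub>" "\<zero>\<^bsub>opposite_ring R\<^esub> = \<zero>\<^bsub>R\<^esub>" "x \<oplus>\<^bsub>opposite_ring R\<^esub> y = x \<oplus>\<^bsub>R\<^esub> y"
  by (simp_all add: opposite_ring_def)

context comm_noeth
begin

lemma maximal_quotient_simple:
  assumes m: "maximalideal m A"
  shows "simple_rmod A (restr_rmod ((+>\<^bsub>A\<^esub>) m) (reg_rmod (A Quot m)))"
proof -
  interpret m: maximalideal m A by (rule m)
  let ?Q = "restr_rmod ((+>\<^bsub>A\<^esub>) m) (reg_rmod (A Quot m))"
  note q = quotient_rmod[OF m.is_ideal]
  have h: "(+>\<^bsub>A\<^esub>) m \<in> rmod_hom A (reg_rmod A) ?Q" using q(2) ..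
  have ker: "m +>\<^bsub>A\<^esub> a = \<zero>\<^bsub>?Q\<^esub> \<longleftrightarrow> a \<in> m" if "a \<in> carrier A" for a using q(3) that by blast
  show ?thesis
    unfolding simple_rmod_def
  proof (intro conjI allI impI q(1))
    obtain a where "a \<in> carrier A" "a \<notin> m" using m.I_notcarr m.a_subset by blast
    then show "carrier ?Q \<noteq> {\<zero>\<^bsub>?Q\<^esub>}" using ker hom_closed[OF h] by fastforce
    fix U assume U: "submod A ?Q U"
    let ?J = "{a \<in> carrier (reg_rmod A). m +>\<^bsub>A\<^esub> a \<in> U}"
    have J: "ideal ?J A"
      using submod_vimg[OF h reg_A q(1) U] by (simp add: submod_reg_iff[OF A_cring])
    have "m \<subseteq> ?J"
    proof
      fix a assume a: "a \<in> m"
      then have c: "a \<in> carrier A" using m.a_subset by blast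
      then have "m +>\<^bsub>A\<^esub> a = \<zero>\<^bsub>?Q\<^esub>" using ker a by simp
      then have "m +>\<^bsub>A\<^esub> a \<in> U" by (simp only: submodD(2)[OF U])
      with c show "a \<in> ?J" by simp
    qed
    moreover have "?J \<subseteq> carrier A" by simp
    ultimately have "?J = m \<or> ?J = carrier A" by (rule m.I_maximal[OF J])
    moreover have im: "\<exists>a\<in>carrier A. u = m +>\<^bsub>A\<^esub> a" if "u \<in> carrier ?Q" for u using epiE[OF q(2) that] by simp
    ultimately show "U = {\<zero>\<^bsub>?Q\<^esub>} \<or> U = carrier ?Q"
    proof (elim disjE)
      assume J: "?J = m"
      have "u = \<zero>\<^bsub>?Q\<^esub>" if u: "u \<in> U" for u
      proof -
        obtain a where a: "a \<in> carrier A" "u = m +>\<^bsub>A\<^esub> a" using im[OF subsetD[OF submodD(1)[OF U] u]] by (elim bexE)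
        then have "a \<in> ?J" using u by simp
        then have "a \<in> m" by (simp only: J)
        then show ?thesis using ker[OF a(1)] a(2) by simp
      qed
      then have "U = {\<zero>\<^bsub>?Q\<^esub>}" using submodD(2)[OF U] by blast
      then show ?thesis ..
    next
      assume J: "?J = carrier A"
      have "carrier ?Q \<subseteq> U"
      proof
        fix u assume "u \<in> carrier ?Q"
        then obtain a where a: "a \<in> carrier A" "u = m +>\<^bsub>A\<^esub> a" using im by blast
        from a(1) have "a \<in> ?J" by (simp only: J)
        then show "u \<in> U" using a(2) by simp
      qed
      with submodD(1)[OF U] have "U = carrier ?Q" by (rule equalityI)
      then show ?thesis ..
    qed
  qed
qed

lemma ex_maximal_ideal:
  assumes J: "ideal J A" "J \<noteq> carrier A"
  obtains m where "maximalideal m A" "J \<subseteq> m"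
proof -
  interpret noetherian_ring A by (rule A_noeth)
  let ?S = "{I. ideal I A \<and> J \<subseteq> I \<and> I \<noteq> carrier A}"
  have "\<exists>M\<in>?S. \<forall>I\<in>?S. M \<subseteq> I \<longrightarrow> I = M"
    by (rule maximal_ideal_in) (use J in auto)
  then obtain m where mS: "m \<in> ?S" and max: "\<forall>I\<in>?S. m \<subseteq> I \<longrightarrow> I = m" by (rule bexE)
  have m: "ideal m A" "J \<subseteq> m" "m \<noteq> carrier A" using mS by simp_all
  have "maximalideal m A"
  proof (rule maximalidealI[OF m(1)])
    show "carrier A \<noteq> m" using m(3) by (rule not_sym)
    fix I assume I: "ideal I A" "m \<subseteq> I" "I \<subseteq> carrier A"
    show "I = m \<or> I = carrier A"
    proof (cases "I = carrier A")
      case False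
      then have "I \<in> ?S" using I(1) order_trans[OF m(2) I(2)] by simp
      with max I(2) show ?thesis by simp
    qed simp
  qed
  then show thesis using m(2) by (rule that)
qed

text \<open>\<open>A / m\<close> represents one of the classes. The coset of \<open>\<one>\<close>,
  moved to the chosen representative of this class, is nonzero and killed by
  \<open>m\<close>.\<close>

lemma simple_killed:
  assumes m: "maximalideal m A"
  obtains c s where "c \<in> simple_classes A" "s \<in> carrier (class_rep c)" "s \<noteq> \<zero>\<^bsub>class_rep c\<^esub>"
    "\<forall>a\<in>m. s \<cdot>\<^bsub>class_rep c\<^esub> a = \<zero>\<^bsub>class_rep c\<^esub>"
proof -
  interpret m: maximalideal m A by (rule m)
  let ?Q = "restr_rmod ((+>\<^bsub>A\<^esub>) m) (reg_rmod (A Quot m))"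
  let ?r = "{(M :: ('a, 'a set) rmod, N :: ('a, 'a set) rmod). simple_rmod A M \<and> simple_rmod A N \<and> rmod_iso A M N}"
  note q = quotient_rmod[OF m.is_ideal]
  have h: "(+>\<^bsub>A\<^esub>) m \<in> rmod_hom A (reg_rmod A) ?Q" using q(2) ..
  have ker: "m +>\<^bsub>A\<^esub> a = \<zero>\<^bsub>?Q\<^esub> \<longleftrightarrow> a \<in> m" if "a \<in> carrier A" for a using q(3) that by blast
  note Qs = maximal_quotient_simple[OF m]
  define c where "c = ?r `` {?Q}"
  have c: "c \<in> simple_classes A" unfolding simple_classes_def c_def by (rule quotientI) (use Qs in simp)
  note cr = simple_class_rep[OF c]
  have "\<forall>N\<in>c. rmod_iso A ?Q N" by (simp add: c_def)
  from bspec[OF this cr(1)] have "rmod_iso A ?Q (class_rep c)" .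
  then obtain f where f: "f \<in> rmod_hom A ?Q (class_rep c)" "bij_betw f (carrier ?Q) (carrier (class_rep c))"
    unfolding rmod_iso_def by blast
  let ?x = "m +>\<^bsub>A\<^esub> \<one>\<^bsub>A\<^esub>"
  have x: "?x \<in> carrier ?Q" using hom_closed[OF h] by simp
  have z: "f \<zero>\<^bsub>?Q\<^esub> = \<zero>\<^bsub>class_rep c\<^esub>" by (rule hom_zero[OF f(1) q(1) cr(3)])
  have zc: "\<zero>\<^bsub>?Q\<^esub> \<in> carrier ?Q" using hom_closed[OF h, of "\<zero>\<^bsub>A\<^esub>"] ker[of "\<zero>\<^bsub>A\<^esub>"] m.zero_closed by simp
  have "\<one>\<^bsub>A\<^esub> \<notin> m" using m.I_notcarr m.one_imp_carrier by auto
  then have "?x \<noteq> \<zero>\<^bsub>?Q\<^esub>" using ker by simp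
  then have n: "f ?x \<noteq> \<zero>\<^bsub>class_rep c\<^esub>"
    using inj_onD[OF bij_betw_imp_inj_on[OF f(2)], of ?x "\<zero>\<^bsub>?Q\<^esub>"] x zc z by auto
  have k: "f ?x \<cdot>\<^bsub>class_rep c\<^esub> a = \<zero>\<^bsub>class_rep c\<^esub>" if a: "a \<in> m" for a
  proof -
    have aA: "a \<in> carrier A" using a m.a_subset by auto
    have "f ?x \<cdot>\<^bsub>class_rep c\<^esub> a = f (?x \<cdot>\<^bsub>?Q\<^esub> a)" by (rule hom_ract[OF f(1) x aA, symmetric])
    also have "?x \<cdot>\<^bsub>?Q\<^esub> a = m +>\<^bsub>A\<^esub> a" using hom_ract[OF h, of "\<one>\<^bsub>A\<^esub>" a] aA by simp
    also have "\<dots> = \<zero>\<^bsub>?Q\<^esub>" using ker aA a by blast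
    finally show ?thesis using z by simp
  qed
  show thesis by (rule that[OF c hom_closed[OF f(1) x] n]) (use k in blast)
qed

text \<open>The annihilator has only a bimodule entry, so its product with \<open>g\<close> involves
  nothing of \<open>g\<close> but \<open>fst g\<close>, which acts on the summand isomorphic to
  \<open>A / m\<close> as zero.\<close>

lemma cover_annihilated_first:
  assumes G: "G \<subseteq> carrier (cover A)" and m: "maximalideal m A" "fst ` G \<subseteq> m"
  shows "\<exists>r\<in>carrier (cover A). r \<noteq> \<zero>\<^bsub>cover A\<^esub> \<and> (\<forall>g\<in>G. r \<otimes>\<^bsub>cover A\<^esub> g = \<zero>\<^bsub>cover A\<^esub>)"
proof -
  interpret S: right_module A "cover_bimodule A" by (rule cover_bimodule_module[OF A_ring])
  interpret B: ring "cover_corner A" by (rule cover_corner_ring)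
  note sel = direct_sum_sel[of "simple_classes A" class_rep, folded cover_bimodule_def]
  have zr: "\<zero>\<^bsub>class_rep c\<^esub> \<in> carrier (class_rep c)" "\<And>a. a \<in> carrier A \<Longrightarrow> \<zero>\<^bsub>class_rep c\<^esub> \<cdot>\<^bsub>class_rep c\<^esub> a = \<zero>\<^bsub>class_rep c\<^esub>"
    if "c \<in> simple_classes A" for c
  proof -
    interpret right_module A "class_rep c" by (rule simple_class_rep[OF that])
    show "\<zero>\<^bsub>class_rep c\<^esub> \<in> carrier (class_rep c)" "\<And>a. a \<in> carrier A \<Longrightarrow> \<zero>\<^bsub>class_rep c\<^esub> \<cdot>\<^bsub>class_rep c\<^esub> a = \<zero>\<^bsub>class_rep c\<^esub>"
      by simp_all
  qed
  obtain c s where c: "c \<in> simple_classes A" and s: "s \<in> carrier (class_rep c)" "s \<noteq> \<zero>\<^bsub>class_rep c\<^esub>"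
    "\<forall>a\<in>m. s \<cdot>\<^bsub>class_rep c\<^esub> a = \<zero>\<^bsub>class_rep c\<^esub>" by (rule simple_killed[OF m(1)])
  define t where "t = (\<lambda>d\<in>simple_classes A. if d = c then s else \<zero>\<^bsub>class_rep d\<^esub>)"
  have "finite {d \<in> simple_classes A. t d \<noteq> \<zero>\<^bsub>class_rep d\<^esub>}"
    by (rule finite_subset[of _ "{c}"]) (auto simp: t_def)
  then have t: "t \<in> carrier (cover_bimodule A)" using s(1) zr(1) by (auto simp: sel t_def)
  have "t c \<noteq> \<zero>\<^bsub>cover_bimodule A\<^esub> c" using c s(2) by (simp add: t_def sel)
  then have t0: "t \<noteq> \<zero>\<^bsub>cover_bimodule A\<^esub>" by metis
  let ?r = "(\<zero>\<^bsub>A\<^esub>, t, \<zero>\<^bsub>cover_corner A\<^esub>)"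
  have "?r \<otimes>\<^bsub>cover A\<^esub> g = \<zero>\<^bsub>cover A\<^esub>" if g: "g \<in> G" for g
  proof -
    have gc: "fst g \<in> carrier A" "fst (snd g) \<in> carrier (cover_bimodule A)" "snd (snd g) \<in> carrier (cover_corner A)"
      using g G by (auto simp: cover_def)
    have "fst g \<in> m" using g m(2) by blast
    then have 1: "t \<cdot>\<^bsub>cover_bimodule A\<^esub> fst g = \<zero>\<^bsub>cover_bimodule A\<^esub>"
      using s(3) zr(2) gc(1) by (auto simp: sel t_def fun_eq_iff)
    have 2: "cover_act A \<zero>\<^bsub>cover_corner A\<^esub> (fst (snd g)) = \<zero>\<^bsub>cover_bimodule A\<^esub>"
      using gc(2) by (auto simp: sel cover_corner_def fun_eq_iff PiE_iff)
    show ?thesis using 1 2 gc by (simp add: cover_def)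
  qed
  moreover have "?r \<in> carrier (cover A)" using t by (simp add: cover_def)
  moreover have "?r \<noteq> \<zero>\<^bsub>cover A\<^esub>" using t0 by (simp add: cover_def)
  ultimately show ?thesis by blast
qed

text \<open>The annihilator has a corner entry \<open>(\<zero>, \<one>)\<close> at the class
  \<open>c\<close>. It kills the square-zero ideal and, its first component being zero, also acts as
  zero on the bimodule; an annihilator of the corner entries alone would not remove the bimodule
  entries of \<open>G\<close>.\<close>

lemma cover_annihilated_second:
  assumes G: "G \<subseteq> carrier (cover A)" and c: "c \<in> simple_classes A"
    and z: "\<forall>g\<in>G. fst (snd (snd g) c) = \<zero>\<^bsub>end_ring A (class_rep c)\<^esub>"
  shows "\<exists>r\<in>carrier (cover A). r \<noteq> \<zero>\<^bsub>cover A\<^esub> \<and> (\<forall>g\<in>G. r \<otimes>\<^bsub>cover A\<^esub> g = \<zero>\<^bsub>cover A\<^esub>)"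
proof -
  interpret S: right_module A "cover_bimodule A" by (rule cover_bimodule_module[OF A_ring])
  interpret B: ring "cover_corner A" by (rule cover_corner_ring)
  note sel = direct_sum_sel[of "simple_classes A" class_rep, folded cover_bimodule_def]
  let ?E = "\<lambda>d. end_ring A (class_rep d)"
  have E: "ring (?E d)" if "d \<in> simple_classes A" for d
    by (rule end_ring_ring[OF simple_class_rep(3)[OF that]])
  note T = ring.ring_simprules[OF trivial_ext_ring[OF E]]
  define b where "b = (\<lambda>d\<in>simple_classes A. if d = c then (\<zero>\<^bsub>?E d\<^esub>, \<one>\<^bsub>?E d\<^esub>) else \<zero>\<^bsub>trivial_ext (?E d)\<^esub>)"
  have b: "b \<in> carrier (cover_corner A)"
    unfolding cover_corner_def ring_product_sel b_def
    using T(2) ring.ring_simprules(2,6)[OF E] by (auto simp del: end_ring_sel)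
  have ne: "\<one>\<^bsub>?E c\<^esub> \<noteq> \<zero>\<^bsub>?E c\<^esub>"
  proof
    assume "\<one>\<^bsub>?E c\<^esub> = \<zero>\<^bsub>?E c\<^esub>"
    then have "x = \<zero>\<^bsub>class_rep c\<^esub>" if "x \<in> carrier (class_rep c)" for x
      using that by (metis end_ring_sel(3,4) restrict_apply')
    moreover have "\<zero>\<^bsub>class_rep c\<^esub> \<in> carrier (class_rep c)"
      using simple_class_rep(3)[OF c] by (simp add: right_module_def abelian_group_def abelian_monoid.zero_closed)
    ultimately show False using simple_class_rep(2)[OF c] unfolding simple_rmod_def by blast
  qed
  have "b c \<noteq> \<zero>\<^bsub>cover_corner A\<^esub> c" using c ne by (simp add: b_def cover_corner_def del: end_ring_sel)
  then have b0: "b \<noteq> \<zero>\<^bsub>cover_corner A\<^esub>" by metis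
  let ?r = "(\<zero>\<^bsub>A\<^esub>, \<zero>\<^bsub>cover_bimodule A\<^esub>, b)"
  have "?r \<otimes>\<^bsub>cover A\<^esub> g = \<zero>\<^bsub>cover A\<^esub>" if g: "g \<in> G" for g
  proof -
    have gc: "fst g \<in> carrier A" "fst (snd g) \<in> carrier (cover_bimodule A)" "snd (snd g) \<in> carrier (cover_corner A)"
      using g G by (auto simp: cover_def)
    have gd: "snd (snd g) d \<in> carrier (trivial_ext (?E d))" if "d \<in> simple_classes A" for d
      using gc(3) that unfolding cover_corner_def ring_product_sel by blast
    have "(b \<otimes>\<^bsub>cover_corner A\<^esub> snd (snd g)) = \<zero>\<^bsub>cover_corner A\<^esub>"
    proof
      fix d
      show "(b \<otimes>\<^bsub>cover_corner A\<^esub> snd (snd g)) d = \<zero>\<^bsub>cover_corner A\<^esub> d"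
      proof (cases "d \<in> simple_classes A")
        case True
        interpret E: ring "?E d" by (rule E[OF True])
        interpret T: ring "trivial_ext (?E d)" by (rule trivial_ext_ring[OF E[OF True]])
        have gg: "fst (snd (snd g) d) \<in> carrier (?E d)" "snd (snd (snd g) d) \<in> carrier (?E d)" using gd[OF True] by auto
        have "b d \<otimes>\<^bsub>trivial_ext (?E d)\<^esub> snd (snd g) d = \<zero>\<^bsub>trivial_ext (?E d)\<^esub>"
        proof (cases "d = c")
          case True
          have fz: "fst (snd (snd g) d) = \<zero>\<^bsub>?E d\<^esub>" using z g True by simp
          have "b d = (\<zero>\<^bsub>?E d\<^esub>, \<one>\<^bsub>?E d\<^esub>)" using c True by (simp add: b_def del: end_ring_sel)
          then show ?thesis using gg fz by (simp del: end_ring_sel)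
        next
          case False
          then show ?thesis using True T.l_null[OF gd[OF True]] by (simp add: b_def del: end_ring_sel trivial_ext_sel)
        qed
        then show ?thesis using True by (simp add: cover_corner_def del: end_ring_sel trivial_ext_sel)
      qed (simp add: cover_corner_def)
    qed
    moreover have "cover_act A b (fst (snd g)) = \<zero>\<^bsub>cover_bimodule A\<^esub>"
      using gc(2) by (auto simp: sel b_def fun_eq_iff PiE_iff)
    ultimately show ?thesis using gc by (simp add: cover_def)
  qed
  moreover have "?r \<in> carrier (cover A)" using b by (simp add: cover_def)
  moreover have "?r \<noteq> \<zero>\<^bsub>cover A\<^esub>" using b0 by (simp add: cover_def)
  ultimately show ?thesis by blast
qed

text \<open>Without annihilators of the two kinds, the first components of \<open>G\<close> generate
  \<open>A\<close>, and at each class some corner entry of \<open>G\<close> is right invertible. The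
  two diagonal idempotents are produced separately, the upper one with a bimodule entry that is
  cancelled at the end.\<close>

lemma cover_right_ideal_one:
  assumes G: "finite G" "G \<subseteq> carrier (cover A)"
    and L: "left_ideal (opposite_ring (cover A)) L" "G \<subseteq> L"
    and first: "\<And>J. ideal J A \<Longrightarrow> fst ` G \<subseteq> J \<Longrightarrow> J = carrier A"
    and second: "\<And>c. c \<in> simple_classes A \<Longrightarrow> \<exists>g\<in>G. fst (snd (snd g) c) \<noteq> \<zero>\<^bsub>end_ring A (class_rep c)\<^esub>"
  shows "\<one>\<^bsub>cover A\<^esub> \<in> L"
proof -
  interpret S: right_module A "cover_bimodule A" by (rule cover_bimodule_module[OF A_ring])
  interpret B: ring "cover_corner A" by (rule cover_corner_ring)
  interpret C: ring "cover A" by (rule cover_ring[OF A_ring])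
  note sel = direct_sum_sel[of "simple_classes A" class_rep, folded cover_bimodule_def]
  let ?S = "cover_bimodule A" and ?B = "cover_corner A"
  have Lc: "L \<subseteq> carrier (cover A)" and L0: "\<zero>\<^bsub>cover A\<^esub> \<in> L" and La: "\<And>x y. x \<in> L \<Longrightarrow> y \<in> L \<Longrightarrow> x \<oplus>\<^bsub>cover A\<^esub> y \<in> L"
    and Lm: "\<And>x r. x \<in> L \<Longrightarrow> r \<in> carrier (cover A) \<Longrightarrow> x \<otimes>\<^bsub>cover A\<^esub> r \<in> L"
    using L(1) by (auto simp: left_ideal_def)
  have act0: "cover_act A b \<zero>\<^bsub>?S\<^esub> = \<zero>\<^bsub>?S\<^esub>" if "b \<in> carrier ?B" for b
    using hom_zero[OF corner_comp_hom[OF that] simple_class_rep(3,3)] by (auto simp: sel fun_eq_iff)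
  have act1: "cover_act A \<one>\<^bsub>?B\<^esub> s = s" if "s \<in> carrier ?S" for s
    using that by (auto simp: fun_eq_iff cover_corner_def sel PiE_iff extensional_def)
  have car: "x \<in> carrier (cover A) \<longleftrightarrow> fst x \<in> carrier A \<and> fst (snd x) \<in> carrier ?S \<and> snd (snd x) \<in> carrier ?B" for x
    by (simp add: cover_def mem_Times_iff)
  \<comment> \<open>Multiplication by \<open>(\<one>, \<zero>, \<zero>)\<close> removes the corner
    entry but keeps the bimodule entry, hence the unspecified \<open>t\<close>.\<close>
  let ?J = "{a \<in> carrier A. \<exists>t\<in>carrier ?S. (a, t, \<zero>\<^bsub>?B\<^esub>) \<in> L}"
  have "submod A (reg_rmod A) ?J"
  proof (rule submodI)
    show "\<zero>\<^bsub>reg_rmod A\<^esub> \<in> ?J" using L0 by (auto simp: cover_def)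
    show "x \<oplus>\<^bsub>reg_rmod A\<^esub> y \<in> ?J" if xy: "x \<in> ?J" "y \<in> ?J" for x y
    proof -
      from xy obtain t u where tu: "t \<in> carrier ?S" "(x, t, \<zero>\<^bsub>?B\<^esub>) \<in> L" "u \<in> carrier ?S" "(y, u, \<zero>\<^bsub>?B\<^esub>) \<in> L"
        "x \<in> carrier A" "y \<in> carrier A" by blast
      have "(x \<oplus>\<^bsub>A\<^esub> y, t \<oplus>\<^bsub>?S\<^esub> u, \<zero>\<^bsub>?B\<^esub>) \<in> L" using La[OF tu(2,4)] by (simp add: cover_def)
      then show ?thesis using tu by auto
    qed
    show "x \<cdot>\<^bsub>reg_rmod A\<^esub> a \<in> ?J" if xa: "x \<in> ?J" "a \<in> carrier A" for x a
    proof -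
      from xa obtain t where t: "t \<in> carrier ?S" "(x, t, \<zero>\<^bsub>?B\<^esub>) \<in> L" "x \<in> carrier A" by blast
      have "(x, t, \<zero>\<^bsub>?B\<^esub>) \<otimes>\<^bsub>cover A\<^esub> (a, \<zero>\<^bsub>?S\<^esub>, \<zero>\<^bsub>?B\<^esub>) \<in> L" using xa by (intro Lm t) (simp add: car)
      then have "(x \<otimes>\<^bsub>A\<^esub> a, t \<cdot>\<^bsub>?S\<^esub> a, \<zero>\<^bsub>?B\<^esub>) \<in> L"
        using act0[OF B.zero_closed] t xa by (simp add: cover_def)
      moreover have "t \<cdot>\<^bsub>?S\<^esub> a \<in> carrier ?S" using t xa by simp
      ultimately show ?thesis using t(3) xa(2) by auto
    qed
  qed auto
  then have "ideal ?J A" by (simp add: submod_reg_iff[OF A_cring])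
  moreover have "fst ` G \<subseteq> ?J"
  proof
    fix a assume "a \<in> fst ` G"
    then obtain g where g: "g \<in> G" "a = fst g" by blast
    have gc: "fst g \<in> carrier A" "fst (snd g) \<in> carrier ?S" "snd (snd g) \<in> carrier ?B" using g(1) G(2) car by blast+
    have "g \<otimes>\<^bsub>cover A\<^esub> (\<one>\<^bsub>A\<^esub>, \<zero>\<^bsub>?S\<^esub>, \<zero>\<^bsub>?B\<^esub>) \<in> L" using g L(2) by (intro Lm) (auto simp: car)
    then have "(fst g, fst (snd g), \<zero>\<^bsub>?B\<^esub>) \<in> L" using gc act0[OF gc(3)] by (simp add: cover_def)
    then show "a \<in> ?J" using g gc by auto
  qed
  ultimately have "?J = carrier A" by (rule first)
  then have "\<one>\<^bsub>A\<^esub> \<in> ?J" by simp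
  then obtain t where t: "t \<in> carrier ?S" "(\<one>\<^bsub>A\<^esub>, t, \<zero>\<^bsub>?B\<^esub>) \<in> L" by blast
  let ?T = "\<lambda>c. trivial_ext (end_ring A (class_rep c))"
  have T: "ring (?T c)" if "c \<in> simple_classes A" for c
    by (intro trivial_ext_ring end_ring_ring simple_class_rep(3)[OF that])
  have "\<exists>g u. g \<in> G \<and> u \<in> carrier (?T c) \<and> snd (snd g) c \<otimes>\<^bsub>?T c\<^esub> u = \<one>\<^bsub>?T c\<^esub>" if c: "c \<in> simple_classes A" for c
  proof -
    obtain g where g: "g \<in> G" "fst (snd (snd g) c) \<noteq> \<zero>\<^bsub>end_ring A (class_rep c)\<^esub>" using second[OF c] by blast
    have "snd (snd g) \<in> carrier ?B" using g(1) G(2) car by blast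
    then have gc: "snd (snd g) c \<in> carrier (?T c)" using c unfolding cover_corner_def ring_product_sel by blast
    then have "fst (snd (snd g) c) \<in> carrier (end_ring A (class_rep c))" by auto
    then obtain y where y: "y \<in> carrier (end_ring A (class_rep c))"
      "fst (snd (snd g) c) \<otimes>\<^bsub>end_ring A (class_rep c)\<^esub> y = \<one>\<^bsub>end_ring A (class_rep c)\<^esub>"
      by (rule simple_endo_inverse[OF simple_class_rep(2)[OF c] _ g(2)])
    obtain u where "u \<in> carrier (?T c)" "snd (snd g) c \<otimes>\<^bsub>?T c\<^esub> u = \<one>\<^bsub>?T c\<^esub>"
      by (rule trivial_ext_right_inverse[OF end_ring_ring[OF simple_class_rep(3)[OF c]] gc y])
    with g(1) show ?thesis by blast
  qed
  then obtain \<gamma> u where \<gamma>: "\<And>c. c \<in> simple_classes A \<Longrightarrow> \<gamma> c \<in> G \<and> u c \<in> carrier (?T c) \<and>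
      snd (snd (\<gamma> c)) c \<otimes>\<^bsub>?T c\<^esub> u c = \<one>\<^bsub>?T c\<^esub>" by metis
  \<comment> \<open>The classes may be infinite in number, but \<open>G\<close> is finite. They are
    grouped by the member \<open>\<gamma> c\<close> of \<open>G\<close> whose entry is right
    invertible at \<open>c\<close>; \<open>e F\<close> is the idempotent of the groups that belong
    to \<open>F\<close>.\<close>
  define e where "e F = (\<lambda>c\<in>simple_classes A. if \<gamma> c \<in> F then \<one>\<^bsub>?T c\<^esub> else \<zero>\<^bsub>?T c\<^esub>)" for F
  have "F \<subseteq> G \<longrightarrow> (\<zero>\<^bsub>A\<^esub>, \<zero>\<^bsub>?S\<^esub>, e F) \<in> L" if "finite F" for F
    using that
  proof (induction F)
    case empty
    have "e {} = \<zero>\<^bsub>?B\<^esub>" by (simp add: e_def cover_corner_def del: trivial_ext_sel)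
    then show ?case using L0 by (simp add: cover_def)
  next
    case (insert g F)
    show ?case
    proof
      assume gF: "insert g F \<subseteq> G"
      have gc: "fst g \<in> carrier A" "fst (snd g) \<in> carrier ?S" "snd (snd g) \<in> carrier ?B" using gF G(2) car by blast+
      have gd: "snd (snd g) c \<in> carrier (?T c)" if "c \<in> simple_classes A" for c
        using gc(3) that unfolding cover_corner_def ring_product_sel by blast
      \<comment> \<open>\<open>w\<close> collects the right inverses over the group of
        \<open>g\<close>, so that the corner entry of \<open>g\<close> times \<open>w\<close> is the
        idempotent of this group.\<close>
      define w where "w = (\<lambda>c\<in>simple_classes A. if \<gamma> c = g then u c else \<zero>\<^bsub>?T c\<^esub>)"
      have w: "w \<in> carrier ?B"
        unfolding cover_corner_def ring_product_sel w_def
        using \<gamma> ring.ring_simprules(2)[OF T] by (auto simp del: trivial_ext_sel)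
      have "g \<otimes>\<^bsub>cover A\<^esub> (\<zero>\<^bsub>A\<^esub>, \<zero>\<^bsub>?S\<^esub>, w) \<in> L" using gF L(2) w by (intro Lm) (auto simp: car)
      then have "(\<zero>\<^bsub>A\<^esub>, \<zero>\<^bsub>?S\<^esub>, snd (snd g) \<otimes>\<^bsub>?B\<^esub> w) \<in> L" using gc act0[OF gc(3)] by (simp add: cover_def)
      moreover have "(\<zero>\<^bsub>A\<^esub>, \<zero>\<^bsub>?S\<^esub>, e F) \<in> L" using insert gF by blast
      ultimately have "(\<zero>\<^bsub>A\<^esub>, \<zero>\<^bsub>?S\<^esub>, e F \<oplus>\<^bsub>?B\<^esub> snd (snd g) \<otimes>\<^bsub>?B\<^esub> w) \<in> L"
        using La[of "(\<zero>\<^bsub>A\<^esub>, \<zero>\<^bsub>?S\<^esub>, e F)" "(\<zero>\<^bsub>A\<^esub>, \<zero>\<^bsub>?S\<^esub>, snd (snd g) \<otimes>\<^bsub>?B\<^esub> w)"] by (simp add: cover_def)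
      moreover have "e F \<oplus>\<^bsub>?B\<^esub> snd (snd g) \<otimes>\<^bsub>?B\<^esub> w = e (insert g F)"
      proof
        fix c
        show "(e F \<oplus>\<^bsub>?B\<^esub> snd (snd g) \<otimes>\<^bsub>?B\<^esub> w) c = e (insert g F) c"
        proof (cases "c \<in> simple_classes A")
          case True
          interpret T: ring "?T c" by (rule T[OF True])
          show ?thesis
            using True \<gamma>[OF True] gd[OF True] insert.hyps T.r_null T.l_zero T.r_zero T.one_closed T.zero_closed
            by (auto simp: cover_corner_def e_def w_def simp del: trivial_ext_sel)
        qed (simp add: cover_corner_def e_def)
      qed
      ultimately show "(\<zero>\<^bsub>A\<^esub>, \<zero>\<^bsub>?S\<^esub>, e (insert g F)) \<in> L" by simp
    qed
  qed
  then have "(\<zero>\<^bsub>A\<^esub>, \<zero>\<^bsub>?S\<^esub>, e G) \<in> L" using G(1) by blast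
  moreover have "e G = \<one>\<^bsub>?B\<^esub>" using \<gamma> by (auto simp: e_def cover_corner_def fun_eq_iff simp del: trivial_ext_sel)
  ultimately have e2: "(\<zero>\<^bsub>A\<^esub>, \<zero>\<^bsub>?S\<^esub>, \<one>\<^bsub>?B\<^esub>) \<in> L" by simp
  have "(\<zero>\<^bsub>A\<^esub>, \<zero>\<^bsub>?S\<^esub>, \<one>\<^bsub>?B\<^esub>) \<otimes>\<^bsub>cover A\<^esub> (\<zero>\<^bsub>A\<^esub>, \<ominus>\<^bsub>?S\<^esub> t, \<one>\<^bsub>?B\<^esub>) \<in> L" using t by (intro Lm e2) (simp add: car)
  then have "(\<zero>\<^bsub>A\<^esub>, \<ominus>\<^bsub>?S\<^esub> t, \<one>\<^bsub>?B\<^esub>) \<in> L" using t act1[of "\<ominus>\<^bsub>?S\<^esub> t"] by (simp add: cover_def)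
  \<comment> \<open>Right multiplication by \<open>(\<zero>, \<ominus> t, \<one>)\<close> has given
    the lower idempotent the bimodule entry that cancels \<open>t\<close>.\<close>
  from La[OF t(2) this] show "\<one>\<^bsub>cover A\<^esub> \<in> L" using t(1) by (simp add: cover_def S.M.r_neg)
qed

lemma cover_left_ideals_annihilated: "left_ideals_annihilated (opposite_ring (cover A))"
  unfolding left_ideals_annihilated_def
proof (intro allI impI)
  fix G assume "finite G \<and> G \<subseteq> carrier (opposite_ring (cover A))"
  then have G: "finite G" "G \<subseteq> carrier (cover A)" by auto
  let ?ann = "\<exists>r\<in>carrier (cover A). r \<noteq> \<zero>\<^bsub>cover A\<^esub> \<and> (\<forall>g\<in>G. r \<otimes>\<^bsub>cover A\<^esub> g = \<zero>\<^bsub>cover A\<^esub>)"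
  have "\<one>\<^bsub>cover A\<^esub> \<in> L" if nann: "\<not> ?ann" and L: "left_ideal (opposite_ring (cover A)) L" "G \<subseteq> L" for L
  proof (rule cover_right_ideal_one[OF G L])
    fix J assume J: "ideal J A" "fst ` G \<subseteq> J"
    show "J = carrier A"
    proof (rule ccontr)
      assume "J \<noteq> carrier A"
      then obtain m where "maximalideal m A" "J \<subseteq> m" by (rule ex_maximal_ideal[OF J(1)])
      with cover_annihilated_first[OF G(2), of m] J(2) nann show False by blast
    qed
  next
    fix c assume "c \<in> simple_classes A"
    with cover_annihilated_second[OF G(2)] nann
    show "\<exists>g\<in>G. fst (snd (snd g) c) \<noteq> \<zero>\<^bsub>end_ring A (class_rep c)\<^esub>" by blast
  qed
  then show "(\<exists>r\<in>carrier (opposite_ring (cover A)). r \<noteq> \<zero>\<^bsub>opposite_ring (cover A)\<^esub> \<and>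
      (\<forall>g\<in>G. g \<otimes>\<^bsub>opposite_ring (cover A)\<^esub> r = \<zero>\<^bsub>opposite_ring (cover A)\<^esub>)) \<or>
    (\<forall>L. left_ideal (opposite_ring (cover A)) L \<and> G \<subseteq> L \<longrightarrow> \<one>\<^bsub>opposite_ring (cover A)\<^esub> \<in> L)"
    unfolding opposite_sel by blast
qed

end

theorem corollary10:
  fixes A :: "('a, 'r) ring_scheme"
  assumes "cring A"
    and "noetherian_ring A"
    and "regular_ring A"
    and "krull_dim A = \<infinity>"
  shows "fin_dim (cover A) = \<infinity> \<and> fin_dim (opposite_ring (cover A)) = 0"
proof
  show "fin_dim (cover A) = \<infinity>" by (rule fin_dim_cover_infinite[OF assms])
  interpret comm_noeth A by (rule comm_noeth.intro) fact+
  show "fin_dim (opposite_ring (cover A)) = 0" by (rule fin_dim_zero[OF cover_left_ideals_annihilated])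
qed

end
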